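(* For every $\lambda\in\Lambda$ there are expansions (a) $$R_\lambda(u_1+u_2,u_2,u_3+u_4,u_4,\dots)=\sum_{\mu\in\mathbb N^n}a_{\lambda\mu}u^\mu,$$ where only those $\mu$ occur which satisfy $\mu\le[\lambda]$ and $\mu_{\rm even}\le\lambda_{\rm even}$; (b) $$R_\lambda(z)=\sum_{\mu\in\Lambda:\ \mu\preceq\lambda}b_{\lambda\mu}\,\mathbf e_\mu(z)\qquad\text{and}\qquad \overline R_\lambda(z)=\sum_{\mu\in\Lambda:\ \mu\preceq\lambda,\ |\mu|_{\rm odd}=|\lambda|_{\rm odd}}b_{\lambda\mu}\,\mathbf e_\mu(z),$$ with coefficients $a_{\lambda\mu},b_{\lambda\mu}\in k$.
   Context: Let $k$ be a field of characteristic zero, $n\ge 1$, $\mathcal P=k[z_1,\dots,z_n]$, and let $W\subseteq S_n$ be the group of permutations $\pi$ with $\pi(i)\equiv i \bmod 2$ for all $i$, acting by permuting variables. $\mathbb N$ contains $0$. For a vector $v$ of length $n$ put $v_{\rm odd}=(v_1,v_3,v_5,\dots)$ and $v_{\rm even}=(v_2,v_4,\dots)$. $\Lambda$ is the set of integer tuples $\lambda=(\lambda_1\ge\dots\ge\lambda_n\ge 0)$ and $|\lambda|_{\rm odd}=\sum_{i\text{ odd}}\lambda_i$. Fix $r\in k$ which is not a negative rational number and put $\rho=((n-1)r,(n-2)r,\dots,r,0)$. For $\lambda\in\Lambda$ let $[\lambda]\in\mathbb N^n$ be given by $[\lambda]_m=\lambda_m-\lambda_{m+1}+\dots+(-1)^{n-m}\lambda_n$.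 $R_\lambda(z)=R_\lambda(z;r)\in\mathcal P^W$ is the unique $W$-invariant polynomial of degree $|\lambda|_{\rm odd}$ which satisfies $R_\lambda(\rho+\mu)=0$ for all $\mu\in\Lambda$ with $|\mu|_{\rm odd}\le|\lambda|_{\rm odd}$, $\mu\ne\lambda$, and in which the monomial $z^{[\lambda]}$ has coefficient $1$ (it is known that this exists and is unique). $\overline R_\lambda$ is its homogeneous component of highest degree $|\lambda|_{\rm odd}$. In (a), $u_1,\dots,u_n$ are variables and the $i$-th argument is $u_i+u_{i+1}$ for $i$ odd and $u_i$ for $i$ even, with $u_{n+1}:=0$ if $n$ is odd. For integer vectors $\mu,\nu$ of equal length, $\mu\le\nu$ means $\mu_1+\dots+\mu_m\le\nu_1+\dots+\nu_m$ for all $m$. Elementary semisymmetric polynomials: $\mathbf e_m(z)=\overline R_{(1^m)}(z)$ for $1\le m\le n$; explicitly $\mathbf e_{2m-1}(z)=e_m(z_{\rm odd})-e_m(z_{\rm even})$ and $\mathbf e_{2m}(z)=e_m(z_{\rm even})$, with $e_m$ the usual elementary symmetric polynomial. For $\mu\in\Lambda$, $\mathbf e_\mu=\mathbf e_1^{\mu_1-\mu_2}\mathbf e_2^{\mu_2-\mu_3}\cdots\mathbf e_{n-1}^{\mu_{n-1}-\mu_n}\mathbf e_n^{\mu_n}$. Order on $\Lambda$: let $\epsilon_i$ be the standard basis vectors of $\mathbb Z^n$, $\Phi^+\subseteq\mathbb Z^n$ the submonoid generated by $\epsilon_i-\epsilon_{i+2}$, $1\le i\le n-2$, and $\Psi_0\subseteq\mathbb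 Z^n$ the smallest $W$-stable submonoid containing $\Lambda$. Then $\mu\preceq\lambda$ means $\lambda-\mu\in\Psi_0+\Phi^+$; equivalently, $\mu_{\rm odd}\le\lambda_{\rm odd}$, $\mu_{\rm even}\le\lambda_{\rm even}$ and $[\mu]_1\le[\lambda]_1$. *)

theory Defs
  imports
    Complex_Main
    "HOL-Library.Poly_Mapping"
    "HOL-Library.Function_Algebras"
    "HOL-Combinatorics.Permutations"
begin

section \<open>Polynomials\<close>

text \<open>
  Polynomials over \<open>'k\<close> in the variables \<open>X 1, X 2, \<dots>\<close> are finitely supported maps from
  exponents to coefficients; \<open>k[z\<^sub>1, \<dots>, z\<^sub>n]\<close> is the subset \<open>polys n\<close>.
\<close>

type_synonym 'k mpoly = "(nat \<Rightarrow>\<^sub>0 nat) \<Rightarrow>\<^sub>0 'k"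

definition Const :: "'k::zero \<Rightarrow> 'k mpoly" where
  "Const c = Poly_Mapping.single 0 c"

definition X :: "nat \<Rightarrow> 'k::zero_neq_one mpoly" where
  "X i = Poly_Mapping.single (Poly_Mapping.single i 1) 1"

definition polys :: "nat \<Rightarrow> 'k::zero mpoly set" where
  "polys n = {p. \<forall>m \<in> Poly_Mapping.keys p. Poly_Mapping.keys m \<subseteq> {1..n}}"

text \<open>Image of \<open>p\<close> under the map that is \<open>h\<close> on coefficients and sends \<open>X i\<close> to \<open>f i\<close>.\<close>

definition poly_map :: "('k::zero \<Rightarrow> 'b::comm_semiring_1) \<Rightarrow> (nat \<Rightarrow> 'b) \<Rightarrow> 'k mpoly \<Rightarrow> 'b" where
  "poly_map h f p =
     (\<Sum>m \<in> Poly_Mapping.keys p. h (Poly_Mapping.lookup p m) *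
        (\<Prod>i \<in> Poly_Mapping.keys m. f i ^ Poly_Mapping.lookup m i))"

definition poly_eval :: "(nat \<Rightarrow> 'k) \<Rightarrow> 'k::comm_semiring_1 mpoly \<Rightarrow> 'k" where
  "poly_eval x p = poly_map (\<lambda>c. c) x p"

definition poly_subst :: "(nat \<Rightarrow> 'k mpoly) \<Rightarrow> 'k::comm_semiring_1 mpoly \<Rightarrow> 'k mpoly" where
  "poly_subst f p = poly_map Const f p"

definition mon_degree :: "(nat \<Rightarrow>\<^sub>0 nat) \<Rightarrow> nat" where
  "mon_degree m = (\<Sum>i \<in> Poly_Mapping.keys m. Poly_Mapping.lookup m i)"

text \<open>Convention: the zero polynomial has degree 0.\<close>

definition total_degree :: "'k::zero mpoly \<Rightarrow> nat" where
  "total_degree p = Max (insert 0 (mon_degree ` Poly_Mapping.keys p))"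

definition hom_component :: "nat \<Rightarrow> 'k::comm_monoid_add mpoly \<Rightarrow> 'k mpoly" where
  "hom_component d p =
     (\<Sum>m \<in> {m \<in> Poly_Mapping.keys p. mon_degree m = d}.
        Poly_Mapping.single m (Poly_Mapping.lookup p m))"

definition top_component :: "'k::comm_monoid_add mpoly \<Rightarrow> 'k mpoly" where
  "top_component p = hom_component (total_degree p) p"


section \<open>Integer vectors and partitions\<close>

text \<open>
  A vector of length \<open>n\<close> is a function on \<open>nat\<close>, indexed from 1 and equal to 0 outside \<open>{1..n}\<close>.
  In particular its entry at \<open>n + 1\<close> is 0.
\<close>

definition int_vecs :: "nat \<Rightarrow> (nat \<Rightarrow> int) set" where
  "int_vecs n = {v. \<forall>i. i \<notin> {1..n} \<longrightarrow> v i = 0}"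

definition nat_vecs :: "nat \<Rightarrow> (nat \<Rightarrow> int) set" where
  "nat_vecs n = {v \<in> int_vecs n. \<forall>i. 0 \<le> v i}"

definition Lam :: "nat \<Rightarrow> (nat \<Rightarrow> int) set" where
  "Lam n = {v \<in> int_vecs n. (\<forall>i \<in> {1..<n}. v (Suc i) \<le> v i) \<and> 0 \<le> v n}"

definition odd_size :: "nat \<Rightarrow> (nat \<Rightarrow> int) \<Rightarrow> int" where
  "odd_size n v = (\<Sum>i \<in> {i \<in> {1..n}. odd i}. v i)"

text \<open>\<open>even_part v\<close> has length \<open>n div 2\<close> if \<open>v\<close> has length \<open>n\<close>.\<close>

definition even_part :: "(nat \<Rightarrow> int) \<Rightarrow> nat \<Rightarrow> int" where
  "even_part v j = v (2 * j)"

text \<open>The relation \<open>\<mu> \<le> \<nu>\<close> for vectors of length \<open>l\<close>.\<close>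

definition dom_le :: "nat \<Rightarrow> (nat \<Rightarrow> int) \<Rightarrow> (nat \<Rightarrow> int) \<Rightarrow> bool" where
  "dom_le l \<mu> \<nu> \<longleftrightarrow> (\<forall>m \<in> {1..l}. (\<Sum>i = 1..m. \<mu> i) \<le> (\<Sum>i = 1..m. \<nu> i))"

definition bracket :: "nat \<Rightarrow> (nat \<Rightarrow> int) \<Rightarrow> nat \<Rightarrow> int" where
  "bracket n v m = (if m \<in> {1..n} then \<Sum>j = m..n. (- 1) ^ (j - m) * v j else 0)"

definition expo :: "nat \<Rightarrow> (nat \<Rightarrow> int) \<Rightarrow> (nat \<Rightarrow>\<^sub>0 nat)" where
  "expo n v = (\<Sum>i = 1..n. Poly_Mapping.single i (nat (v i)))"

definition mon :: "nat \<Rightarrow> (nat \<Rightarrow> int) \<Rightarrow> 'k::zero_neq_one mpoly" where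
  "mon n v = Poly_Mapping.single (expo n v) 1"


section \<open>The group \<open>W\<close> and the order on partitions\<close>

definition W :: "nat \<Rightarrow> (nat \<Rightarrow> nat) set" where
  "W n = {\<pi>. \<pi> permutes {1..n} \<and> (\<forall>i. \<pi> i mod 2 = i mod 2)}"

definition W_invariant :: "nat \<Rightarrow> 'k::comm_semiring_1 mpoly \<Rightarrow> bool" where
  "W_invariant n p \<longleftrightarrow> (\<forall>\<pi> \<in> W n. poly_subst (\<lambda>i. X (\<pi> i)) p = p)"

definition std_basis :: "nat \<Rightarrow> nat \<Rightarrow> int" where
  "std_basis i j = (if j = i then 1 else 0)"

inductive_set Phi_plus :: "nat \<Rightarrow> (nat \<Rightarrow> int) set" for n :: nat where
  zero: "0 \<in> Phi_plus n"
| gen: "1 \<le> i \<Longrightarrow> i + 2 \<le> n \<Longrightarrow> std_basis i - std_basis (i + 2) \<in> Phi_plus n"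
| add: "v \<in> Phi_plus n \<Longrightarrow> w \<in> Phi_plus n \<Longrightarrow> v + w \<in> Phi_plus n"

inductive_set Psi_zero :: "nat \<Rightarrow> (nat \<Rightarrow> int) set" for n :: nat where
  zero: "0 \<in> Psi_zero n"
| Lam: "v \<in> Lam n \<Longrightarrow> v \<in> Psi_zero n"
| add: "v \<in> Psi_zero n \<Longrightarrow> w \<in> Psi_zero n \<Longrightarrow> v + w \<in> Psi_zero n"
| perm: "v \<in> Psi_zero n \<Longrightarrow> \<pi> \<in> W n \<Longrightarrow> v \<circ> \<pi> \<in> Psi_zero n"

definition preceq :: "nat \<Rightarrow> (nat \<Rightarrow> int) \<Rightarrow> (nat \<Rightarrow> int) \<Rightarrow> bool" where
  "preceq n \<mu> v \<longleftrightarrow> (\<exists>\<psi> \<in> Psi_zero n. \<exists>\<phi> \<in> Phi_plus n. v - \<mu> = \<psi> + \<phi>)"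


section \<open>Elementary semisymmetric polynomials\<close>

definition elem_sym :: "nat set \<Rightarrow> nat \<Rightarrow> 'k::comm_semiring_1 mpoly" where
  "elem_sym A m = (\<Sum>S \<in> {S. S \<subseteq> A \<and> card S = m}. \<Prod>i \<in> S. X i)"

definition elem_semisym :: "nat \<Rightarrow> nat \<Rightarrow> 'k::comm_ring_1 mpoly" where
  "elem_semisym n j =
     (if odd j
      then elem_sym {i \<in> {1..n}. odd i} ((j + 1) div 2)
           - elem_sym {i \<in> {1..n}. even i} ((j + 1) div 2)
      else elem_sym {i \<in> {1..n}. even i} (j div 2))"

definition elem_semisym_prod :: "nat \<Rightarrow> (nat \<Rightarrow> int) \<Rightarrow> 'k::comm_ring_1 mpoly" where
  "elem_semisym_prod n \<mu> = (\<Prod>i = 1..n. elem_semisym n i ^ nat (\<mu> i - \<mu> (Suc i)))"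


section \<open>The polynomials \<open>R\<^sub>\<lambda>\<close>\<close>

definition shifted :: "nat \<Rightarrow> 'k::ring_1 \<Rightarrow> (nat \<Rightarrow> int) \<Rightarrow> nat \<Rightarrow> 'k" where
  "shifted n r \<mu> i = of_nat (n - i) * r + of_int (\<mu> i)"

text \<open>
  \<open>is_R n r v p\<close> says that \<open>p\<close> is the polynomial \<open>R\<^sub>v(z; r)\<close>.  If \<open>r\<close> is not a negative rational
  number, exactly one \<open>p\<close> satisfies it (Knop).
\<close>

definition is_R :: "nat \<Rightarrow> 'k::field_char_0 \<Rightarrow> (nat \<Rightarrow> int) \<Rightarrow> 'k mpoly \<Rightarrow> bool" where
  "is_R n r v p \<longleftrightarrow>
     p \<in> polys n \<and>
     W_invariant n p \<and>
     int (total_degree p) = odd_size n v \<and>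
     (\<forall>\<mu> \<in> Lam n. odd_size n \<mu> \<le> odd_size n v \<and> \<mu> \<noteq> v \<longrightarrow> poly_eval (shifted n r \<mu>) p = 0) \<and>
     Poly_Mapping.lookup p (expo n (bracket n v)) = 1"

definition u_arg :: "nat \<Rightarrow> nat \<Rightarrow> 'k::comm_semiring_1 mpoly" where
  "u_arg n i = (if odd i \<and> i < n then X i + X (i + 1) else X i)"


section \<open>The index sets of the expansions are finite\<close>

lemma finite_bounded_vecs:
  "finite {v \<in> nat_vecs n. \<forall>i \<in> {1..n}. v i \<le> (B :: int)}"
proof (rule finite_subset)
  show "{v \<in> nat_vecs n. \<forall>i \<in> {1..n}. v i \<le> B}
    \<subseteq> {f. \<forall>x. (x \<in> {1..n} \<longrightarrow> f x \<in> {0..B}) \<and> (x \<notin> {1..n} \<longrightarrow> f x = 0)}"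
    by (auto simp: nat_vecs_def int_vecs_def)
  show "finite {f. \<forall>x. (x \<in> {1..n} \<longrightarrow> f x \<in> {0..B}) \<and> (x \<notin> {1..n} \<longrightarrow> f x = (0::int))}"
    by (rule finite_set_of_finite_funs) auto
qed

lemma Lam_antimono:
  assumes "v \<in> Lam n" "1 \<le> i" "i \<le> j"
  shows "v j \<le> v i"
  using assms(3)
proof (induction j rule: dec_induct)
  case (step j)
  have "v (Suc j) \<le> v j"
  proof (cases "Suc j \<le> n")
    case True
    then show ?thesis using assms step by (auto simp: Lam_def)
  next
    case False
    then have "v (Suc j) = 0" "j = n \<or> n < j"
      using assms(1) by (auto simp: Lam_def int_vecs_def)
    moreover have "v j = 0" if "n < j"
      using assms(1) that by (auto simp: Lam_def int_vecs_def)
    moreover have "0 \<le> v n"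
      using assms(1) by (auto simp: Lam_def)
    ultimately show ?thesis by auto
  qed
  then show ?case using step by simp
qed simp

lemma Lam_subset_nat_vecs: "Lam n \<subseteq> nat_vecs n"
proof
  fix v assume v: "v \<in> Lam n"
  have "0 \<le> v i" for i
  proof (cases "i \<in> {1..n}")
    case True
    then show ?thesis using Lam_antimono[OF v, of i n] v by (auto simp: Lam_def)
  qed (use v in \<open>auto simp: Lam_def int_vecs_def\<close>)
  with v show "v \<in> nat_vecs n" by (auto simp: Lam_def nat_vecs_def)
qed

lemma finite_preceq: "finite {\<mu> \<in> Lam n. preceq n \<mu> v}"
proof (rule finite_subset[OF _ finite_bounded_vecs[of n "v 1"]], safe)
  fix \<mu> assume \<mu>: "\<mu> \<in> Lam n" and "preceq n \<mu> v"
  then obtain \<psi> \<phi> where *: "\<psi> \<in> Psi_zero n" "\<phi> \<in> Phi_plus n" "v - \<mu> = \<psi> + \<phi>"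
    by (auto simp: preceq_def)
  show "\<mu> \<in> nat_vecs n" using \<mu> Lam_subset_nat_vecs by auto
  have "0 \<le> \<psi> i" for i
    using *(1)
  proof (induction arbitrary: i)
    case (Lam v)
    then show ?case using Lam_subset_nat_vecs by (auto simp: nat_vecs_def)
  qed auto
  moreover have "0 \<le> \<phi> 1"
    using *(2) by induction (auto simp: std_basis_def)
  moreover have "v 1 - \<mu> 1 = \<psi> 1 + \<phi> 1"
    using fun_cong[OF *(3), of 1] by simp
  ultimately have "\<mu> 1 \<le> v 1"
    by (smt (verit))
  moreover fix i assume "i \<in> {1..n}"
  ultimately show "\<mu> i \<le> v 1"
    using Lam_antimono[OF \<mu>, of 1 i] by auto
qed

lemma finite_dom_le: "finite {\<mu> \<in> nat_vecs n. dom_le n \<mu> \<nu>}"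
proof (rule finite_subset[OF _ finite_bounded_vecs[of n "\<Sum>j = 1..n. \<bar>\<nu> j\<bar>"]], safe)
  fix \<mu> i assume \<mu>: "\<mu> \<in> nat_vecs n" "dom_le n \<mu> \<nu>" and i: "i \<in> {1..n}"
  have "\<mu> i \<le> (\<Sum>j = 1..n. \<mu> j)"
    using \<mu>(1) i by (intro member_le_sum) (auto simp: nat_vecs_def)
  also have "\<dots> \<le> (\<Sum>j = 1..n. \<nu> j)"
    using \<mu>(2) i by (auto simp: dom_le_def)
  also have "\<dots> \<le> (\<Sum>j = 1..n. \<bar>\<nu> j\<bar>)"
    by (intro sum_mono) auto
  finally show "\<mu> i \<le> (\<Sum>j = 1..n. \<bar>\<nu> j\<bar>)" .
qed

end

theory Submission
  imports Defs "HOL-Computational_Algebra.Polynomial"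
begin

text \<open>
  For \<open>r \<noteq> 0\<close> there is a difference operator that preserves invariant polynomials of degree at most \<open>d\<close>,
  lowers coordinates by 1 on the shifted partitions, and has the odd size of \<open>\<kappa>\<close> as the sum of its coefficients
  at \<open>\<rho> + \<kappa>\<close>.  As \<open>R\<^sub>\<lambda>\<close> vanishes at all small partitions other than \<open>\<lambda>\<close>, it is an eigenvector, and this
  yields extra zeros: \<open>R\<^sub>\<lambda>(\<rho> + \<kappa>) \<noteq> 0\<close> forces \<open>\<lambda>\<^sub>i \<le> \<kappa>\<^sub>i\<close> for all \<open>i\<close> and \<open>[\<lambda>]\<^sub>1 \<le> [\<kappa>]\<^sub>1\<close>.  View \<open>R\<^sub>\<lambda>\<close> as a
  polynomial in \<open>z\<^sub>1, \<dots>, z\<^sub>m\<close>, or in \<open>u\<^sub>2, u\<^sub>4, \<dots>, u\<^sub>2\<^sub>j\<close>.  The coefficients are polynomials in the remaining variables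
  which vanish at many lattice points, so they are zero if their degree is too small.  This bounds the
  partial degrees of \<open>R\<^sub>\<lambda>\<close>.

  The polynomials \<open>\<^bold>e\<^sub>\<mu>\<close> have distinct leading monomials in two suitable coordinate systems, and each of the
  partial degrees is attained there.  Hence no cancellation is possible in the expansion of \<open>R\<^sub>\<lambda>\<close> in the
  \<open>\<^bold>e\<^sub>\<mu>\<close>, and every \<open>\<mu>\<close> that occurs satisfies the inequalities that define \<open>\<mu> \<preceq> \<lambda>\<close>.  This is (b), and (a)
  follows from the partial degrees of the \<open>\<^bold>e\<^sub>\<mu>\<close>.

  For \<open>r = 0\<close>, solve the vanishing conditions over \<open>k[t]\<close> with \<open>t\<close> in place of \<open>r\<close>.  A coefficient outside the
  order ideal vanishes at \<open>t = 1, 2, \<dots>\<close>, hence also at \<open>t = 0\<close>.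
\<close>

section \<open>Evaluation and substitution\<close>

text \<open>The operator lowers either one odd coordinate, or one odd and one even coordinate. Both
  kinds of steps lower the odd size by 1; they change [\<kappa>]_1 by -1 and by 0. A descent from
  \<kappa> to \<lambda> therefore yields containment and the inequality for [\<kappa>]_1 at once.
  The coefficients have denominators z_i - z_l with i and l of equal parity, and Lagrange
  interpolation shows that the sums are nevertheless polynomial. At r = 0 equal entries of \<kappa>
  make such denominators zero, hence the separate treatment of that case. The inequalities for \<mu>
  \<preceq> \<lambda> come from two kinds of weights. The degree in z_1, ..., z_m gives those on odd
  positions (m even) and the one for [\<mu>]_1 (m = 1). The degree in u_2, u_4, ..., u_{2j} gives
  those on even positions. For the latter the leading monomial with exponent [\<mu>] is useless,
  because [\<mu>]_2 + ... + [\<mu>]_{2j} may be smaller than \<mu>_2 + ... + \<mu>_{2j}; an order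
  with the variables u_2, u_4, ... in front is needed.\<close>

abbreviation lkp :: "('a \<Rightarrow>\<^sub>0 'b::zero) \<Rightarrow> 'a \<Rightarrow> 'b" where "lkp \<equiv> Poly_Mapping.lookup"
abbreviation kys :: "('a \<Rightarrow>\<^sub>0 'b::zero) \<Rightarrow> 'a set" where "kys \<equiv> Poly_Mapping.keys"

text \<open>\<open>poly_eval\<close> and \<open>poly_subst\<close> are \<open>poly_map\<close> with
  the coefficient maps \<open>\<lambda>c. c\<close> and \<open>Const\<close>; compatibility with
  sums and products is shown once for every homomorphism \<open>h\<close>.\<close>

definition coeff_hom :: "('k::comm_semiring_1 \<Rightarrow> 'b::comm_semiring_1) \<Rightarrow> bool" where
  "coeff_hom h \<longleftrightarrow> h 0 = 0 \<and> h 1 = 1 \<and> (\<forall>a b. h (a + b) = h a + h b) \<and> (\<forall>a b. h (a * b) = h a * h b)"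

definition mon_eval :: "(nat \<Rightarrow> 'b) \<Rightarrow> (nat \<Rightarrow>\<^sub>0 nat) \<Rightarrow> 'b::comm_semiring_1" where
  "mon_eval f m = (\<Prod>i \<in> kys m. f i ^ lkp m i)"

lemma mon_eval_superset:
  assumes "finite S" "kys m \<subseteq> S"
  shows "mon_eval f m = (\<Prod>i \<in> S. f i ^ lkp m i)"
  unfolding mon_eval_def using assms
  by (intro prod.mono_neutral_left) (auto simp: in_keys_iff)

lemma mon_eval_zero [simp]: "mon_eval f 0 = 1"
  by (simp add: mon_eval_def)

lemma mon_eval_add: "mon_eval f (m + m') = mon_eval f m * mon_eval f m'"
proof -
  let ?S = "kys m \<union> kys m'"
  have "kys (m + m') \<subseteq> ?S" by (rule Poly_Mapping.keys_add)
  then have "mon_eval f (m + m') = (\<Prod>i \<in> ?S. f i ^ lkp (m + m') i)"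
    by (intro mon_eval_superset) auto
  also have "\<dots> = mon_eval f m * mon_eval f m'"
    by (simp add: lookup_add power_add prod.distrib mon_eval_superset[of ?S])
  finally show ?thesis .
qed

lemma mon_eval_single [simp]: "mon_eval f (Poly_Mapping.single i a) = f i ^ a"
  by (cases "a = 0") (auto simp: mon_eval_def)

lemma poly_map_superset:
  assumes "coeff_hom h" "finite S" "kys p \<subseteq> S"
  shows "poly_map h f p = (\<Sum>m \<in> S. h (lkp p m) * mon_eval f m)"
  unfolding poly_map_def mon_eval_def[symmetric] using assms
  by (intro sum.mono_neutral_left) (auto simp: in_keys_iff coeff_hom_def)

lemma poly_map_add:
  assumes "coeff_hom h"
  shows "poly_map h f (p + q) = poly_map h f p + poly_map h f q"
proof -
  let ?S = "kys p \<union> kys q"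
  have "kys (p + q) \<subseteq> ?S" by (rule Poly_Mapping.keys_add)
  then have "poly_map h f (p + q) = (\<Sum>m \<in> ?S. h (lkp (p + q) m) * mon_eval f m)"
    by (intro poly_map_superset assms) auto
  also have "\<dots> = poly_map h f p + poly_map h f q"
    using assms by (simp add: lookup_add poly_map_superset[OF assms, of ?S] sum.distrib
        distrib_right coeff_hom_def)
  finally show ?thesis .
qed

lemma poly_map_single:
  assumes "coeff_hom h"
  shows "poly_map h f (Poly_Mapping.single m c) = h c * mon_eval f m"
  using assms by (subst poly_map_superset[of h "{m}"]) auto

lemma poly_map_zero [simp]: "poly_map h f 0 = 0"
  by (simp add: poly_map_def)

lemma poly_map_sum:
  assumes "coeff_hom h"
  shows "poly_map h f (\<Sum>i\<in>I. g i) = (\<Sum>i\<in>I. poly_map h f (g i))"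
  by (induction I rule: infinite_finite_induct) (auto simp: poly_map_add[OF assms])

lemma mpoly_sum_singles: "p = (\<Sum>m \<in> kys p. Poly_Mapping.single m (lkp p m))"
  by (rule poly_mapping_eqI) (auto simp: lookup_sum lookup_single when_def in_keys_iff)

lemma mpoly_induct [case_names zero single add]:
  fixes p :: "'k::comm_monoid_add mpoly"
  assumes "P 0" "\<And>m c. P (Poly_Mapping.single m c)" "\<And>p q. P p \<Longrightarrow> P q \<Longrightarrow> P (p + q)"
  shows "P p"
proof -
  have "P (\<Sum>m \<in> S. Poly_Mapping.single m (lkp p m))" for S
    by (induction S rule: infinite_finite_induct) (auto intro: assms)
  then show ?thesis using mpoly_sum_singles[of p] by metis
qed

lemma poly_map_mult:
  assumes "coeff_hom h"
  shows "poly_map h f (p * q) = poly_map h f p * poly_map h f q"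
proof (induction p rule: mpoly_induct)
  case (single m c)
  show ?case
  proof (induction q rule: mpoly_induct)
    case (single m' c')
    then show ?case using assms
      by (simp add: mult_single poly_map_single mon_eval_add coeff_hom_def mult_ac)
  qed (simp_all add: poly_map_add[OF assms] distrib_left)
qed (simp_all add: poly_map_add[OF assms] distrib_right)

lemma Const_hom: "coeff_hom (Const :: 'k::comm_semiring_1 \<Rightarrow> 'k mpoly)"
  by (auto simp: coeff_hom_def Const_def single_add mult_single)

lemma id_hom: "coeff_hom (\<lambda>c. c)"
  by (auto simp: coeff_hom_def)

lemma poly_eval_add [simp]: "poly_eval x (p + q) = poly_eval x p + poly_eval x q"
  and poly_eval_mult [simp]: "poly_eval x (p * q) = poly_eval x p * poly_eval x q"
  and poly_eval_zero [simp]: "poly_eval x 0 = 0"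
  and poly_eval_single: "poly_eval x (Poly_Mapping.single m c) = c * mon_eval x m"
  and poly_eval_sum [simp]: "poly_eval x (\<Sum>i\<in>I. g i) = (\<Sum>i\<in>I. poly_eval x (g i))"
  by (simp_all add: poly_eval_def poly_map_add poly_map_mult poly_map_single poly_map_sum id_hom)

lemma poly_eval_Const [simp]: "poly_eval x (Const c) = c"
  by (simp add: Const_def poly_eval_single)

lemma poly_eval_X [simp]: "poly_eval x (X i) = x i"
  by (simp add: X_def poly_eval_single)

lemma Const_0 [simp]: "Const 0 = 0" and Const_1 [simp]: "Const 1 = 1"
  by (simp_all add: Const_def)

lemma poly_eval_one [simp]: "poly_eval x 1 = 1"
  using poly_eval_Const[of x 1] by simp

lemma poly_eval_uminus [simp]: "poly_eval x (- p) = - poly_eval (x :: nat \<Rightarrow> 'k::comm_ring_1) p"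
  using poly_eval_add[of x p "- p"] by (simp add: eq_neg_iff_add_eq_0 add.commute)

lemma poly_eval_diff [simp]:
  "poly_eval x (p - q) = poly_eval (x :: nat \<Rightarrow> 'k::comm_ring_1) p - poly_eval x q"
  by (metis add_uminus_conv_diff poly_eval_add poly_eval_uminus)

lemma poly_eval_prod [simp]: "poly_eval x (\<Prod>i\<in>I. g i) = (\<Prod>i\<in>I. poly_eval x (g i))"
  by (induction I rule: infinite_finite_induct) auto

lemma poly_eval_power [simp]: "poly_eval x (p ^ k) = poly_eval x p ^ k"
  by (induction k) auto

lemma poly_subst_add [simp]: "poly_subst s (p + q) = poly_subst s p + poly_subst s q"
  and poly_subst_mult [simp]: "poly_subst s (p * q) = poly_subst s p * poly_subst s q"
  and poly_subst_zero [simp]: "poly_subst s 0 = 0"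
  and poly_subst_single: "poly_subst s (Poly_Mapping.single m c) = Const c * mon_eval s m"
  and poly_subst_sum [simp]: "poly_subst s (\<Sum>i\<in>I. g i) = (\<Sum>i\<in>I. poly_subst s (g i))"
  by (simp_all add: poly_subst_def poly_map_add poly_map_mult poly_map_single poly_map_sum Const_hom)

lemma poly_subst_Const [simp]: "poly_subst s (Const c) = Const c"
  by (simp add: Const_def poly_subst_single)

lemma poly_subst_X [simp]: "poly_subst s (X i) = s i"
  by (simp add: X_def poly_subst_single)

lemma poly_subst_one [simp]: "poly_subst s 1 = 1"
  using poly_subst_Const[of s 1] by simp

lemma poly_subst_uminus [simp]: "poly_subst s (- p) = - poly_subst (s :: nat \<Rightarrow> 'k::comm_ring_1 mpoly) p"
  using poly_subst_add[of s p "- p"] by (simp add: eq_neg_iff_add_eq_0 add.commute)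

lemma poly_subst_diff [simp]:
  "poly_subst s (p - q) = poly_subst (s :: nat \<Rightarrow> 'k::comm_ring_1 mpoly) p - poly_subst s q"
  by (metis add_uminus_conv_diff poly_subst_add poly_subst_uminus)

lemma poly_subst_prod [simp]: "poly_subst s (\<Prod>i\<in>I. g i) = (\<Prod>i\<in>I. poly_subst s (g i))"
  by (induction I rule: infinite_finite_induct) auto

lemma poly_subst_power [simp]: "poly_subst s (p ^ k) = poly_subst s p ^ k"
  by (induction k) auto

lemma poly_eval_subst: "poly_eval x (poly_subst s p) = poly_eval (\<lambda>i. poly_eval x (s i)) p"
proof (induction p rule: mpoly_induct)
  case (single m c)
  then show ?case by (simp add: poly_subst_single poly_eval_single mon_eval_def)
qed auto

lemma poly_eval_alt: "poly_eval x p = (\<Sum>m \<in> kys p. lkp p m * mon_eval x m)"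
  by (simp add: poly_eval_def poly_map_def mon_eval_def)

lemma poly_eval_cong:
  assumes "\<And>m i. m \<in> kys p \<Longrightarrow> i \<in> kys m \<Longrightarrow> x i = y i"
  shows "poly_eval x p = poly_eval y p"
proof -
  have "mon_eval x m = mon_eval y m" if "m \<in> kys p" for m
    unfolding mon_eval_def using assms[OF that] by (intro prod.cong) auto
  then show ?thesis unfolding poly_eval_alt by (intro sum.cong) auto
qed

text \<open>Used for coordinate lines, where vanishing is tested one variable at a time, and for the
  line t \<mapsto> \<open>shifted n t \<kappa>\<close> along which the parameter is
  deformed.\<close>

lemma poly_eval_line:
  fixes p :: "'k::comm_ring_1 mpoly"
  shows "\<exists>q. \<forall>t. poly q t = poly_eval (\<lambda>i. c i + t * d i) p"
proof (induction p rule: mpoly_induct)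
  case zero
  show ?case by (rule exI[of _ 0]) auto
next
  case (single m a)
  show ?case
    by (rule exI[of _ "[:a:] * (\<Prod>i \<in> kys m. [:c i, d i:] ^ lkp m i)"])
      (simp add: poly_eval_single mon_eval_def poly_prod)
next
  case (add p q)
  then obtain u v where "\<forall>t. poly u t = poly_eval (\<lambda>i. c i + t * d i) p"
    "\<forall>t. poly v t = poly_eval (\<lambda>i. c i + t * d i) q" by blast
  then show ?case by (intro exI[of _ "u + v"]) simp
qed

lemma poly_eval_coordinate:
  fixes p :: "'k::comm_ring_1 mpoly"
  shows "\<exists>q. \<forall>t. poly q t = poly_eval (z(i := t)) p"
proof -
  have "(\<lambda>j. (z(i := 0)) j + t * (if j = i then 1 else 0)) = z(i := t)" for t by auto
  then show ?thesis using poly_eval_line[of "z(i := 0)" "\<lambda>j. if j = i then 1 else 0" p] by metis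
qed

lemma infinite_zeros_imp_zero:
  fixes q :: "'k::idom poly"
  assumes "infinite {t. poly q t = 0}"
  shows "q = 0"
  using assms poly_roots_finite by blast

section \<open>Polynomials read as polynomials in a subset of the variables\<close>

definition restr :: "nat set \<Rightarrow> (nat \<Rightarrow>\<^sub>0 nat) \<Rightarrow> (nat \<Rightarrow>\<^sub>0 nat)" where
  "restr U m = (\<Sum>i \<in> U \<inter> kys m. Poly_Mapping.single i (lkp m i))"

lemma lookup_restr: "lkp (restr U m) i = (if i \<in> U then lkp m i else 0)"
  by (auto simp: restr_def lookup_sum lookup_single when_def in_keys_iff)

lemma keys_restr: "kys (restr U m) = U \<inter> kys m"
  by (auto simp: in_keys_iff lookup_restr split: if_splits)

text \<open>The coefficient of the monomial \<open>\<alpha>\<close> when \<open>p\<close> is read as a polynomial in the variables in \<open>U\<close>.\<close>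

definition mpart :: "nat set \<Rightarrow> (nat \<Rightarrow>\<^sub>0 nat) \<Rightarrow> 'k::comm_monoid_add mpoly \<Rightarrow> 'k mpoly" where
  "mpart U \<alpha> p = (\<Sum>m \<in> {m \<in> kys p. restr U m = \<alpha>}. Poly_Mapping.single (m - \<alpha>) (lkp p m))"

lemma keys_mpart:
  assumes "m' \<in> kys (mpart U \<alpha> p)"
  shows "m' + \<alpha> \<in> kys p" "restr U (m' + \<alpha>) = \<alpha>" "kys m' \<inter> U = {}"
proof -
  have "lkp (mpart U \<alpha> p) m' \<noteq> 0" using assms by (simp add: in_keys_iff)
  then obtain m where m: "m \<in> kys p" "restr U m = \<alpha>" "m' = m - \<alpha>"
    unfolding mpart_def lookup_sum lookup_single when_def
    by (smt (verit) mem_Collect_eq sum.not_neutral_contains_not_neutral)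
  have "m - \<alpha> + \<alpha> = m" using m(2)
    by (intro poly_mapping_eqI) (auto simp: lookup_add lookup_minus lookup_restr)
  then show "m' + \<alpha> \<in> kys p" "restr U (m' + \<alpha>) = \<alpha>" using m by auto
  show "kys m' \<inter> U = {}" using m by (auto simp: in_keys_iff lookup_minus lookup_restr)
qed

text \<open>Monomials with the same restriction to \<open>U\<close> stay distinct after that
  restriction is divided out, so no cancellation occurs inside \<open>mpart\<close>.\<close>

lemma mpart_eq_0_imp:
  assumes "mpart U (restr U m) p = 0"
  shows "m \<notin> kys p"
proof
  assume "m \<in> kys p"
  let ?a = "restr U m"
  have "lkp (mpart U ?a p) (m - ?a) = (\<Sum>m' \<in> {m' \<in> kys p. restr U m' = ?a}. lkp p m' when m' - ?a = m - ?a)"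
    by (simp add: mpart_def lookup_sum lookup_single)
  also have "\<dots> = (\<Sum>m' \<in> {m}. lkp p m')"
  proof (rule sum.mono_neutral_cong_right)
    show "\<forall>i\<in>{m' \<in> kys p. restr U m' = ?a} - {m}. (lkp p i when i - ?a = m - ?a) = 0"
    proof safe
      fix m' assume *: "(lkp p m' when m' - ?a = m - ?a) \<noteq> 0" "restr U m' = ?a"
      then have "m' - ?a = m - ?a" by (auto simp: when_def split: if_splits)
      then have "lkp m' i = lkp m i" for i
        using *(2) by (cases "i \<in> U") (metis lookup_restr, metis diff_zero lookup_minus lookup_restr)
      then show "m' = m" by (intro poly_mapping_eqI)
    qed
  qed (use \<open>m \<in> kys p\<close> in auto)
  finally show False using \<open>m \<in> kys p\<close> assms by (simp add: in_keys_iff)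
qed

lemma mpart_decomp:
  "p = (\<Sum>\<alpha> \<in> restr U ` kys p. Poly_Mapping.single \<alpha> 1 * mpart U \<alpha> (p :: 'k::comm_semiring_1 mpoly))"
proof -
  have *: "Poly_Mapping.single \<alpha> 1 * Poly_Mapping.single (m - \<alpha>) (lkp p m) = Poly_Mapping.single m (lkp p m)"
    if "restr U m = \<alpha>" for m \<alpha>
  proof -
    have "\<alpha> + (m - \<alpha>) = m" using that
      by (intro poly_mapping_eqI) (auto simp: lookup_add lookup_minus lookup_restr)
    then show ?thesis by (simp add: mult_single)
  qed
  have "p = (\<Sum>m \<in> kys p. Poly_Mapping.single m (lkp p m))" by (rule mpoly_sum_singles)
  also have "\<dots> = (\<Sum>\<alpha> \<in> restr U ` kys p. \<Sum>m \<in> {m \<in> kys p. restr U m = \<alpha>}. Poly_Mapping.single m (lkp p m))"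
    by (rule sum.group[symmetric]) auto
  also have "\<dots> = (\<Sum>\<alpha> \<in> restr U ` kys p. Poly_Mapping.single \<alpha> 1 * mpart U \<alpha> p)"
    unfolding mpart_def sum_distrib_left by (intro sum.cong refl) (simp add: *)
  finally show ?thesis .
qed

lemma poly_eval_mpart_cong:
  assumes "\<And>i. i \<notin> U \<Longrightarrow> x i = y i"
  shows "poly_eval x (mpart U \<alpha> p) = poly_eval y (mpart U \<alpha> p)"
  by (rule poly_eval_cong) (use keys_mpart(3) assms in blast)

text \<open>Induction on the set of variables. With the other coordinates fixed, p is a univariate
  polynomial vanishing on an infinite field; hence its coefficients with respect to z_i, which no
  longer involve z_i, vanish at every point.\<close>

lemma poly_eval_all_zero_aux:
  fixes p :: "'k::field_char_0 mpoly"
  assumes "finite V" "\<forall>m \<in> kys p. kys m \<subseteq> V" "\<forall>z. poly_eval z p = 0"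
  shows "p = 0"
  using assms
proof (induction V arbitrary: p rule: finite_induct)
  case empty
  then have "m = 0" if "m \<in> kys p" for m using that by auto
  then have "p = Const (lkp p 0)"
    by (intro poly_mapping_eqI) (auto simp: Const_def lookup_single when_def in_keys_iff)
  then show ?case using empty(2) by (metis Const_0 poly_eval_Const)
next
  case (insert i V)
  let ?s = "\<lambda>k. Poly_Mapping.single i (k::nat)"
  let ?K = "restr {i} ` kys p"
  have restr: "restr {i} m = ?s (lkp m i)" for m
    by (intro poly_mapping_eqI) (auto simp: lookup_restr lookup_single)
  have "mpart {i} (?s k) p = 0" for k
  proof (rule insert.IH)
    show "\<forall>m\<in>kys (mpart {i} (?s k) p). kys m \<subseteq> V"
    proof
      fix m assume m: "m \<in> kys (mpart {i} (?s k) p)"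
      have "m + ?s k \<in> kys p" by (rule keys_mpart(1)[OF m])
      then have "kys (m + ?s k) \<subseteq> insert i V" using insert.prems by auto
      moreover have "kys m \<subseteq> kys (m + ?s k)" by (auto simp: in_keys_iff lookup_add)
      ultimately show "kys m \<subseteq> V" using keys_mpart(3)[OF m] by auto
    qed
    show "\<forall>z. poly_eval z (mpart {i} (?s k) p) = 0"
    proof
      fix z
      let ?N = "(\<lambda>m. lkp m i) ` kys p"
      define q where "q = (\<Sum>j \<in> ?N. monom (poly_eval z (mpart {i} (?s j) p)) j)"
      have "poly q t = 0" for t
      proof -
        have K: "?K = ?s ` ?N" by (auto simp: restr image_iff)
        have "0 = poly_eval (z(i := t)) p" using insert.prems by simp
        also have "\<dots> = (\<Sum>\<alpha> \<in> ?K. mon_eval (z(i := t)) \<alpha> * poly_eval z (mpart {i} \<alpha> p))"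
        proof -
          have "poly_eval (z(i := t)) (mpart {i} \<alpha> p) = poly_eval z (mpart {i} \<alpha> p)" for \<alpha>
            by (rule poly_eval_mpart_cong) auto
          then show ?thesis by (subst mpart_decomp[of p "{i}"]) (simp add: poly_eval_single)
        qed
        also have "\<dots> = (\<Sum>j \<in> ?N. t ^ j * poly_eval z (mpart {i} (?s j) p))"
          unfolding K by (subst sum.reindex) (auto simp: inj_on_def dest: injD[OF inj_single])
        finally show ?thesis unfolding q_def by (simp add: poly_sum poly_monom mult.commute)
      qed
      then have "q = 0" using infinite_zeros_imp_zero[of q] by (simp add: infinite_UNIV_char_0)
      show "poly_eval z (mpart {i} (?s k) p) = 0"
      proof (cases "k \<in> ?N")
        case True
        have "0 = coeff q k" using \<open>q = 0\<close> by simp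
        also have "\<dots> = (\<Sum>j \<in> ?N. if j = k then poly_eval z (mpart {i} (?s j) p) else 0)"
          unfolding q_def by (simp add: coeff_sum)
        finally show ?thesis using True by simp
      next
        case False
        then have "{m \<in> kys p. restr {i} m = ?s k} = {}" by (auto simp: restr dest: injD[OF inj_single])
        then have "mpart {i} (?s k) p = 0" by (simp only: mpart_def sum.empty)
        then show ?thesis by simp
      qed
    qed
  qed
  then have "mpart {i} (restr {i} m) p = 0" for m by (simp add: restr)
  then have "kys p = {}" using mpart_eq_0_imp by blast
  then show ?case by simp
qed

lemma poly_eval_all_zero:
  fixes p :: "'k::field_char_0 mpoly"
  assumes "\<And>z. poly_eval z p = 0"
  shows "p = 0"
proof (rule poly_eval_all_zero_aux)
  show "finite (\<Union>m \<in> kys p. kys m)" by auto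
qed (use assms in auto)

lemma poly_eval_eqI:
  fixes p :: "'k::field_char_0 mpoly"
  assumes "\<And>z. poly_eval z p = poly_eval z q"
  shows "p = q"
  using poly_eval_all_zero[of "p - q"] assms by simp

section \<open>Weighted degrees and invariant polynomials\<close>

definition wdeg :: "(nat \<Rightarrow> nat) \<Rightarrow> (nat \<Rightarrow>\<^sub>0 nat) \<Rightarrow> nat" where
  "wdeg \<omega> m = (\<Sum>i \<in> kys m. \<omega> i * lkp m i)"

lemma wdeg_superset:
  assumes "finite S" "kys m \<subseteq> S"
  shows "wdeg \<omega> m = (\<Sum>i \<in> S. \<omega> i * lkp m i)"
  unfolding wdeg_def using assms by (intro sum.mono_neutral_left) (auto simp: in_keys_iff)

lemma wdeg_add: "wdeg \<omega> (m + m') = wdeg \<omega> m + wdeg \<omega> m'"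
proof -
  let ?S = "kys m \<union> kys m'"
  have "kys (m + m') \<subseteq> ?S" by (rule Poly_Mapping.keys_add)
  then have "wdeg \<omega> (m + m') = (\<Sum>i \<in> ?S. \<omega> i * lkp (m + m') i)"
    by (intro wdeg_superset) auto
  also have "\<dots> = wdeg \<omega> m + wdeg \<omega> m'"
    by (simp add: lookup_add distrib_left sum.distrib wdeg_superset[of ?S])
  finally show ?thesis .
qed

lemma wdeg_zero [simp]: "wdeg \<omega> 0 = 0"
  by (simp add: wdeg_def)

lemma wdeg_single [simp]: "wdeg \<omega> (Poly_Mapping.single i a) = \<omega> i * a"
  by (cases "a = 0") (auto simp: wdeg_def)

lemma mon_degree_eq_wdeg: "mon_degree m = wdeg (\<lambda>_. 1) m"
  by (simp add: mon_degree_def wdeg_def)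

definition wle :: "(nat \<Rightarrow> nat) \<Rightarrow> nat \<Rightarrow> 'k::zero mpoly \<Rightarrow> bool" where
  "wle \<omega> c p \<longleftrightarrow> (\<forall>m \<in> kys p. wdeg \<omega> m \<le> c)"

lemma wle_mono: "wle \<omega> c p \<Longrightarrow> c \<le> c' \<Longrightarrow> wle \<omega> c' p"
  by (auto simp: wle_def)

lemma wle_zero [simp]: "wle \<omega> c 0"
  by (simp add: wle_def)

lemma wle_Const [simp]: "wle \<omega> c (Const a)"
  by (auto simp: wle_def Const_def)

lemma wle_one [simp]: "wle \<omega> c (1 :: 'k::comm_semiring_1 mpoly)"
  by (auto simp: wle_def)

lemma wle_X: "\<omega> i \<le> c \<Longrightarrow> wle \<omega> c (X i)"
  by (auto simp: wle_def X_def)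

lemma wle_add: "wle \<omega> c p \<Longrightarrow> wle \<omega> c q \<Longrightarrow> wle \<omega> c (p + q)"
  using Poly_Mapping.keys_add[of p q] by (auto simp: wle_def)

lemma wle_uminus: "wle \<omega> c p \<Longrightarrow> wle \<omega> c (- (p :: 'k::comm_ring_1 mpoly))"
  by (auto simp: wle_def in_keys_iff)

lemma wle_diff: "wle \<omega> c p \<Longrightarrow> wle \<omega> c q \<Longrightarrow> wle \<omega> c (p - (q :: 'k::comm_ring_1 mpoly))"
  using wle_add[of \<omega> c p "- q"] wle_uminus[of \<omega> c q] by simp

lemma wle_mult:
  assumes "wle \<omega> c p" "wle \<omega> d q"
  shows "wle \<omega> (c + d) (p * (q :: 'k::comm_semiring_1 mpoly))"
  unfolding wle_def
proof
  fix m assume "m \<in> kys (p * q)"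
  then obtain a b where "a \<in> kys p" "b \<in> kys q" "m = a + b" using keys_mult[of p q] by auto
  then show "wdeg \<omega> m \<le> c + d" using assms by (auto simp: wle_def wdeg_add intro: add_mono)
qed

lemma wle_sum: "(\<And>i. i \<in> I \<Longrightarrow> wle \<omega> c (g i)) \<Longrightarrow> wle \<omega> c (\<Sum>i\<in>I. g i)"
  by (induction I rule: infinite_finite_induct) (auto intro: wle_add)

lemma wle_prod:
  "(\<And>i. i \<in> I \<Longrightarrow> wle \<omega> (c i) (g i)) \<Longrightarrow> wle \<omega> (\<Sum>i\<in>I. c i) (\<Prod>i\<in>I. g i :: 'k::comm_semiring_1 mpoly)"
  by (induction I rule: infinite_finite_induct) (auto intro: wle_mult)

lemma wle_power: "wle \<omega> c p \<Longrightarrow> wle \<omega> (k * c) ((p :: 'k::comm_semiring_1 mpoly) ^ k)"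
  by (induction k) (auto intro: wle_mult)

lemma poly_subst_alt: "poly_subst s p = (\<Sum>m \<in> kys p. Const (lkp p m) * mon_eval s m)"
  by (simp add: poly_subst_def poly_map_def mon_eval_def)

lemma wle_subst:
  assumes "wle \<nu> d p" "\<And>i. wle \<omega> (\<nu> i) (s i)"
  shows "wle \<omega> d (poly_subst s (p :: 'k::comm_semiring_1 mpoly))"
  unfolding poly_subst_alt
proof (rule wle_sum)
  fix m assume m: "m \<in> kys p"
  have "wle \<omega> (wdeg \<nu> m) (mon_eval s m)"
    unfolding wdeg_def mon_eval_def
  proof (rule wle_prod)
    show "wle \<omega> (\<nu> i * lkp m i) (s i ^ lkp m i)" for i
      using wle_power[OF assms(2), of "lkp m i" i] by (simp add: mult.commute)
  qed
  then have "wle \<omega> (0 + wdeg \<nu> m) (Const (lkp p m) * mon_eval s m)"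
    by (intro wle_mult) auto
  then show "wle \<omega> d (Const (lkp p m) * mon_eval s m)"
    by (rule wle_mono) (use assms(1) m in \<open>simp add: wle_def\<close>)
qed

text \<open>The condition of \<open>polys\<close> for an arbitrary set of variables, needed because
  coefficient polynomials involve only the variables of a tail and some spectators.\<close>

definition inv_vars :: "nat set \<Rightarrow> 'k::zero mpoly \<Rightarrow> bool" where
  "inv_vars V p \<longleftrightarrow> (\<forall>m \<in> kys p. kys m \<subseteq> V)"

lemma polys_iff: "p \<in> polys n \<longleftrightarrow> inv_vars {1..n} p"
  by (simp add: polys_def inv_vars_def)

lemma inv_vars_zero [simp]: "inv_vars V 0"
  and inv_vars_Const [simp]: "inv_vars V (Const a)"
  and inv_vars_one [simp]: "inv_vars V (1 :: 'k::comm_semiring_1 mpoly)"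
  by (auto simp: inv_vars_def Const_def)

lemma inv_vars_X: "i \<in> V \<Longrightarrow> inv_vars V (X i)"
  by (auto simp: inv_vars_def X_def)

lemma inv_vars_add: "inv_vars V p \<Longrightarrow> inv_vars V q \<Longrightarrow> inv_vars V (p + q)"
  using Poly_Mapping.keys_add[of p q] unfolding inv_vars_def by blast

lemma inv_vars_uminus: "inv_vars V p \<Longrightarrow> inv_vars V (- (p :: 'k::comm_ring_1 mpoly))"
  by (auto simp: inv_vars_def in_keys_iff)

lemma inv_vars_diff: "inv_vars V p \<Longrightarrow> inv_vars V q \<Longrightarrow> inv_vars V (p - (q :: 'k::comm_ring_1 mpoly))"
  using inv_vars_add[of V p "- q"] inv_vars_uminus[of V q] by simp

lemma inv_vars_mult:
  assumes "inv_vars V p" "inv_vars V q"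
  shows "inv_vars V (p * (q :: 'k::comm_semiring_1 mpoly))"
  unfolding inv_vars_def
proof
  fix m assume "m \<in> kys (p * q)"
  then obtain a b where ab: "a \<in> kys p" "b \<in> kys q" "m = a + b" using keys_mult[of p q] by auto
  then have "kys m \<subseteq> kys a \<union> kys b" using Poly_Mapping.keys_add[of a b] by simp
  then show "kys m \<subseteq> V" using assms ab unfolding inv_vars_def by blast
qed

lemma inv_vars_sum: "(\<And>i. i \<in> I \<Longrightarrow> inv_vars V (g i)) \<Longrightarrow> inv_vars V (\<Sum>i\<in>I. g i)"
  by (induction I rule: infinite_finite_induct) (auto intro: inv_vars_add)

lemma inv_vars_prod:
  "(\<And>i. i \<in> I \<Longrightarrow> inv_vars V (g i)) \<Longrightarrow> inv_vars V (\<Prod>i\<in>I. g i :: 'k::comm_semiring_1 mpoly)"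
  by (induction I rule: infinite_finite_induct) (auto intro: inv_vars_mult)

lemma inv_vars_power: "inv_vars V p \<Longrightarrow> inv_vars V ((p :: 'k::comm_semiring_1 mpoly) ^ k)"
  by (induction k) (auto intro: inv_vars_mult)

lemma inv_vars_subst:
  assumes "inv_vars V p" "\<And>i. i \<in> V \<Longrightarrow> inv_vars V' (s i)"
  shows "inv_vars V' (poly_subst s (p :: 'k::comm_semiring_1 mpoly))"
  unfolding poly_subst_alt mon_eval_def
proof (intro inv_vars_sum inv_vars_mult inv_vars_prod inv_vars_power inv_vars_Const)
  fix m i assume "m \<in> kys p" "i \<in> kys m"
  then show "inv_vars V' (s i)" using assms(1) by (intro assms(2)) (unfold inv_vars_def, blast)
qed

lemma poly_eval_cong_vars:
  assumes "inv_vars V p" "\<And>i. i \<in> V \<Longrightarrow> x i = y i"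
  shows "poly_eval x p = poly_eval y p"
proof (rule poly_eval_cong)
  fix m i assume "m \<in> kys p" "i \<in> kys m"
  then show "x i = y i" using assms(1) by (intro assms(2)) (unfold inv_vars_def, blast)
qed

lemma wle_total_degree: "wle (\<lambda>_. 1) (total_degree p) p"
  by (auto simp: wle_def total_degree_def mon_degree_eq_wdeg)

text \<open>Over an infinite field a polynomial is determined by its values, so invariance becomes
  an identity of functions.\<close>

lemma W_invariant_eval:
  fixes p :: "'k::field_char_0 mpoly"
  shows "W_invariant n p \<longleftrightarrow> (\<forall>\<pi> \<in> W n. \<forall>z. poly_eval (\<lambda>i. z (\<pi> i)) p = poly_eval z p)"
proof -
  have *: "poly_eval z (poly_subst (\<lambda>i. X (\<pi> i)) p) = poly_eval (\<lambda>i. z (\<pi> i)) p" for \<pi> z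
    by (simp add: poly_eval_subst)
  show ?thesis unfolding W_invariant_def
    by (metis (no_types, lifting) * poly_eval_eqI)
qed

definition Inv :: "nat \<Rightarrow> nat \<Rightarrow> 'k::field_char_0 mpoly \<Rightarrow> bool" where
  "Inv n d p \<longleftrightarrow> p \<in> polys n \<and> W_invariant n p \<and> wle (\<lambda>_. 1) d p"

lemma Inv_zero [simp]: "Inv n d 0" and Inv_Const [simp]: "Inv n d (Const c)"
  and Inv_one [simp]: "Inv n d 1"
  by (auto simp: Inv_def polys_iff W_invariant_def)

lemma Inv_mono: "Inv n d p \<Longrightarrow> d \<le> d' \<Longrightarrow> Inv n d' p"
  by (auto simp: Inv_def intro: wle_mono)

lemma Inv_add: "Inv n d p \<Longrightarrow> Inv n d q \<Longrightarrow> Inv n d (p + q)"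
  by (auto simp: Inv_def polys_iff W_invariant_def intro: wle_add inv_vars_add)

lemma Inv_uminus: "Inv n d p \<Longrightarrow> Inv n d (- p)"
  by (auto simp: Inv_def polys_iff W_invariant_def intro: wle_uminus inv_vars_uminus)

lemma Inv_diff: "Inv n d p \<Longrightarrow> Inv n d q \<Longrightarrow> Inv n d (p - q)"
  by (auto simp: Inv_def polys_iff W_invariant_def intro: wle_diff inv_vars_diff)

lemma Inv_mult: "Inv n d p \<Longrightarrow> Inv n e q \<Longrightarrow> Inv n (d + e) (p * q)"
  by (auto simp: Inv_def polys_iff W_invariant_def intro: wle_mult inv_vars_mult)

lemma Inv_smult: "Inv n d p \<Longrightarrow> Inv n d (Const c * p)"
  using Inv_mult[of n 0 "Const c" d p] by simp

lemma Inv_sum: "(\<And>i. i \<in> I \<Longrightarrow> Inv n d (g i)) \<Longrightarrow> Inv n d (\<Sum>i\<in>I. g i)"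
  by (induction I rule: infinite_finite_induct) (auto intro: Inv_add)

lemma Inv_prod:
  "(\<And>i. i \<in> I \<Longrightarrow> Inv n (d i) (g i)) \<Longrightarrow> Inv n (\<Sum>i\<in>I. d i) (\<Prod>i\<in>I. g i)"
  by (induction I rule: infinite_finite_induct) (auto intro: Inv_mult)

lemma Inv_power: "Inv n d p \<Longrightarrow> Inv n (k * d) (p ^ k)"
  by (induction k) (auto intro: Inv_mult)

text \<open>Kept separate from \<open>elem_sym\<close> so that the arguments may lie in any
  commutative semiring: evaluation and substitution then merely change the arguments.\<close>

definition esf :: "(nat \<Rightarrow> 'b::comm_semiring_1) \<Rightarrow> nat set \<Rightarrow> nat \<Rightarrow> 'b" where
  "esf f A k = (\<Sum>S \<in> {S. S \<subseteq> A \<and> card S = k}. \<Prod>i \<in> S. f i)"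

lemma elem_sym_esf: "elem_sym A k = esf X A k"
  by (simp add: elem_sym_def esf_def)

lemma poly_eval_esf: "poly_eval z (esf f A k) = esf (\<lambda>i. poly_eval z (f i)) A k"
  by (simp add: esf_def)

lemma poly_subst_esf: "poly_subst s (esf f A k) = esf (\<lambda>i. poly_subst s (f i)) A k"
  by (simp add: esf_def)

lemma poly_eval_elem_sym [simp]: "poly_eval z (elem_sym A k) = esf z A k"
  by (simp add: elem_sym_esf poly_eval_esf)

lemma esf_0 [simp]: assumes "finite A" shows "esf f A 0 = 1"
proof -
  have "{S. S \<subseteq> A \<and> card S = 0} = {{}}" using assms by (auto dest: finite_subset)
  then show ?thesis by (simp add: esf_def)
qed

lemma esf_insert:
  assumes "finite A" "b \<notin> A"
  shows "esf f (insert b A) (Suc k) = esf f A (Suc k) + f b * esf f A k"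
proof -
  let ?P = "{S. S \<subseteq> A \<and> card S = Suc k}" and ?Q = "{S. S \<subseteq> A \<and> card S = k}"
  have eq: "{S. S \<subseteq> insert b A \<and> card S = Suc k} = ?P \<union> insert b ` ?Q"
  proof safe
    fix S assume S: "S \<subseteq> insert b A" "card S = Suc k" "S \<notin> insert b ` ?Q"
    have "finite S" using S(1) assms(1) by (meson finite_insert finite_subset)
    have "b \<notin> S"
    proof
      assume "b \<in> S"
      then have "S = insert b (S - {b})" "S - {b} \<in> ?Q" using S \<open>finite S\<close> by auto
      then show False using S(3) by blast
    qed
    then show "x \<in> A" if "x \<in> S" for x using S(1) that by auto
  next
    fix S assume "S \<subseteq> A" then show "card (insert b S) = Suc (card S)"
      using assms by (subst card_insert_disjoint) (auto dest: finite_subset)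
  qed auto
  have "esf f (insert b A) (Suc k) = (\<Sum>S \<in> ?P. prod f S) + (\<Sum>S \<in> insert b ` ?Q. prod f S)"
    unfolding esf_def eq using assms by (intro sum.union_disjoint) auto
  also have "(\<Sum>S \<in> insert b ` ?Q. prod f S) = (\<Sum>S \<in> ?Q. f b * prod f S)"
  proof (subst sum.reindex)
    show "inj_on (insert b) ?Q" using assms(2) by (auto simp: inj_on_def)
    show "sum (prod f \<circ> insert b) ?Q = (\<Sum>S\<in>?Q. f b * prod f S)"
    proof (intro sum.cong refl)
      fix S assume "S \<in> ?Q"
      then have "finite S" "b \<notin> S" using assms by (auto dest: finite_subset)
      then show "(prod f \<circ> insert b) S = f b * prod f S" by simp
    qed
  qed
  finally show ?thesis by (simp add: esf_def sum_distrib_left)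
qed

lemma esf_remove:
  assumes "finite A" "b \<in> A"
  shows "esf f A (Suc k) = esf f (A - {b}) (Suc k) + f b * esf f (A - {b}) k"
  using esf_insert[of "A - {b}" b f k] assms by (simp add: insert_absorb)

lemma esf_gt_card: assumes "finite A" "card A < k" shows "esf f A k = 0"
proof -
  have "{S. S \<subseteq> A \<and> card S = k} = {}" using assms card_mono leD by blast
  then show ?thesis by (simp only: esf_def sum.empty)
qed

lemma esf_cong: assumes "\<And>i. i \<in> A \<Longrightarrow> f i = g i" shows "esf f A k = esf g A k"
  unfolding esf_def using assms by (intro sum.cong prod.cong) auto

lemma esf_image:
  assumes "inj_on \<pi> A"
  shows "esf (\<lambda>i. f (\<pi> i)) A k = esf f (\<pi> ` A) k"
  unfolding esf_def
proof (rule sum.reindex_bij_witness[where i="\<lambda>S. A \<inter> \<pi> -` S" and j="(`) \<pi>"])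
  fix S assume S: "S \<in> {S. S \<subseteq> A \<and> card S = k}"
  then show "A \<inter> \<pi> -` \<pi> ` S = S" using assms by (auto dest: inj_onD)
  show "\<pi> ` S \<in> {S. S \<subseteq> \<pi> ` A \<and> card S = k}"
    using S assms by (auto simp: card_image inj_on_subset)
  show "prod f (\<pi> ` S) = (\<Prod>i\<in>S. f (\<pi> i))"
    using S assms by (auto simp: prod.reindex inj_on_subset)
next
  fix S assume S: "S \<in> {S. S \<subseteq> \<pi> ` A \<and> card S = k}"
  then show eq: "\<pi> ` (A \<inter> \<pi> -` S) = S" by auto
  have "card (\<pi> ` (A \<inter> \<pi> -` S)) = card (A \<inter> \<pi> -` S)"
    using assms by (intro card_image) (auto simp: inj_on_def)
  then show "A \<inter> \<pi> -` S \<in> {S. S \<subseteq> A \<and> card S = k}" using S eq by auto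
qed

lemma prod_add_esf:
  fixes f :: "nat \<Rightarrow> 'b::comm_semiring_1"
  assumes "finite A"
  shows "(\<Prod>i\<in>A. s + f i) = (\<Sum>k\<le>card A. esf f A k * s ^ (card A - k))"
  using assms
proof (induction A rule: finite_induct)
  case (insert b A)
  let ?N = "card A"
  have "(\<Prod>i\<in>insert b A. s + f i) = (s + f b) * (\<Sum>k\<le>?N. esf f A k * s ^ (?N - k))"
    using insert by simp
  also have "\<dots> = (\<Sum>k\<le>?N. esf f A k * s ^ (Suc ?N - k)) + (\<Sum>k\<le>?N. f b * esf f A k * s ^ (?N - k))"
    by (simp add: distrib_right sum_distrib_left Suc_diff_le mult_ac sum.distrib)
  also have "(\<Sum>k\<le>?N. esf f A k * s ^ (Suc ?N - k)) = (\<Sum>k\<le>Suc ?N. esf f A k * s ^ (Suc ?N - k))"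
    using insert by (simp add: esf_gt_card)
  also have "\<dots> = s ^ Suc ?N + (\<Sum>k\<le>?N. esf f A (Suc k) * s ^ (?N - k))"
    using insert by (subst sum.atMost_Suc_shift) simp
  also have "\<dots> + (\<Sum>k\<le>?N. f b * esf f A k * s ^ (?N - k)) =
      s ^ Suc ?N + (\<Sum>k\<le>?N. esf f (insert b A) (Suc k) * s ^ (?N - k))"
    using insert by (simp add: esf_insert sum.distrib algebra_simps)
  also have "\<dots> = (\<Sum>k\<le>Suc ?N. esf f (insert b A) k * s ^ (Suc ?N - k))"
    using insert by (subst sum.atMost_Suc_shift) simp
  finally show ?case using insert by simp
qed auto

abbreviation Odds :: "nat \<Rightarrow> nat set" where "Odds n \<equiv> {i \<in> {1..n}. odd i}"
abbreviation Evens :: "nat \<Rightarrow> nat set" where "Evens n \<equiv> {i \<in> {1..n}. even i}"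

lemma W_image:
  assumes "\<pi> \<in> W n"
  shows "\<pi> ` Odds n = Odds n" "\<pi> ` Evens n = Evens n" "inj_on \<pi> A"
proof -
  have p: "\<pi> permutes {1..n}" and par: "\<And>i. \<pi> i mod 2 = i mod 2" using assms by (auto simp: W_def)
  have odd: "odd (\<pi> i) \<longleftrightarrow> odd i" for i using par[of i] by presburger
  show inj: "inj_on \<pi> A" for A using p permutes_inj_on by blast
  show "\<pi> ` Odds n = Odds n"
    using permutes_in_image[OF p] odd by (intro card_subset_eq) (auto simp: card_image inj)
  show "\<pi> ` Evens n = Evens n"
    using permutes_in_image[OF p] odd by (intro card_subset_eq) (auto simp: card_image inj)
qed

lemma Inv_elem_sym:
  assumes "A = Odds n \<or> A = Evens n"
  shows "Inv n k (elem_sym A k :: 'k::field_char_0 mpoly)"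
  unfolding Inv_def
proof (intro conjI)
  have A: "A \<subseteq> {1..n}" using assms by auto
  have "inv_vars {1..n} (elem_sym A k)"
    unfolding elem_sym_def using A by (intro inv_vars_sum inv_vars_prod inv_vars_X) auto
  then show "elem_sym A k \<in> polys n" by (simp add: polys_iff)
  have "wle (\<lambda>_. 1) k (\<Prod>i\<in>S. X i :: 'k mpoly)" if "card S = k" for S
    using wle_prod[of S "\<lambda>_. 1" "\<lambda>_. 1" "X :: nat \<Rightarrow> 'k mpoly"] that by (simp add: wle_X)
  then show "wle (\<lambda>_. 1) k (elem_sym A k :: 'k mpoly)"
    unfolding elem_sym_def by (intro wle_sum) auto
  show "W_invariant n (elem_sym A k :: 'k mpoly)"
    unfolding W_invariant_eval
  proof (intro ballI allI)
    fix \<pi> and z :: "nat \<Rightarrow> 'k" assume "\<pi> \<in> W n"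
    then have "\<pi> ` A = A" "inj_on \<pi> A" using W_image[of \<pi> n] assms by blast+
    then show "poly_eval (\<lambda>i. z (\<pi> i)) (elem_sym A k) = poly_eval z (elem_sym A k)"
      using esf_image[of \<pi> A z k] by simp
  qed
qed

lemma Inv_elem_semisym: "Inv n ((i + 1) div 2) (elem_semisym n i :: 'k::field_char_0 mpoly)"
proof (cases "odd i")
  case True
  then show ?thesis unfolding elem_semisym_def by (auto intro!: Inv_diff Inv_elem_sym)
next
  case False
  then have "(i + 1) div 2 = i div 2" by presburger
  then show ?thesis using False unfolding elem_semisym_def by (auto intro!: Inv_elem_sym)
qed

section \<open>Leading monomials\<close>

text \<open>The order on exponents is lexicographic with the smallest index most significant. It is
  compatible with addition, which makes \<open>lead\<close> compatible with products.\<close>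

definition slt :: "(nat \<Rightarrow>\<^sub>0 nat) \<Rightarrow> 'k::zero mpoly \<Rightarrow> bool" where
  "slt m p \<longleftrightarrow> (\<forall>m' \<in> kys p. m' < m)"

text \<open>\<open>m\<close> is the lexicographically largest monomial of \<open>p\<close>, and its coefficient is 1.\<close>

definition lead :: "(nat \<Rightarrow>\<^sub>0 nat) \<Rightarrow> 'k::comm_ring_1 mpoly \<Rightarrow> bool" where
  "lead m p \<longleftrightarrow> slt m (p - Poly_Mapping.single m 1)"

lemma slt_add: "slt m p \<Longrightarrow> slt m q \<Longrightarrow> slt m (p + q)"
  using Poly_Mapping.keys_add[of p q] by (auto simp: slt_def)

lemma slt_zero [simp]: "slt m 0"
  by (simp add: slt_def)

lemma slt_uminus: "slt m p \<Longrightarrow> slt m (- (p :: 'k::comm_ring_1 mpoly))"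
  by (auto simp: slt_def in_keys_iff)

lemma slt_sum: "(\<And>i. i \<in> I \<Longrightarrow> slt m (g i)) \<Longrightarrow> slt m (\<Sum>i\<in>I. g i)"
  by (induction I rule: infinite_finite_induct) (auto intro: slt_add)

lemma slt_mult:
  assumes "slt m p" "\<forall>b \<in> kys q. b \<le> m'"
  shows "slt (m + m') (p * (q :: 'k::comm_ring_1 mpoly))"
  unfolding slt_def
proof
  fix x assume "x \<in> kys (p * q)"
  then obtain a b where "a \<in> kys p" "b \<in> kys q" "x = a + b" using keys_mult[of p q] by auto
  then show "x < m + m'" using assms by (auto simp: slt_def intro: add_less_le_mono)
qed

lemma lead_alt:
  "lead m (p :: 'k::comm_ring_1 mpoly) \<longleftrightarrow> (\<exists>q. p = Poly_Mapping.single m 1 + q \<and> slt m q)"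
  by (auto simp: lead_def intro!: exI[of _ "p - Poly_Mapping.single m 1"])

lemma lead_keys: "lead m p \<Longrightarrow> m' \<in> kys p \<Longrightarrow> m' \<le> m"
proof -
  assume "lead m p" and m': "m' \<in> kys p"
  then obtain q where q: "p = Poly_Mapping.single m 1 + q" "slt m q" by (auto simp: lead_alt)
  then have "m' \<in> kys (Poly_Mapping.single m (1::'a)) \<union> kys q"
    using m' subsetD[OF Poly_Mapping.keys_add[of "Poly_Mapping.single m 1" q]] by simp
  then have "m' = m \<or> m' \<in> kys q" by simp
  then show ?thesis using q(2) unfolding slt_def by (metis less_imp_le order_refl)
qed

lemma lead_coeff: "lead m p \<Longrightarrow> lkp p m = 1"
proof -
  assume "lead m p"
  then obtain q where q: "p = Poly_Mapping.single m 1 + q" "slt m q" by (auto simp: lead_alt)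
  then have "m \<notin> kys q" unfolding slt_def by blast
  then show ?thesis using q(1) by (simp add: lookup_add not_in_keys_iff_lookup_eq_zero)
qed

lemma lead_mult:
  assumes "lead m p" "lead m' (q :: 'k::comm_ring_1 mpoly)"
  shows "lead (m + m') (p * q)"
proof -
  obtain p' q' where p: "p = Poly_Mapping.single m 1 + p'" "slt m p'"
    and q: "q = Poly_Mapping.single m' 1 + q'" "slt m' q'" using assms by (auto simp: lead_alt)
  have "p * q = Poly_Mapping.single (m + m') 1 + (p' * q + q' * Poly_Mapping.single m 1)"
    unfolding p(1) q(1) by (simp add: algebra_simps mult_single)
  moreover have "slt (m + m') (p' * q)"
    using lead_keys[OF assms(2)] by (intro slt_mult p(2)) auto
  moreover have "slt (m' + m) (q' * Poly_Mapping.single m 1)"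
    by (intro slt_mult q(2)) auto
  ultimately show ?thesis unfolding lead_alt by (auto simp: add.commute intro!: slt_add)
qed

lemma lead_one: "lead 0 1"
  by (simp add: lead_def)

lemma lead_prod:
  "(\<And>i. i \<in> I \<Longrightarrow> lead (m i) (g i)) \<Longrightarrow> lead (\<Sum>i\<in>I. m i) (\<Prod>i\<in>I. g i)"
  by (induction I rule: infinite_finite_induct) (auto intro: lead_mult lead_one)

lemma lead_power: "lead m p \<Longrightarrow> lead (\<Sum>j<k. m) (p ^ k)"
  using lead_prod[of "{..<k}" "\<lambda>_. m" "\<lambda>_. p"] by simp

lemma lead_imp_slt: "lead m p \<Longrightarrow> m < m' \<Longrightarrow> slt m' p"
  using lead_keys unfolding slt_def by (meson le_less_trans)

lemma lead_add: "lead m p \<Longrightarrow> slt m q \<Longrightarrow> lead m (p + q)"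
  using slt_add[of m "p - Poly_Mapping.single m 1" q] by (simp add: lead_def algebra_simps)

lemma lex_lessI:
  fixes m m' :: "nat \<Rightarrow>\<^sub>0 nat"
  assumes "lkp m i < lkp m' i" "\<And>j. j < i \<Longrightarrow> lkp m j = lkp m' j"
  shows "m < m'"
  using assms unfolding less_poly_mapping.rep_eq less_fun_def by auto

definition ind :: "nat set \<Rightarrow> (nat \<Rightarrow>\<^sub>0 nat)" where
  "ind S = (\<Sum>i\<in>S. Poly_Mapping.single i 1)"

lemma lookup_ind: "finite S \<Longrightarrow> lkp (ind S) i = (if i \<in> S then 1 else 0)"
  by (simp add: ind_def lookup_sum lookup_single when_def)

text \<open>
  Coordinates in which \<open>z\<^sub>2\<^sub>a\<^sub>-\<^sub>1 = u\<^sub>2\<^sub>a\<^sub>-\<^sub>1 + u\<^sub>2\<^sub>a\<close> for \<open>a \<le> J\<close>, while the other variables are unchanged.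
\<close>

definition cs :: "nat \<Rightarrow> nat \<Rightarrow> 'k::comm_semiring_1 mpoly" where
  "cs J i = (if odd i \<and> (i + 1) div 2 \<le> J then X i + X (i + 1) else X i)"

lemma cs_zero: "cs 0 = X"
  by (rule ext) (auto simp: cs_def elim!: oddE)

lemma cs_u_arg: "cs (n div 2) = u_arg n"
proof
  fix i
  have "odd i \<Longrightarrow> (i + 1) div 2 \<le> n div 2 \<longleftrightarrow> i < n" by presburger
  then show "cs (n div 2) i = u_arg n i" by (auto simp: cs_def u_arg_def)
qed

lemma lead_cs: "lead (Poly_Mapping.single i 1) (cs J i)"
proof -
  have "Poly_Mapping.single (Suc i) (1::nat) < Poly_Mapping.single i 1"
    by (rule lex_lessI[of _ i]) (auto simp: lookup_single)
  then have "slt (Poly_Mapping.single i 1) (X (Suc i))" by (auto simp: slt_def X_def)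
  moreover have "lead (Poly_Mapping.single i 1) (X i)" by (simp add: lead_def X_def)
  ultimately show ?thesis by (auto simp: cs_def intro: lead_add)
qed

text \<open>Support i, i - 2, ..., ending at 1 or 2: the leading exponent of
  \<open>elem_semisym n i\<close>, both in the variables z and after the substitution
  \<open>cs\<close>.\<close>

definition ivec :: "nat \<Rightarrow> (nat \<Rightarrow>\<^sub>0 nat)" where
  "ivec i = ind {j \<in> {1..i}. even (i - j)}"

lemma lookup_ivec: "lkp (ivec i) j = (if 1 \<le> j \<and> j \<le> i \<and> even (i - j) then 1 else 0)"
  by (simp add: ivec_def lookup_ind)

text \<open>\<open>S0\<close> is an initial segment of \<open>A\<close>. Before the least element of
  \<open>S0 - S\<close> the two sets agree, and there \<open>S0\<close> wins.\<close>

lemma ind_less: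
  assumes "finite A" "S \<subseteq> A" "S0 \<subseteq> A" "card S = card S0" "S \<noteq> S0"
    and "\<And>i j. i \<in> S0 \<Longrightarrow> j \<in> A \<Longrightarrow> j < i \<Longrightarrow> j \<in> S0"
  shows "ind S < ind S0"
proof -
  have fin: "finite S" "finite S0" using assms(1-3) by (simp_all add: finite_subset)
  have "\<not> S0 \<subseteq> S" using assms fin by (metis card_subset_eq)
  then have ne: "S0 - S \<noteq> {}" by auto
  define i where "i = Min (S0 - S)"
  have i: "i \<in> S0 - S" unfolding i_def using fin ne by (intro Min_in) auto
  have min: "i \<le> j" if "j \<in> S0 - S" for j unfolding i_def using fin that by (intro Min_le) auto
  show ?thesis
  proof (rule lex_lessI[of _ i])
    fix j assume "j < i"
    then have "j \<in> S \<longleftrightarrow> j \<in> S0" using min[of j] i assms(2,6) by auto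
    then show "lkp (ind S) j = lkp (ind S0) j" using fin by (simp add: lookup_ind)
  qed (use i fin in \<open>auto simp: lookup_ind\<close>)
qed

text \<open>Replacing z_i by z_i + z_{i+1} adds a lexicographically smaller term, so the coordinate
  change leaves the leading monomial of every squarefree product alone.\<close>

lemma lead_elem_sym:
  assumes "finite A" "S0 \<subseteq> A" "\<And>i j. i \<in> S0 \<Longrightarrow> j \<in> A \<Longrightarrow> j < i \<Longrightarrow> j \<in> S0"
  shows "lead (ind S0) (poly_subst (cs J) (elem_sym A (card S0)) :: 'k::comm_ring_1 mpoly)"
proof -
  let ?P = "\<lambda>S. \<Prod>i\<in>S. cs J i :: 'k mpoly"
  have lead: "lead (ind S) (?P S)" for S
    unfolding ind_def by (rule lead_prod) (rule lead_cs)
  have "poly_subst (cs J) (elem_sym A (card S0)) = (\<Sum>S \<in> {S. S \<subseteq> A \<and> card S = card S0}. ?P S)"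
    by (simp add: elem_sym_def)
  also have "\<dots> = ?P S0 + (\<Sum>S \<in> {S. S \<subseteq> A \<and> card S = card S0} - {S0}. ?P S)"
    using assms by (subst sum.remove[of _ S0]) auto
  finally have eq: "poly_subst (cs J) (elem_sym A (card S0)) =
    ?P S0 + (\<Sum>S \<in> {S. S \<subseteq> A \<and> card S = card S0} - {S0}. ?P S)" .
  show ?thesis unfolding eq
  proof (intro lead_add lead slt_sum)
    fix S assume "S \<in> {S. S \<subseteq> A \<and> card S = card S0} - {S0}"
    then have "ind S < ind S0" by (intro ind_less[OF assms(1) _ assms(2) _ _ assms(3)]) auto
    then show "slt (ind S0) (?P S)" by (rule lead_imp_slt[OF lead])
  qed
qed

lemma card_parity: "card {j \<in> {1..i}. even (i - j)} = (i + 1) div 2"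
proof (induction i rule: nat_induct2)
  case (step i)
  have "{j \<in> {1..i + 2}. even (i + 2 - j)} = insert (i + 2) {j \<in> {1..i}. even (i - j)}"
    by (auto simp: le_Suc_eq)
  then show ?case using step by simp
next
  case 1
  have "{j \<in> {1..1}. even (1 - j)} = {1::nat}" by auto
  then show ?case by simp
qed auto

lemma lead_elem_semisym:
  assumes "i \<in> {1..n}"
  shows "lead (ivec i) (poly_subst (cs J) (elem_semisym n i) :: 'k::comm_ring_1 mpoly)"
proof -
  let ?S = "{j \<in> {1..i}. even (i - j)}"
  show ?thesis
  proof (cases "odd i")
    case True
    have l: "lead (ind ?S) (poly_subst (cs J) (elem_sym (Odds n) (card ?S)))"
      using assms True by (intro lead_elem_sym) auto
    have "slt (ind ?S) (poly_subst (cs J) (elem_sym (Evens n) (card ?S)) :: 'k mpoly)"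
      unfolding elem_sym_def poly_subst_sum
    proof (rule slt_sum)
      fix S assume S: "S \<in> {S. S \<subseteq> Evens n \<and> card S = card ?S}"
      have "lead (ind S) (\<Prod>i\<in>S. cs J i :: 'k mpoly)"
        unfolding ind_def by (rule lead_prod) (rule lead_cs)
      \<comment> \<open>The variable 1 occurs in \<open>?S\<close>, because i is odd, but in no set
        of even indices.\<close>
      moreover have "ind S < ind ?S"
      proof (rule lex_lessI[of _ 1])
        have fin: "finite S" using S by (intro finite_subset[of S "Evens n"]) auto
        show "lkp (ind S) 1 < lkp (ind ?S) 1" using S assms True fin by (auto simp: lookup_ind)
        show "lkp (ind S) j = lkp (ind ?S) j" if "j < 1" for j
          using S assms that fin by (auto simp: lookup_ind)
      qed
      ultimately have "slt (ind ?S) (\<Prod>i\<in>S. cs J i :: 'k mpoly)" by (rule lead_imp_slt)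
      then show "slt (ind ?S) (poly_subst (cs J) (\<Prod>i\<in>S. X i) :: 'k mpoly)"
        by (simp only: poly_subst_prod poly_subst_X)
    qed
    from lead_add[OF l slt_uminus[OF this]] show ?thesis
      using True unfolding ivec_def elem_semisym_def card_parity by simp
  next
    case False
    then have "card ?S = i div 2" using card_parity[of i] by presburger
    moreover have "lead (ind ?S) (poly_subst (cs J) (elem_sym (Evens n) (card ?S)))"
      using assms False by (intro lead_elem_sym) auto
    ultimately show ?thesis using False by (simp add: ivec_def elem_semisym_def)
  qed
qed

section \<open>The vectors [v] and the leading exponents of the products\<close>

lemma Lam_zero_outside: "v \<in> Lam n \<Longrightarrow> i \<notin> {1..n} \<Longrightarrow> v i = 0"
  unfolding Lam_def int_vecs_def by blast

lemma Lam_nonneg: "v \<in> Lam n \<Longrightarrow> 0 \<le> v i"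
  using Lam_subset_nat_vecs by (auto simp: nat_vecs_def)

lemma bracket_rec: "i \<in> {1..n} \<Longrightarrow> bracket n v i = v i - bracket n v (Suc i)"
proof -
  assume i: "i \<in> {1..n}"
  have "(\<Sum>j = i..n. (- 1) ^ (j - i) * v j) = v i + (\<Sum>j = Suc i..n. (- 1) ^ (j - i) * v j)"
    using i by (subst sum.atLeast_Suc_atMost) auto
  also have "(\<Sum>j = Suc i..n. (- 1) ^ (j - i) * v j) = - (\<Sum>j = Suc i..n. (- 1) ^ (j - Suc i) * v j)"
    unfolding sum_negf[symmetric]
  proof (intro sum.cong refl)
    fix j assume "j \<in> {Suc i..n}"
    then have "j - i = Suc (j - Suc i)" by auto
    then show "(- 1) ^ (j - i) * v j = - ((- 1) ^ (j - Suc i) * v j)" by simp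
  qed
  finally show ?thesis using i by (simp add: bracket_def)
qed

lemma bracket_outside: "i \<notin> {1..n} \<Longrightarrow> bracket n v i = 0"
  by (simp only: bracket_def if_False)

text \<open>Consecutive entries pair up by [v]_i + [v]_{i+1} = v_i for odd i; an odd m leaves the
  last pair incomplete.\<close>

lemma bracket_prefix:
  "m \<le> n \<Longrightarrow> (\<Sum>i = 1..m. bracket n v i) =
     (\<Sum>i \<in> {i \<in> {1..m}. odd i}. v i) - (if odd m then bracket n v (Suc m) else 0)"
proof (induction m)
  case (Suc m)
  have eq: "{i \<in> {1..Suc m}. odd i} = (if odd m then {i \<in> {1..m}. odd i} else insert (Suc m) {i \<in> {1..m}. odd i})"
    by (auto simp: le_Suc_eq)
  show ?case using Suc bracket_rec[of "Suc m" n v] unfolding eq by simp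
qed auto

lemma sum_bracket: "(\<Sum>i = 1..n. bracket n v i) = odd_size n v"
  using bracket_prefix[of n n v] by (simp add: odd_size_def bracket_outside)

text \<open>The inner sum repeats \<open>ivec i\<close> once for each factor
  \<open>elem_semisym n i\<close>. For \<mu> in \<open>Lam n\<close> the result is the vector
  [\<mu>], by \<open>lookup_lexp\<close>.\<close>

definition lexp :: "nat \<Rightarrow> (nat \<Rightarrow> int) \<Rightarrow> (nat \<Rightarrow>\<^sub>0 nat)" where
  "lexp n \<mu> = (\<Sum>i = 1..n. \<Sum>j < nat (\<mu> i - \<mu> (Suc i)). ivec i)"

lemma lead_elem_semisym_prod: "lead (lexp n \<mu>) (poly_subst (cs J) (elem_semisym_prod n \<mu>))"
  unfolding lexp_def elem_semisym_prod_def poly_subst_prod poly_subst_power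
  by (intro lead_prod lead_power lead_elem_semisym)

lemma bracket_outside_lam: "bracket n v j = 0" if "n < j"
  using that by (simp add: bracket_def)

text \<open>Grouping the alternating sum into differences v_i - v_{i+1} exhibits the multiplicities
  with which the vectors \<open>ivec i\<close> enter \<open>lexp\<close>.\<close>

lemma bracket_alt:
  assumes "v (Suc n) = 0" "1 \<le> j"
  shows "bracket n v j = (\<Sum>i \<in> {i \<in> {1..n}. j \<le> i \<and> even (i - j)}. v i - v (Suc i))"
  using assms(2)
proof (induction "Suc n - j" arbitrary: j rule: less_induct)
  case less
  show ?case
  proof (cases "j \<le> n")
    case False
    then have "{i \<in> {1..n}. j \<le> i \<and> even (i - j)} = {}" by auto
    then show ?thesis using False by (simp only: bracket_outside_lam sum.empty)
  next
    case True
    have "{i \<in> {1..n}. j \<le> i \<and> even (i - j)} = insert j {i \<in> {1..n}. Suc (Suc j) \<le> i \<and> even (i - Suc (Suc j))}"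
      using True less.prems by (auto simp: not_less_eq_eq le_Suc_eq)
        (metis Suc_leI Suc_lessI diff_Suc_Suc even_Suc even_diff_nat le_neq_implies_less linorder_not_less odd_one One_nat_def Suc_diff_Suc nat_less_le diff_self_eq_0)+
    then have "(\<Sum>i \<in> {i \<in> {1..n}. j \<le> i \<and> even (i - j)}. v i - v (Suc i)) = v j - v (Suc j) + bracket n v (Suc (Suc j))"
      using less.hyps[of "Suc (Suc j)"] True by (simp add: Suc_diff_le)
    also have "\<dots> = bracket n v j"
    proof (cases "j = n")
      case True
      then show ?thesis using bracket_rec[of j n v] less.prems assms(1) by (simp add: bracket_outside_lam)
    next
      case False
      then show ?thesis using True less.prems bracket_rec[of j n v] bracket_rec[of "Suc j" n v] by simp
    qed
    finally show ?thesis by simp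
  qed
qed

lemma lookup_lexp:
  assumes "\<mu> \<in> Lam n"
  shows "int (lkp (lexp n \<mu>) j) = bracket n \<mu> j"
proof (cases "1 \<le> j")
  case True
  have ge: "\<mu> (Suc i) \<le> \<mu> i" if "1 \<le> i" for i using Lam_antimono[OF assms that] by auto
  have "int (lkp (lexp n \<mu>) j) = (\<Sum>i = 1..n. (\<mu> i - \<mu> (Suc i)) * (if j \<le> i \<and> even (i - j) then 1 else 0))"
    unfolding lexp_def lookup_sum of_nat_sum
    by (intro sum.cong refl) (use ge True in \<open>auto simp: lookup_ivec\<close>)
  also have "\<dots> = (\<Sum>i \<in> {i \<in> {1..n}. j \<le> i \<and> even (i - j)}. \<mu> i - \<mu> (Suc i))"
    by (rule sum.mono_neutral_cong_right) auto
  also have "\<dots> = bracket n \<mu> j"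
    using assms True by (intro bracket_alt[symmetric]) (auto simp: Lam_zero_outside)
  finally show ?thesis .
next
  case False
  then have "lkp (lexp n \<mu>) j = 0" unfolding lexp_def lookup_sum lookup_ivec by simp
  then show ?thesis using False by (simp add: bracket_outside)
qed

lemma inj_lexp: "inj_on (lexp n) (Lam n)"
proof
  fix \<mu> \<nu> assume \<mu>: "\<mu> \<in> Lam n" and \<nu>: "\<nu> \<in> Lam n" and eq: "lexp n \<mu> = lexp n \<nu>"
  have b: "bracket n \<mu> j = bracket n \<nu> j" for j using lookup_lexp[OF \<mu>] lookup_lexp[OF \<nu>] eq by metis
  show "\<mu> = \<nu>"
  proof
    fix i show "\<mu> i = \<nu> i"
    proof (cases "i \<in> {1..n}")
      case True
      then show ?thesis using bracket_rec[of i n \<mu>] bracket_rec[of i n \<nu>] b by simp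
    qed (use \<mu> \<nu> Lam_zero_outside in metis)
  qed
qed

lemma keys_lexp: assumes "\<mu> \<in> Lam n" shows "kys (lexp n \<mu>) \<subseteq> {1..n}"
proof
  fix j assume "j \<in> kys (lexp n \<mu>)"
  then have "bracket n \<mu> j \<noteq> 0" using lookup_lexp[OF assms, of j] by (simp add: in_keys_iff)
  then show "j \<in> {1..n}" using bracket_outside by blast
qed

lemma wdeg_lexp:
  assumes "\<mu> \<in> Lam n"
  shows "int (wdeg \<omega> (lexp n \<mu>)) = (\<Sum>i = 1..n. int (\<omega> i) * bracket n \<mu> i)"
  using wdeg_superset[OF _ keys_lexp[OF assms], of \<omega>] by (simp add: lookup_lexp[OF assms])

lemma mon_degree_lexp:
  assumes "\<mu> \<in> Lam n"
  shows "int (wdeg (\<lambda>_. 1) (lexp n \<mu>)) = odd_size n \<mu>"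
  using wdeg_lexp[OF assms, of "\<lambda>_. 1"] sum_bracket[of n \<mu>] by simp

lemma wle_elem_semisym_prod:
  assumes "\<And>i. i \<in> {1..n} \<Longrightarrow> wle \<omega> (wdeg \<omega> (ivec i)) (poly_subst s (elem_semisym n i :: 'k::comm_ring_1 mpoly))"
  shows "wle \<omega> (wdeg \<omega> (lexp n \<mu>)) (poly_subst s (elem_semisym_prod n \<mu> :: 'k mpoly))"
proof -
  have sum: "wdeg \<omega> (\<Sum>i\<in>I. m i) = (\<Sum>i\<in>I. wdeg \<omega> (m i))" for I :: "nat set" and m
    by (induction I rule: infinite_finite_induct) (auto simp: wdeg_add)
  show ?thesis unfolding lexp_def elem_semisym_prod_def poly_subst_prod poly_subst_power sum
  proof (rule wle_prod)
    fix i assume "i \<in> {1..n}"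
    then show "wle \<omega> (\<Sum>j<nat (\<mu> i - \<mu> (Suc i)). wdeg \<omega> (ivec i))
       (poly_subst s (elem_semisym n i) ^ nat (\<mu> i - \<mu> (Suc i)))"
      using wle_power[OF assms] by simp
  qed
qed

lemma poly_subst_id [simp]: "poly_subst X p = (p :: 'k::field_char_0 mpoly)"
  by (rule poly_eval_eqI) (simp add: poly_eval_subst)

lemma wdeg_ivec: "wdeg (\<lambda>_. 1) (ivec i) = (i + 1) div 2"
proof -
  let ?S = "{j \<in> {1..i}. even (i - j)}"
  have "kys (ivec i) \<subseteq> ?S" by (auto simp: in_keys_iff lookup_ivec split: if_splits)
  then have "wdeg (\<lambda>_. 1) (ivec i) = (\<Sum>j\<in>?S. 1 * lkp (ivec i) j)" by (intro wdeg_superset) auto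
  also have "\<dots> = (\<Sum>j\<in>?S. 1)" by (intro sum.cong) (auto simp: lookup_ivec)
  finally show ?thesis using card_parity[of i] by simp
qed

lemma Inv_elem_semisym_prod:
  assumes "\<mu> \<in> Lam n"
  shows "Inv n (nat (odd_size n \<mu>)) (elem_semisym_prod n \<mu> :: 'k::field_char_0 mpoly)"
proof -
  have "wle (\<lambda>_. 1) (wdeg (\<lambda>_. 1) (lexp n \<mu>)) (poly_subst X (elem_semisym_prod n \<mu> :: 'k mpoly))"
    using Inv_elem_semisym[where 'k = 'k, of n]
    by (intro wle_elem_semisym_prod) (simp add: Inv_def wdeg_ivec del: One_nat_def)
  moreover have "wdeg (\<lambda>_. 1) (lexp n \<mu>) = nat (odd_size n \<mu>)" using mon_degree_lexp[OF assms] by simp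
  moreover have "\<exists>d. Inv n d (elem_semisym_prod n \<mu> :: 'k mpoly)"
    unfolding elem_semisym_prod_def
    by (rule exI, rule Inv_prod, rule Inv_power, rule Inv_elem_semisym)
  ultimately show ?thesis by (auto simp: Inv_def)
qed

text \<open>It indexes the products of degree at most d, and at the same time the interpolation
  points that determine an invariant polynomial of degree at most d.\<close>

definition LamD :: "nat \<Rightarrow> nat \<Rightarrow> (nat \<Rightarrow> int) set" where
  "LamD n d = {\<mu> \<in> Lam n. odd_size n \<mu> \<le> int d}"

lemma Lam_1_le_odd_size: assumes "\<mu> \<in> Lam n" shows "\<mu> 1 \<le> odd_size n \<mu>"
proof (cases "n = 0")
  case False
  then show ?thesis unfolding odd_size_def using Lam_nonneg[OF assms]
    by (intro member_le_sum) auto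
qed (use Lam_zero_outside[OF assms, of 1] in \<open>simp add: odd_size_def\<close>)

lemma finite_LamD [simp]: "finite (LamD n d)"
proof (rule finite_subset[OF _ finite_bounded_vecs[of n "int d"]])
  show "LamD n d \<subseteq> {v \<in> nat_vecs n. \<forall>i\<in>{1..n}. v i \<le> int d}"
  proof safe
    fix \<mu> assume "\<mu> \<in> LamD n d"
    then have \<mu>: "\<mu> \<in> Lam n" "odd_size n \<mu> \<le> int d" by (auto simp: LamD_def)
    then show "\<mu> \<in> nat_vecs n" using Lam_subset_nat_vecs by auto
    show "\<mu> i \<le> int d" if "i \<in> {1..n}" for i
      using Lam_antimono[OF \<mu>(1), of 1 i] that Lam_1_le_odd_size[OF \<mu>(1)] \<mu>(2) by auto
  qed
qed

section \<open>Expansion in elementary semisymmetric polynomials\<close>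

definition perm_exp :: "(nat \<Rightarrow> nat) \<Rightarrow> (nat \<Rightarrow>\<^sub>0 nat) \<Rightarrow> (nat \<Rightarrow>\<^sub>0 nat)" where
  "perm_exp \<pi> m = (\<Sum>i \<in> kys m. Poly_Mapping.single (\<pi> i) (lkp m i))"

lemma lookup_perm_exp:
  assumes "inj \<pi>"
  shows "lkp (perm_exp \<pi> m) (\<pi> i) = lkp m i"
proof -
  have "lkp (perm_exp \<pi> m) (\<pi> i) = (\<Sum>j \<in> kys m. if j = i then lkp m j else 0)"
    unfolding perm_exp_def lookup_sum using assms
    by (intro sum.cong) (auto simp: lookup_single when_def dest: injD)
  then show ?thesis by (auto simp: in_keys_iff)
qed

lemma mon_eval_X: "mon_eval (\<lambda>i. X (\<pi> i)) m = (Poly_Mapping.single (perm_exp \<pi> m) 1 :: 'k::comm_semiring_1 mpoly)"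
proof -
  have pow: "X i ^ k = (Poly_Mapping.single (Poly_Mapping.single i k) 1 :: 'k mpoly)" for i k
    by (induction k) (auto simp: X_def mult_single single_add[symmetric])
  have "(\<Prod>i\<in>S. Poly_Mapping.single (g i) 1) = (Poly_Mapping.single (\<Sum>i\<in>S. g i) 1 :: 'k mpoly)"
    for S :: "nat set" and g
    by (induction S rule: infinite_finite_induct) (auto simp: mult_single)
  then show ?thesis by (simp add: mon_eval_def perm_exp_def pow)
qed

lemma W_invariant_keys:
  assumes "W_invariant n p" "\<pi> \<in> W n" "m \<in> kys (p :: 'k::comm_semiring_1 mpoly)"
  shows "perm_exp \<pi> m \<in> kys p"
proof -
  have "inj \<pi>" using W_image(3)[OF assms(2)] .
  then have inj: "perm_exp \<pi> m = perm_exp \<pi> m' \<Longrightarrow> m = m'" for m m'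
    by (metis lookup_perm_exp poly_mapping_eqI)
  have "p = poly_subst (\<lambda>i. X (\<pi> i)) p" using assms by (simp add: W_invariant_def)
  also have "\<dots> = (\<Sum>m' \<in> kys p. Poly_Mapping.single (perm_exp \<pi> m') (lkp p m'))"
    unfolding poly_subst_alt mon_eval_X by (intro sum.cong) (auto simp: Const_def mult_single)
  finally have "lkp p (perm_exp \<pi> m) = lkp (\<Sum>m' \<in> kys p. Poly_Mapping.single (perm_exp \<pi> m') (lkp p m')) (perm_exp \<pi> m)"
    by (rule arg_cong)
  also have "\<dots> = (\<Sum>m' \<in> kys p. if m' = m then lkp p m' else 0)"
    unfolding lookup_sum by (intro sum.cong) (auto simp: lookup_single when_def dest: inj)
  finally show ?thesis using assms(3) by (simp add: in_keys_iff)
qed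

lemma transpose_in_W:
  assumes "1 \<le> i" "i + 2 \<le> n"
  shows "transpose i (i + 2) \<in> W n"
  using assms by (auto simp: W_def transpose_def intro!: permutes_swap_id)

text \<open>Otherwise the transposition of i and i + 2, which belongs to \<open>W n\<close>, would
  carry m to a larger monomial of p.\<close>

lemma max_key_decreasing:
  assumes p: "W_invariant n p" "m \<in> kys (p :: 'k::comm_semiring_1 mpoly)"
    and max: "\<And>m'. m' \<in> kys p \<Longrightarrow> m' \<le> m" and i: "1 \<le> i" "i + 2 \<le> n"
  shows "lkp m (i + 2) \<le> lkp m i"
proof (rule ccontr)
  assume less: "\<not> lkp m (i + 2) \<le> lkp m i"
  let ?\<pi> = "transpose i (i + 2)" and ?m = "perm_exp (transpose i (i + 2)) m"
  have l: "lkp ?m j = lkp m (?\<pi> j)" for j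
    using lookup_perm_exp[of ?\<pi> m "?\<pi> j"] by simp
  have "m < ?m"
  proof (rule lex_lessI[of _ i])
    show "lkp m i < lkp ?m i" using less unfolding l by simp
    show "lkp m j = lkp ?m j" if "j < i" for j using that unfolding l by (simp add: transpose_def)
  qed
  moreover have "?m \<le> m" by (intro max W_invariant_keys[OF p(1) transpose_in_W p(2)] i)
  ultimately show False by simp
qed

lemma lexp_surj:
  assumes keys: "kys m \<subseteq> {1..n}" and dec: "\<And>i. 1 \<le> i \<Longrightarrow> i + 2 \<le> n \<Longrightarrow> lkp m (i + 2) \<le> lkp m i"
  shows "\<exists>\<mu> \<in> Lam n. lexp n \<mu> = m"
proof
  \<comment> \<open>Forced by [\<mu>]_i + [\<mu>]_{i+1} = \<mu>_i.\<close>
  define \<mu> where "\<mu> i = (if i \<in> {1..n} then int (lkp m i) + int (lkp m (Suc i)) else 0)" for i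
  have out: "lkp m i = 0" if "i \<notin> {1..n}" for i using keys that by (auto simp: in_keys_iff subset_iff)
  have dec': "lkp m (Suc (Suc i)) \<le> lkp m i" if "1 \<le> i" for i
    using dec[of i] out[of "Suc (Suc i)"] that by (cases "i + 2 \<le> n") auto
  show Lam: "\<mu> \<in> Lam n"
    unfolding Lam_def int_vecs_def using dec' by (auto simp: \<mu>_def)
  have "1 \<le> j \<Longrightarrow> bracket n \<mu> j = int (lkp m j)" for j
  proof (induction "Suc n - j" arbitrary: j rule: less_induct)
    case less
    show ?case
    proof (cases "j \<le> n")
      case True
      then have "bracket n \<mu> (Suc j) = int (lkp m (Suc j))" using less by auto
      then show ?thesis using bracket_rec[of j n \<mu>] less.prems True by (simp add: \<mu>_def)
    qed (use out[of j] in \<open>simp add: bracket_outside_lam\<close>)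
  qed
  then have "int (lkp (lexp n \<mu>) j) = int (lkp m j)" for j
    using lookup_lexp[OF Lam, of j] out[of j] bracket_outside[of j n \<mu>] by (cases "1 \<le> j") auto
  then show "lexp n \<mu> = m" by (intro poly_mapping_eqI) simp
qed

lemma finite_bounded_exponents: "finite {m. kys m \<subseteq> {1..n} \<and> wdeg (\<lambda>_. 1) m \<le> d}"
proof -
  let ?M = "{m. kys m \<subseteq> {1..n} \<and> wdeg (\<lambda>_. 1) m \<le> d}"
  have "Poly_Mapping.lookup ` ?M \<subseteq> {f. \<forall>x. (x \<in> {1..n} \<longrightarrow> f x \<in> {0..d}) \<and> (x \<notin> {1..n} \<longrightarrow> f x = 0)}"
  proof safe
    fix m x assume m: "kys m \<subseteq> {1..n}" "wdeg (\<lambda>_. 1) m \<le> d"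
    show "lkp m x = 0" if "x \<notin> {1..n}" using m that by (auto simp: in_keys_iff subset_iff)
    assume x: "x \<in> {1..n}"
    have "lkp m x \<le> wdeg (\<lambda>_. 1) m"
      using x wdeg_superset[OF _ m(1), of "\<lambda>_. 1"] by (simp add: member_le_sum)
    then show "lkp m x \<in> {0..d}" using m by simp
  qed
  moreover have "finite {f. \<forall>x. (x \<in> {1..n} \<longrightarrow> f x \<in> {0..d}) \<and> (x \<notin> {1..n} \<longrightarrow> f x = (0::nat))}"
    by (rule finite_set_of_finite_funs) auto
  ultimately have "finite (Poly_Mapping.lookup ` ?M)" by (rule finite_subset)
  then show ?thesis by (rule finite_imageD) (auto simp: inj_on_def intro: poly_mapping_eqI)
qed

lemma lead_elem_semisym_prod_id: "lead (lexp n \<mu>) (elem_semisym_prod n \<mu> :: 'k::field_char_0 mpoly)"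
  using lead_elem_semisym_prod[where 'a = 'k, of n \<mu> 0] by (simp add: cs_zero)

text \<open>Division algorithm: the largest monomial of an invariant polynomial is the leading
  monomial of some product, and a multiple of that product is subtracted. The induction measure
  counts the exponents of degree at most d below some monomial of p; it is the degree bound that
  makes this set finite, as a lexicographic order alone has infinite down-sets.\<close>

theorem semisym_expansion:
  fixes p :: "'k::field_char_0 mpoly"
  assumes "Inv n d p"
  shows "\<exists>b. p = (\<Sum>\<mu> \<in> LamD n d. Const (b \<mu>) * elem_semisym_prod n \<mu>)"
  using assms
proof (induction "card {m. kys m \<subseteq> {1..n} \<and> wdeg (\<lambda>_. 1) m \<le> d \<and> (\<exists>m' \<in> kys p. m \<le> m')}"
    arbitrary: p rule: less_induct)
  case less
  let ?K = "\<lambda>p :: 'k mpoly. {m. kys m \<subseteq> {1..n} \<and> wdeg (\<lambda>_. 1) m \<le> d \<and> (\<exists>m' \<in> kys p. m \<le> m')}"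
  have fin: "finite (?K p)" for p by (rule finite_subset[OF _ finite_bounded_exponents[of n d]]) auto
  show ?case
  proof (cases "p = 0")
    case True
    then show ?thesis by (intro exI[of _ "\<lambda>_. 0"]) simp
  next
    case False
    then have ne: "kys p \<noteq> {}" by simp
    define m where "m = Max (kys p)"
    have m: "m \<in> kys p" and max: "\<And>m'. m' \<in> kys p \<Longrightarrow> m' \<le> m" unfolding m_def using ne by auto
    have p: "p \<in> polys n" "W_invariant n p" "wle (\<lambda>_. 1) d p" using less.prems by (auto simp: Inv_def)
    have keys: "kys m \<subseteq> {1..n}" and deg: "wdeg (\<lambda>_. 1) m \<le> d" using p m by (auto simp: polys_def wle_def)
    obtain \<mu> where \<mu>: "\<mu> \<in> Lam n" "lexp n \<mu> = m"
      using lexp_surj[OF keys] max_key_decreasing[OF p(2) m max] by blast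
    have \<mu>d: "\<mu> \<in> LamD n d" using mon_degree_lexp[OF \<mu>(1)] \<mu> deg by (simp add: LamD_def)
    define e :: "'k mpoly" where "e = elem_semisym_prod n \<mu>"
    have e: "lead m e" unfolding e_def using lead_elem_semisym_prod_id[of n \<mu>] \<mu> by simp
    have eI: "Inv n d e" unfolding e_def using Inv_elem_semisym_prod[OF \<mu>(1)]
      by (rule Inv_mono) (use \<mu>d in \<open>auto simp: LamD_def\<close>)
    define q where "q = p - Const (lkp p m) * e"
    have lq: "lkp q m' = lkp p m' - lkp p m * lkp e m'" for m'
    proof -
      have "Const (lkp p m) * e = Poly_Mapping.map ((*) (lkp p m)) e"
        by (simp add: mult_map_scale_conv_mult Const_def)
      then show ?thesis by (simp add: q_def lookup_minus map.rep_eq when_def)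
    qed
    have slt: "m' < m" if "m' \<in> kys q" for m'
    proof -
      have "lkp q m' \<noteq> 0" using that by (simp add: in_keys_iff)
      then have "m' \<noteq> m" "m' \<in> kys p \<or> m' \<in> kys e" using lead_coeff[OF e] by (auto simp: lq in_keys_iff)
      then show ?thesis using max lead_keys[OF e] by (auto simp: less_le)
    qed
    have "Inv n d q" unfolding q_def by (intro Inv_diff less.prems Inv_smult eI)
    moreover have "card (?K q) < card (?K p)"
    proof (rule psubset_card_mono[OF fin])
      have "\<exists>m' \<in> kys p. x \<le> m'" if "m' \<in> kys q" "x \<le> m'" for x m'
        using order_trans[OF that(2) less_imp_le[OF slt[OF that(1)]]] m by (rule bexI)
      then have "?K q \<subseteq> ?K p" by auto
      moreover have "m \<in> ?K p" using m keys deg by auto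
      moreover have "m \<notin> ?K q" using slt by (auto simp: not_le)
      ultimately show "?K q \<subset> ?K p" by blast
    qed
    ultimately obtain b where b: "q = (\<Sum>\<mu> \<in> LamD n d. Const (b \<mu>) * elem_semisym_prod n \<mu>)"
      using less.hyps by blast
    have "(\<Sum>\<nu> \<in> LamD n d. Const (b \<nu> + (if \<nu> = \<mu> then lkp p m else 0)) * elem_semisym_prod n \<nu>)
      = q + (\<Sum>\<nu> \<in> LamD n d. if \<nu> = \<mu> then Const (lkp p m) * elem_semisym_prod n \<nu> else 0)"
      unfolding b sum.distrib[symmetric]
      by (intro sum.cong) (auto simp: Const_def single_add distrib_right)
    also have "\<dots> = p" using \<mu>d by (simp add: q_def e_def)
    finally have "p = (\<Sum>\<nu> \<in> LamD n d. Const (b \<nu> + (if \<nu> = \<mu> then lkp p m else 0)) * elem_semisym_prod n \<nu>)"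
      by (rule sym)
    then show ?thesis by (intro exI[of _ "\<lambda>\<nu>. b \<nu> + (if \<nu> = \<mu> then lkp p m else 0)"])
  qed
qed

text \<open>The lexicographically largest of the leading monomials of maximal weight cannot cancel.\<close>

lemma expansion_top_key:
  fixes b :: "(nat \<Rightarrow> int) \<Rightarrow> 'k::field_char_0"
  assumes M: "finite M" "M \<subseteq> Lam n"
    and lead: "\<And>\<mu>. lead (E \<mu>) (poly_subst s (elem_semisym_prod n \<mu> :: 'k mpoly))" and inj: "inj_on E (Lam n)"
    and wle: "\<And>\<mu>. \<mu> \<in> M \<Longrightarrow> wle \<omega> (wdeg \<omega> (E \<mu>)) (poly_subst s (elem_semisym_prod n \<mu> :: 'k mpoly))"
    and \<mu>: "\<mu> \<in> M" "b \<mu> \<noteq> 0"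
  shows "\<exists>m \<in> kys (poly_subst s (\<Sum>\<mu> \<in> M. Const (b \<mu>) * elem_semisym_prod n \<mu>)).
    wdeg \<omega> (E \<mu>) \<le> wdeg \<omega> m"
proof -
  define c' where "c' = Max ((\<lambda>\<nu>. wdeg \<omega> (E \<nu>)) ` {\<nu> \<in> M. b \<nu> \<noteq> 0})"
  define M' where "M' = {\<nu> \<in> M. b \<nu> \<noteq> 0 \<and> wdeg \<omega> (E \<nu>) = c'}"
  have fin: "finite {\<nu> \<in> M. b \<nu> \<noteq> 0}" "finite M'" using M by (auto simp: M'_def)
  have max: "wdeg \<omega> (E \<nu>) \<le> c'" if "\<nu> \<in> M" "b \<nu> \<noteq> 0" for \<nu>
    unfolding c'_def using fin that by (intro Max_ge) auto
  have "c' \<in> (\<lambda>\<nu>. wdeg \<omega> (E \<nu>)) ` {\<nu> \<in> M. b \<nu> \<noteq> 0}"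
    unfolding c'_def using fin \<mu> by (intro Max_in) auto
  then have ne: "M' \<noteq> {}" by (auto simp: M'_def)
  define m where "m = Max (E ` M')"
  have "m \<in> E ` M'" unfolding m_def using fin ne by (intro Max_in) auto
  then obtain \<nu> where \<nu>: "\<nu> \<in> M'" "m = E \<nu>" by auto
  have coeff: "lkp (Const (b \<kappa>) * poly_subst s (elem_semisym_prod n \<kappa>)) m = (if \<kappa> = \<nu> then b \<nu> else 0)"
    if \<kappa>: "\<kappa> \<in> M" for \<kappa>
  proof -
    define e :: "'k mpoly" where "e = poly_subst s (elem_semisym_prod n \<kappa>)"
    have lead: "lead (E \<kappa>) e" unfolding e_def by (rule lead)
    have "Const (b \<kappa>) * e = Poly_Mapping.map ((*) (b \<kappa>)) e"
      by (simp add: mult_map_scale_conv_mult Const_def)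
    then have l: "lkp (Const (b \<kappa>) * e) m = b \<kappa> * lkp e m" by (simp add: map.rep_eq when_def)
    \<comment> \<open>The weight of m is maximal, which puts \<open>\<kappa>\<close> into
      \<open>M'\<close>. Then \<open>E \<kappa> \<le> m\<close> by the choice of m, and
      \<open>m \<le> E \<kappa>\<close> because \<open>E \<kappa>\<close> is leading.\<close>
    have "\<kappa> = \<nu>" if "b \<kappa> \<noteq> 0" "lkp e m \<noteq> 0"
    proof -
      have m: "m \<in> kys e" using that by (simp add: in_keys_iff)
      have "wdeg \<omega> m = c'" using \<nu> by (simp add: M'_def)
      moreover have "wdeg \<omega> m \<le> wdeg \<omega> (E \<kappa>)"
        using wle[OF \<kappa>] m unfolding e_def wle_def by blast
      ultimately have "\<kappa> \<in> M'" using max[OF \<kappa> that(1)] \<kappa> that(1) by (simp add: M'_def)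
      then have "E \<kappa> \<le> m" unfolding m_def using fin by (intro Max_ge) auto
      then have "E \<kappa> = E \<nu>" using lead_keys[OF lead m] \<nu> by simp
      then show "\<kappa> = \<nu>" using inj \<kappa> \<nu> M unfolding M'_def by (auto dest: inj_onD)
    qed
    moreover have "lkp e m = 1" if "\<kappa> = \<nu>" using lead_coeff[OF lead] \<nu> that by simp
    ultimately show ?thesis unfolding e_def[symmetric] l by auto
  qed
  let ?p = "poly_subst s (\<Sum>\<mu> \<in> M. Const (b \<mu>) * elem_semisym_prod n \<mu>)"
  have "lkp ?p m = (\<Sum>\<kappa>\<in>M. lkp (Const (b \<kappa>) * poly_subst s (elem_semisym_prod n \<kappa>)) m)"
    by (simp add: lookup_sum)
  also have "\<dots> = (\<Sum>\<kappa>\<in>M. if \<kappa> = \<nu> then b \<nu> else 0)" by (intro sum.cong refl coeff)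
  also have "\<dots> = b \<nu>" using M \<nu> by (simp add: M'_def)
  finally have "m \<in> kys ?p" using \<nu> by (simp add: in_keys_iff M'_def)
  moreover have "wdeg \<omega> (E \<mu>) \<le> wdeg \<omega> m" using max[OF \<mu>] \<nu> by (simp add: M'_def)
  ultimately show ?thesis by blast
qed

text \<open>For the zero weight every bound in \<open>expansion_top_key\<close> is trivial; what
  remains is the existence of a monomial that does not cancel.\<close>

lemma elem_semisym_prod_independent:
  fixes b :: "(nat \<Rightarrow> int) \<Rightarrow> 'k::field_char_0"
  assumes "finite M" "M \<subseteq> Lam n" "(\<Sum>\<mu> \<in> M. Const (b \<mu>) * elem_semisym_prod n \<mu>) = 0" "\<mu> \<in> M"
  shows "b \<mu> = 0"
proof (rule ccontr)
  assume "b \<mu> \<noteq> 0"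
  moreover have "wle (\<lambda>_. 0) (wdeg (\<lambda>_. 0) m) p" for m and p :: "'k mpoly"
    by (simp add: wle_def wdeg_def)
  ultimately show False
    using expansion_top_key[OF assms(1,2) lead_elem_semisym_prod inj_lexp, of "\<lambda>_. 0" 0 \<mu> b] assms(3,4)
    by simp
qed

section \<open>Polynomials vanishing on shifted partitions\<close>

text \<open>The polynomial q is p with the variables outside \<open>U\<close> specialised to
  \<open>z0\<close>. This transfers statements about values of p to values of its coefficient
  polynomials.\<close>

lemma mpart_section:
  fixes p :: "'k::comm_semiring_1 mpoly"
  shows "\<exists>q. (\<forall>y. poly_eval y q = poly_eval (\<lambda>i. if i \<in> U then y i else z0 i) p) \<and>
             (\<forall>\<alpha>. lkp q \<alpha> = poly_eval z0 (mpart U \<alpha> p))"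
proof (intro exI conjI allI)
  let ?q = "\<Sum>\<beta> \<in> restr U ` kys p. Poly_Mapping.single \<beta> (poly_eval z0 (mpart U \<beta> p))"
  fix y
  let ?z = "\<lambda>i. if i \<in> U then y i else z0 i"
  have cong: "poly_eval ?z (mpart U \<beta> p) = poly_eval z0 (mpart U \<beta> p)" for \<beta>
    by (rule poly_eval_mpart_cong) auto
  have "poly_eval ?z p = (\<Sum>\<beta> \<in> restr U ` kys p. mon_eval ?z \<beta> * poly_eval z0 (mpart U \<beta> p))"
    by (subst mpart_decomp[of p U]) (simp add: poly_eval_single cong)
  also have "\<dots> = poly_eval y ?q"
    by (auto simp: poly_eval_single mon_eval_def keys_restr mult.commute intro!: sum.cong prod.cong)
  finally show "poly_eval y ?q = poly_eval ?z p" by simp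
next
  fix \<alpha>
  have "lkp (\<Sum>\<beta> \<in> restr U ` kys p. Poly_Mapping.single \<beta> (poly_eval z0 (mpart U \<beta> p))) \<alpha>
    = (\<Sum>\<beta> \<in> restr U ` kys p. if \<beta> = \<alpha> then poly_eval z0 (mpart U \<beta> p) else 0)"
    by (simp add: lookup_sum lookup_single when_def)
  also have "\<dots> = poly_eval z0 (mpart U \<alpha> p)"
  proof (cases "\<alpha> \<in> restr U ` kys p")
    case False
    then have "{m \<in> kys p. restr U m = \<alpha>} = {}" by auto
    then have "mpart U \<alpha> p = 0" by (simp only: mpart_def sum.empty)
    then show ?thesis using False by simp
  qed simp
  finally show "lkp (\<Sum>\<beta> \<in> restr U ` kys p. Poly_Mapping.single \<beta> (poly_eval z0 (mpart U \<beta> p))) \<alpha>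
    = poly_eval z0 (mpart U \<alpha> p)" .
qed

lemma mpart_eval_zero:
  fixes p :: "'k::field_char_0 mpoly"
  assumes "\<And>y. poly_eval (\<lambda>i. if i \<in> U then y i else z0 i) p = 0"
  shows "poly_eval z0 (mpart U \<alpha> p) = 0"
proof -
  obtain q where q: "\<forall>y. poly_eval y q = poly_eval (\<lambda>i. if i \<in> U then y i else z0 i) p"
    "\<forall>\<alpha>. lkp q \<alpha> = poly_eval z0 (mpart U \<alpha> p)" using mpart_section by blast
  have "q = 0" by (rule poly_eval_all_zero) (simp add: q(1) assms)
  then show ?thesis using q(2) by (metis lookup_zero)
qed

lemma mpart_eval_eq:
  fixes p :: "'k::field_char_0 mpoly"
  assumes "\<And>y. poly_eval (\<lambda>i. if i \<in> U then y i else z0 i) p = poly_eval (\<lambda>i. if i \<in> U then y i else z1 i) p"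
  shows "poly_eval z0 (mpart U \<alpha> p) = poly_eval z1 (mpart U \<alpha> p)"
proof -
  obtain q0 where q0: "\<forall>y. poly_eval y q0 = poly_eval (\<lambda>i. if i \<in> U then y i else z0 i) p"
    "\<forall>\<alpha>. lkp q0 \<alpha> = poly_eval z0 (mpart U \<alpha> p)" using mpart_section by blast
  obtain q1 where q1: "\<forall>y. poly_eval y q1 = poly_eval (\<lambda>i. if i \<in> U then y i else z1 i) p"
    "\<forall>\<alpha>. lkp q1 \<alpha> = poly_eval z1 (mpart U \<alpha> p)" using mpart_section by blast
  have "q0 = q1" by (rule poly_eval_eqI) (simp add: q0(1) q1(1) assms)
  then show ?thesis using q0(2) q1(2) by metis
qed

section \<open>Division by products of variables\<close>

lemma prod_X: "finite I \<Longrightarrow> (\<Prod>i\<in>I. X i) = (Poly_Mapping.single (ind I) 1 :: 'k::comm_semiring_1 mpoly)"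
  by (induction I rule: finite_induct) (auto simp: X_def ind_def mult_single)

text \<open>Setting z_i = 0 keeps exactly the monomials free of z_i, so their sum is the zero
  polynomial and there are none.\<close>

lemma keys_positive:
  fixes p :: "'k::field_char_0 mpoly"
  assumes "\<And>z. z i = 0 \<Longrightarrow> poly_eval z p = 0" "m \<in> kys p"
  shows "lkp m i \<noteq> 0"
proof
  assume m: "lkp m i = 0"
  define p0 where "p0 = (\<Sum>m \<in> {m \<in> kys p. lkp m i = 0}. Poly_Mapping.single m (lkp p m))"
  have "poly_eval z p0 = 0" for z
  proof -
    let ?z = "z(i := 0)"
    have z0: "mon_eval ?z m = 0" if "lkp m i \<noteq> 0" for m
      unfolding mon_eval_def using that by (intro prod_zero) (auto simp: in_keys_iff intro!: bexI[of _ i])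
    have z1: "mon_eval ?z m = mon_eval z m" if "lkp m i = 0" for m
      unfolding mon_eval_def using that by (intro prod.cong) (auto simp: in_keys_iff)
    have "0 = poly_eval ?z p" using assms(1)[of ?z] by simp
    also have "\<dots> = (\<Sum>m \<in> {m \<in> kys p. lkp m i = 0}. lkp p m * mon_eval z m)"
      unfolding poly_eval_alt by (intro sum.mono_neutral_cong_right) (auto simp: z0 z1)
    finally show ?thesis by (simp add: p0_def poly_eval_single)
  qed
  then have "p0 = 0" by (rule poly_eval_all_zero)
  moreover have "lkp p0 m = lkp p m"
    unfolding p0_def lookup_sum lookup_single when_def using m assms(2) by simp
  ultimately show False using assms(2) by (simp add: in_keys_iff)
qed

lemma divide_prod_X:
  fixes p :: "'k::field_char_0 mpoly"
  assumes "finite I" "\<forall>i\<in>I. \<forall>z. z i = 0 \<longrightarrow> poly_eval z p = 0"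
  shows "\<exists>h. p = (\<Prod>i\<in>I. X i) * h \<and> (\<forall>m \<in> kys h. m + ind I \<in> kys p)"
proof (intro exI conjI ballI)
  let ?h = "\<Sum>m \<in> kys p. Poly_Mapping.single (m - ind I) (lkp p m)"
  have eq: "m - ind I + ind I = m" if "m \<in> kys p" for m
  proof (rule poly_mapping_eqI)
    fix i
    have "i \<in> I \<Longrightarrow> lkp m i \<noteq> 0" using keys_positive[of i p m] assms(2) that by blast
    then show "lkp (m - ind I + ind I) i = lkp m i"
      using assms(1) by (auto simp: lookup_add lookup_minus lookup_ind)
  qed
  have "(\<Prod>i\<in>I. X i) * ?h = (\<Sum>m \<in> kys p. Poly_Mapping.single m (lkp p m))"
    unfolding prod_X[OF assms(1)] sum_distrib_left
    by (intro sum.cong) (auto simp: mult_single add.commute[of "ind I"] eq)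
  then show "p = (\<Prod>i\<in>I. X i) * ?h" using mpoly_sum_singles[of p] by simp
  fix m' assume "m' \<in> kys ?h"
  then have "lkp ?h m' \<noteq> 0" by (simp add: in_keys_iff)
  then obtain m where "m \<in> kys p" "m' = m - ind I"
    unfolding lookup_sum lookup_single when_def by (smt (verit) sum.not_neutral_contains_not_neutral)
  then show "m' + ind I \<in> kys p" using eq by simp
qed

lemma divide_prod_X_degree:
  fixes p :: "'k::field_char_0 mpoly"
  assumes "finite I" "\<forall>i\<in>I. \<forall>z. z i = 0 \<longrightarrow> poly_eval z p = 0"
    and "inv_vars V p" "wle (\<lambda>_. 1) d p" "p \<noteq> 0"
  shows "\<exists>h. p = (\<Prod>i\<in>I. X i) * h \<and> inv_vars V h \<and> card I \<le> d \<and> wle (\<lambda>_. 1) (d - card I) h"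
proof -
  obtain h where h: "p = (\<Prod>i\<in>I. X i) * h" "\<forall>m \<in> kys h. m + ind I \<in> kys p"
    using divide_prod_X[OF assms(1,2)] by blast
  have deg: "wdeg (\<lambda>_. 1) (ind I) = card I"
    using assms(1) wdeg_superset[of I "ind I" "\<lambda>_. 1"]
    by (simp add: lookup_ind in_keys_iff subset_iff)
  have le: "wdeg (\<lambda>_. 1) m + card I \<le> d" if "m \<in> kys h" for m
    using assms(4) h(2) that unfolding wle_def by (metis deg wdeg_add)
  have "kys m \<subseteq> V" if "m \<in> kys h" for m
  proof -
    have "kys (m + ind I) \<subseteq> V" using h(2) that assms(3) by (simp add: inv_vars_def)
    moreover have "kys m \<subseteq> kys (m + ind I)" by (auto simp: in_keys_iff lookup_add)
    ultimately show ?thesis by simp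
  qed
  moreover have "kys h \<noteq> {}" using assms(5) h(1) by auto
  then obtain m where "m \<in> kys h" by blast
  ultimately show ?thesis using h(1) le[of m] le
    by (intro exI[of _ h]) (force simp: inv_vars_def wle_def)
qed

text \<open>\<open>tails n m\<close> are the partitions placed at the positions \<open>m + 1, \<dots>, n\<close>.\<close>

definition tails :: "nat \<Rightarrow> nat \<Rightarrow> (nat \<Rightarrow> nat) set" where
  "tails n m = {\<kappa>. (\<forall>i. i \<notin> {m<..n} \<longrightarrow> \<kappa> i = 0) \<and> (\<forall>i>m. \<kappa> (Suc i) \<le> \<kappa> i)}"

definition tail_size :: "nat \<Rightarrow> nat \<Rightarrow> (nat \<Rightarrow> nat) \<Rightarrow> nat" where
  "tail_size n m \<kappa> = (\<Sum>i \<in> {i \<in> {m<..n}. odd (i - m)}. \<kappa> i)"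

text \<open>The symmetry that survives when an invariant polynomial is expanded in variables among
  the first m: its coefficients still satisfy it.\<close>

definition tail_invariant :: "nat \<Rightarrow> nat \<Rightarrow> 'k::comm_semiring_1 mpoly \<Rightarrow> bool" where
  "tail_invariant n m p \<longleftrightarrow>
     (\<forall>\<pi> \<in> W n. (\<forall>i\<le>m. \<pi> i = i) \<longrightarrow> poly_subst (\<lambda>i. X (\<pi> i)) p = p)"

lemma tail_invariant_eval:
  assumes "tail_invariant n m p" "\<pi> \<in> W n" "\<forall>i\<le>m. \<pi> i = i"
  shows "poly_eval (\<lambda>i. z (\<pi> i)) p = poly_eval z p"
proof -
  have "poly_eval z (poly_subst (\<lambda>i. X (\<pi> i)) p) = poly_eval z p"
    using assms by (simp add: tail_invariant_def)
  then show ?thesis by (simp add: poly_eval_subst)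
qed

text \<open>Equivalent to r not being a negative rational, by
  \<open>generic_iff_not_negative_rational\<close>. In this form it says that coordinates (n - i) r
  + \<kappa>_i with \<kappa>_i > 0 are nonzero, so that one may divide by them.\<close>

definition generic :: "'k::field_char_0 \<Rightarrow> bool" where
  "generic r \<longleftrightarrow> (\<forall>a b::nat. 0 < b \<longrightarrow> of_nat a * r + of_nat b \<noteq> 0)"

lemma W_outside: "\<pi> \<in> W n \<Longrightarrow> i \<notin> {1..n} \<Longrightarrow> \<pi> i = i"
  unfolding W_def by (auto simp: permutes_def)

lemma W_mono: "\<pi> \<in> W n \<Longrightarrow> n \<le> n' \<Longrightarrow> \<pi> \<in> W n'"
  unfolding W_def by (auto intro: permutes_subset)

lemma transpose_in_W': "i \<in> {1..n} \<Longrightarrow> j \<in> {1..n} \<Longrightarrow> even (i + j) \<Longrightarrow> transpose i j \<in> W n"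
proof -
  assume *: "i \<in> {1..n}" "j \<in> {1..n}" "even (i + j)"
  then have "i mod 2 = j mod 2" by presburger
  then have "transpose i j l mod 2 = l mod 2" for l by (simp add: transpose_def)
  then show ?thesis using permutes_swap_id[OF *(1,2)] by (simp add: W_def)
qed

text \<open>The reflection i \<mapsto> n + m + 1 - i. It ensures that adding 1 to every tail entry
  raises \<open>tail_size\<close> by exactly the number of variables divided out in
  \<open>tail_vanishing\<close>.\<close>

lemma card_tail_parity:
  "card {i \<in> {m<..n::nat}. odd (i - m)} = card {i \<in> {m<..n}. even (n - i)}"
proof (rule bij_betw_same_card)
  show "bij_betw (\<lambda>i. n + m + 1 - i) {i \<in> {m<..n}. odd (i - m)} {i \<in> {m<..n}. even (n - i)}"
  proof (rule bij_betw_byWitness[where f' = "\<lambda>i. n + m + 1 - i"])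
    show "(\<lambda>i. n + m + 1 - i) ` {i \<in> {m<..n}. odd (i - m)} \<subseteq> {i \<in> {m<..n}. even (n - i)}"
    proof safe
      fix i assume i: "i \<in> {m<..n}" "odd (i - m)"
      have "m < i" "i \<le> n" using i(1) by auto
      then show "n + m + 1 - i \<in> {m<..n}" unfolding greaterThanAtMost_iff by linarith
      have "n - (n + m + 1 - i) = i - m - 1" using i(1) by auto
      then show "even (n - (n + m + 1 - i))" using i(2) by simp
    qed
    show "(\<lambda>i. n + m + 1 - i) ` {i \<in> {m<..n}. even (n - i)} \<subseteq> {i \<in> {m<..n}. odd (i - m)}"
    proof safe
      fix i assume "i \<in> {m<..n}" "even (n - i)"
      then show "n + m + 1 - i \<in> {m<..n}" by auto
    next
      fix i assume i: "i \<in> {m<..n}" "even (n - i)" "even (n + m + 1 - i - m)"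
      then have "n + m + 1 - i - m = Suc (n - i)" by auto
      then show False using i(2,3) by simp
    qed
  qed auto
qed

text \<open>Uniqueness of interpolation, by induction on n and then on d. The points whose last
  entry is 0 show, by induction on n, that g vanishes where the last variable is 0; by symmetry g is
  divisible by all tail variables of that parity. The quotient has smaller degree and vanishes at
  the relevant points with positive entries, which become smaller partitions after a translation by
  1.\<close>

lemma tail_vanishing:
  fixes g :: "'k::field_char_0 mpoly"
  assumes r: "generic r"
    and "inv_vars {m<..n} g" "tail_invariant n m g" "wle (\<lambda>_. 1) d g"
    and "\<And>\<kappa>. \<kappa> \<in> tails n m \<Longrightarrow> tail_size n m \<kappa> \<le> d \<Longrightarrow>
      poly_eval (\<lambda>i. of_nat (n - i) * r + of_nat (\<kappa> i)) g = 0"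
  shows "g = 0"
  using assms(2-)
proof (induction n arbitrary: g d)
  case 0
  then have "kys k = {}" if "k \<in> kys g" for k using that by (auto simp: inv_vars_def)
  then have "g = Const (lkp g 0)"
    by (intro poly_mapping_eqI) (auto simp: Const_def lookup_single when_def in_keys_iff)
  moreover have "(\<lambda>_. 0) \<in> tails 0 m" "tail_size 0 m (\<lambda>_. 0) \<le> d" by (auto simp: tails_def tail_size_def)
  ultimately show ?case using "0.prems"(4)[of "\<lambda>_. 0"] by (metis Const_0 poly_eval_Const)
next
  case (Suc n)
  show ?case
  proof (cases "m \<le> n")
    case False
    then have V: "{m<..Suc n} = {}" by auto
    then have "kys k = {}" if "k \<in> kys g" for k using that Suc.prems(1) by (auto simp: inv_vars_def)
    then have "g = Const (lkp g 0)"
      by (intro poly_mapping_eqI) (auto simp: Const_def lookup_single when_def in_keys_iff)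
    moreover have "(\<lambda>_. 0) \<in> tails (Suc n) m" "tail_size (Suc n) m (\<lambda>_. 0) \<le> d"
      by (auto simp: tails_def tail_size_def)
    ultimately show ?thesis using Suc.prems(4)[of "\<lambda>_. 0"] by (metis Const_0 poly_eval_Const)
  next
    case mn: True
    show ?thesis using Suc.prems
    proof (induction d arbitrary: g rule: less_induct)
      case (less d g)
      \<comment> \<open>Adding r converts the shifts (n - i) r for n variables into the shifts (n +
        1 - i) r of the first n among n + 1 variables.\<close>
      define s :: "nat \<Rightarrow> 'k mpoly" where "s i = (if i = Suc n then 0 else X i + Const r)" for i
      define f where "f = poly_subst s g"
      have evalf: "poly_eval z f = poly_eval (\<lambda>i. if i = Suc n then 0 else z i + r) g" for z
        unfolding f_def poly_eval_subst s_def by (rule arg_cong[where f="\<lambda>x. poly_eval x g"]) auto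
      have "f = 0"
      proof (rule Suc.IH)
        show "inv_vars {m<..n} f" unfolding f_def
          by (rule inv_vars_subst[OF less.prems(1)])
            (auto simp: s_def intro!: inv_vars_add inv_vars_X)
        show "tail_invariant n m f" unfolding tail_invariant_def
        proof (intro ballI impI poly_eval_eqI)
          fix \<pi> z assume \<pi>: "\<pi> \<in> W n" "\<forall>i\<le>m. \<pi> i = i"
          have "\<pi> (Suc n) = Suc n" using W_outside[OF \<pi>(1)] by simp
          then have iff: "\<pi> i = Suc n \<longleftrightarrow> i = Suc n" for i
            using W_image(3)[OF \<pi>(1), of UNIV] by (metis injD)
          have "poly_eval z (poly_subst (\<lambda>i. X (\<pi> i)) f) =
            poly_eval (\<lambda>i. (\<lambda>j. if j = Suc n then 0 else z j + r) (\<pi> i)) g"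
            by (simp add: poly_eval_subst evalf iff)
          also have "\<dots> = poly_eval z f"
            unfolding evalf by (rule tail_invariant_eval[OF less.prems(2)]) (use \<pi> W_mono in auto)
          finally show "poly_eval z (poly_subst (\<lambda>i. X (\<pi> i)) f) = poly_eval z f" .
        qed
        show "wle (\<lambda>_. 1) d f" unfolding f_def
          by (rule wle_subst[OF less.prems(3)]) (auto simp: s_def intro!: wle_add wle_X)
        fix \<kappa> assume \<kappa>: "\<kappa> \<in> tails n m" "tail_size n m \<kappa> \<le> d"
        then have "\<kappa> (Suc n) = 0" by (auto simp: tails_def)
        then have "tail_size (Suc n) m \<kappa> = tail_size n m \<kappa>"
          unfolding tail_size_def by (intro sum.mono_neutral_right) (auto simp: le_Suc_eq)
        moreover have "\<kappa> \<in> tails (Suc n) m" using \<kappa> by (auto simp: tails_def)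
        ultimately have "poly_eval (\<lambda>i. of_nat (Suc n - i) * r + of_nat (\<kappa> i)) g = 0"
          using \<kappa> less.prems(4) by simp
        moreover have "poly_eval (\<lambda>i. of_nat (n - i) * r + of_nat (\<kappa> i)) f =
          poly_eval (\<lambda>i. of_nat (Suc n - i) * r + of_nat (\<kappa> i)) g"
          unfolding evalf using \<open>\<kappa> (Suc n) = 0\<close>
          by (intro poly_eval_cong_vars[OF less.prems(1)]) (auto simp: Suc_diff_le algebra_simps)
        ultimately show "poly_eval (\<lambda>i. of_nat (n - i) * r + of_nat (\<kappa> i)) f = 0" by simp
      qed
      have zero_last: "poly_eval z g = 0" if "z (Suc n) = 0" for z
      proof -
        have "poly_eval (\<lambda>i. z i - r) f = poly_eval z g"
          unfolding evalf by (rule arg_cong[where f="\<lambda>x. poly_eval x g"]) (use that in auto)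
        then show ?thesis using \<open>f = 0\<close> by simp
      qed
      \<comment> \<open>The tail positions that a permutation in \<open>W (Suc n)\<close> fixing 1,
        ..., m can exchange with the last one.\<close>
      define I where "I = {i \<in> {m<..Suc n}. even (Suc n - i)}"
      have zeroI: "poly_eval z g = 0" if "i \<in> I" "z i = 0" for z i
      proof -
        let ?\<pi> = "transpose i (Suc n)"
        have "even (i + Suc n)" using that by (auto simp: I_def)
        then have "?\<pi> \<in> W (Suc n)" using that by (intro transpose_in_W') (auto simp: I_def)
        moreover have "\<forall>i\<le>m. ?\<pi> i = i" using that mn by (auto simp: I_def transpose_def)
        ultimately have "poly_eval z g = poly_eval (\<lambda>j. z (?\<pi> j)) g"
          using tail_invariant_eval[OF less.prems(2)] by simp
        then show ?thesis using zero_last[of "\<lambda>j. z (?\<pi> j)"] that by simp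
      qed
      show "g = 0"
      proof (rule ccontr)
        assume "g \<noteq> 0"
        have "finite I" by (simp add: I_def)
        have zeroI': "\<forall>i\<in>I. \<forall>z. z i = 0 \<longrightarrow> poly_eval z g = 0" using zeroI by blast
        then obtain h where h: "g = (\<Prod>i\<in>I. X i) * h" "inv_vars {m<..Suc n} h" "card I \<le> d"
          "wle (\<lambda>_. 1) (d - card I) h"
          using divide_prod_X_degree[OF \<open>finite I\<close> zeroI' less.prems(1,3) \<open>g \<noteq> 0\<close>]
          by (elim exE conjE) (rule that)
        have "Suc n \<in> I" using mn by (auto simp: I_def)
        then have "card I > 0" using \<open>finite I\<close> by (auto simp: card_gt_0_iff)
        \<comment> \<open>The value of \<open>h1\<close> at a partition \<open>\<kappa>\<close> is
          that of h at \<open>\<kappa>\<close> with every tail entry raised by 1, so the induction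
          hypothesis on the degree meets only points where the divided-out variables are
          nonzero.\<close>
        define h1 where "h1 = poly_subst (\<lambda>i. X i + Const 1) h"
        have evalh1: "poly_eval z h1 = poly_eval (\<lambda>i. z i + 1) h" for z
          unfolding h1_def poly_eval_subst by simp
        have "h1 = 0"
        proof (rule less.IH[of "d - card I"])
          show "d - card I < d" using \<open>card I > 0\<close> h(3) by simp
          show "inv_vars {m<..Suc n} h1" unfolding h1_def
            by (rule inv_vars_subst[OF h(2)]) (auto intro!: inv_vars_add inv_vars_X)
          show "wle (\<lambda>_. 1) (d - card I) h1" unfolding h1_def
            by (rule wle_subst[OF h(4)]) (auto intro!: wle_add wle_X)
          show "tail_invariant (Suc n) m h1" unfolding tail_invariant_def
          proof (intro ballI impI poly_eval_eqI)
            fix \<pi> z assume \<pi>: "\<pi> \<in> W (Suc n)" "\<forall>i\<le>m. \<pi> i = i"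
            have inj: "inj \<pi>" using W_image(3)[OF \<pi>(1)] .
            have par: "even (\<pi> i) \<longleftrightarrow> even i" for i
            proof -
              have "\<pi> i mod 2 = i mod 2" using \<pi>(1) by (simp add: W_def)
              then show ?thesis by presburger
            qed
            have "\<pi> i \<in> I" if "i \<in> I" for i
            proof -
              have "\<pi> i \<in> {1..Suc n}" using \<pi>(1) that permutes_in_image[of \<pi> "{1..Suc n}" i] by (auto simp: W_def I_def)
              moreover have "m < \<pi> i"
              proof (rule ccontr)
                assume "\<not> m < \<pi> i"
                then have "\<pi> (\<pi> i) = \<pi> i" using \<pi>(2) by simp
                then have "\<pi> i = i" using inj by (auto dest: injD)
                then show False using \<open>\<not> m < \<pi> i\<close> that by (simp add: I_def)
              qed
              ultimately show ?thesis using that par[of i] by (auto simp: I_def)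
            qed
            then have img: "\<pi> ` I = I" using inj \<open>finite I\<close>
              by (intro card_subset_eq) (auto simp: card_image inj_on_subset)
            have "(\<Prod>i\<in>I. X (\<pi> i)) = (\<Prod>i\<in>I. X i :: 'k mpoly)"
              using prod.reindex[of \<pi> I "X :: nat \<Rightarrow> 'k mpoly"] img inj by (simp add: inj_on_subset)
            moreover have "poly_subst (\<lambda>i. X (\<pi> i)) g = g"
              using less.prems(2) \<pi> unfolding tail_invariant_def by blast
            ultimately have "(\<Prod>i\<in>I. X i) * poly_subst (\<lambda>i. X (\<pi> i)) h = (\<Prod>i\<in>I. X i) * h"
              unfolding h(1) by simp
            moreover have "(\<Prod>i\<in>I. X i) \<noteq> (0 :: 'k mpoly)" using h(1) \<open>g \<noteq> 0\<close> by auto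
            ultimately have "poly_subst (\<lambda>i. X (\<pi> i)) h = h" by simp
            then have "poly_eval y (poly_subst (\<lambda>i. X (\<pi> i)) h) = poly_eval y h" for y by simp
            then show "poly_eval z (poly_subst (\<lambda>i. X (\<pi> i)) h1) = poly_eval z h1"
              by (simp add: poly_eval_subst evalh1)
          qed
          fix \<kappa> assume \<kappa>: "\<kappa> \<in> tails (Suc n) m" "tail_size (Suc n) m \<kappa> \<le> d - card I"
          define \<kappa>' where "\<kappa>' i = (if i \<in> {m<..Suc n} then Suc (\<kappa> i) else 0)" for i
          have "\<kappa>' \<in> tails (Suc n) m" using \<kappa>(1) by (auto simp: tails_def \<kappa>'_def)
          moreover have "tail_size (Suc n) m \<kappa>' \<le> d"
          proof -
            have "tail_size (Suc n) m \<kappa>' = (\<Sum>i \<in> {i \<in> {m<..Suc n}. odd (i - m)}. \<kappa> i + 1)"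
              unfolding tail_size_def by (intro sum.cong) (auto simp: \<kappa>'_def)
            also have "\<dots> = tail_size (Suc n) m \<kappa> + card I"
              using card_tail_parity[of m "Suc n"]
              unfolding sum.distrib tail_size_def I_def card_eq_sum by (simp only:)
            finally show ?thesis using \<kappa>(2) h(3) by simp
          qed
          ultimately have "poly_eval (\<lambda>i. of_nat (Suc n - i) * r + of_nat (\<kappa>' i)) g = 0"
            by (rule less.prems(4))
          \<comment> \<open>Tail entries of \<open>\<kappa>'\<close> are positive, so genericity
            applies.\<close>
          moreover have "of_nat (Suc n - i) * r + of_nat (\<kappa>' i) \<noteq> 0" if "i \<in> I" for i
            using r that unfolding generic_def by (intro r[unfolded generic_def, rule_format]) (auto simp: I_def \<kappa>'_def)
          ultimately have "poly_eval (\<lambda>i. of_nat (Suc n - i) * r + of_nat (\<kappa>' i)) h = 0"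
            using \<open>finite I\<close> unfolding h(1) by simp
          moreover have "poly_eval (\<lambda>i. of_nat (Suc n - i) * r + of_nat (\<kappa> i)) h1 =
            poly_eval (\<lambda>i. of_nat (Suc n - i) * r + of_nat (\<kappa>' i)) h"
            unfolding evalh1 by (rule poly_eval_cong_vars[OF h(2)]) (auto simp: \<kappa>'_def)
          ultimately show "poly_eval (\<lambda>i. of_nat (Suc n - i) * r + of_nat (\<kappa> i)) h1 = 0" by simp
        qed
        have "h = 0"
        proof (rule poly_eval_all_zero)
          show "poly_eval z h = 0" for z using evalh1[of "\<lambda>i. z i - 1"] \<open>h1 = 0\<close> by simp
        qed
        then show False using h(1) \<open>g \<noteq> 0\<close> by simp
      qed
    qed
  qed
qed

text \<open>
  Each variable in \<open>V\<close> is handled on its own: a polynomial of degree at most \<open>d\<close> in one variable is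
  determined by its values at \<open>0, \<dots>, d\<close>.
\<close>

lemma tail_vanishing_spectators:
  fixes g :: "'k::field_char_0 mpoly"
  assumes r: "generic r" and V: "finite V" "V \<subseteq> {..m}"
    and "inv_vars (V \<union> {m<..n}) g" "tail_invariant n m g" "wle (\<lambda>_. 1) d g"
    and "\<And>a \<kappa>. \<kappa> \<in> tails n m \<Longrightarrow> (\<Sum>v\<in>V. a v) + tail_size n m \<kappa> \<le> d \<Longrightarrow>
      poly_eval (\<lambda>i. if i \<in> V then of_nat (a i) else of_nat (n - i) * r + of_nat (\<kappa> i)) g = 0"
  shows "g = 0"
  using V assms(4-)
proof (induction V arbitrary: g d rule: finite_induct)
  case empty
  then show ?case by (intro tail_vanishing[OF r, of m n g d]) auto
next
  case (insert v V)
  have v: "v \<le> m" using insert.prems(1) by simp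
  show ?case using insert.prems
  proof (induction d arbitrary: g rule: less_induct)
    case (less d g)
    \<comment> \<open>At z_v = 0 one spectator fewer remains, which settles divisibility by z_v; the
      quotient, with z_v translated by 1, has degree d - 1.\<close>
    let ?s = "\<lambda>i. if i = v then 0 else X i :: 'k mpoly"
    define f where "f = poly_subst ?s g"
    have evalf: "poly_eval z f = poly_eval (z(v := 0)) g" for z
      unfolding f_def poly_eval_subst by (rule arg_cong[where f="\<lambda>x. poly_eval x g"]) auto
    have tinv: "poly_eval (\<lambda>i. z (\<pi> i)) g = poly_eval z g" if "\<pi> \<in> W n" "\<forall>i\<le>m. \<pi> i = i" for \<pi> z
      using tail_invariant_eval[OF less.prems(3)] that by blast
    have piv: "\<pi> i = v \<longleftrightarrow> i = v" if "\<pi> \<in> W n" "\<forall>i\<le>m. \<pi> i = i" for \<pi> i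
      using W_image(3)[OF that(1), of UNIV] v that(2) by (metis injD)
    have "f = 0"
    proof (rule insert.IH)
      show "V \<subseteq> {..m}" using insert.prems by simp
      show "inv_vars (V \<union> {m<..n}) f" unfolding f_def
        by (rule inv_vars_subst[OF less.prems(2)]) (auto intro!: inv_vars_X)
      show "tail_invariant n m f" unfolding tail_invariant_def
      proof (intro ballI impI poly_eval_eqI)
        fix \<pi> z assume \<pi>: "\<pi> \<in> W n" "\<forall>i\<le>m. \<pi> i = i"
        have "poly_eval z (poly_subst (\<lambda>i. X (\<pi> i)) f) = poly_eval (\<lambda>i. (z(v := 0)) (\<pi> i)) g"
          unfolding poly_eval_subst evalf
          by (rule arg_cong[where f="\<lambda>x. poly_eval x g"]) (auto simp: piv[OF \<pi>])
        also have "\<dots> = poly_eval (z(v := 0)) g" by (rule tinv[OF \<pi>])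
        finally show "poly_eval z (poly_subst (\<lambda>i. X (\<pi> i)) f) = poly_eval z f"
          unfolding evalf .
      qed
      show "wle (\<lambda>_. 1) d f" unfolding f_def
        by (rule wle_subst[OF less.prems(4)]) (auto intro!: wle_X)
      fix a \<kappa> assume *: "\<kappa> \<in> tails n m" "(\<Sum>v\<in>V. a v) + tail_size n m \<kappa> \<le> d"
      have "(\<Sum>w\<in>insert v V. (a(v := 0)) w) = (\<Sum>v\<in>V. a v)"
        using insert.hyps by (simp, intro sum.cong) auto
      then have "poly_eval (\<lambda>i. if i \<in> insert v V then of_nat ((a(v := 0)) i) else of_nat (n - i) * r + of_nat (\<kappa> i)) g = 0"
        using * by (intro less.prems(5)) auto
      moreover have "(\<lambda>i. if i \<in> insert v V then of_nat ((a(v := 0)) i) else of_nat (n - i) * r + of_nat (\<kappa> i)) =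
        (\<lambda>i. if i \<in> V then of_nat (a i) else of_nat (n - i) * r + of_nat (\<kappa> i)) (v := 0 :: 'k)"
        using insert.hyps by auto
      ultimately show "poly_eval (\<lambda>i. if i \<in> V then of_nat (a i) else of_nat (n - i) * r + of_nat (\<kappa> i)) f = 0"
        unfolding evalf by simp
    qed
    have zero: "\<forall>i\<in>{v}. \<forall>z. z i = 0 \<longrightarrow> poly_eval z g = 0"
    proof (intro ballI allI impI)
      fix i and z :: "nat \<Rightarrow> 'k" assume "i \<in> {v}" "z i = 0"
      then have "z(v := 0) = z" by auto
      then show "poly_eval z g = 0" using evalf[of z] \<open>f = 0\<close> by simp
    qed
    show "g = 0"
    proof (rule ccontr)
      assume "g \<noteq> 0"
      obtain h where h: "g = (\<Prod>i\<in>{v}. X i) * h" "inv_vars (insert v V \<union> {m<..n}) h" "card {v} \<le> d"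
        "wle (\<lambda>_. 1) (d - card {v}) h"
        using divide_prod_X_degree[OF finite.insertI[OF finite.emptyI] zero less.prems(2,4) \<open>g \<noteq> 0\<close>]
        by (elim exE conjE) (rule that)
      have inv: "poly_subst (\<lambda>i. X (\<pi> i)) h = h" if \<pi>: "\<pi> \<in> W n" "\<forall>i\<le>m. \<pi> i = i" for \<pi>
      proof -
        have "X v * poly_subst (\<lambda>i. X (\<pi> i)) h = X v * h"
          using less.prems(3) \<pi> v unfolding tail_invariant_def h(1) by simp
        moreover have "X v \<noteq> (0 :: 'k mpoly)" using h(1) \<open>g \<noteq> 0\<close> by auto
        ultimately show ?thesis by simp
      qed
      define h1 where "h1 = poly_subst (\<lambda>i. if i = v then X v + Const 1 else X i) h"
      have evalh1: "poly_eval z h1 = poly_eval (z(v := z v + 1)) h" for z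
        unfolding h1_def poly_eval_subst by (rule arg_cong[where f="\<lambda>x. poly_eval x h"]) auto
      have "h1 = 0"
      proof (rule less.IH[of "d - 1"])
        show "d - 1 < d" using h(3) by simp
        show "insert v V \<subseteq> {..m}" by (rule less.prems)
        show "inv_vars (insert v V \<union> {m<..n}) h1" unfolding h1_def
          by (rule inv_vars_subst[OF h(2)]) (auto intro!: inv_vars_add inv_vars_X)
        show "wle (\<lambda>_. 1) (d - 1) h1" unfolding h1_def
          by (rule wle_subst[of "\<lambda>_. 1"]) (use h(4) in \<open>auto intro!: wle_add wle_X\<close>)
        show "tail_invariant n m h1" unfolding tail_invariant_def
        proof (intro ballI impI poly_eval_eqI)
          fix \<pi> z assume \<pi>: "\<pi> \<in> W n" "\<forall>i\<le>m. \<pi> i = i"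
          have "poly_eval z (poly_subst (\<lambda>i. X (\<pi> i)) h1) = poly_eval (\<lambda>i. (z(v := z v + 1)) (\<pi> i)) h"
            unfolding poly_eval_subst evalh1
            by (rule arg_cong[where f="\<lambda>x. poly_eval x h"]) (use \<pi>(2) v in \<open>auto simp: piv[OF \<pi>]\<close>)
          also have "\<dots> = poly_eval (z(v := z v + 1)) (poly_subst (\<lambda>i. X (\<pi> i)) h)"
            by (simp add: poly_eval_subst)
          finally show "poly_eval z (poly_subst (\<lambda>i. X (\<pi> i)) h1) = poly_eval z h1"
            by (simp add: inv[OF \<pi>] evalh1)
        qed
        fix a \<kappa> assume *: "\<kappa> \<in> tails n m" "(\<Sum>v\<in>insert v V. a v) + tail_size n m \<kappa> \<le> d - 1"
        let ?z = "\<lambda>a i. if i \<in> insert v V then of_nat (a i) else of_nat (n - i) * r + of_nat (\<kappa> i)"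
        let ?a = "a(v := Suc (a v))"
        have "(\<Sum>w\<in>V. ?a w) = (\<Sum>w\<in>V. a w)" using insert.hyps by (intro sum.cong) auto
        then have "(\<Sum>w\<in>insert v V. ?a w) = Suc (\<Sum>v\<in>insert v V. a v)" using insert.hyps by simp
        then have "(\<Sum>w\<in>insert v V. ?a w) + tail_size n m \<kappa> \<le> d" using * h(3) by simp
        then have "poly_eval (?z ?a) g = 0" by (intro less.prems(5) *(1))
        moreover have "of_nat (Suc (a v)) \<noteq> (0 :: 'k)" by (simp only: of_nat_eq_0_iff nat.distinct not_False_eq_True)
        ultimately have "poly_eval (?z ?a) h = 0" unfolding h(1) by simp
        moreover have "(?z a) (v := ?z a v + 1) = ?z ?a" by auto
        ultimately show "poly_eval (?z a) h1 = 0" unfolding evalh1 by simp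
      qed
      have "h = 0"
      proof (rule poly_eval_all_zero)
        fix z :: "nat \<Rightarrow> 'k"
        have "(z(v := z v - 1)) (v := (z(v := z v - 1)) v + 1) = z" by (rule ext) simp
        then show "poly_eval z h = 0" using evalh1[of "z(v := z v - 1)"] \<open>h1 = 0\<close> by simp
      qed
      then show False using h(1) \<open>g \<noteq> 0\<close> by simp
    qed
  qed
qed

section \<open>Bounds for partial degrees\<close>

text \<open>Lattice points whose entries decrease along \<open>U\<close> with gaps at least
  \<open>M\<close> are Zariski dense. The smallest index is freed first, because the chamber bounds
  its entry only from below by the others: for fixed other entries it still takes infinitely many
  values.\<close>

lemma vanishing_on_chamber:
  fixes p :: "'k::field_char_0 mpoly"
  assumes "finite U"
    and "\<And>z \<kappa>. (\<forall>i. i \<notin> U \<longrightarrow> z i = z0 i) \<Longrightarrow> (\<forall>i\<in>U. z i = c i + of_nat (\<kappa> i)) \<Longrightarrow>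
      (\<forall>i\<in>U. M \<le> \<kappa> i) \<Longrightarrow> (\<forall>i\<in>U. \<forall>j\<in>U. i < j \<longrightarrow> \<kappa> j + M \<le> \<kappa> i) \<Longrightarrow> poly_eval z p = 0"
    and "\<forall>i. i \<notin> U \<longrightarrow> z i = z0 i"
  shows "poly_eval z p = 0"
  using assms
proof (induction "card U" arbitrary: U z z0)
  case 0
  then show ?case by (intro "0.prems"(2)[of z "\<lambda>_. 0"]) auto
next
  case (Suc k)
  then have "U \<noteq> {}" by auto
  define u where "u = Min U"
  have u: "u \<in> U" "\<And>i. i \<in> U \<Longrightarrow> u \<le> i" unfolding u_def using Suc.prems(1) \<open>U \<noteq> {}\<close> by auto
  show ?case
  proof (rule Suc.hyps(1)[of "U - {u}" z])
    show "k = card (U - {u})" using Suc.hyps(2) u Suc.prems(1) by simp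
    show "finite (U - {u})" using Suc.prems(1) by simp
    show "\<forall>i. i \<notin> U - {u} \<longrightarrow> z i = z i" by simp
    fix y \<kappa>
    assume y: "\<forall>i. i \<notin> U - {u} \<longrightarrow> y i = z i" "\<forall>i\<in>U - {u}. y i = c i + of_nat (\<kappa> i)"
      "\<forall>i\<in>U - {u}. M \<le> \<kappa> i" "\<forall>i\<in>U - {u}. \<forall>j\<in>U - {u}. i < j \<longrightarrow> \<kappa> j + M \<le> \<kappa> i"
    obtain q where q: "\<forall>t. poly q t = poly_eval (y(u := t)) p" using poly_eval_coordinate by blast
    \<comment> \<open>Every entry N + a satisfies the gap conditions against all other
      entries.\<close>
    define N where "N = M + (\<Sum>j\<in>U. \<kappa> j + M)"
    have "poly q (c u + of_nat (N + a)) = 0" for a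
    proof -
      let ?k = "\<kappa>(u := N + a)"
      have le: "\<kappa> j + M \<le> N" if "j \<in> U" for j
      proof -
        have "\<kappa> j + M \<le> (\<Sum>j\<in>U. \<kappa> j + M)" using that Suc.prems(1)
          by (intro member_le_sum) auto
        then show ?thesis by (simp add: N_def)
      qed
      have "poly_eval (y(u := c u + of_nat (N + a))) p = 0"
      proof (rule Suc.prems(2))
        show "\<forall>i. i \<notin> U \<longrightarrow> (y(u := c u + of_nat (N + a))) i = z0 i"
          using y(1) Suc.prems(3) u(1) by auto
        show "\<forall>i\<in>U. (y(u := c u + of_nat (N + a))) i = c i + of_nat (?k i)"
          using y(2) by auto
        show "\<forall>i\<in>U. M \<le> ?k i" using y(3) by (auto simp: N_def)
        show "\<forall>i\<in>U. \<forall>j\<in>U. i < j \<longrightarrow> ?k j + M \<le> ?k i"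
        proof (intro ballI impI)
          fix i j assume *: "i \<in> U" "j \<in> U" "i < j"
          then have "j \<noteq> u" using u(2)[of i] by auto
          then show "?k j + M \<le> ?k i" using y(4) * le[of j] by (cases "i = u") auto
        qed
      qed
      then show ?thesis using q by simp
    qed
    then have "range (\<lambda>a. c u + of_nat (N + a)) \<subseteq> {t. poly q t = 0}" by auto
    moreover have "infinite (range (\<lambda>a. c u + of_nat (N + a)))"
      by (rule range_inj_infinite) (auto simp: inj_on_def simp del: of_nat_add)
    ultimately have "q = 0" by (intro infinite_zeros_imp_zero) (auto dest: finite_subset)
    then have "poly_eval (y(u := y u)) p = 0" using q by (metis poly_0)
    then show "poly_eval y p = 0" by simp
  qed
qed

definition chi :: "nat set \<Rightarrow> nat \<Rightarrow> nat" where
  "chi U i = (if i \<in> U then 1 else 0)"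

text \<open>
  The coefficients of \<open>S\<close> as a polynomial in the variables in \<open>U\<close> have small degree, so by
  \<open>tail_vanishing_spectators\<close> they cannot vanish at all small points.
\<close>

lemma partial_degree_bound:
  fixes S :: "'k::field_char_0 mpoly"
  assumes r: "generic r" and mn: "m \<le> n" and UV: "U \<union> V = {1..m}" "U \<inter> V = {}"
    and S: "inv_vars {1..n} S" "tail_invariant n m S" "wle (\<lambda>_. 1) d S"
    and vanish: "\<And>z a \<kappa>. \<kappa> \<in> tails n m \<Longrightarrow> (\<forall>v\<in>V. z v = of_nat (a v)) \<Longrightarrow>
      (\<forall>i\<in>{m<..n}. z i = of_nat (n - i) * r + of_nat (\<kappa> i)) \<Longrightarrow>
      (\<Sum>v\<in>V. a v) + tail_size n m \<kappa> < D \<Longrightarrow> poly_eval z S = 0"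
    and k: "k \<in> kys S"
  shows "wdeg (chi U) k + D \<le> d"
proof (rule ccontr)
  assume gt: "\<not> wdeg (chi U) k + D \<le> d"
  let ?\<alpha> = "restr U k"
  define g where "g = mpart U ?\<alpha> S"
  have Ule: "i \<in> U \<Longrightarrow> i \<le> m" and Vle: "i \<in> V \<Longrightarrow> i \<le> m" for i
    using UV(1) by (metis Un_iff atLeastAtMost_iff)+
  have fin: "finite U" "finite V" using UV(1) by (metis finite_Un finite_atLeastAtMost)+
  have deg: "wdeg (chi U) k = wdeg (\<lambda>_. 1) ?\<alpha>"
  proof -
    have "wdeg (chi U) k = (\<Sum>i \<in> kys k. chi U i * lkp k i)" by (simp add: wdeg_def)
    also have "\<dots> = (\<Sum>i \<in> U \<inter> kys k. lkp k i)"
      by (rule sum.mono_neutral_cong_right) (auto simp: chi_def)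
    also have "\<dots> = wdeg (\<lambda>_. 1) ?\<alpha>" unfolding wdeg_def keys_restr
      by (intro sum.cong) (auto simp: lookup_restr)
    finally show ?thesis .
  qed
  have kd: "wdeg (chi U) k \<le> d"
  proof -
    have "wdeg (chi U) k \<le> wdeg (\<lambda>_. 1) k" unfolding wdeg_def by (intro sum_mono) (auto simp: chi_def)
    then show ?thesis using S(3) k unfolding wle_def by force
  qed
  \<comment> \<open>If the bound fails, the degree left for g is smaller than D, and
    \<open>vanish\<close> covers all points that \<open>tail_vanishing_spectators\<close> asks
    for.\<close>
  have "g = 0"
  proof (rule tail_vanishing_spectators[OF r fin(2), of m n g "d - wdeg (chi U) k"])
    show "V \<subseteq> {..m}" using UV by auto
    have "kys m' \<subseteq> V \<union> {m<..n}" if "m' \<in> kys g" for m'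
    proof -
      have "m' + ?\<alpha> \<in> kys S" "kys m' \<inter> U = {}" using keys_mpart that unfolding g_def by blast+
      then have "kys (m' + ?\<alpha>) \<subseteq> {1..n}" using S(1) by (simp add: inv_vars_def)
      moreover have "kys m' \<subseteq> kys (m' + ?\<alpha>)" by (auto simp: in_keys_iff lookup_add)
      ultimately have "kys m' \<subseteq> {1..n}" by simp
      moreover have "{1..n} \<subseteq> U \<union> V \<union> {m<..n}" using UV by auto
      ultimately show ?thesis using \<open>kys m' \<inter> U = {}\<close> by blast
    qed
    then show "inv_vars (V \<union> {m<..n}) g" by (simp add: inv_vars_def)
    show "wle (\<lambda>_. 1) (d - wdeg (chi U) k) g" unfolding wle_def
    proof
      fix m' assume "m' \<in> kys g"
      then have "m' + ?\<alpha> \<in> kys S" using keys_mpart unfolding g_def by blast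
      then have "wdeg (\<lambda>_. 1) (m' + ?\<alpha>) \<le> d" using S(3) unfolding wle_def by blast
      then show "wdeg (\<lambda>_. 1) m' \<le> d - wdeg (chi U) k" unfolding deg by (simp add: wdeg_add)
    qed
    show "tail_invariant n m g" unfolding tail_invariant_def
    proof (intro ballI impI poly_eval_eqI)
      fix \<pi> z assume \<pi>: "\<pi> \<in> W n" "\<forall>i\<le>m. \<pi> i = i"
      have piU: "\<pi> i \<in> U \<longleftrightarrow> i \<in> U" and fixU: "i \<in> U \<Longrightarrow> \<pi> i = i" for i
      proof -
        show "i \<in> U \<Longrightarrow> \<pi> i = i" for i using \<pi>(2) UV(1) by (metis Un_iff atLeastAtMost_iff)
        then show "\<pi> i \<in> U \<longleftrightarrow> i \<in> U" using W_image(3)[OF \<pi>(1), of UNIV] by (metis injD)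
      qed
      have "poly_eval (\<lambda>i. z (\<pi> i)) g = poly_eval z g" unfolding g_def
      proof (rule mpart_eval_eq)
        fix y
        have "(\<lambda>i. if i \<in> U then y i else z (\<pi> i)) = (\<lambda>i. (\<lambda>j. if j \<in> U then y j else z j) (\<pi> i))"
          by (auto simp: piU fixU)
        then show "poly_eval (\<lambda>i. if i \<in> U then y i else z (\<pi> i)) S = poly_eval (\<lambda>i. if i \<in> U then y i else z i) S"
          using tail_invariant_eval[OF S(2) \<pi>, of "\<lambda>j. if j \<in> U then y j else z j"] by simp
      qed
      then show "poly_eval z (poly_subst (\<lambda>i. X (\<pi> i)) g) = poly_eval z g" by (simp add: poly_eval_subst)
    qed
    fix a \<kappa> assume *: "\<kappa> \<in> tails n m" "(\<Sum>v\<in>V. a v) + tail_size n m \<kappa> \<le> d - wdeg (chi U) k"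
    show "poly_eval (\<lambda>i. if i \<in> V then of_nat (a i) else of_nat (n - i) * r + of_nat (\<kappa> i)) g = 0"
      unfolding g_def
    proof (rule mpart_eval_zero)
      fix y
      show "poly_eval (\<lambda>i. if i \<in> U then y i else if i \<in> V then of_nat (a i)
        else of_nat (n - i) * r + of_nat (\<kappa> i)) S = 0"
      proof (rule vanish[OF *(1), of _ a])
        show "(\<Sum>v\<in>V. a v) + tail_size n m \<kappa> < D" using *(2) gt kd by simp
      qed (use UV(2) Ule Vle in \<open>fastforce+\<close>)
    qed
  qed
  then show False using mpart_eq_0_imp[of U k S] k by (simp add: g_def)
qed

section \<open>Interpolation\<close>

lemma prod_linear:
  fixes y :: "nat \<Rightarrow> 'k::comm_ring_1"
  assumes "finite S"
  shows "degree (\<Prod>l\<in>S. [:- y l, 1:]) \<le> card S" "coeff (\<Prod>l\<in>S. [:- y l, 1:]) (card S) = 1"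
    "S \<noteq> {} \<Longrightarrow> coeff (\<Prod>l\<in>S. [:- y l, 1:]) (card S - 1) = - (\<Sum>l\<in>S. y l)"
  using assms
proof (induction S rule: finite_induct)
  case (insert b S)
  let ?P = "\<Prod>l\<in>S. [:- y l, 1:]"
  have P: "(\<Prod>l\<in>insert b S. [:- y l, 1:]) = pCons 0 ?P - smult (y b) ?P" using insert by simp
  {
    case 1
    have "degree (pCons 0 ?P) \<le> Suc (card S)" using insert.IH(1) degree_pCons_le[of 0 ?P] by simp
    moreover have "degree (smult (y b) ?P) \<le> Suc (card S)"
      using insert.IH(1) degree_smult_le[of "y b" ?P] by simp
    ultimately show ?case unfolding P using insert.hyps by (simp add: degree_diff_le)
  next
    case 2
    have "coeff ?P (Suc (card S)) = 0" using insert.IH(1) by (simp add: coeff_eq_0)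
    then show ?case unfolding P using insert by simp
  next
    case 3
    show ?case
    proof (cases "S = {}")
      case False
      then obtain k where "card S = Suc k" using insert.hyps by (metis card_eq_0_iff not0_implies_Suc)
      then show ?thesis unfolding P using insert False by simp
    qed simp
  }
qed auto

lemma lagrange:
  fixes w :: "'k::field poly" and z :: "nat \<Rightarrow> 'k"
  assumes "finite A" "inj_on z A" "degree w < card A"
  shows "(\<Sum>i\<in>A. smult (poly w (z i) / (\<Prod>l\<in>A - {i}. z i - z l)) (\<Prod>l\<in>A - {i}. [:- z l, 1:])) = w"
    (is "?L = w")
proof (rule poly_eqI_degree[of "z ` A"])
  have nz: "(\<Prod>l\<in>A - {i}. z i - z l) \<noteq> 0" if "i \<in> A" for i
    using assms that by (auto simp: inj_on_def)
  show "degree w < card (z ` A)" using assms by (simp add: card_image)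
  have "degree (\<Prod>l\<in>A - {i}. [:- z l, 1:]) \<le> card A - 1" if "i \<in> A" for i
    using prod_linear(1)[of "A - {i}" z] assms that by simp
  then have "degree ?L \<le> card A - 1"
    by (intro degree_sum_le assms) (meson degree_smult_le le_trans)
  then show "degree ?L < card (z ` A)" using assms by (simp add: card_image)
  fix t assume "t \<in> z ` A"
  then obtain j where j: "j \<in> A" "t = z j" by auto
  have "poly ?L t = (\<Sum>i\<in>A. if i = j then poly w t else 0)"
    unfolding poly_sum
  proof (intro sum.cong refl)
    fix i assume i: "i \<in> A"
    show "poly (smult (poly w (z i) / (\<Prod>l\<in>A - {i}. z i - z l)) (\<Prod>l\<in>A - {i}. [:- z l, 1:])) t
      = (if i = j then poly w t else 0)"
    proof (cases "i = j")
      case True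
      then show ?thesis using nz[OF i] j by (simp add: poly_prod)
    next
      case False
      then have "(\<Prod>l\<in>A - {i}. z j - z l) = 0" using assms j by (intro prod_zero) auto
      then show ?thesis using False j by (simp add: poly_prod)
    qed
  qed
  also have "\<dots> = poly w t" using assms j by simp
  finally show "poly ?L t = poly w t" .
qed

text \<open>Compares the coefficients of degree |A| - 1 in the interpolation formula, where every
  basis polynomial is monic up to its denominator.\<close>

lemma lagrange_coeff:
  fixes w :: "'k::field poly" and z :: "nat \<Rightarrow> 'k"
  assumes "finite A" "inj_on z A" "degree w < card A"
  shows "(\<Sum>i\<in>A. poly w (z i) / (\<Prod>l\<in>A - {i}. z i - z l)) = coeff w (card A - 1)"
proof -
  have "coeff w (card A - 1) = (\<Sum>i\<in>A. poly w (z i) / (\<Prod>l\<in>A - {i}. z i - z l) *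
      coeff (\<Prod>l\<in>A - {i}. [:- z l, 1:]) (card A - 1))"
    by (subst lagrange[OF assms, symmetric]) (simp add: coeff_sum)
  also have "\<dots> = (\<Sum>i\<in>A. poly w (z i) / (\<Prod>l\<in>A - {i}. z i - z l))"
  proof (intro sum.cong refl)
    fix i assume "i \<in> A"
    then show "poly w (z i) / (\<Prod>l\<in>A - {i}. z i - z l) * coeff (\<Prod>l\<in>A - {i}. [:- z l, 1:]) (card A - 1)
      = poly w (z i) / (\<Prod>l\<in>A - {i}. z i - z l)"
      using prod_linear(2)[of "A - {i}" z] assms(1) by simp
  qed
  finally show ?thesis by simp
qed

lemma lagrange_eval:
  fixes w :: "'k::field poly" and z :: "nat \<Rightarrow> 'k"
  assumes "finite A" "inj_on z A" "degree w < card A"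
  shows "(\<Sum>i\<in>A. poly w (z i) * (\<Prod>l\<in>A - {i}. t - z l) / (\<Prod>l\<in>A - {i}. z i - z l)) = poly w t"
proof -
  have "poly w t = (\<Sum>i\<in>A. poly w (z i) / (\<Prod>l\<in>A - {i}. z i - z l) * (\<Prod>l\<in>A - {i}. t - z l))"
    by (subst lagrange[OF assms, symmetric]) (simp add: poly_sum poly_prod)
  then show ?thesis by simp
qed

lemma esf_uminus: "esf (\<lambda>i. - f i) A k = (- 1) ^ k * esf (f :: nat \<Rightarrow> 'b::comm_ring_1) A k"
proof -
  have "(\<Prod>i\<in>S. - f i) = (- 1) ^ card S * prod f S" for S
    using prod.distrib[of "\<lambda>_. - 1" f S] by simp
  then show ?thesis by (simp add: esf_def sum_distrib_left)
qed

lemma prod_diff_esf: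
  assumes "finite A"
  shows "(\<Prod>l\<in>A. s - z l) = (\<Sum>k\<le>card A. (- 1) ^ k * esf z A k * (s :: 'k::comm_ring_1) ^ (card A - k))"
  using prod_add_esf[OF assms, of s "\<lambda>l. - z l"] by (simp add: esf_uminus)

text \<open>Complete homogeneous polynomials as divided differences of powers.\<close>

lemma power_divided_difference:
  assumes A: "A = Odds n \<or> A = Evens n" "A \<noteq> {}"
  shows "\<exists>G :: 'k::field_char_0 mpoly. (if a + 1 < card A then G = 0 else Inv n (a + 1 - card A) G) \<and>
    (\<forall>z. inj_on z A \<longrightarrow> (\<Sum>i\<in>A. z i ^ a / (\<Prod>l\<in>A - {i}. z i - z l)) = poly_eval z G)"
proof (induction a rule: less_induct)
  case (less a)
  have fin: "finite A" using A by auto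
  let ?p = "card A"
  show ?case
  proof (cases "a < ?p")
    case True
    define G :: "'k mpoly" where "G = (if a + 1 < ?p then 0 else 1)"
    have "(\<Sum>i\<in>A. z i ^ a / (\<Prod>l\<in>A - {i}. z i - z l)) = poly_eval z G" if "inj_on z A" for z :: "nat \<Rightarrow> 'k"
      using lagrange_coeff[OF fin that, of "monom 1 a"] True
      by (auto simp: G_def poly_monom degree_monom_eq)
    then show ?thesis by (intro exI[of _ G]) (auto simp: G_def)
  next
    case False
    let ?Q = "\<lambda>b G :: 'k mpoly. (if b + 1 < ?p then G = 0 else Inv n (b + 1 - ?p) G) \<and>
      (\<forall>z. inj_on z A \<longrightarrow> (\<Sum>i\<in>A. z i ^ b / (\<Prod>l\<in>A - {i}. z i - z l)) = poly_eval z G)"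
    define g where "g b = (SOME G. ?Q b G)" for b
    have g: "?Q b (g b)" if "b < a" for b
      unfolding g_def by (rule someI_ex) (rule less.IH[OF that])
    define G where "G = - (\<Sum>k\<in>{1..?p}. Const ((- 1) ^ k) * elem_sym A k * g (a - k))"
    have "?p > 0" using A fin by (simp add: card_gt_0_iff)
    have I: "Inv n (a + 1 - ?p) (Const ((- 1) ^ k) * elem_sym A k * g (a - k))" if "k \<in> {1..?p}" for k
    proof (cases "a - k + 1 < ?p")
      case True
      then have "g (a - k) = 0" using g[of "a - k"] that \<open>?p > 0\<close> False by auto
      then show ?thesis by simp
    next
      case nl: False
      then have "Inv n (a - k + 1 - ?p) (g (a - k))" using g[of "a - k"] that \<open>?p > 0\<close> False by auto
      then have "Inv n (k + (a - k + 1 - ?p)) (Const ((- 1) ^ k) * elem_sym A k * g (a - k))"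
        by (intro Inv_mult Inv_smult Inv_elem_sym A)
      then show ?thesis using nl that False by (elim Inv_mono) auto
    qed
    have "Inv n (a + 1 - ?p) G" unfolding G_def by (intro Inv_uminus Inv_sum I)
    moreover have "(\<Sum>i\<in>A. z i ^ a / (\<Prod>l\<in>A - {i}. z i - z l)) = poly_eval z G" if z: "inj_on z A" for z
    proof -
      \<comment> \<open>z_i is a root of the product of all t - z_l, so its powers obey a linear
        recurrence of order |A| with invariant coefficients; the divided differences inherit
        it.\<close>
      have rec: "z i ^ a = - (\<Sum>k\<in>{1..?p}. (- 1) ^ k * esf z A k * z i ^ (a - k))" if "i \<in> A" for i
      proof -
        have "0 = (\<Prod>l\<in>A. z i - z l)" using that fin by (auto intro: prod_zero)
        also have "\<dots> = z i ^ ?p + (\<Sum>k\<in>{1..?p}. (- 1) ^ k * esf z A k * z i ^ (?p - k))"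
          unfolding prod_diff_esf[OF fin] using fin
          by (simp add: atMost_atLeast0 sum.atLeast_Suc_atMost)
        finally have *: "z i ^ ?p = - (\<Sum>k\<in>{1..?p}. (- 1) ^ k * esf z A k * z i ^ (?p - k))"
          by (simp add: eq_neg_iff_add_eq_0)
        have "z i ^ a = z i ^ (a - ?p) * z i ^ ?p" using False by (simp add: power_add[symmetric])
        also have "\<dots> = - (\<Sum>k\<in>{1..?p}. (- 1) ^ k * esf z A k * (z i ^ (a - ?p) * z i ^ (?p - k)))"
          unfolding * by (simp add: sum_distrib_left mult_ac)
        also have "(\<Sum>k\<in>{1..?p}. (- 1) ^ k * esf z A k * (z i ^ (a - ?p) * z i ^ (?p - k))) =
          (\<Sum>k\<in>{1..?p}. (- 1) ^ k * esf z A k * z i ^ (a - k))"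
          using False by (intro sum.cong refl) (simp add: power_add[symmetric])
        finally show ?thesis .
      qed
      have "(\<Sum>i\<in>A. z i ^ a / (\<Prod>l\<in>A - {i}. z i - z l)) =
        - (\<Sum>i\<in>A. \<Sum>k\<in>{1..?p}. (- 1) ^ k * esf z A k * (z i ^ (a - k) / (\<Prod>l\<in>A - {i}. z i - z l)))"
        unfolding sum_negf[symmetric]
        by (intro sum.cong refl) (simp add: rec sum_divide_distrib sum_negf)
      also have "\<dots> = - (\<Sum>k\<in>{1..?p}. (- 1) ^ k * esf z A k * (\<Sum>i\<in>A. z i ^ (a - k) / (\<Prod>l\<in>A - {i}. z i - z l)))"
        by (subst sum.swap) (simp add: sum_distrib_left)
      also have "\<dots> = poly_eval z G"
        unfolding G_def using g z \<open>?p > 0\<close> False by simp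
      finally show ?thesis .
    qed
    ultimately show ?thesis using False by (intro exI[of _ G]) auto
  qed
qed

text \<open>Functions polynomial in s and t with invariant coefficients in z, of total degree at
  most D. The slots s and t receive two coordinates z_i and z_j; summing over i and j against the
  denominators then produces invariant polynomials again.\<close>

inductive qpol :: "nat \<Rightarrow> nat \<Rightarrow> ((nat \<Rightarrow> 'k) \<Rightarrow> 'k \<Rightarrow> 'k \<Rightarrow> 'k::field_char_0) \<Rightarrow> bool" for n D where
  mono: "Inv n e f \<Longrightarrow> e + a + b \<le> D \<Longrightarrow> qpol n D (\<lambda>z s t. poly_eval z f * s ^ a * t ^ b)"
| add: "qpol n D F \<Longrightarrow> qpol n D G \<Longrightarrow> qpol n D (\<lambda>z s t. F z s t + G z s t)"

lemma qpol_mono: "qpol n D F \<Longrightarrow> D \<le> D' \<Longrightarrow> qpol n D' F"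
  by (induction rule: qpol.induct) (auto intro: qpol.intros)

lemma qpol_Inv: "Inv n D f \<Longrightarrow> qpol n D (\<lambda>z s t. poly_eval z f)"
  using qpol.mono[of n D f 0 0 D] by simp

lemma qpol_const: "qpol n D (\<lambda>z s t. c)"
  using qpol_Inv[of n D "Const c"] by simp

lemma qpol_s: "qpol n 1 (\<lambda>z s t. s)" and qpol_t: "qpol n 1 (\<lambda>z s t. t)"
  using qpol.mono[of n 0 1 1 0 1] qpol.mono[of n 0 1 0 1 1] by simp_all

lemma qpol_mult_aux:
  assumes "qpol n E G" "Inv n e f" "e + a + b \<le> D"
  shows "qpol n (D + E) (\<lambda>z s t. (poly_eval z f * s ^ a * t ^ b) * G z s t)"
  using assms(1)
proof induction
  case (mono e' f' a' b')
  have "qpol n (D + E) (\<lambda>z s t. poly_eval z (f * f') * s ^ (a + a') * t ^ (b + b'))"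
    using mono assms(2,3) by (intro qpol.mono[of n "e + e'"] Inv_mult) auto
  then show ?case by (simp add: power_add mult_ac)
next
  case (add F G)
  then show ?case using qpol.add by (fastforce simp: distrib_left)
qed

lemma qpol_mult:
  assumes "qpol n D F" "qpol n E G"
  shows "qpol n (D + E) (\<lambda>z s t. F z s t * G z s t)"
  using assms(1)
proof induction
  case (mono e f a b)
  then show ?case by (intro qpol_mult_aux assms(2))
next
  case (add F G)
  then show ?case using qpol.add by (fastforce simp: distrib_right)
qed

lemma qpol_uminus: "qpol n D F \<Longrightarrow> qpol n D (\<lambda>z s t. - F z s t)"
  using qpol_mult[OF qpol_const[of n 0 "- 1"]] by simp

lemma qpol_diff: "qpol n D F \<Longrightarrow> qpol n D G \<Longrightarrow> qpol n D (\<lambda>z s t. F z s t - G z s t)"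
  using qpol.add[OF _ qpol_uminus] by simp

lemma qpol_sum: "(\<And>i. i \<in> I \<Longrightarrow> qpol n D (F i)) \<Longrightarrow> qpol n D (\<lambda>z s t. \<Sum>i\<in>I. F i z s t)"
  by (induction I rule: infinite_finite_induct) (auto intro: qpol.add qpol_const)

lemma qpol_power: "qpol n D F \<Longrightarrow> qpol n (k * D) (\<lambda>z s t. F z s t ^ k)"
  by (induction k) (auto intro: qpol_mult qpol_const)

lemma qpol_swap: "qpol n D F \<Longrightarrow> qpol n D (\<lambda>z s t. F z t s)"
proof (induction rule: qpol.induct)
  case (mono e f a b)
  then have "qpol n D (\<lambda>z s t. poly_eval z f * s ^ b * t ^ a)" by (intro qpol.mono) auto
  then show ?case by (simp add: mult_ac)
qed (auto intro: qpol.add)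

text \<open>A divided difference lowers the degree by |A| - 1. There is no second coordinate here,
  so t is set to 0 and only the terms with b = 0 survive.\<close>

lemma qpol_sum_single:
  assumes "qpol n D (F :: (nat \<Rightarrow> 'k::field_char_0) \<Rightarrow> _)" "A = Odds n \<or> A = Evens n" "A \<noteq> {}"
  shows "\<exists>G. Inv n (D + 1 - card A) G \<and>
    (\<forall>z. inj_on z A \<longrightarrow> (\<Sum>i\<in>A. F z (z i) 0 / (\<Prod>l\<in>A - {i}. z i - z l)) = poly_eval z G)"
  using assms(1)
proof induction
  case (mono e f a b)
  obtain G :: "'k mpoly" where G: "if a + 1 < card A then G = 0 else Inv n (a + 1 - card A) G"
    "\<And>z. inj_on z A \<Longrightarrow> (\<Sum>i\<in>A. z i ^ a / (\<Prod>l\<in>A - {i}. z i - z l)) = poly_eval z G"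
    using power_divided_difference[OF assms(2,3)] by blast
  show ?case
  proof (cases "b = 0")
    case True
    have "Inv n (D + 1 - card A) (f * G)"
    proof (cases "a + 1 < card A")
      case False
      then have "Inv n (e + (a + 1 - card A)) (f * G)" using G(1) mono by (intro Inv_mult) auto
      then show ?thesis using mono(2) False by (elim Inv_mono) auto
    qed (use G(1) in simp)
    moreover have "(\<Sum>i\<in>A. poly_eval z f * z i ^ a * 0 ^ b / (\<Prod>l\<in>A - {i}. z i - z l)) = poly_eval z (f * G)"
      if "inj_on z A" for z
      using True by (simp add: G(2)[OF that, symmetric] sum_distrib_left)
    ultimately show ?thesis by blast
  next
    case False
    then show ?thesis by (intro exI[of _ 0]) (simp add: power_0_left)
  qed
next
  case (add F1 F2)
  then obtain G1 G2 where G: "Inv n (D + 1 - card A) G1" "Inv n (D + 1 - card A) G2"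
    "\<forall>z. inj_on z A \<longrightarrow> (\<Sum>i\<in>A. F1 z (z i) 0 / (\<Prod>l\<in>A - {i}. z i - z l)) = poly_eval z G1"
    "\<forall>z. inj_on z A \<longrightarrow> (\<Sum>i\<in>A. F2 z (z i) 0 / (\<Prod>l\<in>A - {i}. z i - z l)) = poly_eval z G2" by blast
  then show ?case by (intro exI[of _ "G1 + G2"] conjI Inv_add) (simp_all add: add_divide_distrib sum.distrib)
qed

lemma qpol_sum_double:
  assumes "qpol n D (F :: (nat \<Rightarrow> 'k::field_char_0) \<Rightarrow> _)" "Odds n \<noteq> {}" "Evens n \<noteq> {}"
  shows "\<exists>G. Inv n (D + 2 - card (Odds n) - card (Evens n)) G \<and>
    (\<forall>z. inj_on z (Odds n) \<longrightarrow> inj_on z (Evens n) \<longrightarrow>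
      (\<Sum>i\<in>Odds n. \<Sum>j\<in>Evens n. F z (z i) (z j) /
        ((\<Prod>l\<in>Odds n - {i}. z i - z l) * (\<Prod>l\<in>Evens n - {j}. z j - z l))) = poly_eval z G)"
  using assms(1)
proof induction
  case (mono e f a b)
  let ?A = "Odds n" and ?B = "Evens n"
  obtain G :: "'k mpoly" where G: "if a + 1 < card ?A then G = 0 else Inv n (a + 1 - card ?A) G"
    "\<And>z. inj_on z ?A \<Longrightarrow> (\<Sum>i\<in>?A. z i ^ a / (\<Prod>l\<in>?A - {i}. z i - z l)) = poly_eval z G"
    using power_divided_difference[of ?A n a] assms(2) by blast
  obtain H :: "'k mpoly" where H: "if b + 1 < card ?B then H = 0 else Inv n (b + 1 - card ?B) H"
    "\<And>z. inj_on z ?B \<Longrightarrow> (\<Sum>i\<in>?B. z i ^ b / (\<Prod>l\<in>?B - {i}. z i - z l)) = poly_eval z H"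
    using power_divided_difference[of ?B n b] assms(3) by blast
  have "Inv n (D + 2 - card ?A - card ?B) (f * (G * H))"
  proof (cases "a + 1 < card ?A \<or> b + 1 < card ?B")
    case False
    then have "Inv n (e + ((a + 1 - card ?A) + (b + 1 - card ?B))) (f * (G * H))"
      using G(1) H(1) mono by (intro Inv_mult) auto
    then show ?thesis using mono(2) False by (elim Inv_mono) linarith
  qed (use G(1) H(1) in auto)
  moreover have "(\<Sum>i\<in>?A. \<Sum>j\<in>?B. poly_eval z f * z i ^ a * z j ^ b /
        ((\<Prod>l\<in>?A - {i}. z i - z l) * (\<Prod>l\<in>?B - {j}. z j - z l))) = poly_eval z (f * (G * H))"
    if "inj_on z ?A" "inj_on z ?B" for z
  proof -
    have "poly_eval z (f * (G * H)) = poly_eval z f *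
      ((\<Sum>i\<in>?A. z i ^ a / (\<Prod>l\<in>?A - {i}. z i - z l)) * (\<Sum>j\<in>?B. z j ^ b / (\<Prod>l\<in>?B - {j}. z j - z l)))"
      by (simp only: G(2)[OF that(1)] H(2)[OF that(2)] poly_eval_mult)
    also have "\<dots> = (\<Sum>i\<in>?A. \<Sum>j\<in>?B. poly_eval z f *
      ((z i ^ a / (\<Prod>l\<in>?A - {i}. z i - z l)) * (z j ^ b / (\<Prod>l\<in>?B - {j}. z j - z l))))"
      unfolding sum_product by (simp only: sum_distrib_left)
    finally show ?thesis by (simp add: mult.assoc)
  qed
  ultimately show ?case by blast
next
  case (add F1 F2)
  let ?V = "\<lambda>z i j. (\<Prod>l\<in>Odds n - {i}. z i - z l) * (\<Prod>l\<in>Evens n - {j}. z j - z l) :: 'k"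
  obtain G1 G2 where G: "Inv n (D + 2 - card (Odds n) - card (Evens n)) G1"
    "Inv n (D + 2 - card (Odds n) - card (Evens n)) G2"
    "\<forall>z. inj_on z (Odds n) \<longrightarrow> inj_on z (Evens n) \<longrightarrow> (\<Sum>i\<in>Odds n. \<Sum>j\<in>Evens n. F1 z (z i) (z j) / ?V z i j) = poly_eval z G1"
    "\<forall>z. inj_on z (Odds n) \<longrightarrow> inj_on z (Evens n) \<longrightarrow> (\<Sum>i\<in>Odds n. \<Sum>j\<in>Evens n. F2 z (z i) (z j) / ?V z i j) = poly_eval z G2"
    using add.IH by blast
  then show ?case by (intro exI[of _ "G1 + G2"] conjI Inv_add) (simp_all add: add_divide_distrib sum.distrib)
qed

section \<open>A difference operator\<close>

text \<open>\<open>hat z A t k\<close> is the elementary symmetric function of the \<open>z l\<close> with one argument \<open>t\<close> left out.\<close>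

fun hat :: "(nat \<Rightarrow> 'k::comm_ring_1) \<Rightarrow> nat set \<Rightarrow> 'k \<Rightarrow> nat \<Rightarrow> 'k" where
  "hat z A t 0 = 1"
| "hat z A t (Suc k) = esf z A (Suc k) - t * hat z A t k"

lemma hat_esf:
  assumes "finite A" "i \<in> A"
  shows "hat z A (z i) k = esf z (A - {i}) k"
  using assms by (induction k) (simp_all add: esf_remove)

lemma qpol_hat:
  assumes "A = Odds n \<or> A = Evens n"
  shows "qpol n k (\<lambda>(z :: nat \<Rightarrow> 'k::field_char_0) s t. hat z A s k)"
    "qpol n k (\<lambda>(z :: nat \<Rightarrow> 'k) s t. hat z A t k)"
proof -
  show s: "qpol n k (\<lambda>(z :: nat \<Rightarrow> 'k) s t. hat z A s k)"
  proof (induction k)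
    case (Suc k)
    have "qpol n (Suc k) (\<lambda>(z :: nat \<Rightarrow> 'k) s t. esf z A (Suc k))"
      using qpol_Inv[OF Inv_elem_sym[OF assms, of "Suc k"]] by simp
    moreover have "qpol n (1 + k) (\<lambda>(z :: nat \<Rightarrow> 'k) s t. s * hat z A s k)" by (intro qpol_mult qpol_s Suc)
    ultimately show ?case by (simp add: qpol_diff)
  qed (simp add: qpol_const)
  show "qpol n k (\<lambda>(z :: nat \<Rightarrow> 'k) s t. hat z A t k)" using qpol_swap[OF s] by simp
qed

lemma qpol_prod_full:
  assumes "A = Odds n \<or> A = Evens n"
  shows "qpol n (card A) (\<lambda>z s t. \<Prod>l\<in>A. s - c - z l)"
proof -
  have fin: "finite A" using assms by auto
  have "qpol n (card A) (\<lambda>z s t. (- 1) ^ k * esf z A k * (s - c) ^ (card A - k))" if "k \<le> card A" for k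
  proof -
    have "qpol n ((0 + k) + (card A - k) * 1) (\<lambda>z s t. (- 1) ^ k * esf z A k * (s - c) ^ (card A - k))"
      using qpol_Inv[OF Inv_elem_sym[OF assms, of k]]
      by (intro qpol_mult qpol_power qpol_diff qpol_s qpol_const) simp
    then show ?thesis using that by simp
  qed
  then have "qpol n (card A) (\<lambda>z s t. \<Sum>k\<le>card A. (- 1) ^ k * esf z A k * (s - c) ^ (card A - k))"
    by (intro qpol_sum) auto
  then show ?thesis by (simp add: prod_diff_esf[OF fin])
qed

text \<open>The omitted index enters only through the value t = z_i, since \<open>hat\<close>
  expresses the elementary symmetric functions of the remaining variables by those of all variables
  and z_i.\<close>

lemma qpol_prod_except:
  assumes "A = Odds n \<or> A = Evens n"
  shows "\<exists>F :: (nat \<Rightarrow> 'k::field_char_0) \<Rightarrow> _. qpol n (card A - 1) F \<and>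
    (\<forall>z s. \<forall>i\<in>A. F z s (z i) = (\<Prod>l\<in>A - {i}. s - c - z l))"
proof (intro exI conjI)
  have fin: "finite A" using assms by auto
  let ?N = "card A - 1"
  let ?F = "\<lambda>z s t :: 'k. \<Sum>k\<le>?N. (- 1) ^ k * hat z A t k * (s - c) ^ (?N - k)"
  have "qpol n ?N (\<lambda>z s t :: 'k. (- 1) ^ k * hat z A t k * (s - c) ^ (?N - k))" if "k \<le> ?N" for k
  proof -
    have "qpol n ((0 + k) + (?N - k) * 1) (\<lambda>z s t :: 'k. (- 1) ^ k * hat z A t k * (s - c) ^ (?N - k))"
      by (intro qpol_mult qpol_power qpol_diff qpol_s qpol_const qpol_hat(2) assms)
    then show ?thesis by (rule qpol_mono) (use that in simp)
  qed
  then show "qpol n ?N ?F" by (intro qpol_sum) auto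
  show "\<forall>z s. \<forall>i\<in>A. ?F z s (z i) = (\<Prod>l\<in>A - {i}. s - c - z l)"
    using fin by (simp add: prod_diff_esf hat_esf)
qed

section \<open>Differences of invariant polynomials along lowerings\<close>

definition lower :: "bool \<Rightarrow> nat \<Rightarrow> nat \<Rightarrow> (nat \<Rightarrow> 'k::ring_1) \<Rightarrow> nat \<Rightarrow> 'k" where
  "lower \<beta> i j z = (if \<beta> then z(i := z i - 1, j := z j - 1) else z(i := z i - 1))"

text \<open>
  The difference of \<open>f\<close> along a lowering is a polynomial of degree \<open>d - 1\<close> in \<open>z\<close>, \<open>z i\<close> and \<open>z j\<close>;
  multiplying it by a polynomial of positive degree avoids the subtraction \<open>d - 1\<close>.
\<close>

definition dpol :: "nat \<Rightarrow> bool \<Rightarrow> nat \<Rightarrow> 'k::field_char_0 mpoly \<Rightarrow> bool" where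
  "dpol n \<beta> d f \<longleftrightarrow> (\<exists>g.
     (\<forall>P a. qpol n (Suc a) P \<longrightarrow> qpol n (d + a) (\<lambda>z s t. P z s t * g z s t)) \<and>
     (\<forall>z i j t. i \<in> Odds n \<longrightarrow> (\<beta> \<longrightarrow> j \<in> Evens n \<and> t = z j) \<longrightarrow>
        g z (z i) t = poly_eval z f - poly_eval (lower \<beta> i j z) f))"

lemma dpol_Const: "dpol n \<beta> d (Const c)"
  unfolding dpol_def by (rule exI[of _ "\<lambda>z s t. 0"]) (simp add: qpol_const)

lemma dpol_add:
  assumes "dpol n \<beta> d f" "dpol n \<beta> d h"
  shows "dpol n \<beta> d (f + (h :: 'k::field_char_0 mpoly))"
proof -
  obtain g1 where g1: "\<forall>P a. qpol n (Suc a) P \<longrightarrow> qpol n (d + a) (\<lambda>z s t. P z s t * g1 z s t)"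
    "\<forall>z i j t. i \<in> Odds n \<longrightarrow> (\<beta> \<longrightarrow> j \<in> Evens n \<and> t = z j) \<longrightarrow>
        g1 z (z i) t = poly_eval z f - poly_eval (lower \<beta> i j z) f" using assms(1) unfolding dpol_def by blast
  obtain g2 where g2: "\<forall>P a. qpol n (Suc a) P \<longrightarrow> qpol n (d + a) (\<lambda>z s t. P z s t * g2 z s t)"
    "\<forall>z i j t. i \<in> Odds n \<longrightarrow> (\<beta> \<longrightarrow> j \<in> Evens n \<and> t = z j) \<longrightarrow>
        g2 z (z i) t = poly_eval z h - poly_eval (lower \<beta> i j z) h" using assms(2) unfolding dpol_def by blast
  show ?thesis unfolding dpol_def
  proof (intro exI[of _ "\<lambda>z s t. g1 z s t + g2 z s t"] conjI allI impI)
    fix P :: "(nat \<Rightarrow> 'k) \<Rightarrow> 'k \<Rightarrow> 'k \<Rightarrow> 'k" and a assume "qpol n (Suc a) P"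
    then have "qpol n (d + a) (\<lambda>z s t. P z s t * g1 z s t + P z s t * g2 z s t)"
      using g1(1) g2(1) by (intro qpol.add) auto
    then show "qpol n (d + a) (\<lambda>z s t. P z s t * (g1 z s t + g2 z s t))" by (simp add: distrib_left)
  next
    fix z :: "nat \<Rightarrow> 'k" and i j t assume ij: "i \<in> Odds n" "\<beta> \<longrightarrow> j \<in> Evens n \<and> t = z j"
    have "g1 z (z i) t = poly_eval z f - poly_eval (lower \<beta> i j z) f" using g1(2) ij by blast
    moreover have "g2 z (z i) t = poly_eval z h - poly_eval (lower \<beta> i j z) h" using g2(2) ij by blast
    ultimately show "g1 z (z i) t + g2 z (z i) t = poly_eval z (f + h) - poly_eval (lower \<beta> i j z) (f + h)"
      by simp
  qed
qed

lemma dpol_mult: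
  assumes "dpol n \<beta> d f" "dpol n \<beta> e h" "Inv n d f" "Inv n e h"
  shows "dpol n \<beta> (d + e) (f * (h :: 'k::field_char_0 mpoly))"
proof -
  obtain g1 where g1: "\<forall>P a. qpol n (Suc a) P \<longrightarrow> qpol n (d + a) (\<lambda>z s t. P z s t * g1 z s t)"
    "\<forall>z i j t. i \<in> Odds n \<longrightarrow> (\<beta> \<longrightarrow> j \<in> Evens n \<and> t = z j) \<longrightarrow>
        g1 z (z i) t = poly_eval z f - poly_eval (lower \<beta> i j z) f" using assms(1) unfolding dpol_def by blast
  obtain g2 where g2: "\<forall>P a. qpol n (Suc a) P \<longrightarrow> qpol n (e + a) (\<lambda>z s t. P z s t * g2 z s t)"
    "\<forall>z i j t. i \<in> Odds n \<longrightarrow> (\<beta> \<longrightarrow> j \<in> Evens n \<and> t = z j) \<longrightarrow>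
        g2 z (z i) t = poly_eval z h - poly_eval (lower \<beta> i j z) h" using assms(2) unfolding dpol_def by blast
  have "qpol n (d + 0) (\<lambda>z s t. 1 * g1 z s t)" using g1(1) qpol_const by blast
  then have q1: "qpol n d g1" by simp
  \<comment> \<open>Discrete Leibniz rule f h - f' h' = (f - f') h + f' (h - h'), where the lowered
    value f' is written as f minus its difference.\<close>
  let ?g = "\<lambda>(z :: nat \<Rightarrow> 'k) s t. g1 z s t * poly_eval z h + (poly_eval z f - g1 z s t) * g2 z s t"
  show ?thesis unfolding dpol_def
  proof (intro exI[of _ ?g] conjI allI impI)
    fix P :: "(nat \<Rightarrow> 'k) \<Rightarrow> 'k \<Rightarrow> 'k \<Rightarrow> 'k" and a assume P: "qpol n (Suc a) P"
    have "qpol n ((d + a) + e) (\<lambda>z s t. (P z s t * g1 z s t) * poly_eval z h)"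
    proof (rule qpol_mult)
      show "qpol n (d + a) (\<lambda>z s t. P z s t * g1 z s t)" using g1(1) P by blast
    qed (rule qpol_Inv[OF assms(4)])
    moreover have "qpol n (d + (e + a)) (\<lambda>z s t. (poly_eval z f - g1 z s t) * (P z s t * g2 z s t))"
    proof (rule qpol_mult)
      show "qpol n (e + a) (\<lambda>z s t. P z s t * g2 z s t)" using g2(1) P by blast
    qed (intro qpol_diff qpol_Inv assms(3) q1)
    ultimately have "qpol n (d + e + a) (\<lambda>z s t. (P z s t * g1 z s t) * poly_eval z h +
        (poly_eval z f - g1 z s t) * (P z s t * g2 z s t))"
      by (intro qpol.add) (simp_all add: ac_simps)
    then show "qpol n (d + e + a) (\<lambda>z s t. P z s t * ?g z s t)" by (simp add: algebra_simps)
  next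
    fix z :: "nat \<Rightarrow> 'k" and i j t assume ij: "i \<in> Odds n" "\<beta> \<longrightarrow> j \<in> Evens n \<and> t = z j"
    have e1: "g1 z (z i) t = poly_eval z f - poly_eval (lower \<beta> i j z) f" using g1(2) ij by blast
    have e2: "g2 z (z i) t = poly_eval z h - poly_eval (lower \<beta> i j z) h" using g2(2) ij by blast
    show "?g z (z i) t = poly_eval z (f * h) - poly_eval (lower \<beta> i j z) (f * h)"
      unfolding e1 e2 by (simp add: algebra_simps)
  qed
qed

lemma dpol_mono:
  assumes "dpol n \<beta> d f" "d \<le> e"
  shows "dpol n \<beta> e f"
proof -
  obtain g where g: "\<forall>P a. qpol n (Suc a) P \<longrightarrow> qpol n (d + a) (\<lambda>z s t. P z s t * g z s t)"
    "\<forall>z i j t. i \<in> Odds n \<longrightarrow> (\<beta> \<longrightarrow> j \<in> Evens n \<and> t = z j) \<longrightarrow>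
        g z (z i) t = poly_eval z f - poly_eval (lower \<beta> i j z) f" using assms(1) unfolding dpol_def by blast
  have "qpol n (e + a) (\<lambda>z s t. P z s t * g z s t)" if "qpol n (Suc a) P" for P a
    by (rule qpol_mono[of n "d + a"]) (use g(1) that assms(2) in auto)
  then show ?thesis using g(2) unfolding dpol_def by (intro exI[of _ g]) blast
qed

lemma dpol_sum: "(\<And>i. i \<in> I \<Longrightarrow> dpol n \<beta> d (f i)) \<Longrightarrow> dpol n \<beta> d (\<Sum>i\<in>I. f i)"
  using dpol_Const[of n \<beta> d 0]
  by (induction I rule: infinite_finite_induct) (auto intro: dpol_add)

lemma dpol_power: "dpol n \<beta> d f \<Longrightarrow> Inv n d f \<Longrightarrow> dpol n \<beta> (k * d) (f ^ k)"
  using dpol_Const[of n \<beta> 0 1]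
  by (induction k) (auto intro!: dpol_mult Inv_power)

lemma dpol_prod:
  "(\<And>i. i \<in> I \<Longrightarrow> dpol n \<beta> (d i) (f i) \<and> Inv n (d i) (f i)) \<Longrightarrow> dpol n \<beta> (\<Sum>i\<in>I. d i) (\<Prod>i\<in>I. f i)"
  using dpol_Const[of n \<beta> 0 1]
  by (induction I rule: infinite_finite_induct) (auto intro!: dpol_mult Inv_prod)

text \<open>An elementary symmetric function has degree 1 in each variable.\<close>

lemma esf_lower:
  assumes "finite A" "i \<in> A"
  shows "esf z A (Suc k) - esf (z(i := z i - 1)) A (Suc k) = esf (z :: nat \<Rightarrow> 'k::comm_ring_1) (A - {i}) k"
proof -
  have "esf (z(i := z i - 1)) (A - {i}) m = esf z (A - {i}) m" for m by (rule esf_cong) auto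
  then show ?thesis using assms by (simp add: esf_remove algebra_simps)
qed

lemma dpol_elem_sym:
  assumes A: "A = Odds n \<or> A = Evens n"
  shows "dpol n \<beta> k (elem_sym A k)"
proof (cases k)
  case 0
  have "finite A" using A by auto
  then have "elem_sym A 0 = (Const 1 :: 'a mpoly)" by (intro poly_eval_eqI) simp
  then show ?thesis using 0 dpol_Const by metis
next
  case (Suc k')
  have mul: "qpol n (Suc a) P \<Longrightarrow> qpol n k' g \<Longrightarrow> qpol n (k + a) (\<lambda>z s t. P z s t * g z s t)"
    for a P and g :: "(nat \<Rightarrow> 'a) \<Rightarrow> 'a \<Rightarrow> 'a \<Rightarrow> 'a"
    using qpol_mult[of n "Suc a" P k' g] Suc by (simp add: add.commute)
  have disj: "i \<in> Odds n \<Longrightarrow> i \<notin> Evens n" for i by auto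
  show ?thesis
  proof (cases "A = Odds n")
    case True
    have "poly_eval z (elem_sym A k) - poly_eval (lower \<beta> i j z) (elem_sym A k) = hat z A (z i) k'"
      if "i \<in> Odds n" "\<beta> \<longrightarrow> j \<in> Evens n" for z :: "nat \<Rightarrow> 'a" and i j
    proof -
      have "esf (lower \<beta> i j z) A k = esf (z(i := z i - 1)) A k"
        using that disj True by (intro esf_cong) (auto simp: lower_def)
      then show ?thesis using esf_lower[of A i z k'] that True Suc by (simp add: hat_esf)
    qed
    then show ?thesis unfolding dpol_def
      by (intro exI[of _ "\<lambda>z s t. hat z A s k'"] conjI allI impI mul qpol_hat[OF A]) auto
  next
    case False
    then have A': "A = Evens n" using A by auto
    show ?thesis
    proof (cases \<beta>)
      case True
      have "poly_eval z (elem_sym A k) - poly_eval (lower \<beta> i j z) (elem_sym A k) = hat z A (z j) k'"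
        if "i \<in> Odds n" "j \<in> Evens n" for z :: "nat \<Rightarrow> 'a" and i j
      proof -
        have "esf (lower \<beta> i j z) A k = esf (z(j := z j - 1)) A k"
          using that disj True A' by (intro esf_cong) (auto simp: lower_def)
        then show ?thesis using esf_lower[of A j z k'] that A' Suc by (simp add: hat_esf)
      qed
      then show ?thesis using True unfolding dpol_def
        by (intro exI[of _ "\<lambda>z s t. hat z A t k'"] conjI allI impI mul qpol_hat[OF A]) auto
    next
      case False
      have h: "poly_eval (lower \<beta> i j z) (elem_sym A k) = poly_eval z (elem_sym A k)"
        if "i \<in> Odds n" for z :: "nat \<Rightarrow> 'a" and i j
        using that disj False A' unfolding poly_eval_elem_sym
        by (intro esf_cong) (auto simp: lower_def)
      show ?thesis unfolding dpol_def
        by (intro exI[of _ "\<lambda>z s t. 0"] conjI allI impI mul qpol_const) (simp_all only: h diff_self)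
    qed
  qed
qed

lemma dpol_uminus: "dpol n \<beta> d f \<Longrightarrow> Inv n d f \<Longrightarrow> dpol n \<beta> d (- f)"
  using dpol_mult[of n \<beta> 0 "Const (- 1)" d f] dpol_Const[of n \<beta> 0 "- 1"] Inv_uminus[OF Inv_one, of n 0]
  by (simp add: Const_def single_uminus)

lemma dpol_diff:
  "dpol n \<beta> d f \<Longrightarrow> dpol n \<beta> d h \<Longrightarrow> Inv n d h \<Longrightarrow> dpol n \<beta> d (f - h)"
  using dpol_add[OF _ dpol_uminus] by fastforce

lemma dpol_elem_semisym: "dpol n \<beta> ((i + 1) div 2) (elem_semisym n i)"
proof (cases "odd i")
  case True
  then show ?thesis unfolding elem_semisym_def
    by (auto intro!: dpol_diff dpol_elem_sym Inv_elem_sym)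
next
  case False
  then have "(i + 1) div 2 = i div 2" by presburger
  then show ?thesis using False unfolding elem_semisym_def by (auto intro!: dpol_elem_sym)
qed

text \<open>The differences are known for elementary symmetric polynomials and pass to products, so
  \<open>semisym_expansion\<close> yields them for all invariants. That expansion uses only products
  of degree at most d, so no degree is lost.\<close>

lemma dpol_Inv:
  assumes "Inv n d f"
  shows "dpol n \<beta> d (f :: 'k::field_char_0 mpoly)"
proof -
  obtain b where f: "f = (\<Sum>\<mu> \<in> LamD n d. Const (b \<mu>) * elem_semisym_prod n \<mu>)"
    using semisym_expansion[OF assms] by blast
  show ?thesis unfolding f
  proof (rule dpol_sum)
    fix \<mu> assume \<mu>: "\<mu> \<in> LamD n d"
    then have Lam: "\<mu> \<in> Lam n" by (simp add: LamD_def)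
    have sum: "wdeg (\<lambda>_. 1) (\<Sum>i\<in>I. m i) = (\<Sum>i\<in>I. wdeg (\<lambda>_. 1) (m i))" for I :: "nat set" and m
      by (induction I rule: infinite_finite_induct) (auto simp: wdeg_add)
    have "wdeg (\<lambda>_. 1) (lexp n \<mu>) = (\<Sum>i = 1..n. nat (\<mu> i - \<mu> (Suc i)) * ((i + 1) div 2))"
      unfolding lexp_def sum wdeg_ivec by simp
    then have "(\<Sum>i = 1..n. nat (\<mu> i - \<mu> (Suc i)) * ((i + 1) div 2)) \<le> d"
      using mon_degree_lexp[OF Lam] \<mu> by (simp only: LamD_def mem_Collect_eq) linarith
    then have *: "dpol n \<beta> d (elem_semisym_prod n \<mu> :: 'k mpoly)" unfolding elem_semisym_prod_def
      by (rule dpol_mono[rotated]) (intro dpol_prod conjI dpol_power Inv_power dpol_elem_semisym Inv_elem_semisym)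
    have "Inv n d (elem_semisym_prod n \<mu> :: 'k mpoly)"
      using Inv_elem_semisym_prod[OF Lam] by (rule Inv_mono) (use \<mu> in \<open>auto simp: LamD_def\<close>)
    then show "dpol n \<beta> d (Const (b \<mu>) * elem_semisym_prod n \<mu>)"
      using dpol_mult[OF dpol_Const[of n \<beta> 0 "b \<mu>"] *] by simp
  qed
qed

lemma card_Odds: "card (Odds n) = (n + 1) div 2" and card_Evens: "card (Evens n) = n div 2"
proof (induction n rule: nat_induct2)
  case (step n)
  { case 1
    have "Odds (n + 2) = (if odd n then insert (n + 2) (Odds n) else insert (n + 1) (Odds n))"
      by (auto simp: le_Suc_eq)
    then show ?case using step by (auto simp: card_insert_if) }
  { case 2
    have "Evens (n + 2) = (if even n then insert (n + 2) (Evens n) else insert (n + 1) (Evens n))"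
      by (auto simp: le_Suc_eq)
    then show ?case using step by (auto simp: card_insert_if) }
next
  case 1
  { case 1
    have "Odds 1 = {1}" by auto
    then show ?case by simp }
  { case 2
    have "Evens 1 = {}" by auto
    then show ?case by simp }
qed auto

text \<open>
  In the operator \<open>opN\<close> the coefficients vanish whenever lowering a partition leaves \<open>Lam n\<close>.  Hence at a
  lattice point \<open>shifted n r \<kappa>\<close> the operator only involves values at partitions of smaller odd size, and
  its coefficients sum to the odd size of \<open>\<kappa>\<close>.
\<close>

definition xi :: "nat \<Rightarrow> 'k::comm_ring_1 \<Rightarrow> 'k" where "xi n t = (if even n then 1 else t)"
definition eta :: "nat \<Rightarrow> 'k::comm_ring_1 \<Rightarrow> 'k" where "eta n t = (if even n then t else 1)"

text \<open>At \<open>shifted n r \<kappa>\<close> the factor with l = i + 1 vanishes if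
  \<kappa>_{i+1} = \<kappa>_i, and \<open>xi\<close> vanishes for i = n if \<kappa>_n = 0: these are
  the two ways in which lowering \<kappa>_i can leave \<open>Lam n\<close>. The factor
  \<open>xi\<close> also makes up for the sizes of the two parity classes, so that the numerator
  always has degree one more than the denominator.\<close>

definition coefE :: "nat \<Rightarrow> 'k::field_char_0 \<Rightarrow> (nat \<Rightarrow> 'k) \<Rightarrow> nat \<Rightarrow> 'k" where
  "coefE n r z i = xi n (z i) * (\<Prod>l\<in>Evens n. z i - r - z l) / (\<Prod>l\<in>Odds n - {i}. z i - z l)"

text \<open>The factors for the pair i, j itself are omitted, because adjacent equal entries may be
  lowered together. The remaining factors vanish when a neighbour outside the pair blocks the
  lowering, and one of \<open>xi\<close> and \<open>eta\<close> guards the last entry.\<close>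

definition coefH :: "nat \<Rightarrow> 'k::field_char_0 \<Rightarrow> (nat \<Rightarrow> 'k) \<Rightarrow> nat \<Rightarrow> nat \<Rightarrow> 'k" where
  "coefH n r z i j = xi n (z i) * eta n (z j) *
     (\<Prod>l\<in>Evens n - {j}. z i - r - z l) * (\<Prod>l\<in>Odds n - {i}. z j - r - z l) /
     ((\<Prod>l\<in>Odds n - {i}. z i - z l) * (\<Prod>l\<in>Evens n - {j}. z j - z l))"

definition regular :: "nat \<Rightarrow> (nat \<Rightarrow> 'k) \<Rightarrow> bool" where
  "regular n z \<longleftrightarrow> inj_on z (Odds n) \<and> inj_on z (Evens n)"

definition opN :: "nat \<Rightarrow> 'k::field_char_0 \<Rightarrow> 'k mpoly \<Rightarrow> (nat \<Rightarrow> 'k) \<Rightarrow> 'k" where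
  "opN n r f z =
     (\<Sum>i\<in>Odds n. coefE n r z i * (poly_eval z f - poly_eval (lower False i i z) f)) +
     (\<Sum>i\<in>Odds n. \<Sum>j\<in>Evens n. coefH n r z i j * (poly_eval z f - poly_eval (lower True i j z) f))"

text \<open>The numerators have degree one more than the denominators, the difference of f has
  degree d - 1, and the divided differences subtract the degree of the denominators; altogether the
  degree stays at most d.\<close>

lemma opN_polynomial:
  assumes n: "n \<ge> 1" and f: "Inv n d (f :: 'k::field_char_0 mpoly)"
  shows "\<exists>G. Inv n d G \<and> (\<forall>z. regular n z \<longrightarrow> opN n r f z = poly_eval z G)"
proof -
  have "1 \<in> Odds n" using n by auto
  then have ne: "Odds n \<noteq> {}" by blast
  have xi: "qpol n (if even n then 0 else 1) (\<lambda>z s t :: 'k. xi n s)"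
    unfolding xi_def by (auto intro: qpol_const qpol_s[simplified])
  have eta: "qpol n (if even n then 1 else 0) (\<lambda>z s t :: 'k. eta n t)"
    unfolding eta_def by (auto intro: qpol_const qpol_t[simplified])
  obtain g where g: "\<forall>P a. qpol n (Suc a) P \<longrightarrow> qpol n (d + a) (\<lambda>z s t. P z s t * g z s t)"
    "\<forall>z i j t. i \<in> Odds n \<longrightarrow> (False \<longrightarrow> j \<in> Evens n \<and> t = z j) \<longrightarrow>
        g z (z i) t = poly_eval z f - poly_eval (lower False i j z) f"
    using dpol_Inv[OF f, of False] unfolding dpol_def by blast
  define P where "P = (\<lambda>(z :: nat \<Rightarrow> 'k) s t :: 'k. xi n s * (\<Prod>l\<in>Evens n. s - r - z l))"
  have "qpol n ((if even n then 0 else 1) + card (Evens n)) P"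
    unfolding P_def by (intro qpol_mult xi qpol_prod_full) auto
  moreover have "(if even n then 0 else 1) + card (Evens n) = Suc (card (Odds n) - 1)"
    using n unfolding card_Odds card_Evens by presburger
  ultimately have "qpol n (d + (card (Odds n) - 1)) (\<lambda>z s t. P z s t * g z s t)" using g(1) by simp
  then obtain G1 where G1: "Inv n (d + (card (Odds n) - 1) + 1 - card (Odds n)) G1"
    "\<forall>z. inj_on z (Odds n) \<longrightarrow> (\<Sum>i\<in>Odds n. P z (z i) 0 * g z (z i) 0 / (\<Prod>l\<in>Odds n - {i}. z i - z l)) = poly_eval z G1"
    using qpol_sum_single[of n _ _ "Odds n"] ne by blast
  have d1: "d + (card (Odds n) - 1) + 1 - card (Odds n) = d"
    using n unfolding card_Odds by simp
  have E: "(\<Sum>i\<in>Odds n. coefE n r z i * (poly_eval z f - poly_eval (lower False i i z) f)) = poly_eval z G1"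
    if "regular n z" for z
  proof -
    have "(\<Sum>i\<in>Odds n. coefE n r z i * (poly_eval z f - poly_eval (lower False i i z) f)) =
      (\<Sum>i\<in>Odds n. P z (z i) 0 * g z (z i) 0 / (\<Prod>l\<in>Odds n - {i}. z i - z l))"
    proof (intro sum.cong refl)
      fix i assume "i \<in> Odds n"
      then have "g z (z i) 0 = poly_eval z f - poly_eval (lower False i i z) f" using g(2) by blast
      then show "coefE n r z i * (poly_eval z f - poly_eval (lower False i i z) f) =
        P z (z i) 0 * g z (z i) 0 / (\<Prod>l\<in>Odds n - {i}. z i - z l)"
        by (simp add: coefE_def P_def)
    qed
    then show ?thesis using G1(2) that by (simp add: regular_def)
  qed
  have "\<exists>G2. Inv n d G2 \<and> (\<forall>z. regular n z \<longrightarrow>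
    (\<Sum>i\<in>Odds n. \<Sum>j\<in>Evens n. coefH n r z i j * (poly_eval z f - poly_eval (lower True i j z) f)) = poly_eval z G2)"
  proof (cases "Evens n = {}")
    case True
    show ?thesis unfolding True by (intro exI[of _ 0]) simp
  next
    case ne': False
    then have q: "card (Evens n) > 0" by (simp add: card_gt_0_iff)
    obtain h where h: "\<forall>P a. qpol n (Suc a) P \<longrightarrow> qpol n (d + a) (\<lambda>z s t. P z s t * h z s t)"
      "\<forall>z i j t. i \<in> Odds n \<longrightarrow> (True \<longrightarrow> j \<in> Evens n \<and> t = z j) \<longrightarrow>
          h z (z i) t = poly_eval z f - poly_eval (lower True i j z) f"
      using dpol_Inv[OF f, of True] unfolding dpol_def by blast
    obtain F1 :: "(nat \<Rightarrow> 'k) \<Rightarrow> 'k \<Rightarrow> 'k \<Rightarrow> 'k" where F1: "qpol n (card (Evens n) - 1) F1"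
      "\<forall>z s. \<forall>j\<in>Evens n. F1 z s (z j) = (\<Prod>l\<in>Evens n - {j}. s - r - z l)"
      using qpol_prod_except[of "Evens n" n r] by blast
    obtain F2 :: "(nat \<Rightarrow> 'k) \<Rightarrow> 'k \<Rightarrow> 'k \<Rightarrow> 'k" where F2: "qpol n (card (Odds n) - 1) F2"
      "\<forall>z s. \<forall>i\<in>Odds n. F2 z s (z i) = (\<Prod>l\<in>Odds n - {i}. s - r - z l)"
      using qpol_prod_except[of "Odds n" n r] by blast
    define Q where "Q = (\<lambda>z s t. xi n s * eta n t * F1 z s t * F2 z t s)"
    have "qpol n ((if even n then 0 else 1) + (if even n then 1 else 0) + (card (Evens n) - 1) + (card (Odds n) - 1)) Q"
      unfolding Q_def by (intro qpol_mult xi eta F1(1) qpol_swap[OF F2(1)])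
    then have "qpol n (Suc ((card (Evens n) - 1) + (card (Odds n) - 1))) Q" by (simp split: if_splits)
    then have "qpol n (d + ((card (Evens n) - 1) + (card (Odds n) - 1))) (\<lambda>z s t. Q z s t * h z s t)"
      using h(1) by blast
    then obtain G2 where G2: "Inv n (d + ((card (Evens n) - 1) + (card (Odds n) - 1)) + 2 - card (Odds n) - card (Evens n)) G2"
      "\<forall>z. inj_on z (Odds n) \<longrightarrow> inj_on z (Evens n) \<longrightarrow>
      (\<Sum>i\<in>Odds n. \<Sum>j\<in>Evens n. Q z (z i) (z j) * h z (z i) (z j) /
        ((\<Prod>l\<in>Odds n - {i}. z i - z l) * (\<Prod>l\<in>Evens n - {j}. z j - z l))) = poly_eval z G2"
      using qpol_sum_double[OF _ ne ne'] by blast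
    have d2: "d + ((card (Evens n) - 1) + (card (Odds n) - 1)) + 2 - card (Odds n) - card (Evens n) = d"
      using n q unfolding card_Odds by simp
    have "(\<Sum>i\<in>Odds n. \<Sum>j\<in>Evens n. coefH n r z i j * (poly_eval z f - poly_eval (lower True i j z) f)) = poly_eval z G2"
      if "regular n z" for z
    proof -
      have "(\<Sum>i\<in>Odds n. \<Sum>j\<in>Evens n. coefH n r z i j * (poly_eval z f - poly_eval (lower True i j z) f)) =
        (\<Sum>i\<in>Odds n. \<Sum>j\<in>Evens n. Q z (z i) (z j) * h z (z i) (z j) /
        ((\<Prod>l\<in>Odds n - {i}. z i - z l) * (\<Prod>l\<in>Evens n - {j}. z j - z l)))"
      proof (intro sum.cong refl)
        fix i j assume ij: "i \<in> Odds n" "j \<in> Evens n"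
        have "h z (z i) (z j) = poly_eval z f - poly_eval (lower True i j z) f" using h(2) ij by blast
        moreover have "F1 z (z i) (z j) = (\<Prod>l\<in>Evens n - {j}. z i - r - z l)" using F1(2) ij by blast
        moreover have "F2 z (z j) (z i) = (\<Prod>l\<in>Odds n - {i}. z j - r - z l)" using F2(2) ij by blast
        ultimately show "coefH n r z i j * (poly_eval z f - poly_eval (lower True i j z) f) =
          Q z (z i) (z j) * h z (z i) (z j) /
          ((\<Prod>l\<in>Odds n - {i}. z i - z l) * (\<Prod>l\<in>Evens n - {j}. z j - z l))"
          by (simp add: coefH_def Q_def)
      qed
      then show ?thesis using G2(2) that by (simp add: regular_def)
    qed
    then show ?thesis using G2(1) unfolding d2 by blast
  qed
  then obtain G2 where G2: "Inv n d G2" "\<And>z. regular n z \<Longrightarrow>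
    (\<Sum>i\<in>Odds n. \<Sum>j\<in>Evens n. coefH n r z i j * (poly_eval z f - poly_eval (lower True i j z) f)) = poly_eval z G2"
    by blast
  show ?thesis
  proof (intro exI[of _ "G1 + G2"] conjI Inv_add allI impI)
    show "Inv n d G1" using G1(1) unfolding d1 .
    fix z :: "nat \<Rightarrow> 'k" assume "regular n z"
    then show "opN n r f z = poly_eval z (G1 + G2)" unfolding opN_def by (simp only: E G2(2) poly_eval_add)
  qed (rule G2(1))
qed

section \<open>Action on the shifted lattice and extra vanishing\<close>

text \<open>Division with remainder by the polynomial with roots y_l. The top coefficient of R is
  what is wanted: up to the factor - 1 / a it is the sum evaluated in
  \<open>shifted_residue_sum\<close>.\<close>

lemma remainder_poly:
  fixes y :: "nat \<Rightarrow> 'k::comm_ring_1"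
  assumes "finite B"
  shows "\<exists>R. [:c, 1:] * (\<Prod>l\<in>B. [:- (y l + a), 1:]) =
      (\<Prod>l\<in>B. [:- y l, 1:]) * [:c - of_nat (card B) * a, 1:] + R \<and> (\<forall>k\<ge>card B. coeff R k = 0) \<and>
      (B \<noteq> {} \<longrightarrow> coeff R (card B - 1) = - a * ((\<Sum>l\<in>B. y l + c) - a * (\<Sum>k<card B. of_nat k)))"
  using assms
proof (induction B rule: finite_induct)
  case empty
  show ?case by (intro exI[of _ 0]) simp
next
  case (insert b B)
  let ?Y = "\<Prod>l\<in>B. [:- y l, 1:]" and ?q = "card B"
  obtain R where R: "[:c, 1:] * (\<Prod>l\<in>B. [:- (y l + a), 1:]) = ?Y * [:c - of_nat ?q * a, 1:] + R"
    "\<forall>k\<ge>?q. coeff R k = 0"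
    "B \<noteq> {} \<longrightarrow> coeff R (?q - 1) = - a * ((\<Sum>l\<in>B. y l + c) - a * (\<Sum>k<?q. of_nat k))" using insert.IH by blast
  define R' where "R' = smult (- a * (y b + c - of_nat ?q * a)) ?Y + [:- (y b + a), 1:] * R"
  have "[:c, 1:] * (\<Prod>l\<in>insert b B. [:- (y l + a), 1:]) = [:- (y b + a), 1:] * (?Y * [:c - of_nat ?q * a, 1:] + R)"
    unfolding R(1)[symmetric] using insert.hyps by (simp add: mult_ac del: mult_pCons_left mult_pCons_right)
  also have "\<dots> = ?Y * ([:- (y b + a), 1:] * [:c - of_nat ?q * a, 1:]) + [:- (y b + a), 1:] * R"
    by (simp add: distrib_left mult_ac del: mult_pCons_left mult_pCons_right)
  also have "[:- (y b + a), 1:] * [:c - of_nat ?q * a, 1:] =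
     [:- y b, 1:] * [:c - of_nat (Suc ?q) * a, 1:] + [:- a * (y b + c - of_nat ?q * a):]"
    by (simp add: algebra_simps)
  also have "?Y * \<dots> = (\<Prod>l\<in>insert b B. [:- y l, 1:]) * [:c - of_nat (Suc ?q) * a, 1:] + smult (- a * (y b + c - of_nat ?q * a)) ?Y"
  proof -
    have yk: "?Y * [:k:] = smult k ?Y" for k by simp
    show ?thesis unfolding distrib_left yk
      using insert.hyps by (simp add: mult_ac del: mult_pCons_left mult_pCons_right)
  qed
  finally have 1: "[:c, 1:] * (\<Prod>l\<in>insert b B. [:- (y l + a), 1:]) =
      (\<Prod>l\<in>insert b B. [:- y l, 1:]) * [:c - of_nat (card (insert b B)) * a, 1:] + R'"
    using insert.hyps by (simp add: R'_def)
  have cR: "coeff ([:- (y b + a), 1:] * R) (Suc k) = coeff R k - (y b + a) * coeff R (Suc k)" for k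
    by (simp add: algebra_simps)
  have Yz: "coeff ?Y k = 0" if "k > ?q" for k
    using that prod_linear(1)[OF insert.hyps(1), of y] by (intro coeff_eq_0) simp
  have 2: "\<forall>k\<ge>card (insert b B). coeff R' k = 0"
  proof (intro allI impI)
    fix k assume "card (insert b B) \<le> k"
    then obtain k' where "k = Suc k'" "?q \<le> k'" using insert.hyps by (cases k) auto
    then show "coeff R' k = 0" unfolding R'_def coeff_add cR using R(2) Yz by (simp add: cR[simplified])
  qed
  have "coeff R' ?q = - a * ((\<Sum>l\<in>insert b B. y l + c) - a * (\<Sum>k<Suc ?q. of_nat k))"
  proof (cases "B = {}")
    case True
    then have "R = 0" using R(2) by (intro poly_eqI) simp
    then show ?thesis using True by (simp add: R'_def)
  next
    case False
    then obtain k where k: "?q = Suc k" using insert.hyps by (metis card_eq_0_iff not0_implies_Suc)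
    have "coeff R' ?q = - a * (y b + c - of_nat ?q * a) * coeff ?Y ?q + coeff ([:- (y b + a), 1:] * R) (Suc k)"
      unfolding R'_def coeff_add k by simp
    also have "\<dots> = - a * (y b + c - of_nat ?q * a) + coeff R k"
      unfolding cR using R(2) prod_linear(2)[OF insert.hyps(1), of y] k by simp
    also have "coeff R k = - a * ((\<Sum>l\<in>B. y l + c) - a * (\<Sum>k<?q. of_nat k))" using R(3) False k by simp
    finally show ?thesis using insert.hyps by (simp add: algebra_simps)
  qed
  then show ?case using 1 2 insert.hyps by (intro exI[of _ R']) simp
qed

text \<open>At a node z_j the divisor vanishes, so t + c times the shifted product takes the value
  of the remainder. Its factor with l = j equals - a and has to be divided out.\<close>

lemma shifted_residue_sum:
  fixes z :: "nat \<Rightarrow> 'k::field"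
  assumes "finite B" "inj_on z B" "a \<noteq> 0"
  shows "(\<Sum>j\<in>B. (z j + c) * (\<Prod>l\<in>B - {j}. z j - a - z l) / (\<Prod>l\<in>B - {j}. z j - z l)) =
    (\<Sum>j\<in>B. z j + c) - a * (\<Sum>k<card B. of_nat k)"
proof (cases "B = {}")
  case False
  obtain R where R: "[:c, 1:] * (\<Prod>l\<in>B. [:- (z l + a), 1:]) = (\<Prod>l\<in>B. [:- z l, 1:]) * [:c - of_nat (card B) * a, 1:] + R"
    "\<forall>k\<ge>card B. coeff R k = 0"
    "coeff R (card B - 1) = - a * ((\<Sum>l\<in>B. z l + c) - a * (\<Sum>k<card B. of_nat k))"
    using remainder_poly[OF assms(1), of c z a] False by blast
  have "degree R \<le> card B - 1" using R(2) by (intro degree_le) auto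
  moreover have "card B > 0" using False assms(1) by (simp add: card_gt_0_iff)
  ultimately have "degree R < card B" by linarith
  have val: "(z j + c) * (\<Prod>l\<in>B - {j}. z j - a - z l) = - (poly R (z j) / a)" if "j \<in> B" for j
  proof -
    have "poly ([:c, 1:] * (\<Prod>l\<in>B. [:- (z l + a), 1:])) (z j) = poly R (z j)"
    proof -
      have "(\<Prod>l\<in>B. z j - z l) = 0" using assms(1) that by (intro prod_zero) auto
      then show ?thesis unfolding R(1) by (simp add: poly_prod)
    qed
    then have "(z j + c) * (\<Prod>l\<in>B. z j - a - z l) = poly R (z j)"
      by (simp add: poly_prod algebra_simps)
    moreover have "(\<Prod>l\<in>B. z j - a - z l) = - a * (\<Prod>l\<in>B - {j}. z j - a - z l)"
      using assms(1) that by (subst prod.remove[of _ j]) auto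
    ultimately have R': "poly R (z j) = - a * ((z j + c) * (\<Prod>l\<in>B - {j}. z j - a - z l))"
      by (simp only: mult_ac)
    show ?thesis unfolding R' using assms(3) by simp
  qed
  have "(\<Sum>j\<in>B. (z j + c) * (\<Prod>l\<in>B - {j}. z j - a - z l) / (\<Prod>l\<in>B - {j}. z j - z l)) =
    (\<Sum>j\<in>B. (- 1 / a) * (poly R (z j) / (\<Prod>l\<in>B - {j}. z j - z l)))"
    by (intro sum.cong refl) (simp add: val)
  also have "\<dots> = (- 1 / a) * coeff R (card B - 1)"
    unfolding sum_distrib_left[symmetric] using lagrange_coeff[OF assms(1,2) \<open>degree R < card B\<close>] by simp
  finally show ?thesis using R(3) assms(3) by simp
qed simp

section \<open>Sums of the coefficients of the operator\<close>

definition xi_poly :: "nat \<Rightarrow> 'k::comm_ring_1 poly" where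
  "xi_poly n = (if even n then 1 else [:0, 1:])"

lemma poly_xi_poly [simp]: "poly (xi_poly n) t = xi n t"
  by (simp add: xi_poly_def xi_def)

lemma coefE_sum:
  fixes z :: "nat \<Rightarrow> 'k::field_char_0"
  assumes n: "n \<ge> 1" and z: "regular n z"
  shows "(\<Sum>i\<in>Odds n. coefE n r z i) = (\<Sum>i\<in>Odds n. z i) - (\<Sum>j\<in>Evens n. r + z j)"
proof -
  let ?A = "Odds n" and ?B = "Evens n"
  let ?P = "\<Prod>l\<in>?A. [:- z l, 1:]" and ?Q = "\<Prod>l\<in>?B. [:- (r + z l), 1:]"
  have cA: "card ?A = card ?B + (if even n then 0 else 1)" unfolding card_Odds card_Evens using n by presburger
  have "1 \<in> ?A" using n by simp
  then have neA: "?A \<noteq> {}" and cA0: "card ?A > 0" by (blast, simp add: card_gt_0_iff, force)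
  have finB: "finite ?B" and finA: "finite ?A" by auto
  note P = prod_linear[OF finA, of z] and Q = prod_linear[OF finB, of "\<lambda>l. r + z l"]
  \<comment> \<open>Subtracting the monic polynomial \<open>?P\<close>, which vanishes at the nodes,
    keeps the values there and brings the degree below the number of nodes.\<close>
  define w where "w = xi_poly n * ?Q - ?P"
  have "coeff w k = 0" if "k \<ge> card ?A" for k
  proof (cases "k = card ?A")
    case True
    have "coeff (xi_poly n * ?Q) (card ?A) = 1" using Q(2) cA by (simp add: xi_poly_def)
    then show ?thesis using P(2) True by (simp add: w_def)
  next
    case False
    then have k: "k > card ?A" using that by simp
    have "coeff ?P k = 0" using P(1) k by (intro coeff_eq_0) simp
    moreover have "coeff (xi_poly n * ?Q) k = 0"
    proof (cases "even n")
      case True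
      then have "degree ?Q < k" using Q(1) k cA by simp
      then show ?thesis using True by (simp add: xi_poly_def coeff_eq_0)
    next
      case False
      obtain k' where "k = Suc k'" using k by (cases k) auto
      then have "degree ?Q < k'" using Q(1) k cA False by simp
      then show ?thesis using False \<open>k = Suc k'\<close> by (simp add: xi_poly_def coeff_eq_0)
    qed
    ultimately show ?thesis by (simp add: w_def)
  qed
  then have "degree w \<le> card ?A - 1" by (intro degree_le) auto
  then have deg: "degree w < card ?A" using cA0 by linarith
  have "coeff (xi_poly n * ?Q) (card ?A - 1) = - (\<Sum>j\<in>?B. r + z j)"
  proof (cases "even n")
    case True
    then have "2 \<in> ?B" using n by (auto elim!: evenE)
    then have "?B \<noteq> {}" by blast
    then show ?thesis using Q(3) cA True by (simp add: xi_poly_def)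
  next
    case odd: False
    show ?thesis
    proof (cases "?B = {}")
      case True
      then have "card ?A - 1 = 0" using cA odd by (simp only: card.empty) simp
      then show ?thesis unfolding True using odd by (simp add: xi_poly_def)
    next
      case False
      then obtain k where k: "card ?B = Suc k" using finB by (metis card_eq_0_iff not0_implies_Suc)
      then have "card ?A - 1 = Suc k" using cA odd by simp
      then show ?thesis using Q(3)[OF False] k odd by (simp add: xi_poly_def)
    qed
  qed
  then have cw: "coeff w (card ?A - 1) = (\<Sum>i\<in>?A. z i) - (\<Sum>j\<in>?B. r + z j)"
    using P(3)[OF neA] by (simp add: w_def)
  have "(\<Sum>i\<in>?A. coefE n r z i) = (\<Sum>i\<in>?A. poly w (z i) / (\<Prod>l\<in>?A - {i}. z i - z l))"
  proof (intro sum.cong refl)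
    fix i assume i: "i \<in> ?A"
    have "poly ?P (z i) = 0" using i finA by (auto simp: poly_prod intro!: prod_zero)
    then have "poly w (z i) = xi n (z i) * (\<Prod>l\<in>?B. z i - r - z l)"
      by (simp add: w_def poly_prod algebra_simps)
    then show "coefE n r z i = poly w (z i) / (\<Prod>l\<in>?A - {i}. z i - z l)" by (simp add: coefE_def)
  qed
  also have "\<dots> = coeff w (card ?A - 1)" using z deg finA by (intro lagrange_coeff) (auto simp: regular_def)
  finally show ?thesis using cw by simp
qed

text \<open>For fixed j the sum over i is the interpolation formula at the point z_j - r and
  collapses. The factors z_j - r - r - z_l that result explain the shift 2r in the remaining sum
  over j, to which \<open>shifted_residue_sum\<close> applies.\<close>

lemma coefH_sum:
  fixes z :: "nat \<Rightarrow> 'k::field_char_0"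
  assumes r: "r \<noteq> 0" and z: "regular n z"
  shows "(\<Sum>i\<in>Odds n. \<Sum>j\<in>Evens n. coefH n r z i j) =
    (\<Sum>j\<in>Evens n. z j + (if even n then 0 else - r)) - 2 * r * (\<Sum>k<card (Evens n). of_nat k)"
proof -
  let ?A = "Odds n" and ?B = "Evens n"
  have finB: "finite ?B" and finA: "finite ?A" by auto
  have inner: "(\<Sum>i\<in>?A. coefH n r z i j) =
    (z j + (if even n then 0 else - r)) * (\<Prod>l\<in>?B - {j}. z j - 2 * r - z l) / (\<Prod>l\<in>?B - {j}. z j - z l)"
    if j: "j \<in> ?B" for j
  proof -
    let ?Q = "\<Prod>l\<in>?B - {j}. [:- (r + z l), 1:]"
    define w where "w = xi_poly n * ?Q"
    have "card ?B > 0" using j finB by (auto simp: card_gt_0_iff)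
    have "degree ?Q \<le> card ?B - 1" using prod_linear(1)[of "?B - {j}" "\<lambda>l. r + z l"] finB j by simp
    moreover have "degree (xi_poly n :: 'k poly) \<le> (if even n then 0 else 1)" by (simp add: xi_poly_def)
    ultimately have "degree w \<le> (if even n then 0 else 1) + (card ?B - 1)"
      unfolding w_def using degree_mult_le[of "xi_poly n" ?Q] by linarith
    also have "\<dots> < card ?A" using \<open>card ?B > 0\<close> unfolding card_Odds card_Evens by presburger
    finally have deg: "degree w < card ?A" .
    have pw: "poly w t = xi n t * (\<Prod>l\<in>?B - {j}. t - r - z l)" for t
      by (simp add: w_def poly_prod algebra_simps)
    have "(\<Sum>i\<in>?A. coefH n r z i j) = eta n (z j) / (\<Prod>l\<in>?B - {j}. z j - z l) *
      (\<Sum>i\<in>?A. poly w (z i) * (\<Prod>l\<in>?A - {i}. (z j - r) - z l) / (\<Prod>l\<in>?A - {i}. z i - z l))"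
      unfolding sum_distrib_left by (intro sum.cong refl) (simp add: coefH_def pw mult_ac)
    also have "\<dots> = eta n (z j) / (\<Prod>l\<in>?B - {j}. z j - z l) * poly w (z j - r)"
      using z finA deg by (subst lagrange_eval) (auto simp: regular_def)
    also have "poly w (z j - r) = xi n (z j - r) * (\<Prod>l\<in>?B - {j}. z j - 2 * r - z l)"
      unfolding pw by (simp add: algebra_simps)
    finally show ?thesis by (simp add: eta_def xi_def)
  qed
  have "(\<Sum>i\<in>?A. \<Sum>j\<in>?B. coefH n r z i j) = (\<Sum>j\<in>?B. (z j + (if even n then 0 else - r)) *
      (\<Prod>l\<in>?B - {j}. z j - 2 * r - z l) / (\<Prod>l\<in>?B - {j}. z j - z l))"
    by (subst sum.swap) (intro sum.cong refl inner)
  also have "\<dots> = (\<Sum>j\<in>?B. z j + (if even n then 0 else - r)) - 2 * r * (\<Sum>k<card ?B. of_nat k)"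
    using z r finB by (intro shifted_residue_sum) (auto simp: regular_def)
  finally show ?thesis .
qed

text \<open>The even coordinates cancel between the two sums.\<close>

lemma opN_diagonal:
  assumes "n \<ge> 1" "r \<noteq> (0 :: 'k::field_char_0)"
  shows "\<exists>C. \<forall>z. regular n z \<longrightarrow>
    (\<Sum>i\<in>Odds n. coefE n r z i) + (\<Sum>i\<in>Odds n. \<Sum>j\<in>Evens n. coefH n r z i j) = (\<Sum>i\<in>Odds n. z i) + C"
  using coefE_sum[OF assms(1), of _ r] coefH_sum[OF assms(2), of n]
  by (intro exI[of _ "(\<Sum>j\<in>Evens n. (if even n then 0 else - r) - r) - 2 * r * (\<Sum>k<card (Evens n). of_nat k)"])
    (simp only: sum.distrib sum_subtractf, simp add: algebra_simps)

text \<open>Coordinates i < l coincide only if (l - i) r + (\<mu>_i - \<mu>_l) = 0. Genericity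
  excludes \<mu>_i > \<mu>_l, and equal entries would force r = 0.\<close>

lemma shifted_regular:
  assumes r: "generic r" "r \<noteq> 0" and \<mu>: "\<mu> \<in> Lam n"
  shows "regular n (shifted n r \<mu>)"
proof -
  have neq: "shifted n r \<mu> i \<noteq> shifted n r \<mu> l" if "i \<in> {1..n}" "l \<in> {1..n}" "i < l" for i l
  proof
    assume eq: "shifted n r \<mu> i = shifted n r \<mu> l"
    have le: "\<mu> l \<le> \<mu> i" using Lam_antimono[OF \<mu>] that by simp
    have "of_int (\<mu> i) - of_int (\<mu> l) = (of_nat (nat (\<mu> i - \<mu> l)) :: 'a)"
      using le by (simp add: of_nat_nat)
    moreover have "of_nat (n - i) - of_nat (n - l) = (of_nat (l - i) :: 'a)" using that by (simp add: of_nat_diff)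
    moreover have "(of_nat (n - i) - of_nat (n - l)) * r + (of_int (\<mu> i) - of_int (\<mu> l)) = 0"
      using eq by (simp add: shifted_def algebra_simps)
    ultimately have "of_nat (l - i) * r + of_nat (nat (\<mu> i - \<mu> l)) = 0" by simp
    moreover have "nat (\<mu> i - \<mu> l) = 0"
    proof (rule ccontr)
      assume "nat (\<mu> i - \<mu> l) \<noteq> 0"
      then have "of_nat (l - i) * r + of_nat (nat (\<mu> i - \<mu> l)) \<noteq> 0"
        using r(1) unfolding generic_def by blast
      then show False using \<open>of_nat (l - i) * r + of_nat (nat (\<mu> i - \<mu> l)) = 0\<close> by simp
    qed
    ultimately show False using r(2) that by simp
  qed
  have "inj_on (shifted n r \<mu>) {1..n}"
  proof (rule inj_onI)
    fix i l assume "i \<in> {1..n}" "l \<in> {1..n}" "shifted n r \<mu> i = shifted n r \<mu> l"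
    then show "i = l" using neq[of i l] neq[of l i] by (cases i l rule: linorder_cases) auto
  qed
  then have inj: "inj_on (shifted n r \<mu>) S" if "S \<subseteq> {1..n}" for S using that by (rule inj_on_subset)
  show ?thesis unfolding regular_def by (intro conjI inj) auto
qed

lemma lower_shifted:
  assumes "i \<in> {1..n}" "j \<in> {1..n}" "i \<noteq> j"
  shows "lower False i j' (shifted n r \<mu>) = shifted n r (\<mu>(i := \<mu> i - 1))"
    "lower True i j (shifted n r \<mu>) = shifted n r (\<mu>(i := \<mu> i - 1, j := \<mu> j - 1))"
  using assms by (auto simp: lower_def shifted_def fun_eq_iff)

text \<open>The reason for the offset r in \<open>coefE\<close> and \<open>coefH\<close>.\<close>

lemma shifted_step_zero:
  assumes "a < n" "\<mu> (Suc a) = \<mu> a"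
  shows "shifted n r \<mu> a - r - shifted n r \<mu> (Suc a) = (0 :: 'k::field_char_0)"
proof -
  have "n - a = Suc (n - Suc a)" using assms(1) by simp
  then have "of_nat (n - a) = (of_nat (n - Suc a) + 1 :: 'k)" by (simp only: of_nat_Suc add.commute)
  then show ?thesis using assms(2) by (simp add: shifted_def algebra_simps)
qed

lemma lower_one_not_Lam:
  assumes "\<mu> \<in> Lam n" "i \<in> {1..n}" "\<mu>(i := \<mu> i - 1) \<notin> Lam n"
  shows "(i < n \<and> \<mu> (Suc i) = \<mu> i) \<or> (i = n \<and> \<mu> n = 0)"
proof (rule ccontr)
  assume *: "\<not> ?thesis"
  let ?\<nu> = "\<mu>(i := \<mu> i - 1)"
  have dec: "\<mu> (Suc b) \<le> \<mu> b" if "b \<in> {1..<n}" for b using assms(1) that by (auto simp: Lam_def)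
  have "?\<nu> (Suc b) \<le> ?\<nu> b" if "b \<in> {1..<n}" for b using dec[OF that] * that by auto
  moreover have "0 \<le> ?\<nu> n" using assms(1,2) * by (auto simp: Lam_def)
  moreover have "?\<nu> \<in> int_vecs n" using assms(1,2) by (auto simp: Lam_def int_vecs_def)
  ultimately show False using assms(3) unfolding Lam_def by blast
qed

lemma lower_two_not_Lam:
  assumes "\<mu> \<in> Lam n" "i \<in> {1..n}" "j \<in> {1..n}" "i \<noteq> j" "\<mu>(i := \<mu> i - 1, j := \<mu> j - 1) \<notin> Lam n"
  shows "\<exists>a\<in>{i, j}. (a < n \<and> \<mu> (Suc a) = \<mu> a \<and> Suc a \<notin> {i, j}) \<or> (a = n \<and> \<mu> n = 0)"
proof (rule ccontr)
  assume *: "\<not> ?thesis"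
  let ?\<nu> = "\<mu>(i := \<mu> i - 1, j := \<mu> j - 1)"
  have dec: "\<mu> (Suc b) \<le> \<mu> b" if "b \<in> {1..<n}" for b using assms(1) that by (auto simp: Lam_def)
  have \<nu>: "?\<nu> l = \<mu> l - (if l \<in> {i, j} then 1 else 0)" for l using assms(4) by simp
  have "?\<nu> (Suc b) \<le> ?\<nu> b" if b: "b \<in> {1..<n}" for b
  proof (cases "b \<in> {i, j} \<and> \<mu> (Suc b) = \<mu> b")
    case True
    then have "Suc b \<in> {i, j}" using * b by (meson atLeastLessThan_iff)
    then show ?thesis unfolding \<nu> using True by simp
  next
    case False
    then show ?thesis unfolding \<nu> using dec[OF b] by (smt (verit))
  qed
  moreover have "0 \<le> ?\<nu> n"
  proof -
    have "n \<in> {i, j} \<longrightarrow> \<mu> n \<noteq> 0" using * by blast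
    then have "n \<in> {i, j} \<longrightarrow> 1 \<le> \<mu> n" using Lam_nonneg[OF assms(1), of n] by linarith
    then show ?thesis unfolding \<nu> using Lam_nonneg[OF assms(1), of n] by simp
  qed
  moreover have "?\<nu> \<in> int_vecs n" using assms(1-3) by (auto simp: Lam_def int_vecs_def)
  ultimately show False using assms(5) unfolding Lam_def by blast
qed

lemma coefE_zero:
  assumes "\<mu> \<in> Lam n" "i \<in> Odds n" "\<mu>(i := \<mu> i - 1) \<notin> Lam n"
  shows "coefE n r (shifted n r \<mu>) i = 0"
proof -
  consider "i < n" "\<mu> (Suc i) = \<mu> i" | "i = n" "\<mu> n = 0" using lower_one_not_Lam[of \<mu> n i] assms by auto
  then show ?thesis
  proof cases
    case 1
    have "Suc i \<in> Evens n" using 1 assms(2) by auto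
    then have "(\<Prod>l\<in>Evens n. shifted n r \<mu> i - r - shifted n r \<mu> l) = 0"
      by (intro prod_zero bexI[of _ "Suc i"] shifted_step_zero[OF 1]) auto
    then show ?thesis by (simp only: coefE_def mult_zero_right div_0)
  next
    case 2
    then have "xi n (shifted n r \<mu> i) = 0" using assms(2) by (auto simp: xi_def shifted_def)
    then show ?thesis by (simp add: coefE_def)
  qed
qed

lemma coefH_zero:
  assumes "\<mu> \<in> Lam n" "i \<in> Odds n" "j \<in> Evens n" "\<mu>(i := \<mu> i - 1, j := \<mu> j - 1) \<notin> Lam n"
  shows "coefH n r (shifted n r \<mu>) i j = 0"
proof -
  have "i \<noteq> j" using assms(2,3) by auto
  moreover have "i \<in> {1..n}" "j \<in> {1..n}" using assms(2,3) by simp_all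
  ultimately obtain a where a: "a \<in> {i, j}" "(a < n \<and> \<mu> (Suc a) = \<mu> a \<and> Suc a \<notin> {i, j}) \<or> (a = n \<and> \<mu> n = 0)"
    using lower_two_not_Lam[OF assms(1) _ _ _ assms(4)] by blast
  consider "a = i" "i < n" "\<mu> (Suc i) = \<mu> i" "Suc i \<noteq> j" | "a = j" "j < n" "\<mu> (Suc j) = \<mu> j" "Suc j \<noteq> i" | "a = n" "\<mu> n = 0"
    using a by auto
  then show ?thesis
  proof cases
    case 1
    have "Suc i \<in> Evens n - {j}" using 1 assms(2) by auto
    then have "(\<Prod>l\<in>Evens n - {j}. shifted n r \<mu> i - r - shifted n r \<mu> l) = 0"
      by (intro prod_zero bexI[of _ "Suc i"] shifted_step_zero[OF 1(2,3)]) auto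
    then show ?thesis by (simp only: coefH_def mult_zero_right mult_zero_left div_0)
  next
    case 2
    have "Suc j \<in> Odds n - {i}" using 2 assms(3) by auto
    then have "(\<Prod>l\<in>Odds n - {i}. shifted n r \<mu> j - r - shifted n r \<mu> l) = 0"
      by (intro prod_zero bexI[of _ "Suc j"] shifted_step_zero[OF 2(2,3)]) auto
    then show ?thesis by (simp only: coefH_def mult_zero_right mult_zero_left div_0)
  next
    case 3
    then have "xi n (shifted n r \<mu> i) * eta n (shifted n r \<mu> j) = 0"
      using assms(2,3) a(1) by (auto simp: xi_def eta_def shifted_def)
    then show ?thesis by (simp add: coefH_def)
  qed
qed

lemma zero_in_Lam: "(\<lambda>_. 0) \<in> Lam n"
  by (simp add: Lam_def int_vecs_def)

text \<open>The constant in \<open>opN_diagonal\<close> is fixed by the zero partition: nothing can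
  be lowered there, so all coefficients vanish.\<close>

lemma opN_diagonal_lattice:
  assumes n: "n \<ge> 1" and r: "generic r" "r \<noteq> (0 :: 'k::field_char_0)" and \<mu>: "\<mu> \<in> Lam n"
  shows "(\<Sum>i\<in>Odds n. coefE n r (shifted n r \<mu>) i) + (\<Sum>i\<in>Odds n. \<Sum>j\<in>Evens n. coefH n r (shifted n r \<mu>) i j) =
    of_int (odd_size n \<mu>)"
proof -
  let ?D = "\<lambda>z. (\<Sum>i\<in>Odds n. coefE n r z i) + (\<Sum>i\<in>Odds n. \<Sum>j\<in>Evens n. coefH n r z i j)"
  obtain C where C: "\<And>z. regular n z \<Longrightarrow> ?D z = (\<Sum>i\<in>Odds n. z i) + C" using opN_diagonal[OF n r(2)] by blast
  have nonneg: "\<nu> i \<ge> 0" if "\<nu> \<in> Lam n" for \<nu> i using Lam_nonneg[OF that] .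
  let ?o = "\<lambda>_. 0 :: int"
  have o: "?o(i := ?o i - 1) \<notin> Lam n" "?o(i := ?o i - 1, j := ?o j - 1) \<notin> Lam n" for i j
    using nonneg[of "?o(i := ?o i - 1)" i] nonneg[of "?o(i := ?o i - 1, j := ?o j - 1)" j] by auto
  have "coefE n r (shifted n r ?o) i = 0" if "i \<in> Odds n" for i
    by (rule coefE_zero[OF zero_in_Lam that o(1)])
  moreover have "coefH n r (shifted n r ?o) i j = 0" if "i \<in> Odds n" "j \<in> Evens n" for i j
    by (rule coefH_zero[OF zero_in_Lam that o(2)])
  ultimately have "?D (shifted n r ?o) = 0" by (simp only: sum.neutral_const cong: sum.cong) simp
  moreover have "?D (shifted n r (\<lambda>_. 0)) = (\<Sum>i\<in>Odds n. shifted n r (\<lambda>_. 0) i) + C"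
    by (rule C[OF shifted_regular[OF r zero_in_Lam]])
  moreover have "?D (shifted n r \<mu>) = (\<Sum>i\<in>Odds n. shifted n r \<mu> i) + C"
    by (rule C[OF shifted_regular[OF r \<mu>]])
  moreover have "(\<Sum>i\<in>Odds n. shifted n r \<mu> i) = (\<Sum>i\<in>Odds n. shifted n r (\<lambda>_. 0) i) + of_int (odd_size n \<mu>)"
    by (simp add: shifted_def odd_size_def sum.distrib)
  ultimately show ?thesis by (simp only:) algebra
qed

text \<open>The case m = 0 of \<open>tail_vanishing\<close>. It is the uniqueness half of the
  interpolation problem, and lets two invariant polynomials of degree at most d be compared at
  finitely many points.\<close>

lemma Inv_vanishing:
  fixes f :: "'k::field_char_0 mpoly"
  assumes r: "generic r" and f: "Inv n d f"
    and zero: "\<And>\<mu>. \<mu> \<in> Lam n \<Longrightarrow> odd_size n \<mu> \<le> int d \<Longrightarrow> poly_eval (shifted n r \<mu>) f = 0"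
  shows "f = 0"
proof (rule tail_vanishing[OF r, of 0 n f d])
  have V: "{0<..n} = {1..n}" by auto
  show "inv_vars {0<..n} f" "wle (\<lambda>_. 1) d f" using f unfolding Inv_def polys_iff V by auto
  show "tail_invariant n 0 f" using f by (auto simp: Inv_def tail_invariant_def W_invariant_def)
  fix \<kappa> assume \<kappa>: "\<kappa> \<in> tails n 0" "tail_size n 0 \<kappa> \<le> d"
  let ?\<mu> = "\<lambda>i. int (\<kappa> i)"
  have out: "\<kappa> i = 0" if "i \<notin> {1..n}" for i
  proof -
    have "i \<notin> {0<..n}" using that by auto
    then show ?thesis using \<kappa>(1) unfolding tails_def by blast
  qed
  have "?\<mu> \<in> Lam n" using \<kappa>(1) out by (auto simp: tails_def Lam_def int_vecs_def)
  moreover have "odd_size n ?\<mu> \<le> int d" using \<kappa>(2) unfolding odd_size_def tail_size_def V by (simp flip: of_nat_sum)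
  ultimately have "poly_eval (shifted n r ?\<mu>) f = 0" by (rule zero)
  then show "poly_eval (\<lambda>i. of_nat (n - i) * r + of_nat (\<kappa> i)) f = 0" by (simp add: shifted_def[abs_def])
qed

lemma bracket_1:
  assumes "n \<ge> 1"
  shows "bracket n v 1 = odd_size n v - (\<Sum>i\<in>Evens n. v i)"
proof -
  have "bracket n v 1 = (\<Sum>j\<in>{1..n}. if odd j then v j else - v j)"
    using assms unfolding bracket_def by (auto intro!: sum.cong)
  also have "\<dots> = (\<Sum>j\<in>Odds n. v j) + (\<Sum>j\<in>Evens n. - v j)"
  proof -
    have "(\<Sum>j\<in>{1..n}. if odd j then v j else - v j) = sum v ({1..n} \<inter> {j. odd j}) + (\<Sum>j\<in>{1..n} \<inter> - {j. odd j}. - v j)"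
      by (rule sum.If_cases) simp
    moreover have "{1..n} \<inter> {j. odd j} = Odds n" "{1..n} \<inter> - {j. odd j} = Evens n" by auto
    ultimately show ?thesis by simp
  qed
  finally show ?thesis by (simp add: odd_size_def sum_negf)
qed

text \<open>For an eigenvector with eigenvalue d, the value at \<kappa> times the difference between
  the odd size of \<kappa> and d is a combination of values at lowered partitions. A nonzero value
  at \<kappa> of odd size above d thus forces a nonzero value at some lowered partition, and the
  descent can only end at \<open>lam\<close>.\<close>

theorem extra_vanishing:
  fixes f :: "'k::field_char_0 mpoly"
  assumes n: "n \<ge> 1" and r: "generic r" "r \<noteq> 0" and f: "Inv n d f"
    and lam: "odd_size n lam = int d"
    and zero: "\<And>\<mu>. \<mu> \<in> Lam n \<Longrightarrow> odd_size n \<mu> \<le> int d \<Longrightarrow> \<mu> \<noteq> lam \<Longrightarrow> poly_eval (shifted n r \<mu>) f = 0"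
    and \<kappa>: "\<kappa> \<in> Lam n" "poly_eval (shifted n r \<kappa>) f \<noteq> 0"
  shows "(\<forall>i. lam i \<le> \<kappa> i) \<and> bracket n lam 1 \<le> bracket n \<kappa> 1"
proof -
  let ?v = "\<lambda>\<kappa>. poly_eval (shifted n r \<kappa>) f"
  let ?e1 = "\<lambda>\<kappa> i. \<kappa>(i := \<kappa> i - 1 :: int)" and ?e2 = "\<lambda>\<kappa> i j. \<kappa>(i := \<kappa> i - 1 :: int, j := \<kappa> j - 1)"
  have size1: "odd_size n (?e1 \<kappa> i) = odd_size n \<kappa> - 1" if "i \<in> Odds n" for \<kappa> i
  proof -
    have "odd_size n (?e1 \<kappa> i) = (\<Sum>l\<in>Odds n. \<kappa> l - (if l = i then 1 else 0))"
      unfolding odd_size_def by (intro sum.cong) auto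
    then show ?thesis using that by (simp add: odd_size_def sum_subtractf)
  qed
  have size2: "odd_size n (?e2 \<kappa> i j) = odd_size n \<kappa> - 1" if "i \<in> Odds n" "j \<in> Evens n" for \<kappa> i j
  proof -
    have "odd_size n (?e2 \<kappa> i j) = (\<Sum>l\<in>Odds n. \<kappa> l - (if l = i then 1 else 0))"
      unfolding odd_size_def using that by (intro sum.cong) auto
    then show ?thesis using that by (simp add: odd_size_def sum_subtractf)
  qed
  have ev1: "(\<Sum>l\<in>Evens n. (?e1 \<kappa> i) l) = (\<Sum>l\<in>Evens n. \<kappa> l)" if "i \<in> Odds n" for \<kappa> i
    using that by (intro sum.cong) auto
  have ev2: "(\<Sum>l\<in>Evens n. (?e2 \<kappa> i j) l) = (\<Sum>l\<in>Evens n. \<kappa> l) - 1" if "i \<in> Odds n" "j \<in> Evens n" for \<kappa> i j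
  proof -
    have "(\<Sum>l\<in>Evens n. (?e2 \<kappa> i j) l) = (\<Sum>l\<in>Evens n. \<kappa> l - (if l = j then 1 else 0))"
      using that by (intro sum.cong) auto
    then show ?thesis using that by (simp add: sum_subtractf)
  qed
  obtain G where G: "Inv n d G" "\<And>z. regular n z \<Longrightarrow> opN n r f z = poly_eval z G"
    using opN_polynomial[OF n f] by blast
  have N: "poly_eval (shifted n r \<kappa>) G = of_int (odd_size n \<kappa>) * ?v \<kappa> -
      ((\<Sum>i\<in>Odds n. coefE n r (shifted n r \<kappa>) i * ?v (?e1 \<kappa> i)) +
       (\<Sum>i\<in>Odds n. \<Sum>j\<in>Evens n. coefH n r (shifted n r \<kappa>) i j * ?v (?e2 \<kappa> i j)))" if \<kappa>: "\<kappa> \<in> Lam n" for \<kappa>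
  proof -
    let ?z = "shifted n r \<kappa>"
    have l1: "lower False i i ?z = shifted n r (?e1 \<kappa> i)" if "i \<in> Odds n" for i
      using that by (auto simp: lower_def shifted_def fun_eq_iff)
    have l2: "lower True i j ?z = shifted n r (?e2 \<kappa> i j)" if "i \<in> Odds n" "j \<in> Evens n" for i j
      using that by (intro lower_shifted(2)) auto
    have "poly_eval ?z G = opN n r f ?z" using G(2)[OF shifted_regular[OF r \<kappa>]] by simp
    also have "\<dots> = (\<Sum>i\<in>Odds n. coefE n r ?z i * ?v \<kappa> - coefE n r ?z i * ?v (?e1 \<kappa> i)) +
       (\<Sum>i\<in>Odds n. \<Sum>j\<in>Evens n. coefH n r ?z i j * ?v \<kappa> - coefH n r ?z i j * ?v (?e2 \<kappa> i j))"
      unfolding opN_def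
      by (intro arg_cong2[where f="(+)"] sum.cong refl) (simp_all only: l1 l2 right_diff_distrib)
    also have "\<dots> = ((\<Sum>i\<in>Odds n. coefE n r ?z i) + (\<Sum>i\<in>Odds n. \<Sum>j\<in>Evens n. coefH n r ?z i j)) * ?v \<kappa> -
      ((\<Sum>i\<in>Odds n. coefE n r ?z i * ?v (?e1 \<kappa> i)) +
       (\<Sum>i\<in>Odds n. \<Sum>j\<in>Evens n. coefH n r ?z i j * ?v (?e2 \<kappa> i j)))"
      unfolding sum_subtractf distrib_right sum_distrib_right by simp
    finally show ?thesis unfolding opN_diagonal_lattice[OF n r \<kappa>] .
  qed
  \<comment> \<open>From a partition of odd size at most d all lowered partitions have odd size
    below d, so f is zero at them and only the diagonal term is left. It is d times the value of f
    at \<open>lam\<close> and 0 at the other points.\<close>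
  have "G - Const (of_nat d) * f = 0"
  proof (rule Inv_vanishing[OF r(1)])
    show "Inv n d (G - Const (of_nat d) * f)" by (intro Inv_diff G(1) Inv_smult f)
    fix \<mu> assume \<mu>: "\<mu> \<in> Lam n" "odd_size n \<mu> \<le> int d"
    have "coefE n r (shifted n r \<mu>) i * ?v (?e1 \<mu> i) = 0" if "i \<in> Odds n" for i
    proof (cases "?e1 \<mu> i \<in> Lam n")
      case True
      then have "?v (?e1 \<mu> i) = 0" using size1[OF that, of \<mu>] \<mu>(2) lam by (intro zero) auto
      then show ?thesis by simp
    next
      case False
      show ?thesis by (simp only: coefE_zero[OF \<mu>(1) that False] mult_zero_left)
    qed
    moreover have "coefH n r (shifted n r \<mu>) i j * ?v (?e2 \<mu> i j) = 0" if "i \<in> Odds n" "j \<in> Evens n" for i j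
    proof (cases "?e2 \<mu> i j \<in> Lam n")
      case True
      then have "?v (?e2 \<mu> i j) = 0" using size2[OF that, of \<mu>] \<mu>(2) lam by (intro zero) auto
      then show ?thesis by simp
    next
      case False
      show ?thesis by (simp only: coefH_zero[OF \<mu>(1) that False] mult_zero_left)
    qed
    ultimately have "poly_eval (shifted n r \<mu>) G = of_int (odd_size n \<mu>) * ?v \<mu>"
      unfolding N[OF \<mu>(1)] by (simp only: sum.neutral_const cong: sum.cong) simp
    then show "poly_eval (shifted n r \<mu>) (G - Const (of_nat d) * f) = 0"
      using zero[OF \<mu>] lam by (cases "\<mu> = lam") auto
  qed
  then have Gf: "poly_eval z G = of_nat d * poly_eval z f" for z by simp
  show ?thesis using \<kappa>
  proof (induction "nat (odd_size n \<kappa>)" arbitrary: \<kappa> rule: less_induct)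
    case less
    show ?case
    proof (cases "odd_size n \<kappa> \<le> int d")
      case True
      then have "\<kappa> = lam" using zero[of \<kappa>] less.prems by blast
      then show ?thesis by simp
    next
      case False
      have "of_int (odd_size n \<kappa>) \<noteq> (of_nat d :: 'k)"
        using False by (metis of_int_eq_iff of_int_of_nat_eq order_refl)
      then have "(of_int (odd_size n \<kappa>) - of_nat d) * ?v \<kappa> \<noteq> 0" using less.prems(2) by simp
      then have "(\<Sum>i\<in>Odds n. coefE n r (shifted n r \<kappa>) i * ?v (?e1 \<kappa> i)) +
       (\<Sum>i\<in>Odds n. \<Sum>j\<in>Evens n. coefH n r (shifted n r \<kappa>) i j * ?v (?e2 \<kappa> i j)) \<noteq> 0"
        using N[OF less.prems(1)] unfolding Gf by (simp add: algebra_simps)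
      then consider "(\<Sum>i\<in>Odds n. coefE n r (shifted n r \<kappa>) i * ?v (?e1 \<kappa> i)) \<noteq> 0" |
        "(\<Sum>i\<in>Odds n. \<Sum>j\<in>Evens n. coefH n r (shifted n r \<kappa>) i j * ?v (?e2 \<kappa> i j)) \<noteq> 0" by force
      then show ?thesis
      proof cases
        case 1
        then obtain i where i: "i \<in> Odds n" "coefE n r (shifted n r \<kappa>) i * ?v (?e1 \<kappa> i) \<noteq> 0"
          by (rule sum.not_neutral_contains_not_neutral)
        then have L: "?e1 \<kappa> i \<in> Lam n" using coefE_zero[OF less.prems(1)] by force
        have "(\<forall>l. lam l \<le> (?e1 \<kappa> i) l) \<and> bracket n lam 1 \<le> bracket n (?e1 \<kappa> i) 1"
        proof (rule less.hyps[OF _ L])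
          show "nat (odd_size n (?e1 \<kappa> i)) < nat (odd_size n \<kappa>)" unfolding size1[OF i(1)] using False by simp
        qed (use i(2) in simp)
        moreover have "bracket n (?e1 \<kappa> i) 1 = bracket n \<kappa> 1 - 1"
          unfolding bracket_1[OF n] size1[OF i(1)] ev1[OF i(1)] by simp
        ultimately show ?thesis by (force split: if_splits)
      next
        case 2
        then obtain i where i: "i \<in> Odds n" "(\<Sum>j\<in>Evens n. coefH n r (shifted n r \<kappa>) i j * ?v (?e2 \<kappa> i j)) \<noteq> 0"
          by (rule sum.not_neutral_contains_not_neutral)
        then obtain j where j: "j \<in> Evens n" "coefH n r (shifted n r \<kappa>) i j * ?v (?e2 \<kappa> i j) \<noteq> 0"
          by (elim sum.not_neutral_contains_not_neutral)
        then have L: "?e2 \<kappa> i j \<in> Lam n" using coefH_zero[OF less.prems(1) i(1)] by force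
        have "(\<forall>l. lam l \<le> (?e2 \<kappa> i j) l) \<and> bracket n lam 1 \<le> bracket n (?e2 \<kappa> i j) 1"
        proof (rule less.hyps[OF _ L])
          show "nat (odd_size n (?e2 \<kappa> i j)) < nat (odd_size n \<kappa>)"
            unfolding size2[OF i(1) j(1)] using False by simp
        qed (use j(2) in simp)
        moreover have "bracket n (?e2 \<kappa> i j) 1 = bracket n \<kappa> 1"
          unfolding bracket_1[OF n] size2[OF i(1) j(1)] ev2[OF i(1) j(1)] by simp
        moreover have "(?e2 \<kappa> i j) l \<le> \<kappa> l" for l by simp
        ultimately show ?thesis by (metis order_trans)
      qed
    qed
  qed
qed

section \<open>Weights of the elementary semisymmetric polynomials\<close>

text \<open>A squarefree monomial of degree k in the variables of \<open>A\<close> involves at most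
  k variables of \<open>U\<close>, and at most all those of \<open>A \<inter> U\<close>.\<close>

lemma wle_elem_sym:
  assumes "finite A" "\<And>i. i \<in> A \<Longrightarrow> wle \<omega> (chi U i) (s i :: 'k::comm_semiring_1 mpoly)"
  shows "wle \<omega> (min k (card (A \<inter> U))) (poly_subst s (elem_sym A k))"
  unfolding elem_sym_def poly_subst_sum poly_subst_prod poly_subst_X
proof (rule wle_sum)
  fix S assume S: "S \<in> {S. S \<subseteq> A \<and> card S = k}"
  then have fin: "finite S" using assms(1) by (auto intro: finite_subset)
  have "wle \<omega> (\<Sum>i\<in>S. chi U i) (\<Prod>i\<in>S. s i)" using S by (intro wle_prod assms(2)) auto
  moreover have "(\<Sum>i\<in>S. chi U i) = card (S \<inter> U)"
    using fin by (simp add: chi_def sum.If_cases)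
  moreover have "card (S \<inter> U) \<le> card S" "card (S \<inter> U) \<le> card (A \<inter> U)"
    using fin S assms(1) by (auto intro!: card_mono)
  ultimately show "wle \<omega> (min k (card (A \<inter> U))) (\<Prod>i\<in>S. s i)"
    using S by (elim wle_mono) auto
qed

lemma wdeg_chi:
  assumes "finite U"
  shows "wdeg (chi U) k = (\<Sum>i\<in>U. lkp k i)"
proof -
  have "wdeg (chi U) k = (\<Sum>i\<in>kys k \<inter> U. lkp k i)"
    unfolding wdeg_def by (rule sum.mono_neutral_cong_right) (auto simp: chi_def)
  also have "\<dots> = (\<Sum>i\<in>U. lkp k i)"
    using assms by (intro sum.mono_neutral_left) (auto simp: in_keys_iff)
  finally show ?thesis .
qed

lemma sum_indicator_card: "finite A \<Longrightarrow> (\<Sum>j\<in>A. if P j then 1 else 0) = card {j \<in> A. P j}"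
  unfolding card_eq_sum by (rule sum.inter_filter[symmetric])

lemma wdeg_chi_ivec:
  "wdeg (chi {1..m}) (ivec i) = (if odd i then (min i m + 1) div 2 else min i m div 2)"
proof -
  have "wdeg (chi {1..m}) (ivec i) = (\<Sum>j\<in>{1..m}. if j \<le> i \<and> even (i - j) then 1 else 0)"
    by (simp add: wdeg_chi lookup_ivec)
  also have "\<dots> = card {j \<in> {1..m}. j \<le> i \<and> even (i - j)}"
    by (rule sum_indicator_card) simp
  also have "{j \<in> {1..m}. j \<le> i \<and> even (i - j)} = (if odd i then Odds (min i m) else Evens (min i m))"
    by auto
  finally show ?thesis unfolding if_distrib[of card] card_Odds card_Evens .
qed

text \<open>Inside {1..m} the exponent \<open>ivec i\<close> already fills its parity class as far
  as degree and class size permit, so no monomial has larger weight. The substitution does not raise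
  weights, because l + 1 \<le> m implies l \<le> m.\<close>

lemma wle_prefix_elem_semisym:
  assumes i: "i \<in> {1..n}" and m: "m \<le> n"
  shows "wle (chi {1..m}) (wdeg (chi {1..m}) (ivec i)) (poly_subst (cs J) (elem_semisym n i :: 'k::comm_ring_1 mpoly))"
proof -
  have cs: "wle (chi {1..m}) (chi {1..m} l) (cs J l :: 'k mpoly)" if "l \<ge> 1" for l
    using that by (auto simp: cs_def chi_def intro!: wle_add wle_X)
  have sub: "Odds n \<inter> {1..m} = Odds m" "Evens n \<inter> {1..m} = Evens m" using m by auto
  have O: "wle (chi {1..m}) (min k ((m + 1) div 2)) (poly_subst (cs J) (elem_sym (Odds n) k :: 'k mpoly))" for k
    using wle_elem_sym[of "Odds n" "chi {1..m}" "{1..m}" "cs J :: nat \<Rightarrow> 'k mpoly" k] cs unfolding sub card_Odds by simp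
  have E: "wle (chi {1..m}) (min k (m div 2)) (poly_subst (cs J) (elem_sym (Evens n) k :: 'k mpoly))" for k
    using wle_elem_sym[of "Evens n" "chi {1..m}" "{1..m}" "cs J :: nat \<Rightarrow> 'k mpoly" k] cs unfolding sub card_Evens by simp
  show ?thesis
  proof (cases "odd i")
    case True
    have "min ((i + 1) div 2) ((m + 1) div 2) = (min i m + 1) div 2" by (auto simp: min_def intro: div_le_mono antisym)
    moreover have "min ((i + 1) div 2) (m div 2) \<le> min ((i + 1) div 2) ((m + 1) div 2)" by (intro min.mono div_le_mono) auto
    ultimately have "wle (chi {1..m}) ((min i m + 1) div 2) (poly_subst (cs J) (elem_sym (Odds n) ((i + 1) div 2) :: 'k mpoly))"
      "wle (chi {1..m}) ((min i m + 1) div 2) (poly_subst (cs J) (elem_sym (Evens n) ((i + 1) div 2) :: 'k mpoly))"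
      using O[of "(i + 1) div 2"] E[of "(i + 1) div 2"] by (auto elim: wle_mono)
    then show ?thesis unfolding wdeg_chi_ivec elem_semisym_def using True by (simp add: wle_diff)
  next
    case False
    have "min (i div 2) (m div 2) = min i m div 2" by (auto simp: min_def intro: div_le_mono antisym)
    then show ?thesis using E[of "i div 2"] False unfolding wdeg_chi_ivec elem_semisym_def by simp
  qed
qed

text \<open>
  In \<open>e\<^sub>k(x) - e\<^sub>k(y)\<close> with \<open>x = v + y\<close> the monomials containing only variables \<open>y\<close> cancel.
\<close>

lemma wle_prod_diff:
  assumes "finite S" "\<And>a. a \<in> S \<Longrightarrow> wle \<omega> 0 (v a)" "\<And>a. a \<in> S \<Longrightarrow> wle \<omega> 1 (y a)"
  shows "wle \<omega> (card S - 1) ((\<Prod>a\<in>S. v a + y a) - (\<Prod>a\<in>S. y a :: 'k::comm_ring_1 mpoly))"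
  using assms
proof (induction S rule: finite_induct)
  case (insert b S)
  have vy: "wle \<omega> 1 (v a + y a)" if "a \<in> S" for a
    using insert.prems that by (intro wle_add) (auto intro: wle_mono)
  have "wle \<omega> (\<Sum>a\<in>S. 1) (\<Prod>a\<in>S. v a + y a)" by (rule wle_prod) (rule vy)
  then have "wle \<omega> (0 + card S) (v b * (\<Prod>a\<in>S. v a + y a))" using insert.prems by (intro wle_mult) auto
  moreover have "wle \<omega> (card S) (y b * ((\<Prod>a\<in>S. v a + y a) - (\<Prod>a\<in>S. y a)))"
  proof (cases "S = {}")
    case False
    then have "card S > 0" using insert.hyps by (simp add: card_gt_0_iff)
    moreover have "wle \<omega> (1 + (card S - 1)) (y b * ((\<Prod>a\<in>S. v a + y a) - (\<Prod>a\<in>S. y a)))"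
      using insert by (intro wle_mult) auto
    ultimately show ?thesis by simp
  qed simp
  ultimately have "wle \<omega> (card S) (v b * (\<Prod>a\<in>S. v a + y a) + y b * ((\<Prod>a\<in>S. v a + y a) - (\<Prod>a\<in>S. y a)))"
    by (intro wle_add) simp_all
  then show ?case using insert.hyps by (simp add: algebra_simps)
qed simp

text \<open>The variables \<open>y\<^sub>a\<close> and \<open>v\<^sub>a = x\<^sub>a - y\<^sub>a\<close>, where \<open>y\<^sub>a = 0\<close> for \<open>a > n div 2\<close>.\<close>

lemma elem_sym_pairs:
  fixes f :: "nat \<Rightarrow> 'b::comm_semiring_1"
  shows "esf f (Odds n) k = esf (\<lambda>a. f (2 * a - 1)) {1..(n + 1) div 2} k"
    "esf f (Evens n) k = esf (\<lambda>a. if a \<le> n div 2 then f (2 * a) else 0) {1..(n + 1) div 2} k"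
    "esf f (Evens n) k = esf (\<lambda>a. f (2 * a)) {1..n div 2} k"
proof -
  have "(\<lambda>a. 2 * a - 1) ` {1..(n + 1) div 2} = Odds n"
  proof safe
    fix l assume l: "l \<in> {1..n}" "odd l"
    have "l = 2 * ((l + 1) div 2) - 1" using l(2) by presburger
    moreover have "(l + 1) div 2 \<le> (n + 1) div 2" using l(1) by (intro div_le_mono) simp
    moreover have "1 \<le> (l + 1) div 2" using l(1) unfolding atLeastAtMost_iff by presburger
    ultimately show "l \<in> (\<lambda>a. 2 * a - 1) ` {1..(n + 1) div 2}" by (metis atLeastAtMost_iff image_eqI)
  next
    fix a assume a: "a \<in> {1..(n + 1) div 2}"
    then have "2 * a \<le> n + 1" by auto
    then show "2 * a - 1 \<in> {1..n}" using a by auto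
    assume "even (2 * a - 1)"
    then show False using a by simp
  qed
  moreover have "inj_on (\<lambda>a. 2 * a - 1 :: nat) {1..(n + 1) div 2}" by (auto simp: inj_on_def)
  ultimately show "esf f (Odds n) k = esf (\<lambda>a. f (2 * a - 1)) {1..(n + 1) div 2} k"
    using esf_image[of "\<lambda>a. 2 * a - 1" "{1..(n + 1) div 2}" f k] by simp
  have "(\<lambda>a. 2 * a) ` {1..n div 2} = Evens n"
  proof safe
    fix l assume l: "l \<in> {1..n}" "even l"
    then show "l \<in> (\<lambda>a. 2 * a) ` {1..n div 2}"
      by (intro image_eqI[of _ _ "l div 2"]) (auto elim!: evenE)
  qed auto
  then show e: "esf f (Evens n) k = esf (\<lambda>a. f (2 * a)) {1..n div 2} k"
    using esf_image[of "\<lambda>a. 2 * a" "{1..n div 2}" f k] by (simp add: inj_on_def)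
  let ?g = "\<lambda>a. if a \<le> n div 2 then f (2 * a) else 0"
  have "esf ?g {1..(n + 1) div 2} k = esf ?g {1..n div 2} k"
  proof (cases "even n")
    case False
    then have i: "{1..(n + 1) div 2} = insert (n div 2 + 1) {1..n div 2}" by auto
    show ?thesis
    proof (cases k)
      case (Suc k')
      then show ?thesis unfolding i by (subst Suc, subst esf_insert) auto
    qed simp
  qed simp
  also have "\<dots> = esf (\<lambda>a. f (2 * a)) {1..n div 2} k" by (rule esf_cong) auto
  finally show "esf f (Evens n) k = esf ?g {1..(n + 1) div 2} k" using e by simp
qed

definition vvar :: "nat \<Rightarrow> 'k::comm_semiring_1 mpoly" where "vvar a = X (2 * a - 1)"
definition yvar :: "nat \<Rightarrow> nat \<Rightarrow> 'k::comm_semiring_1 mpoly" where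
  "yvar n a = (if a \<le> n div 2 then X (2 * a) else 0)"

text \<open>Both elementary symmetric polynomials are written over one set of pairs, with y = 0 in
  the incomplete pair for odd n, so that they can be subtracted term by term.\<close>

lemma odd_elem_semisym_subst:
  assumes "odd i"
  shows "poly_subst (cs (n div 2)) (elem_semisym n i :: 'k::comm_ring_1 mpoly) =
    (\<Sum>S \<in> {S. S \<subseteq> {1..(n + 1) div 2} \<and> card S = (i + 1) div 2}.
      (\<Prod>a\<in>S. vvar a + yvar n a) - (\<Prod>a\<in>S. yvar n a))"
proof -
  let ?k = "(i + 1) div 2" and ?P = "{1..(n + 1) div 2}"
  have "poly_subst (cs (n div 2)) (elem_semisym n i :: 'k mpoly) = esf (cs (n div 2)) (Odds n) ?k - esf (cs (n div 2)) (Evens n) ?k"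
    unfolding elem_semisym_def elem_sym_esf using assms by (simp add: poly_subst_esf)
  also have "esf (cs (n div 2)) (Odds n) ?k = (esf (\<lambda>a. vvar a + yvar n a) ?P ?k :: 'k mpoly)"
    unfolding elem_sym_pairs(1) by (rule esf_cong) (auto simp: cs_def vvar_def yvar_def)
  also have "esf (cs (n div 2)) (Evens n) ?k = (esf (yvar n) ?P ?k :: 'k mpoly)"
    unfolding elem_sym_pairs(2) by (rule esf_cong) (auto simp: cs_def yvar_def)
  finally show ?thesis by (simp only: esf_def sum_subtractf)
qed

text \<open>For odd i two bounds are combined: cancellation of the pure y monomials gives (i + 1)
  div 2 - 1 = i div 2, and counting the available variables gives j.\<close>

lemma wle_even_elem_semisym:
  assumes i: "i \<in> {1..n}" and j: "2 * j \<le> n"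
  shows "wle (chi (Evens (2 * j))) (min (i div 2) j) (poly_subst (cs (n div 2)) (elem_semisym n i :: 'k::comm_ring_1 mpoly))"
proof -
  let ?U = "Evens (2 * j)"
  let ?\<omega> = "chi ?U"
  have cE: "card (Evens n \<inter> ?U) = j"
  proof -
    have "Evens n \<inter> ?U = ?U" using j by auto
    then show ?thesis using card_Evens[of "2 * j"] by simp
  qed
  have E: "wle ?\<omega> (min k j) (poly_subst (cs (n div 2)) (elem_sym (Evens n) k :: 'k mpoly))" for k
  proof -
    have "wle ?\<omega> (chi ?U l) (cs (n div 2) l :: 'k mpoly)" if "l \<in> Evens n" for l
      using that by (auto simp: cs_def intro: wle_X)
    then show ?thesis using wle_elem_sym[of "Evens n" ?\<omega> ?U "cs (n div 2) :: nat \<Rightarrow> 'k mpoly" k] unfolding cE by simp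
  qed
  show ?thesis
  proof (cases "odd i")
    case False
    then show ?thesis using E[of "i div 2"] by (simp add: elem_semisym_def)
  next
    case True
    let ?k = "(i + 1) div 2"
    have ik: "i div 2 = ?k - 1" using True by presburger
    have v: "wle ?\<omega> 0 (vvar a :: 'k mpoly)" if "a \<ge> 1" for a
      using that by (auto simp: vvar_def chi_def intro!: wle_X)
    have y: "wle ?\<omega> 1 (yvar n a :: 'k mpoly)" for a
      by (auto simp: yvar_def chi_def intro!: wle_X)
    have 1: "wle ?\<omega> (i div 2) (poly_subst (cs (n div 2)) (elem_semisym n i :: 'k mpoly))"
      unfolding odd_elem_semisym_subst[OF True]
    proof (rule wle_sum)
      fix S assume S: "S \<in> {S. S \<subseteq> {1..(n + 1) div 2} \<and> card S = ?k}"
      then have fin: "finite S" by (auto intro: finite_subset)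
      have "wle ?\<omega> (card S - 1) ((\<Prod>a\<in>S. vvar a + yvar n a) - (\<Prod>a\<in>S. yvar n a :: 'k mpoly))"
        using S by (intro wle_prod_diff fin v y) auto
      then show "wle ?\<omega> (i div 2) ((\<Prod>a\<in>S. vvar a + yvar n a) - (\<Prod>a\<in>S. yvar n a :: 'k mpoly))"
        using S ik by simp
    qed
    let ?U' = "Odds (2 * j)"
    have "wle ?\<omega> (chi ?U' l) (cs (n div 2) l :: 'k mpoly)" if "l \<in> Odds n" for l
      using that by (auto simp: cs_def chi_def intro!: wle_X wle_add)
    then have "wle ?\<omega> (min ?k (card (Odds n \<inter> ?U'))) (poly_subst (cs (n div 2)) (elem_sym (Odds n) ?k :: 'k mpoly))"
      by (intro wle_elem_sym) auto
    moreover have "Odds n \<inter> ?U' = ?U'" using j by auto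
    ultimately have O: "wle ?\<omega> (min ?k j) (poly_subst (cs (n div 2)) (elem_sym (Odds n) ?k :: 'k mpoly))"
      using card_Odds[of "2 * j"] by simp
    have 2: "wle ?\<omega> j (poly_subst (cs (n div 2)) (elem_semisym n i :: 'k mpoly))"
      using O E[of ?k] True by (auto simp: elem_semisym_def intro!: wle_diff elim: wle_mono)
    show ?thesis using 1 2 by (simp add: min_def)
  qed
qed

section \<open>A second leading monomial\<close>

text \<open>
  The renaming \<open>y\<^sub>a \<mapsto> X a\<close>, \<open>v\<^sub>a \<mapsto> X (n div 2 + a)\<close> makes the variables \<open>y\<^sub>a\<close> lexicographically larger
  than the \<open>v\<^sub>a\<close>.  The weights of the leading monomials in these variables are the partial sums of
  \<open>\<mu>\<close> over even indices.
\<close>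

definition ren :: "nat \<Rightarrow> nat \<Rightarrow> nat" where
  "ren n i = (if even i then i div 2 else n div 2 + (i + 1) div 2)"

definition cs2 :: "nat \<Rightarrow> nat \<Rightarrow> 'k::comm_semiring_1 mpoly" where
  "cs2 n i = poly_subst (\<lambda>l. X (ren n l)) (cs (n div 2) i)"

lemma poly_subst_cs2: "poly_subst (cs2 n) p = poly_subst (\<lambda>l. X (ren n l)) (poly_subst (cs (n div 2)) (p :: 'k::field_char_0 mpoly))"
  unfolding cs2_def by (rule poly_eval_eqI) (simp add: poly_eval_subst)

definition vec2 :: "nat \<Rightarrow> nat \<Rightarrow> (nat \<Rightarrow>\<^sub>0 nat)" where
  "vec2 n i = (if odd i then ind ({1..i div 2} \<union> {n div 2 + (i + 1) div 2}) else ind {1..i div 2})"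

definition exp2 :: "nat \<Rightarrow> (nat \<Rightarrow> int) \<Rightarrow> (nat \<Rightarrow>\<^sub>0 nat)" where
  "exp2 n \<mu> = (\<Sum>i = 1..n. \<Sum>j < nat (\<mu> i - \<mu> (Suc i)). vec2 n i)"

text \<open>\<open>T\<close> is the set of pairs from which v is taken and \<open>S - T\<close> the
  set from which y is taken; \<open>T\<close> is nonempty because pure y monomials cancel. The
  largest choice uses y_1, ..., y_{k-1} and then v_k.\<close>

lemma ind_less_exp2:
  assumes S: "S \<subseteq> {1..p}" "T \<subseteq> S" "T \<noteq> {}" "card S = k" "S - T \<subseteq> {1..q}"
    and k: "k \<le> p" "p \<le> Suc q"
    and ne: "(S, T) \<noteq> ({1..k}, {k})"
  shows "ind ((S - T) \<union> (+) q ` T) < ind ({1..k - 1} \<union> {q + k})"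
proof -
  have "finite S" by (rule finite_subset[OF S(1)]) simp
  then have fin: "finite S" "finite T" using S(2) by (auto intro: finite_subset)
  let ?Z = "(S - T) \<union> (+) q ` T" and ?R = "{1..k - 1} \<union> {q + k}"
  have finZ: "finite ?Z" "finite ?R" using fin by auto
  have T0: "t \<ge> 1" if "t \<in> T" for t using that S by auto
  have "card T > 0" using S fin by (simp add: card_gt_0_iff)
  have cST: "card (S - T) = k - card T" using S fin by (simp add: card_Diff_subset)
  have "card T \<le> k" using S fin card_mono by blast
  show ?thesis
  proof (cases "{1..k - 1} \<subseteq> S - T")
    case True
    have "card (S - T) \<le> k - 1" using cST \<open>card T > 0\<close> by simp
    then have eq: "S - T = {1..k - 1}" using True fin by (intro card_seteq[symmetric]) auto
    then have "k - card T = k - 1" using cST by simp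
    then have "card T = 1" using \<open>card T > 0\<close> \<open>card T \<le> k\<close> by linarith
    then obtain l where l: "T = {l}" by (auto simp: card_1_singleton_iff)
    have "l \<notin> {1..k - 1}" unfolding eq[symmetric] using l by simp
    moreover have "l \<ge> 1" using T0 l by simp
    ultimately have "l \<ge> k" by auto
    have "k \<ge> 1" using \<open>card T \<le> k\<close> \<open>card T = 1\<close> by simp
    have "l \<noteq> k"
    proof
      assume "l = k"
      have "S = (S - T) \<union> T" using S(2) by blast
      also have "\<dots> = insert k {1..k - 1}" by (simp only: eq) (simp add: l \<open>l = k\<close>)
      also have "\<dots> = {1..k}" using \<open>k \<ge> 1\<close> by auto
      finally have "S = {1..k}" .
      then show False using ne l \<open>l = k\<close> by simp
    qed
    then have "l > k" using \<open>l \<ge> k\<close> by simp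
    have "k - 1 \<le> q" using k by linarith
    have Z: "x \<in> ?Z \<longleftrightarrow> x \<in> {1..k - 1} \<or> x = q + l" for x by (simp only: eq) (auto simp: l)
    show ?thesis
    proof (rule lex_lessI[of _ "q + k"])
      show "lkp (ind ?Z) (q + k) < lkp (ind ?R) (q + k)"
        using \<open>l > k\<close> \<open>k - 1 \<le> q\<close> \<open>k \<ge> 1\<close> unfolding lookup_ind[OF finZ(1)] lookup_ind[OF finZ(2)] Z by auto
      show "lkp (ind ?Z) j = lkp (ind ?R) j" if "j < q + k" for j
        using \<open>l > k\<close> that unfolding lookup_ind[OF finZ(1)] lookup_ind[OF finZ(2)] Z by auto
    qed
  next
    case False
    define D where "D = {1..k - 1} - (S - T)"
    have D: "finite D" "D \<noteq> {}" using False by (auto simp: D_def)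
    define l where "l = Min D"
    have l: "l \<in> D" and min: "\<And>j. j \<in> D \<Longrightarrow> l \<le> j" unfolding l_def using D by auto
    have lq: "l \<le> q" using l k by (auto simp: D_def)
    show ?thesis
    proof (rule lex_lessI[of _ l])
      have "l \<notin> ?Z" using l T0 lq by (force simp: D_def)
      then show "lkp (ind ?Z) l < lkp (ind ?R) l"
        using l unfolding lookup_ind[OF finZ(1)] lookup_ind[OF finZ(2)] by (auto simp: D_def)
      show "lkp (ind ?Z) j = lkp (ind ?R) j" if "j < l" for j
      proof -
        have "j \<in> ?Z \<longleftrightarrow> j \<in> S - T" using that lq T0 by force
        moreover have "j \<in> ?R \<longleftrightarrow> j \<in> {1..k - 1}" using that lq by auto
        moreover have "j \<in> S - T \<longleftrightarrow> j \<in> {1..k - 1}"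
        proof -
          have "l \<in> {1..k - 1}" using l by (simp add: D_def)
          moreover have "j \<notin> D" using min[of j] that by auto
          moreover have "j \<in> S \<Longrightarrow> j \<ge> 1" using S(1) by auto
          ultimately show ?thesis using that by (auto simp: D_def)
        qed
        ultimately show ?thesis unfolding lookup_ind[OF finZ(1)] lookup_ind[OF finZ(2)] by simp
      qed
    qed
  qed
qed

lemma lead_single: "lead m (Poly_Mapping.single m 1)"
  by (simp add: lead_def)

lemma lead_elem_semisym2:
  assumes i: "i \<in> {1..n}"
  shows "lead (vec2 n i) (poly_subst (cs2 n) (elem_semisym n i :: 'k::field_char_0 mpoly))"
proof (cases "odd i")
  case False
  let ?k = "i div 2" and ?q = "n div 2"
  have "poly_subst (cs2 n) (elem_semisym n i :: 'k mpoly) = esf (cs2 n) (Evens n) ?k"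
    using False by (simp add: elem_semisym_def elem_sym_esf poly_subst_esf)
  also have "\<dots> = esf X {1..?q} ?k"
    unfolding elem_sym_pairs(3) by (rule esf_cong) (auto simp: cs2_def cs_def ren_def)
  also have "\<dots> = poly_subst (cs 0) (elem_sym {1..?q} (card {1..?k}))"
    by (simp add: elem_sym_esf cs_zero)
  finally show ?thesis
    using lead_elem_sym[of "{1..?q}" "{1..?k}" 0] i False by (simp add: vec2_def div_le_mono)
next
  case True
  let ?k = "(i + 1) div 2" and ?q = "n div 2" and ?p = "(n + 1) div 2"
  have k: "1 \<le> ?k" "?k \<le> ?p" "?p \<le> Suc ?q" "i div 2 = ?k - 1" using i True by (auto simp: div_le_mono) presburger
  define vv :: "nat \<Rightarrow> 'k mpoly" where "vv a = X (?q + a)" for a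
  define yy :: "nat \<Rightarrow> 'k mpoly" where "yy a = (if a \<le> ?q then X a else 0)" for a
  let ?SS = "{S. S \<subseteq> {1..?p} \<and> card S = ?k}"
  let ?t = "\<lambda>(S, T). prod vv T * prod yy (S - T)"
  let ?I = "SIGMA S:?SS. Pow S - {{}}"
  have finSS: "finite S" if "S \<in> ?SS" for S using that by (auto intro: finite_subset)
  have finSS': "finite ?SS" by (rule finite_subset[of _ "Pow {1..?p}"]) auto
  then have finI: "finite ?I" by (rule finite_SigmaI) (simp only: finite_Diff finite_Pow_iff finSS)
  have "poly_subst (cs2 n) (elem_semisym n i :: 'k mpoly) =
    (\<Sum>S \<in> ?SS. (\<Prod>a\<in>S. vv a + yy a) - (\<Prod>a\<in>S. yy a))"
    unfolding poly_subst_cs2 odd_elem_semisym_subst[OF True] poly_subst_sum poly_subst_diff poly_subst_prod poly_subst_add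
  proof (intro sum.cong refl arg_cong2[where f="(-)"] prod.cong arg_cong2[where f="(+)"])
    fix S a assume "S \<in> ?SS" "a \<in> S"
    then have "a \<ge> 1" by auto
    then show "poly_subst (\<lambda>l. X (ren n l)) (vvar a) = vv a" by (simp add: vvar_def vv_def ren_def)
  qed (auto simp: yvar_def yy_def ren_def)
  also have "\<dots> = (\<Sum>S \<in> ?SS. \<Sum>T \<in> Pow S - {{}}. ?t (S, T))"
  proof (intro sum.cong refl)
    fix S assume "S \<in> ?SS"
    then have fin: "finite S" by (rule finSS)
    then have "(\<Prod>a\<in>S. vv a + yy a) = (\<Sum>T \<in> Pow S. prod vv T * prod yy (S - T))" by (rule prod_add)
    then show "(\<Prod>a\<in>S. vv a + yy a) - (\<Prod>a\<in>S. yy a) = (\<Sum>T \<in> Pow S - {{}}. ?t (S, T))"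
      using fin by (simp add: sum_diff1)
  qed
  also have "\<dots> = (\<Sum>(S, T) \<in> ?I. ?t (S, T))"
    by (rule sum.Sigma[OF finSS']) (intro ballI finite_Diff finite_Pow_iff[THEN iffD2] finSS)
  also have "\<dots> = (\<Sum>I \<in> ?I. ?t I)"
    by (rule sum.cong[OF refl]) (simp only: split_beta prod.collapse)
  also have "\<dots> = ?t ({1..?k}, {?k}) + (\<Sum>I \<in> ?I - {({1..?k}, {?k})}. ?t I)"
    using finI k by (intro sum.remove) auto
  finally have eq: "poly_subst (cs2 n) (elem_semisym n i :: 'k mpoly) =
    ?t ({1..?k}, {?k}) + (\<Sum>I \<in> ?I - {({1..?k}, {?k})}. ?t I)" .
  have mono: "prod vv T * prod yy (S - T) = Poly_Mapping.single (ind ((S - T) \<union> (+) ?q ` T)) 1"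
    if "S \<in> ?SS" "T \<subseteq> S" "S - T \<subseteq> {1..?q}" for S T
  proof -
    have fin: "finite S" "finite T" using that finSS finite_subset by blast+
    have "prod yy (S - T) = prod X (S - T)" using that(3) by (intro prod.cong) (auto simp: yy_def)
    moreover have "prod vv T = prod X ((+) ?q ` T)" by (simp add: vv_def prod.reindex)
    moreover have "(S - T) \<inter> (+) ?q ` T = {}" using that by fastforce
    ultimately have "prod vv T * prod yy (S - T) = prod X ((S - T) \<union> (+) ?q ` T)"
      using fin by (simp add: prod.union_disjoint mult.commute)
    then show ?thesis using fin by (simp add: prod_X)
  qed
  have "{1..?k} - {?k} = {1..?k - 1}" using k(1) by auto
  moreover have "?k - 1 \<le> ?q" using k(2,3) by linarith
  then have "{1..?k - 1} \<subseteq> {1..?q}" by simp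
  moreover have "{1..?k} \<in> ?SS" using k by auto
  ultimately have "?t ({1..?k}, {?k}) = Poly_Mapping.single (ind ({1..?k - 1} \<union> {?q + ?k})) 1"
    using mono[of "{1..?k}" "{?k}"] k(1) by simp
  moreover have vec: "vec2 n i = ind ({1..?k - 1} \<union> {?q + ?k})"
    unfolding vec2_def k(4) using True by (rule if_P)
  ultimately have main: "?t ({1..?k}, {?k}) = Poly_Mapping.single (vec2 n i) 1" by (simp only:)
  have "slt (vec2 n i) (?t I)" if I: "I \<in> ?I - {({1..?k}, {?k})}" for I
  proof -
    obtain S T where ST: "I = (S, T)" "S \<in> ?SS" "T \<subseteq> S" "T \<noteq> {}" using I by auto
    show ?thesis
    proof (cases "S - T \<subseteq> {1..?q}")
      case sub: True
      have "ind ((S - T) \<union> (+) ?q ` T) < ind ({1..?k - 1} \<union> {?q + ?k})"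
      proof (rule ind_less_exp2[OF _ ST(3,4) _ sub k(2,3)])
        show "S \<subseteq> {1..?p}" "card S = ?k" using ST(2) by simp_all
        show "(S, T) \<noteq> ({1..?k}, {?k})" using I ST(1) by blast
      qed
      then have "ind ((S - T) \<union> (+) ?q ` T) < vec2 n i" by (simp only: vec)
      then show ?thesis unfolding ST(1) using lead_imp_slt[OF lead_single] mono[OF ST(2,3) sub] by simp
    next
      case False
      \<comment> \<open>For odd n the last pair has no y, and the corresponding terms are
        zero.\<close>
      then obtain a where a: "a \<in> S - T" "a \<notin> {1..?q}" by blast
      then have "yy a = 0" using ST(2) by (auto simp: yy_def)
      then have "prod yy (S - T) = 0" using a finSS[OF ST(2)] by (intro prod_zero) auto
      then show ?thesis by (simp add: ST(1))
    qed
  qed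
  then show ?thesis unfolding eq main by (intro lead_add lead_single slt_sum) auto
qed

lemma lead_elem_semisym_prod2: "lead (exp2 n \<mu>) (poly_subst (cs2 n) (elem_semisym_prod n \<mu> :: 'k::field_char_0 mpoly))"
  unfolding exp2_def elem_semisym_prod_def poly_subst_prod poly_subst_power
  by (intro lead_prod lead_power lead_elem_semisym2)

lemma sum_differences:
  fixes v :: "nat \<Rightarrow> int"
  assumes "v (Suc n) = 0" "b \<le> Suc n" "b \<ge> 1"
  shows "(\<Sum>i \<in> {i \<in> {1..n}. b \<le> i}. v i - v (Suc i)) = v b"
proof -
  have "{i \<in> {1..n}. b \<le> i} = {b..n}" using assms by auto
  then show ?thesis using assms(1,2) sum_Suc_diff[of b n "\<lambda>i. - v i"] by simp
qed

lemma sum_Lam_differences: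
  assumes "\<mu> \<in> Lam n"
  shows "int (\<Sum>i = 1..n. nat (\<mu> i - \<mu> (Suc i)) * (if P i then 1 else 0)) =
    (\<Sum>i \<in> {i \<in> {1..n}. P i}. \<mu> i - \<mu> (Suc i))"
proof -
  have ge: "\<mu> (Suc i) \<le> \<mu> i" if "i \<in> {1..n}" for i using Lam_antimono[OF assms, of i "Suc i"] that by auto
  have "int (\<Sum>i = 1..n. nat (\<mu> i - \<mu> (Suc i)) * (if P i then 1 else 0)) =
    (\<Sum>i = 1..n. if P i then \<mu> i - \<mu> (Suc i) else 0)"
    unfolding of_nat_sum by (intro sum.cong refl) (use ge in auto)
  also have "\<dots> = (\<Sum>i \<in> {i \<in> {1..n}. P i}. \<mu> i - \<mu> (Suc i))"
    by (rule sum.inter_filter[symmetric]) simp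
  finally show ?thesis .
qed

text \<open>y_a enters the leading monomial of \<open>elem_semisym n i\<close> for all i \<ge> 2a,
  and v_a only for i = 2a - 1; in the first case the multiplicities \<mu>_i - \<mu>_{i+1}
  telescope.\<close>

lemma lookup_exp2:
  assumes "\<mu> \<in> Lam n"
  shows "a \<in> {1..n div 2} \<Longrightarrow> int (lkp (exp2 n \<mu>) a) = \<mu> (2 * a)"
    "a \<in> {1..(n + 1) div 2} \<Longrightarrow> int (lkp (exp2 n \<mu>) (n div 2 + a)) = \<mu> (2 * a - 1) - \<mu> (2 * a)"
proof -
  have v: "lkp (vec2 n i) b = (if b \<in> {1..i div 2} \<or> (odd i \<and> b = n div 2 + (i + 1) div 2) then 1 else 0)" for i b
    by (simp add: vec2_def lookup_ind)
  have l: "lkp (exp2 n \<mu>) b = (\<Sum>i = 1..n. nat (\<mu> i - \<mu> (Suc i)) *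
    (if b \<in> {1..i div 2} \<or> (odd i \<and> b = n div 2 + (i + 1) div 2) then 1 else 0))" for b
    unfolding exp2_def lookup_sum v by (simp only: sum_constant card_lessThan of_nat_id)
  {
    assume a: "a \<in> {1..n div 2}"
    have eq: "{i \<in> {1..n}. a \<in> {1..i div 2} \<or> (odd i \<and> a = n div 2 + (i + 1) div 2)} = {i \<in> {1..n}. 2 * a \<le> i}"
      using a by auto
    have "\<mu> (Suc n) = 0" using Lam_zero_outside[OF assms] by simp
    then show "int (lkp (exp2 n \<mu>) a) = \<mu> (2 * a)"
      unfolding l sum_Lam_differences[OF assms] eq by (rule sum_differences) (use a in auto)
  }
  {
    assume a: "a \<in> {1..(n + 1) div 2}"
    have "{i \<in> {1..n}. n div 2 + a \<in> {1..i div 2} \<or> (odd i \<and> n div 2 + a = n div 2 + (i + 1) div 2)} = {2 * a - 1}"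
    proof (intro equalityI subsetI)
      fix i assume i: "i \<in> {i \<in> {1..n}. n div 2 + a \<in> {1..i div 2} \<or> (odd i \<and> n div 2 + a = n div 2 + (i + 1) div 2)}"
      have "i div 2 \<le> n div 2" using i by (auto intro: div_le_mono)
      then have "odd i" "a = (i + 1) div 2" using i a by auto
      then show "i \<in> {2 * a - 1}" by auto
    next
      fix i assume "i \<in> {2 * a - 1}"
      then show "i \<in> {i \<in> {1..n}. n div 2 + a \<in> {1..i div 2} \<or> (odd i \<and> n div 2 + a = n div 2 + (i + 1) div 2)}"
        using a by auto
    qed
    then have "int (lkp (exp2 n \<mu>) (n div 2 + a)) = \<mu> (2 * a - 1) - \<mu> (Suc (2 * a - 1))"
      unfolding l sum_Lam_differences[OF assms] by simp
    then show "int (lkp (exp2 n \<mu>) (n div 2 + a)) = \<mu> (2 * a - 1) - \<mu> (2 * a)" using a by simp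
  }
qed

lemma inj_exp2: "inj_on (exp2 n) (Lam n)"
proof
  fix \<mu> \<nu> assume \<mu>: "\<mu> \<in> Lam n" and \<nu>: "\<nu> \<in> Lam n" and eq: "exp2 n \<mu> = exp2 n \<nu>"
  have e: "\<mu> (2 * a) = \<nu> (2 * a)" for a
  proof (cases "a \<in> {1..n div 2}")
    case True
    then show ?thesis using lookup_exp2(1)[OF \<mu>] lookup_exp2(1)[OF \<nu>] eq by metis
  next
    case False
    then have "2 * a \<notin> {1..n}" by auto
    then show ?thesis using Lam_zero_outside \<mu> \<nu> by metis
  qed
  have o: "\<mu> (2 * a - 1) = \<nu> (2 * a - 1)" if "a \<ge> 1" for a
  proof (cases "a \<in> {1..(n + 1) div 2}")
    case True
    then have "\<mu> (2 * a - 1) - \<mu> (2 * a) = \<nu> (2 * a - 1) - \<nu> (2 * a)"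
      using lookup_exp2(2)[OF \<mu>] lookup_exp2(2)[OF \<nu>] eq by metis
    then show ?thesis using e[of a] by simp
  next
    case False
    then have "2 * a - 1 \<notin> {1..n}" using that by auto
    then show ?thesis using Lam_zero_outside \<mu> \<nu> by metis
  qed
  show "\<mu> = \<nu>"
  proof
    fix i show "\<mu> i = \<nu> i"
    proof (cases "even i")
      case True
      then show ?thesis using e[of "i div 2"] by simp
    next
      case False
      then show ?thesis using o[of "(i + 1) div 2"] by auto
    qed
  qed
qed

definition even_sum :: "nat \<Rightarrow> (nat \<Rightarrow> int) \<Rightarrow> int" where
  "even_sum j v = (\<Sum>a = 1..j. v (2 * a))"

lemma even_sum_Evens: "even_sum j v = (\<Sum>i\<in>Evens (2 * j). v i)"
proof -
  have "Evens (2 * j) = (\<lambda>a. 2 * a) ` {1..j}" by (auto elim!: evenE)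
  then show ?thesis by (simp add: even_sum_def sum.reindex inj_on_def)
qed

lemma wdeg_exp2:
  assumes "\<mu> \<in> Lam n" "2 * j \<le> n"
  shows "int (wdeg (chi {1..j}) (exp2 n \<mu>)) = even_sum j \<mu>"
proof -
  have "int (wdeg (chi {1..j}) (exp2 n \<mu>)) = (\<Sum>a\<in>{1..j}. int (lkp (exp2 n \<mu>) a))"
    by (simp add: wdeg_chi)
  also have "\<dots> = even_sum j \<mu>" unfolding even_sum_def
    using assms(2) by (intro sum.cong refl lookup_exp2(1)[OF assms(1)]) auto
  finally show ?thesis .
qed

text \<open>The bound min (i div 2) j for one factor is the weight of its second leading exponent,
  so the bounds add up to the partial sum without loss.\<close>

lemma wle_even_elem_semisym_prod:
  assumes \<mu>: "\<mu> \<in> Lam n" and j: "2 * j \<le> n"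
  shows "wle (chi (Evens (2 * j))) (nat (even_sum j \<mu>)) (poly_subst (cs (n div 2)) (elem_semisym_prod n \<mu> :: 'k::field_char_0 mpoly))"
proof -
  have sum: "wdeg \<omega> (\<Sum>i\<in>I. m i) = (\<Sum>i\<in>I. wdeg \<omega> (m i))" for \<omega> and I :: "nat set" and m
    by (induction I rule: infinite_finite_induct) (auto simp: wdeg_add)
  have "wdeg (chi {1..j}) (vec2 n i) = min (i div 2) j" if "i \<in> {1..n}" for i
  proof -
    have "wdeg (chi {1..j}) (vec2 n i) = (\<Sum>a\<in>{1..j}. if a \<le> i div 2 then 1 else 0)"
      unfolding wdeg_chi[OF finite_atLeastAtMost] using j that
      by (intro sum.cong refl) (auto simp: vec2_def lookup_ind)
    also have "\<dots> = card {a \<in> {1..j}. a \<le> i div 2}" by (rule sum_indicator_card) simp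
    also have "{a \<in> {1..j}. a \<le> i div 2} = {1..min (i div 2) j}" by auto
    finally show ?thesis by simp
  qed
  then have "wdeg (chi {1..j}) (exp2 n \<mu>) = (\<Sum>i = 1..n. nat (\<mu> i - \<mu> (Suc i)) * min (i div 2) j)"
    unfolding exp2_def sum by (simp only: sum_constant card_lessThan of_nat_id cong: sum.cong)
  then have "nat (even_sum j \<mu>) = (\<Sum>i = 1..n. nat (\<mu> i - \<mu> (Suc i)) * min (i div 2) j)"
    using wdeg_exp2[OF assms] by (metis nat_int)
  then show ?thesis
    unfolding elem_semisym_prod_def poly_subst_prod poly_subst_power
    by (simp only:) (intro wle_prod wle_power wle_even_elem_semisym j, auto)
qed

lemma wle_ren:
  assumes "wle (chi (Evens (2 * j))) c p" "2 * j \<le> n"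
  shows "wle (chi {1..j}) c (poly_subst (\<lambda>l. X (ren n l)) (p :: 'k::comm_semiring_1 mpoly))"
proof (rule wle_subst[OF assms(1)])
  fix i
  have "chi {1..j} (ren n i) \<le> chi (Evens (2 * j)) i"
    using assms(2) by (auto simp: chi_def ren_def elim!: evenE)
  then show "wle (chi {1..j}) (chi (Evens (2 * j)) i) (X (ren n i) :: 'k mpoly)" by (rule wle_X)
qed

section \<open>Weights of polynomials with extra vanishing\<close>

lemma partition_head_tail:
  assumes \<kappa>: "\<kappa> \<in> tails n m" and mn: "m \<le> n"
    and head: "\<And>i. i \<in> {1..<m} \<Longrightarrow> h (Suc i) \<le> h i" "m \<ge> 1 \<Longrightarrow> \<kappa> (Suc m) \<le> h m"
  shows "(\<lambda>i. if i \<in> {1..m} then int (h i) else int (\<kappa> i)) \<in> Lam n"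
proof -
  have out: "\<kappa> i = 0" if "i \<notin> {1..n}" "i \<notin> {1..m}" for i
  proof -
    have "i \<notin> {m<..n}" using that by auto
    then show ?thesis using \<kappa> unfolding tails_def by blast
  qed
  have dec: "\<kappa> (Suc i) \<le> \<kappa> i" if "i > m" for i using \<kappa> that unfolding tails_def by blast
  have 1: "(if Suc i \<in> {1..m} then int (h (Suc i)) else int (\<kappa> (Suc i))) \<le> (if i \<in> {1..m} then int (h i) else int (\<kappa> i))"
    if i: "i \<in> {1..<n}" for i
  proof -
    consider "i < m" | "i = m" | "i > m" by linarith
    then show ?thesis
    proof cases
      case 1 then show ?thesis using head(1)[of i] i by simp
    next
      case 2 then show ?thesis using head(2) i by simp
    next
      case 3 then show ?thesis using dec[of i] by simp
    qed
  qed
  show ?thesis unfolding Lam_def int_vecs_def using 1 out mn by auto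
qed

lemma tail_split:
  fixes v :: "nat \<Rightarrow> int"
  assumes "m \<le> n" "even (m :: nat)"
  shows "(\<Sum>i\<in>Odds n. v i) = (\<Sum>i\<in>Odds m. v i) + (\<Sum>i \<in> {i \<in> {m<..n}. odd (i - m)}. v i)"
    "(\<Sum>i\<in>Evens n. v i) = (\<Sum>i\<in>Evens m. v i) + (\<Sum>i \<in> {i \<in> {m<..n}. even (i - m)}. v i)"
proof -
  have O: "Odds n = Odds m \<union> {i \<in> {m<..n}. odd (i - m)}" and E: "Evens n = Evens m \<union> {i \<in> {m<..n}. even (i - m)}"
    using assms by auto
  have "sum v (Odds m \<union> {i \<in> {m<..n}. odd (i - m)}) = (\<Sum>i\<in>Odds m. v i) + (\<Sum>i \<in> {i \<in> {m<..n}. odd (i - m)}. v i)"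
    by (rule sum.union_disjoint) auto
  then show "(\<Sum>i\<in>Odds n. v i) = (\<Sum>i\<in>Odds m. v i) + (\<Sum>i \<in> {i \<in> {m<..n}. odd (i - m)}. v i)"
    by (simp only: O)
  have "sum v (Evens m \<union> {i \<in> {m<..n}. even (i - m)}) = (\<Sum>i\<in>Evens m. v i) + (\<Sum>i \<in> {i \<in> {m<..n}. even (i - m)}. v i)"
    by (rule sum.union_disjoint) auto
  then show "(\<Sum>i\<in>Evens n. v i) = (\<Sum>i\<in>Evens m. v i) + (\<Sum>i \<in> {i \<in> {m<..n}. even (i - m)}. v i)"
    by (simp only: E)
qed

lemma sum_pairs:
  fixes v :: "nat \<Rightarrow> 'b::comm_monoid_add"
  shows "(\<Sum>i\<in>Odds (2 * j). v (Suc i)) = (\<Sum>i\<in>Evens (2 * j). v i)"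
  by (rule sum.reindex_bij_witness[where i="\<lambda>i. i - 1" and j=Suc]) (auto, presburger)

context
  fixes n d :: nat and r :: "'k::field_char_0" and lam :: "nat \<Rightarrow> int" and f :: "'k mpoly"
  assumes n: "n \<ge> 1" and r: "generic r" "r \<noteq> 0" and f: "Inv n d f"
    and lam: "lam \<in> Lam n" "odd_size n lam = int d"
    and zero: "\<And>\<mu>. \<mu> \<in> Lam n \<Longrightarrow> odd_size n \<mu> \<le> int d \<Longrightarrow> \<mu> \<noteq> lam \<Longrightarrow> poly_eval (shifted n r \<mu>) f = 0"
begin

lemma extra: "\<kappa> \<in> Lam n \<Longrightarrow> poly_eval (shifted n r \<kappa>) f \<noteq> 0 \<Longrightarrow>
    (\<forall>i. lam i \<le> \<kappa> i) \<and> bracket n lam 1 \<le> bracket n \<kappa> 1"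
  using extra_vanishing[OF n r f lam(2) zero] by blast

lemma f_props: "inv_vars {1..n} f" "tail_invariant n m f" "wle (\<lambda>_. 1) d f"
  using f by (auto simp: Inv_def polys_iff tail_invariant_def W_invariant_def)

text \<open>Read f as a polynomial in z_1, ..., z_m. If some coefficient is nonzero at a tail
  \<kappa>, then f is nonzero at some partition with this tail, since chamber points are dense;
  extra vanishing then bounds the tail from below by that of \<open>lam\<close>. All coefficients
  therefore vanish at smaller tails.\<close>

lemma prefix_degree:
  assumes m: "m \<le> n" and k: "k \<in> kys f"
  shows "int (wdeg (chi {1..m}) k) + (\<Sum>i \<in> {i \<in> {m<..n}. odd (i - m)}. lam i) \<le> int d"
proof -
  define T where "T = (\<Sum>i \<in> {i \<in> {m<..n}. odd (i - m)}. lam i)"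
  have T0: "0 \<le> T" unfolding T_def by (intro sum_nonneg Lam_nonneg[OF lam(1)])
  have "wdeg (chi {1..m}) k + nat T \<le> d"
  proof (rule partial_degree_bound[OF r(1) m, of "{1..m}" "{}" f d "nat T" k])
    fix z :: "nat \<Rightarrow> 'k" and a :: "nat \<Rightarrow> nat" and \<kappa>
    assume \<kappa>: "\<kappa> \<in> tails n m" and z: "\<forall>i\<in>{m<..n}. z i = of_nat (n - i) * r + of_nat (\<kappa> i)"
      and small: "(\<Sum>v\<in>{}. a v) + tail_size n m \<kappa> < nat T"
    show "poly_eval z f = 0"
    proof (rule vanishing_on_chamber[of "{1..m}" z "\<lambda>i. of_nat (n - i) * r" "\<kappa> (Suc m)" f z])
      fix y :: "nat \<Rightarrow> 'k" and h
      assume y: "\<forall>i. i \<notin> {1..m} \<longrightarrow> y i = z i" "\<forall>i\<in>{1..m}. y i = of_nat (n - i) * r + of_nat (h i)"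
        and h: "\<forall>i\<in>{1..m}. \<kappa> (Suc m) \<le> h i" "\<forall>i\<in>{1..m}. \<forall>j\<in>{1..m}. i < j \<longrightarrow> h j + \<kappa> (Suc m) \<le> h i"
      let ?\<mu> = "\<lambda>i. if i \<in> {1..m} then int (h i) else int (\<kappa> i)"
      have dec: "h (Suc i) \<le> h i" if "i \<in> {1..<m}" for i
      proof -
        have "h (Suc i) + \<kappa> (Suc m) \<le> h i" using h(2) that by auto
        then show ?thesis by simp
      qed
      have Lam: "?\<mu> \<in> Lam n"
      proof (rule partition_head_tail[OF \<kappa> m, where h = h])
        show "h (Suc i) \<le> h i" if "i \<in> {1..<m}" for i by (rule dec[OF that])
        show "\<kappa> (Suc m) \<le> h m" if "m \<ge> 1" using h(1) that by auto
      qed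
      have "y i = shifted n r ?\<mu> i" if "i \<in> {1..n}" for i
        using y z that by (auto simp: shifted_def)
      then have eq: "poly_eval y f = poly_eval (shifted n r ?\<mu>) f"
        by (rule poly_eval_cong_vars[OF f_props(1)])
      show "poly_eval y f = 0"
      proof (rule ccontr)
        assume "poly_eval y f \<noteq> 0"
        then have le: "lam i \<le> ?\<mu> i" for i using extra[OF Lam] eq by simp
        have "T \<le> (\<Sum>i \<in> {i \<in> {m<..n}. odd (i - m)}. int (\<kappa> i))" unfolding T_def
        proof (rule sum_mono)
          fix i assume "i \<in> {i \<in> {m<..n}. odd (i - m)}"
          then show "lam i \<le> int (\<kappa> i)" using le[of i] by auto
        qed
        then show False using small by (simp add: tail_size_def flip: of_nat_sum)
      qed
    qed auto
  qed (use k f_props in auto)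
  then show ?thesis using T0 unfolding T_def[symmetric] by linarith
qed

lemma bracket_lam_nonneg: "0 \<le> bracket n lam i"
  using lookup_lexp[OF lam(1), of i] by (metis of_nat_0_le_iff)

text \<open>For odd i < 2j substitute z_i = v_i + r + z_{i+1}. At a shifted partition v_i equals
  \<kappa>_i - \<kappa>_{i+1}, a natural number independent of r, so the v_i can serve as spectators
  while z_2, z_4, ..., z_{2j} are the variables whose degree is bounded. Both parts of the extra
  vanishing enter: [\<kappa>]_1 is the sum of the v_i and of the tail entries with alternating
  signs, and containment controls the tail entries at even positions.\<close>

lemma even_degree:
  assumes j: "2 * j \<le> n" and k: "k \<in> kys (poly_subst (cs (n div 2)) f)"
  shows "int (wdeg (chi (Evens (2 * j))) k) \<le> even_sum j lam"
proof -
  let ?U = "Evens (2 * j)" and ?V = "Odds (2 * j)" and ?m = "2 * j"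
  have em: "even (2 * j)" by simp
  define T where "T = int d - even_sum j lam"
  define tl where "tl v = (\<Sum>i \<in> {i \<in> {?m<..n}. even (i - ?m)}. v i :: int)" for v
  \<comment> \<open>The complementary degree splits into [\<lambda>]_1 and the even tail entries,
    the two quantities that extra vanishing bounds.\<close>
  have T: "T = bracket n lam 1 + tl lam"
    using bracket_1[OF n, of lam] tail_split(2)[OF j em, of lam] lam(2)
    by (simp add: T_def even_sum_Evens tl_def)
  have "0 \<le> tl lam" unfolding tl_def by (intro sum_nonneg Lam_nonneg[OF lam(1)])
  then have T0: "0 \<le> T" using T bracket_lam_nonneg by simp
  define s :: "nat \<Rightarrow> 'k mpoly" where "s i = (if i \<in> ?V then X i + Const r + X (i + 1) else X i)" for i
  define S where "S = poly_subst s f"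
  have evalS: "poly_eval z S = poly_eval (\<lambda>i. if i \<in> ?V then z i + r + z (i + 1) else z i) f" for z
    unfolding S_def poly_eval_subst s_def by (rule arg_cong[where f="\<lambda>x. poly_eval x f"]) auto
  have bound: "wdeg (chi ?U) k' + nat T \<le> d" if k': "k' \<in> kys S" for k'
  proof (rule partial_degree_bound[OF r(1) j _ _ _ _ _ _ k'])
    show "?U \<union> ?V = {1..?m}" "?U \<inter> ?V = {}" by auto
    show "inv_vars {1..n} S" unfolding S_def
    proof (rule inv_vars_subst[OF f_props(1)])
      fix i assume "i \<in> {1..n}"
      moreover have "i + 1 \<in> {1..n}" if "i \<in> ?V"
      proof -
        have "i \<le> 2 * j" "odd i" using that by auto
        then have "i + 1 \<le> 2 * j" by presburger
        then show ?thesis using j by simp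
      qed
      ultimately show "inv_vars {1..n} (s i)"
        unfolding s_def by (auto intro!: inv_vars_add inv_vars_X simp del: atLeastAtMost_iff)
    qed
    show "wle (\<lambda>_. 1) d S" unfolding S_def
      by (rule wle_subst[OF f_props(3)]) (auto simp: s_def intro!: wle_add wle_X)
    show "tail_invariant n ?m S" unfolding tail_invariant_def
    proof (intro ballI impI poly_eval_eqI)
      fix \<pi> z assume \<pi>: "\<pi> \<in> W n" "\<forall>i\<le>?m. \<pi> i = i"
      have inj: "inj \<pi>" using W_image(3)[OF \<pi>(1)] .
      have V: "\<pi> i \<in> ?V \<longleftrightarrow> i \<in> ?V" for i
      proof
        assume "\<pi> i \<in> ?V"
        then have "\<pi> (\<pi> i) = \<pi> i" using \<pi>(2) by simp
        then have "\<pi> i = i" using inj by (simp add: inj_eq)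
        then show "i \<in> ?V" using \<open>\<pi> i \<in> ?V\<close> by simp
      next
        assume i: "i \<in> ?V"
        then have "\<pi> i = i" using \<pi>(2) by simp
        then show "\<pi> i \<in> ?V" using i by simp
      qed
      have fixV: "\<pi> i = i \<and> \<pi> (i + 1) = i + 1" if "i \<in> ?V" for i
      proof -
        have "i \<le> 2 * j" "odd i" using that by auto
        then have "i + 1 \<le> 2 * j" by presburger
        then show ?thesis using \<pi>(2) by simp
      qed
      let ?y = "\<lambda>i. if i \<in> ?V then z i + r + z (i + 1) else z i"
      have "poly_eval z (poly_subst (\<lambda>i. X (\<pi> i)) S) = poly_eval (\<lambda>i. ?y (\<pi> i)) f"
        unfolding poly_eval_subst evalS
        by (rule arg_cong[where f="\<lambda>x. poly_eval x f"], rule ext) (use V fixV in \<open>simp del: mem_Collect_eq\<close>)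
      also have "\<dots> = poly_eval z S" unfolding evalS by (rule tail_invariant_eval[OF f_props(2) \<pi>])
      finally show "poly_eval z (poly_subst (\<lambda>i. X (\<pi> i)) S) = poly_eval z S" .
    qed
    fix z :: "nat \<Rightarrow> 'k" and a :: "nat \<Rightarrow> nat" and \<kappa>
    assume \<kappa>: "\<kappa> \<in> tails n ?m" and zV: "\<forall>v\<in>?V. z v = of_nat (a v)"
      and z: "\<forall>i\<in>{?m<..n}. z i = of_nat (n - i) * r + of_nat (\<kappa> i)"
      and small: "(\<Sum>v\<in>?V. a v) + tail_size n ?m \<kappa> < nat T"
    \<comment> \<open>Gaps of this size leave room for every v_i between consecutive even entries,
      and for the first tail entry below the last of them.\<close>
    define M where "M = \<kappa> (Suc ?m) + (\<Sum>v\<in>?V. a v)"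
    show "poly_eval z S = 0"
    proof (rule vanishing_on_chamber[of ?U z "\<lambda>i. of_nat (n - i) * r" M S z])
      fix y :: "nat \<Rightarrow> 'k" and h
      assume y: "\<forall>i. i \<notin> ?U \<longrightarrow> y i = z i" "\<forall>i\<in>?U. y i = of_nat (n - i) * r + of_nat (h i)"
        and h: "\<forall>i\<in>?U. M \<le> h i" "\<forall>i\<in>?U. \<forall>l\<in>?U. i < l \<longrightarrow> h l + M \<le> h i"
      define H where "H i = (if i \<in> ?V then a i + h (Suc i) else h i)" for i
      let ?\<mu> = "\<lambda>i. if i \<in> {1..?m} then int (H i) else int (\<kappa> i)"
      have aM: "a v \<le> M" if "v \<in> ?V" for v
      proof -
        have "a v \<le> (\<Sum>v\<in>?V. a v)" using that by (intro member_le_sum) auto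
        then show ?thesis by (simp add: M_def)
      qed
      have SucV: "Suc v \<in> ?U" if "v \<in> ?V" for v
      proof -
        have "v \<le> 2 * j" "odd v" using that by auto
        then have "Suc v \<le> 2 * j" by presburger
        then show ?thesis using \<open>odd v\<close> by simp
      qed
      have dec: "H (Suc i) \<le> H i" if i: "i \<in> {1..<?m}" for i
      proof (cases "odd i")
        case True
        then show ?thesis using i by (simp add: H_def)
      next
        case False
        then have V: "Suc i \<in> ?V" and U: "i \<in> ?U" using i by auto
        then have "h (Suc (Suc i)) + M \<le> h i" using h(2) SucV[OF V] by simp
        then show ?thesis using aM[OF V] V False unfolding H_def by simp
      qed
      have Lam: "?\<mu> \<in> Lam n"
      proof (rule partition_head_tail[OF \<kappa> j, where h = H])
        show "H (Suc i) \<le> H i" if "i \<in> {1..<?m}" for i by (rule dec[OF that])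
        assume "?m \<ge> 1"
        then have U: "?m \<in> ?U" and V: "?m \<notin> ?V" by auto
        have "M \<le> h ?m" using h(1) U by (rule bspec)
        moreover have "H ?m = h ?m" using V unfolding H_def by (simp only: if_False)
        ultimately show "\<kappa> (Suc ?m) \<le> H ?m" unfolding M_def by linarith
      qed
      have "(if i \<in> ?V then y i + r + y (i + 1) else y i) = shifted n r ?\<mu> i" if i: "i \<in> {1..n}" for i
      proof (cases "i \<in> ?V")
        case True
        have U: "Suc i \<in> ?U" by (rule SucV[OF True])
        then have "n - i = Suc (n - Suc i)" using j by auto
        then have "of_nat (n - i) = (of_nat (n - Suc i) + 1 :: 'k)" by (simp only: of_nat_Suc add.commute)
        moreover have "y i = of_nat (a i)" using y(1) zV True by auto
        moreover have "y (i + 1) = of_nat (n - Suc i) * r + of_nat (h (Suc i))" using y(2) U by simp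
        moreover have "i \<in> {1..?m}" using True by simp
        ultimately show ?thesis using True by (simp add: shifted_def H_def algebra_simps del: mem_Collect_eq)
      next
        case False
        show ?thesis
        proof (cases "i \<in> ?U")
          case True
          then show ?thesis using False y(2) by (auto simp: shifted_def H_def)
        next
          case nU: False
          then have "i \<in> {?m<..n}" using i False by auto
          then show ?thesis using nU False y(1) z by (auto simp: shifted_def)
        qed
      qed
      then have eq: "poly_eval y S = poly_eval (shifted n r ?\<mu>) f"
        unfolding evalS by (rule poly_eval_cong_vars[OF f_props(1)])
      show "poly_eval y S = 0"
      proof (rule ccontr)
        assume "poly_eval y S \<noteq> 0"
        then have le: "lam i \<le> ?\<mu> i" and br: "bracket n lam 1 \<le> bracket n ?\<mu> 1" for i
          using extra[OF Lam] eq by simp_all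
        have "tl lam \<le> tl (\<lambda>i. int (\<kappa> i))" unfolding tl_def
        proof (rule sum_mono)
          fix i assume "i \<in> {i \<in> {?m<..n}. even (i - ?m)}"
          then show "lam i \<le> int (\<kappa> i)" using le[of i] by auto
        qed
        \<comment> \<open>In the head each pair contributes exactly its v_i; adding the even tail
          entries cancels their negative sign.\<close>
        moreover have "bracket n ?\<mu> 1 + tl (\<lambda>i. int (\<kappa> i)) = int ((\<Sum>v\<in>?V. a v) + tail_size n ?m \<kappa>)"
        proof -
          have "(\<Sum>i \<in> {i \<in> {?m<..n}. odd (i - ?m)}. ?\<mu> i) = int (tail_size n ?m \<kappa>)"
            unfolding tail_size_def of_nat_sum by (intro sum.cong) auto
          moreover have "(\<Sum>i \<in> {i \<in> {?m<..n}. even (i - ?m)}. ?\<mu> i) = tl (\<lambda>i. int (\<kappa> i))"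
            unfolding tl_def by (intro sum.cong) auto
          moreover have "(\<Sum>i\<in>?V. ?\<mu> i) = (\<Sum>i\<in>?V. int (a i)) + (\<Sum>i\<in>?V. int (h (Suc i)))"
            unfolding sum.distrib[symmetric] by (intro sum.cong) (auto simp: H_def)
          moreover have "(\<Sum>i\<in>?U. ?\<mu> i) = (\<Sum>i\<in>?U. int (h i))"
            by (intro sum.cong) (auto simp: H_def)
          ultimately show ?thesis
            unfolding bracket_1[OF n] odd_size_def tail_split(1)[OF j em, of ?\<mu>]
              tail_split(2)[OF j em, of ?\<mu>] of_nat_add of_nat_sum
            using sum_pairs[of "\<lambda>i. int (h i)" j] by linarith
        qed
        ultimately have "T \<le> int ((\<Sum>v\<in>?V. a v) + tail_size n ?m \<kappa>)" using br T by simp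
        then show False using small by linarith
      qed
    qed auto
  qed
  then have "wle (chi ?U) (d - nat T) S" unfolding wle_def
  proof (intro ballI)
    fix k' assume "k' \<in> kys S"
    from bound[OF this] show "wdeg (chi ?U) k' \<le> d - nat T" by simp
  qed
  \<comment> \<open>Undoes the translation by r and performs the change of coordinates in the
    remaining pairs. Weights are not raised, as the variables i + 1 added here have index above
    2j.\<close>
  define s2 :: "nat \<Rightarrow> 'k mpoly" where
    "s2 i = (if i \<in> ?V then X i - Const r else if odd i \<and> (i + 1) div 2 \<le> n div 2 then X i + X (i + 1) else X i)" for i
  have "poly_subst (cs (n div 2)) f = poly_subst s2 S"
  proof (rule poly_eval_eqI)
    fix z
    have "poly_eval (\<lambda>i. poly_eval z (s2 i)) S = poly_eval (\<lambda>i. poly_eval z (cs (n div 2) i)) f"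
      unfolding evalS
    proof (rule arg_cong[where f="\<lambda>x. poly_eval x f"], rule ext)
      fix i
      show "(if i \<in> ?V then poly_eval z (s2 i) + r + poly_eval z (s2 (i + 1)) else poly_eval z (s2 i)) =
        poly_eval z (cs (n div 2) i)"
      proof (cases "i \<in> ?V")
        case True
        then have "odd i" "i \<le> 2 * j" by auto
        then have "i + 1 \<le> 2 * j" by presburger
        then have "i + 1 \<le> n" using j by simp
        then have "(i + 1) div 2 \<le> n div 2" "i + 1 \<notin> ?V" using \<open>odd i\<close> by (simp only: div_le_mono, simp)
        then show ?thesis using True \<open>odd i\<close> by (simp add: s2_def cs_def)
      next
        case False
        then show ?thesis by (simp add: s2_def cs_def del: mem_Collect_eq)
      qed
    qed
    then show "poly_eval z (poly_subst (cs (n div 2)) f) = poly_eval z (poly_subst s2 S)"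
      by (simp add: poly_eval_subst)
  qed
  moreover have "wle (chi ?U) (d - nat T) (poly_subst s2 S)"
  proof (rule wle_subst[OF \<open>wle (chi ?U) (d - nat T) S\<close>])
    fix i show "wle (chi ?U) (chi ?U i) (s2 i)"
    proof (cases "odd i \<and> i \<notin> ?V")
      case True
      moreover have "i \<ge> 1" using True by (cases i) auto
      ultimately have "i + 1 \<notin> ?U" by auto
      then show ?thesis using True by (auto simp: s2_def chi_def intro!: wle_add wle_X)
    next
      case False
      then show ?thesis by (auto simp: s2_def chi_def intro!: wle_diff wle_X)
    qed
  qed
  ultimately have "wdeg (chi ?U) k \<le> d - nat T" using k by (simp add: wle_def)
  moreover have "0 \<le> even_sum j lam" unfolding even_sum_def by (intro sum_nonneg Lam_nonneg[OF lam(1)])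
  then have "int (d - nat T) = even_sum j lam" using T0 by (simp add: T_def)
  ultimately show ?thesis by linarith
qed

end

section \<open>The order on partitions\<close>

text \<open>Sum over i, i - 2, ..., without signs: the coefficient of \<epsilon>_i -
  \<epsilon>_{i+2} when v is written in these vectors.\<close>

definition alt_sum :: "(nat \<Rightarrow> int) \<Rightarrow> nat \<Rightarrow> int" where
  "alt_sum v i = (\<Sum>l \<in> {l \<in> {1..i}. even (i - l)}. v l)"

lemma alt_sum_simps: "alt_sum v 0 = 0" "alt_sum v 1 = v 1" "alt_sum v (Suc (Suc i)) = alt_sum v i + v (Suc (Suc i))"
proof -
  show "alt_sum v 0 = 0" by (simp add: alt_sum_def)
  have "{l \<in> {1..1}. even (1 - l)} = {1::nat}" by auto
  then show "alt_sum v 1 = v 1" unfolding alt_sum_def by (simp only: sum.insert sum.empty) simp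
  have "{l \<in> {1..Suc (Suc i)}. even (Suc (Suc i) - l)} = insert (Suc (Suc i)) {l \<in> {1..i}. even (i - l)}"
    by (auto simp: le_Suc_eq)
  then show "alt_sum v (Suc (Suc i)) = alt_sum v i + v (Suc (Suc i))" by (simp add: alt_sum_def)
qed

lemma Phi_plus_scale: "v \<in> Phi_plus n \<Longrightarrow> (\<lambda>l. int k * v l) \<in> Phi_plus n"
proof (induction k)
  case 0
  have "(\<lambda>l. int 0 * v l) = 0" by (auto simp: fun_eq_iff)
  then show ?case using Phi_plus.zero by simp
next
  case (Suc k)
  have "(\<lambda>l. int (Suc k) * v l) = v + (\<lambda>l. int k * v l)" by (auto simp: fun_eq_iff algebra_simps)
  then show ?case using Suc by (simp add: Phi_plus.add)
qed

lemma Phi_plus_sum: "finite I \<Longrightarrow> (\<And>i. i \<in> I \<Longrightarrow> g i \<in> Phi_plus n) \<Longrightarrow> (\<lambda>l. \<Sum>i\<in>I. g i l) \<in> Phi_plus n"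
proof (induction I rule: finite_induct)
  case empty
  have "(\<lambda>l. \<Sum>i\<in>{}. g i l) = 0" by (auto simp: fun_eq_iff)
  then show ?case using Phi_plus.zero by simp
next
  case (insert i I)
  have "(\<lambda>l. \<Sum>i\<in>insert i I. g i l) = g i + (\<lambda>l. \<Sum>i\<in>I. g i l)" using insert.hyps by (auto simp: fun_eq_iff)
  then show ?case using insert by (simp add: Phi_plus.add)
qed

text \<open>Summation by parts within each parity class; the conditions \<open>last\<close> say that
  the totals of both classes are 0.\<close>

lemma Phi_plusI:
  assumes v: "\<And>i. i \<notin> {1..n} \<Longrightarrow> v i = 0" and nonneg: "\<And>i. i + 2 \<le> n \<Longrightarrow> 0 \<le> alt_sum v i"
    and last: "alt_sum v n = 0" "alt_sum v (n - 1) = 0"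
  shows "v \<in> Phi_plus n"
proof -
  let ?I = "{i \<in> {1..n}. i + 2 \<le> n}"
  let ?g = "\<lambda>i l. int (nat (alt_sum v i)) * (std_basis i - std_basis (i + 2)) l"
  have "(\<lambda>l. \<Sum>i\<in>?I. ?g i l) \<in> Phi_plus n"
    by (rule Phi_plus_sum, simp, rule Phi_plus_scale, rule Phi_plus.gen) simp_all
  moreover have "(\<lambda>l. \<Sum>i\<in>?I. ?g i l) = v"
  proof
    fix l
    have "(\<Sum>i\<in>?I. ?g i l) = (\<Sum>i\<in>?I. (if i = l then alt_sum v i else 0) - (if i + 2 = l then alt_sum v i else 0))"
      using nonneg by (intro sum.cong refl) (auto simp: std_basis_def)
    also have "\<dots> = (if l \<in> ?I then alt_sum v l else 0) - (\<Sum>i\<in>?I. if i + 2 = l then alt_sum v i else 0)"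
      unfolding sum_subtractf by simp
    also have "(\<Sum>i\<in>?I. if i + 2 = l then alt_sum v i else 0) = (if l - 2 \<in> ?I \<and> l \<ge> 2 then alt_sum v (l - 2) else 0)"
    proof -
      have "(\<Sum>i\<in>?I. if i + 2 = l then alt_sum v i else 0) = (\<Sum>i\<in>?I. if i = l - 2 \<and> l \<ge> 2 then alt_sum v i else 0)"
        by (intro sum.cong refl) auto
      then show ?thesis by (cases "l \<ge> 2") auto
    qed
    also have "(if l \<in> ?I then alt_sum v l else 0) = (if l \<in> {1..n} then alt_sum v l else 0)"
    proof -
      have "l = n \<or> l = n - 1" if "l \<in> {1..n}" "\<not> l + 2 \<le> n" using that by auto
      then show ?thesis using last by auto
    qed
    also have "(if l - 2 \<in> ?I \<and> l \<ge> 2 then alt_sum v (l - 2) else 0) = (if l \<in> {1..n} \<and> l \<ge> 2 then alt_sum v (l - 2) else 0)"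
      by (auto simp: alt_sum_simps(1) le_less numeral_2_eq_2 Suc_le_eq)
    also have "(if l \<in> {1..n} then alt_sum v l else 0) - \<dots> = v l"
    proof (cases "l \<in> {1..n}")
      case True
      then consider "l = 1" | l' where "l = Suc (Suc l')" by (metis One_nat_def atLeastAtMost_iff not0_implies_Suc not_one_le_zero)
      then show ?thesis using True alt_sum_simps(2)[of v] by cases (auto simp: alt_sum_simps)
    next
      case False
      then have "v l = 0" by (rule v)
      then show ?thesis using False by (simp del: atLeastAtMost_iff)
    qed
    finally show "(\<Sum>i\<in>?I. ?g i l) = v l" .
  qed
  ultimately show ?thesis by simp
qed

lemma Psi_zero_scale: "v \<in> Psi_zero n \<Longrightarrow> (\<lambda>l. int k * v l) \<in> Psi_zero n"
proof (induction k)
  case 0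
  have "(\<lambda>l. int 0 * v l) = 0" by (auto simp: fun_eq_iff)
  then show ?case using Psi_zero.zero by simp
next
  case (Suc k)
  have "(\<lambda>l. int (Suc k) * v l) = v + (\<lambda>l. int k * v l)" by (auto simp: fun_eq_iff algebra_simps)
  then show ?case using Suc by (simp add: Psi_zero.add)
qed

lemma std_basis_in_Psi_zero:
  assumes "odd l" "l \<in> {1..n}"
  shows "std_basis l \<in> Psi_zero n"
proof -
  have "std_basis 1 \<in> Lam n" using assms by (auto simp: Lam_def int_vecs_def std_basis_def)
  then have "std_basis 1 \<circ> transpose 1 l \<in> Psi_zero n"
    using assms by (intro Psi_zero.perm Psi_zero.Lam transpose_in_W') auto
  moreover have "std_basis 1 \<circ> transpose 1 l = std_basis l"
    by (auto simp: std_basis_def transpose_def fun_eq_iff)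
  ultimately show ?thesis by simp
qed

lemma std_basis_pair_in_Psi_zero:
  assumes "odd l" "l \<in> {1..n}" "even m" "m \<in> {1..n}"
  shows "std_basis l + std_basis m \<in> Psi_zero n"
proof -
  have n: "2 \<le> n" using assms(3,4) by (auto elim!: evenE)
  have "std_basis 1 + std_basis 2 \<in> Lam n" using n by (auto simp: Lam_def int_vecs_def std_basis_def)
  then have "((std_basis 1 + std_basis 2) \<circ> transpose 1 l) \<circ> transpose 2 m \<in> Psi_zero n"
    using assms n by (intro Psi_zero.perm Psi_zero.Lam transpose_in_W') auto
  moreover have "((std_basis 1 + std_basis 2) \<circ> transpose 1 l) \<circ> transpose 2 m = std_basis l + std_basis m"
  proof
    fix i
    have "l \<noteq> 2" "m \<noteq> 1" "l \<noteq> m" using assms(1,3) by auto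
    then show "(((std_basis 1 + std_basis 2) \<circ> transpose 1 l) \<circ> transpose 2 m) i = (std_basis l + std_basis m) i"
      by (auto simp: std_basis_def transpose_def)
  qed
  ultimately show ?thesis by simp
qed

lemma alt_sum_even_odd:
  shows "alt_sum v (2 * j) = even_sum j v" "alt_sum v (2 * j - 1) = (\<Sum>i\<in>Odds (2 * j). v i)"
proof -
  have "{l \<in> {1..2 * j}. even (2 * j - l)} = Evens (2 * j)" by auto
  then show "alt_sum v (2 * j) = even_sum j v" by (simp only: alt_sum_def even_sum_Evens)
  have "{l \<in> {1..2 * j - 1}. even (2 * j - 1 - l)} = Odds (2 * j)"
  proof (intro equalityI subsetI)
    fix l assume l: "l \<in> {l \<in> {1..2 * j - 1}. even (2 * j - 1 - l)}"
    then have "2 * j - 1 = l + (2 * j - 1 - l)" by auto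
    moreover have "odd (2 * j - 1)" using l by (cases j) auto
    ultimately have "odd l" using l by (metis (mono_tags, lifting) even_add mem_Collect_eq)
    then show "l \<in> Odds (2 * j)" using l by auto
  next
    fix l assume l: "l \<in> Odds (2 * j)"
    then have "odd l" "l \<le> 2 * j" by auto
    then have "l \<le> 2 * j - 1" by presburger
    moreover have "odd (2 * j - 1)" using l by (cases j) auto
    ultimately show "l \<in> {l \<in> {1..2 * j - 1}. even (2 * j - 1 - l)}" using l by auto
  qed
  then show "alt_sum v (2 * j - 1) = (\<Sum>i\<in>Odds (2 * j). v i)" by (simp only: alt_sum_def)
qed

lemma alt_sum_diff: "alt_sum (\<lambda>i. v i - w i) i = alt_sum v i - alt_sum w i"
  by (simp add: alt_sum_def sum_subtractf)

lemma alt_sum_single: "alt_sum (\<lambda>i. if i = l then c else 0) m = (if l \<in> {1..m} \<and> even (m - l) then c else 0)"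
  by (simp add: alt_sum_def)

text \<open>Let a and b be the excess of \<open>lam\<close> over \<mu> on odd and on even positions.
  Taking a and b away at the last odd and the last even position leaves a vector with total 0 in
  each class and nonnegative partial sums, hence in \<open>Phi_plus n\<close>. The part taken away
  is (a - b) \<epsilon>_l + b (\<epsilon>_l + \<epsilon>_m), which lies in \<open>Psi_zero n\<close>
  since 0 \<le> b \<le> a; here b \<le> a is the inequality for [\<mu>]_1.\<close>

lemma preceqI:
  assumes n: "n \<ge> 1" and Lam: "\<mu> \<in> Lam n" "lam \<in> Lam n"
    and A: "\<And>j. 2 * j \<le> n \<Longrightarrow> (\<Sum>i\<in>Odds (2 * j). \<mu> i) \<le> (\<Sum>i\<in>Odds (2 * j). lam i)"
    and A': "odd_size n \<mu> \<le> odd_size n lam"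
    and B: "\<And>j. 2 * j \<le> n \<Longrightarrow> even_sum j \<mu> \<le> even_sum j lam"
    and C: "bracket n \<mu> 1 \<le> bracket n lam 1"
  shows "preceq n \<mu> lam"
proof -
  define \<delta> where "\<delta> i = lam i - \<mu> i" for i
  define a where "a = odd_size n lam - odd_size n \<mu>"
  define b where "b = (\<Sum>i\<in>Evens n. lam i) - (\<Sum>i\<in>Evens n. \<mu> i)"
  define l where "l = (if odd n then n else n - 1)"
  \<comment> \<open>For n = 1 there is no even position; then m = 0 and b = 0, so the index 0 is
    harmless.\<close>
  define m where "m = (if even n then n else n - 1)"
  have lm: "odd l" "l \<in> {1..n}" "even m" using n by (auto simp: l_def m_def elim!: evenE)
  have mn: "m \<in> {1..n} \<or> (m = 0 \<and> n = 1)" using n by (auto simp: m_def)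
  have Ev: "Evens n = Evens (2 * (n div 2))" by (auto elim!: evenE)
  have b0: "0 \<le> b" using B[of "n div 2"] unfolding b_def even_sum_Evens Ev[symmetric] by simp
  have b1: "b = 0" if "m = 0"
  proof -
    have "n = 1" using that mn by auto
    then have "Evens n = {}" by auto
    then show ?thesis by (simp only: b_def sum.empty)
  qed
  have ab: "b \<le> a" using C unfolding bracket_1[OF n] a_def b_def by simp
  have a0: "0 \<le> a" using A' by (simp add: a_def)
  have altn: "alt_sum \<delta> l = a" "alt_sum \<delta> m = b"
  proof -
    have "{i \<in> {1..l}. even (l - i)} = Odds n" using lm n unfolding l_def by (auto simp: le_Suc_eq split: if_splits) presburger+
    then show "alt_sum \<delta> l = a" by (simp add: alt_sum_def \<delta>_def a_def odd_size_def sum_subtractf)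
    have "{i \<in> {1..m}. even (m - i)} = Evens n" using lm n unfolding m_def by (auto simp: le_Suc_eq split: if_splits) presburger+
    then show "alt_sum \<delta> m = b" by (simp add: alt_sum_def \<delta>_def b_def sum_subtractf)
  qed
  define \<phi> where "\<phi> i = \<delta> i - ((if i = l then a else 0) + (if i = m then b else 0))" for i
  have alt_sum\<phi>: "alt_sum \<phi> i = alt_sum \<delta> i - ((if l \<in> {1..i} \<and> even (i - l) then a else 0) + (if m \<in> {1..i} \<and> even (i - m) then b else 0))" for i
    unfolding \<phi>_def alt_sum_diff alt_sum_single[symmetric] by (simp add: alt_sum_def sum.distrib)
  have nn: "(n = l \<and> n - 1 = m) \<or> (n = m \<and> n - 1 = l)" by (auto simp: l_def m_def)
  have "\<phi> \<in> Phi_plus n"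
  proof (rule Phi_plusI)
    fix i assume "i \<notin> {1..n}"
    then show "\<phi> i = 0" using lm mn b1 Lam_zero_outside[OF Lam(1)] Lam_zero_outside[OF Lam(2)]
      by (auto simp: \<phi>_def \<delta>_def)
  next
    fix i assume i: "i + 2 \<le> n"
    then have "alt_sum \<phi> i = alt_sum \<delta> i" unfolding alt_sum\<phi> using nn by auto
    also have "0 \<le> alt_sum \<delta> i"
    proof (cases "even i")
      case True
      then obtain j where "i = 2 * j" by (elim evenE)
      then show ?thesis using B[of j] i unfolding \<delta>_def alt_sum_diff by (simp add: alt_sum_even_odd)
    next
      case False
      then obtain j where j: "i + 1 = 2 * j" by (metis even_Suc evenE Suc_eq_plus1)
      then have i': "i = 2 * j - 1" by simp
      have "2 * j \<le> n" using i j by simp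
      from A[OF this] show ?thesis unfolding \<delta>_def i' alt_sum_even_odd sum_subtractf by simp
    qed
    finally show "0 \<le> alt_sum \<phi> i" .
  next
    have "m = 0 \<Longrightarrow> alt_sum \<phi> m = 0" by (simp add: alt_sum_simps(1))
    moreover have "alt_sum \<phi> l = 0" unfolding alt_sum\<phi> altn using lm nn by auto
    moreover have "m \<noteq> 0 \<Longrightarrow> alt_sum \<phi> m = 0" unfolding alt_sum\<phi> altn using lm nn by auto
    ultimately show "alt_sum \<phi> n = 0" "alt_sum \<phi> (n - 1) = 0" using nn by metis+
  qed
  moreover define \<psi> where "\<psi> = (\<lambda>i. int (nat (a - b)) * std_basis l i) + (\<lambda>i. int (nat b) * (std_basis l + std_basis m) i)"
  moreover have "\<psi> \<in> Psi_zero n"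
  proof (cases "m = 0")
    case True
    then have "\<psi> = (\<lambda>i. int (nat (a - b)) * std_basis l i)" using b1 by (auto simp: \<psi>_def fun_eq_iff)
    then show ?thesis using Psi_zero_scale[OF std_basis_in_Psi_zero[OF lm(1,2)], of "nat (a - b)"] by (simp only:)
  next
    case False
    then have "m \<in> {1..n}" using mn by auto
    then show ?thesis unfolding \<psi>_def
      by (intro Psi_zero.add Psi_zero_scale std_basis_in_Psi_zero std_basis_pair_in_Psi_zero lm)
  qed
  moreover have "lam - \<mu> = \<psi> + \<phi>"
  proof
    fix i
    show "(lam - \<mu>) i = (\<psi> + \<phi>) i"
      using ab b0 by (auto simp: \<psi>_def \<phi>_def \<delta>_def std_basis_def algebra_simps)
  qed
  ultimately show ?thesis unfolding preceq_def by blast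
qed

text \<open>After [v]_1 the entries pair up by [v]_{2a} + [v]_{2a+1} = v_{2a}.\<close>

lemma bracket_prefix_odd:
  "2 * j + 1 \<le> n \<Longrightarrow> (\<Sum>i = 1..2 * j + 1. bracket n v i) = bracket n v 1 + even_sum j v"
proof (induction j)
  case (Suc j)
  have "(\<Sum>i = 1..2 * Suc j + 1. bracket n v i) =
    (\<Sum>i = 1..2 * j + 1. bracket n v i) + bracket n v (2 * j + 2) + bracket n v (Suc (2 * j + 2))"
    by (simp add: numeral_eq_Suc)
  also have "\<dots> = bracket n v 1 + even_sum j v + v (2 * j + 2)"
    using Suc bracket_rec[of "2 * j + 2" n v] by simp
  finally show ?case by (simp add: even_sum_def)
qed (simp add: even_sum_def)

text \<open>The inequalities of \<open>preceqI\<close>, imposed on the difference of two partitions.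
  They are additive, so it suffices to check them on the two monoids.\<close>

definition good_vec :: "nat \<Rightarrow> (nat \<Rightarrow> int) \<Rightarrow> bool" where
  "good_vec n v \<longleftrightarrow> (\<forall>j. 2 * j \<le> n \<longrightarrow> 0 \<le> (\<Sum>i\<in>Odds (2 * j). v i)) \<and> 0 \<le> odd_size n v \<and>
     (\<forall>j. 2 * j \<le> n \<longrightarrow> 0 \<le> even_sum j v) \<and> 0 \<le> odd_size n v - (\<Sum>i\<in>Evens n. v i)"

lemma good_vec_add: "good_vec n v \<Longrightarrow> good_vec n w \<Longrightarrow> good_vec n (v + w)"
  by (simp add: good_vec_def odd_size_def even_sum_def sum.distrib)

lemma good_vec_zero: "good_vec n 0"
  by (simp add: good_vec_def odd_size_def even_sum_def)

lemma good_vec_Phi_plus: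
  assumes "v \<in> Phi_plus n"
  shows "good_vec n v"
  using assms
proof induction
  case (gen i)
  have s: "(\<Sum>l\<in>S. (std_basis i - std_basis (i + 2)) l) = (if i \<in> S then 1 else 0) - (if i + 2 \<in> S then 1 else 0)"
    if "finite S" for S
    using that by (simp add: std_basis_def sum_subtractf)
  have e: "even_sum j (std_basis i - std_basis (i + 2)) = (\<Sum>l\<in>Evens (2 * j). (std_basis i - std_basis (i + 2)) l)" for j
    by (rule even_sum_Evens)
  show ?case unfolding good_vec_def odd_size_def e
    by (subst s, simp)+ (use gen in auto)
qed (rule good_vec_zero, rule good_vec_add)

text \<open>The partial sums in \<open>good_vec\<close> are not stable under \<open>W n\<close>. An
  induction along \<open>Psi_zero n\<close> therefore needs a stable property that implies them:
  nonnegative entries, together with the inequality between the totals of the two classes.\<close>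

lemma Psi_zero_props:
  assumes "v \<in> Psi_zero n" "n \<ge> 1"
  shows "(\<forall>i. 0 \<le> v i) \<and> 0 \<le> odd_size n v - (\<Sum>i\<in>Evens n. v i)"
  using assms(1)
proof induction
  case (Lam v)
  have "0 \<le> bracket n v 1" using lookup_lexp[OF Lam, of 1] by (metis of_nat_0_le_iff)
  then show ?case using Lam_nonneg[OF Lam] bracket_1[OF assms(2), of v] by simp
next
  case (perm v \<pi>)
  have "(\<Sum>i\<in>A. (v \<circ> \<pi>) i) = (\<Sum>i\<in>A. v i)" if "\<pi> ` A = A" for A
    using sum.reindex[OF W_image(3)[OF perm.hyps(2)], of v A] that by simp
  then show ?case using perm W_image(1,2)[OF perm.hyps(2)] by (simp add: odd_size_def)
qed (auto simp: odd_size_def sum.distrib)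

lemma good_vec_Psi_zero:
  assumes "v \<in> Psi_zero n" "n \<ge> 1"
  shows "good_vec n v"
  using Psi_zero_props[OF assms] unfolding good_vec_def odd_size_def even_sum_def
  by (auto intro!: sum_nonneg)

lemma preceqD:
  assumes "preceq n \<mu> lam" "n \<ge> 1"
  shows "m \<le> n \<Longrightarrow> (\<Sum>i = 1..m. bracket n \<mu> i) \<le> (\<Sum>i = 1..m. bracket n lam i)"
    "2 * j \<le> n \<Longrightarrow> even_sum j \<mu> \<le> even_sum j lam"
proof -
  obtain \<psi> \<phi> where *: "\<psi> \<in> Psi_zero n" "\<phi> \<in> Phi_plus n" "lam - \<mu> = \<psi> + \<phi>"
    using assms(1) by (auto simp: preceq_def)
  have good: "good_vec n (lam - \<mu>)"
    unfolding *(3) by (intro good_vec_add good_vec_Phi_plus good_vec_Psi_zero * assms(2))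
  show B: "even_sum j \<mu> \<le> even_sum j lam" if "2 * j \<le> n" for j
    using good that unfolding good_vec_def by (simp add: even_sum_def sum_subtractf)
  assume m: "m \<le> n"
  show "(\<Sum>i = 1..m. bracket n \<mu> i) \<le> (\<Sum>i = 1..m. bracket n lam i)"
  proof (cases "even m")
    case True
    then obtain j where j: "m = 2 * j" by (elim evenE)
    have "(\<Sum>i\<in>Odds (2 * j). \<mu> i) \<le> (\<Sum>i\<in>Odds (2 * j). lam i)"
      using good m j unfolding good_vec_def by (simp add: sum_subtractf)
    then show ?thesis using bracket_prefix[OF m, of \<mu>] bracket_prefix[OF m, of lam] True j by simp
  next
    case False
    then obtain j where j: "m = 2 * j + 1" by (elim oddE)
    have "bracket n \<mu> 1 \<le> bracket n lam 1"
      using good unfolding good_vec_def bracket_1[OF assms(2)] by (simp add: odd_size_def sum_subtractf)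
    then show ?thesis using B[of j] m bracket_prefix_odd[of j n \<mu>] bracket_prefix_odd[of j n lam] j by simp
  qed
qed

section \<open>Support of the expansion for generic parameters\<close>

lemma generic_iff_not_negative_rational:
  fixes r :: "'k::field_char_0"
  shows "generic r \<longleftrightarrow> \<not> (\<exists>q::rat. q < 0 \<and> r = of_rat q)"
proof
  assume g: "generic r"
  show "\<not> (\<exists>q::rat. q < 0 \<and> r = of_rat q)"
  proof (intro notI, elim exE conjE)
    fix q :: rat assume q: "q < 0" "r = of_rat q"
    obtain a b where ab: "quotient_of q = (a, b)" by fastforce
    then have b: "b > 0" and qab: "q = of_int a / of_int b"
      by (rule quotient_of_denom_pos, rule quotient_of_div)
    have "a < 0" using q(1) b unfolding qab by (simp add: divide_less_0_iff)
    have "of_int b * r + of_int (- a) = (0 :: 'k)"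
      using b unfolding q(2) qab by (simp add: of_rat_divide)
    then have "of_nat (nat b) * r + of_nat (nat (- a)) = (0 :: 'k)"
      using b \<open>a < 0\<close> by simp
    moreover have "0 < nat (- a)" using \<open>a < 0\<close> by simp
    ultimately show False using g unfolding generic_def by blast
  qed
next
  assume *: "\<not> (\<exists>q::rat. q < 0 \<and> r = of_rat q)"
  show "generic r" unfolding generic_def
  proof (intro allI impI notI)
    fix a b :: nat assume b: "0 < b" and eq: "of_nat a * r + of_nat b = (0 :: 'k)"
    have a: "a \<noteq> 0"
    proof
      assume "a = 0"
      then show False using eq b by simp
    qed
    have "r = - (of_nat b / of_nat a)"
      using eq a by (simp add: field_simps eq_neg_iff_add_eq_0)
    also have "\<dots> = of_rat (- (of_nat b / of_nat a))"
      by (simp add: of_rat_minus of_rat_divide)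
    finally have "r = of_rat (- (of_nat b / of_nat a))" .
    moreover have "- (of_nat b / of_nat a) < (0 :: rat)" using a b by simp
    ultimately show False using * by blast
  qed
qed

lemma wdeg_prefix_lexp:
  assumes "\<mu> \<in> Lam n"
  shows "int (wdeg (chi {1..m}) (lexp n \<mu>)) = (\<Sum>i = 1..m. bracket n \<mu> i)"
proof -
  have "(\<Sum>i = 1..n. int (chi {1..m} i) * bracket n \<mu> i) = (\<Sum>i\<in>{1..n}. if i \<in> {1..m} then bracket n \<mu> i else 0)"
    by (intro sum.cong) (auto simp: chi_def)
  also have "\<dots> = (\<Sum>i = 1..m. if i \<in> {1..n} then bracket n \<mu> i else 0)"
    by (simp only: sum.inter_restrict[symmetric] finite_atLeastAtMost Int_commute)
  also have "\<dots> = (\<Sum>i = 1..m. bracket n \<mu> i)"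
    by (intro sum.cong) (auto simp: bracket_def)
  finally show ?thesis by (simp only: wdeg_lexp[OF assms])
qed

lemma even_sum_nonneg: "v \<in> Lam n \<Longrightarrow> 0 \<le> even_sum j v"
  unfolding even_sum_def by (intro sum_nonneg Lam_nonneg[of v n])

lemma Inv_expansion:
  fixes b :: "(nat \<Rightarrow> int) \<Rightarrow> 'k::field_char_0"
  shows "Inv n d (\<Sum>\<mu>\<in>LamD n d. Const (b \<mu>) * elem_semisym_prod n \<mu>)"
proof (rule Inv_sum, rule Inv_smult)
  fix \<nu> assume "\<nu> \<in> LamD n d"
  then have "\<nu> \<in> Lam n" "nat (odd_size n \<nu>) \<le> d" by (auto simp: LamD_def)
  then show "Inv n d (elem_semisym_prod n \<nu> :: 'k mpoly)" by (rule Inv_mono[OF Inv_elem_semisym_prod])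
qed

text \<open>Only vanishing conditions are assumed, no normalisation, so that the lemma also applies
  to the specialisations \<open>f t\<close> in \<open>expansion_preceq\<close>.\<close>

lemma expansion_support:
  fixes b :: "(nat \<Rightarrow> int) \<Rightarrow> 'k::field_char_0"
  assumes n: "n \<ge> 1" and r: "generic r" "r \<noteq> 0"
    and lam: "lam \<in> Lam n" "odd_size n lam = int d"
    and zero: "\<And>\<mu>. \<mu> \<in> Lam n \<Longrightarrow> odd_size n \<mu> \<le> int d \<Longrightarrow> \<mu> \<noteq> lam \<Longrightarrow>
      poly_eval (shifted n r \<mu>) (\<Sum>\<mu>\<in>LamD n d. Const (b \<mu>) * elem_semisym_prod n \<mu>) = 0"
    and \<mu>: "\<mu> \<in> LamD n d" "b \<mu> \<noteq> 0"
  shows "preceq n \<mu> lam"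
proof -
  define f where "f = (\<Sum>\<mu>\<in>LamD n d. Const (b \<mu>) * elem_semisym_prod n \<mu>)"
  have M: "finite (LamD n d)" "LamD n d \<subseteq> Lam n" by (rule finite_LamD) (auto simp: LamD_def)
  have \<mu>L: "\<mu> \<in> Lam n" and size: "odd_size n \<mu> \<le> odd_size n lam" using \<mu> lam by (auto simp: LamD_def)
  have f: "Inv n d f" unfolding f_def by (rule Inv_expansion)
  have prefix: "(\<Sum>i = 1..m. bracket n \<mu> i) \<le> int d - (\<Sum>i \<in> {i \<in> {m<..n}. odd (i - m)}. lam i)"
    if m: "m \<le> n" for m
  proof -
    have "\<exists>k\<in>kys (poly_subst (cs 0) f). wdeg (chi {1..m}) (lexp n \<mu>) \<le> wdeg (chi {1..m}) k"
      unfolding f_def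
    proof (rule expansion_top_key[where E = "lexp n" and b = b and \<mu> = \<mu>, OF M lead_elem_semisym_prod inj_lexp _ \<mu>])
      fix \<nu>
      show "wle (chi {1..m}) (wdeg (chi {1..m}) (lexp n \<nu>)) (poly_subst (cs 0) (elem_semisym_prod n \<nu> :: 'k mpoly))"
        by (rule wle_elem_semisym_prod) (rule wle_prefix_elem_semisym[OF _ m])
    qed
    then obtain k where "k \<in> kys f" "wdeg (chi {1..m}) (lexp n \<mu>) \<le> wdeg (chi {1..m}) k"
      unfolding cs_zero poly_subst_id by blast
    with prefix_degree[OF n r f lam zero[folded f_def] m] wdeg_prefix_lexp[OF \<mu>L, of m] show ?thesis by fastforce
  qed
  have even: "even_sum j \<mu> \<le> even_sum j lam" if j: "2 * j \<le> n" for j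
  proof -
    have "wle (chi (Evens (2 * j))) (nat (even_sum j lam)) (poly_subst (cs (n div 2)) f)"
      unfolding wle_def
    proof
      fix k assume "k \<in> kys (poly_subst (cs (n div 2)) f)"
      from even_degree[OF n r f lam zero[folded f_def] j this]
      show "wdeg (chi (Evens (2 * j))) k \<le> nat (even_sum j lam)" by simp
    qed
    then have le: "wle (chi {1..j}) (nat (even_sum j lam)) (poly_subst (cs2 n) f)"
      unfolding poly_subst_cs2 by (rule wle_ren[OF _ j])
    have "\<exists>k\<in>kys (poly_subst (cs2 n) f). wdeg (chi {1..j}) (exp2 n \<mu>) \<le> wdeg (chi {1..j}) k"
      unfolding f_def
    proof (rule expansion_top_key[where E = "exp2 n" and b = b and \<mu> = \<mu>, OF M lead_elem_semisym_prod2 inj_exp2 _ \<mu>])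
      fix \<nu> assume "\<nu> \<in> LamD n d"
      then have \<nu>: "\<nu> \<in> Lam n" by (simp add: LamD_def)
      have "wdeg (chi {1..j}) (exp2 n \<nu>) = nat (even_sum j \<nu>)" using wdeg_exp2[OF \<nu> j] by simp
      then show "wle (chi {1..j}) (wdeg (chi {1..j}) (exp2 n \<nu>)) (poly_subst (cs2 n) (elem_semisym_prod n \<nu> :: 'k mpoly))"
        unfolding poly_subst_cs2 by (simp only: wle_ren[OF wle_even_elem_semisym_prod[OF \<nu> j] j])
    qed
    then have "wdeg (chi {1..j}) (exp2 n \<mu>) \<le> nat (even_sum j lam)" using le unfolding wle_def by fastforce
    then show ?thesis using wdeg_exp2[OF \<mu>L j] even_sum_nonneg[OF lam(1), of j] by simp
  qed
  show ?thesis
  proof (rule preceqI[OF n \<mu>L lam(1) _ size even])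
    fix j assume j: "2 * j \<le> n"
    have "(\<Sum>i\<in>Odds (2 * j). lam i) + (\<Sum>i \<in> {i \<in> {2 * j<..n}. odd (i - 2 * j)}. lam i) = int d"
      using tail_split(1)[OF j, of lam] lam(2) unfolding odd_size_def by simp
    then show "(\<Sum>i\<in>Odds (2 * j). \<mu> i) \<le> (\<Sum>i\<in>Odds (2 * j). lam i)"
      using prefix[OF j] bracket_prefix[OF j, of \<mu>] by simp
  next
    have "{i \<in> {1<..n}. odd (i - 1)} = Evens n" by auto
    then show "bracket n \<mu> 1 \<le> bracket n lam 1"
      using prefix[OF n] lam(2) unfolding bracket_1[OF n, of lam] by simp
  qed
qed

text \<open>Gaussian elimination without division: the row \<open>\<kappa>\<close> is eliminated by
  cross-multiplication with a pivot, which works over the domain k[t].\<close>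

lemma underdetermined_system:
  fixes A :: "'a \<Rightarrow> 'b \<Rightarrow> 'c::idom"
  assumes "finite K" "finite M" "card K < card M"
  shows "\<exists>v. (\<forall>\<kappa>\<in>K. (\<Sum>\<mu>\<in>M. A \<kappa> \<mu> * v \<mu>) = 0) \<and> (\<exists>\<mu>\<in>M. v \<mu> \<noteq> 0)"
  using assms
proof (induction K arbitrary: M A rule: finite_induct)
  case empty
  then obtain \<mu> where "\<mu> \<in> M" by fastforce
  then show ?case by (intro exI[of _ "\<lambda>_. 1"]) auto
next
  case (insert \<kappa> K)
  show ?case
  proof (cases "\<forall>\<mu>\<in>M. A \<kappa> \<mu> = 0")
    case True
    have "card K < card M" using insert.prems insert.hyps by simp
    from insert.IH[OF insert.prems(1) this, of A] True show ?thesis by auto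
  next
    case False
    then obtain \<mu>0 where \<mu>0: "\<mu>0 \<in> M" "A \<kappa> \<mu>0 \<noteq> 0" by blast
    define N where "N = M - {\<mu>0}"
    have M: "M = insert \<mu>0 N" "\<mu>0 \<notin> N" "finite N" using \<mu>0 insert.prems by (auto simp: N_def)
    have "card K < card N" using insert.prems insert.hyps M by simp
    from insert.IH[OF M(3) this, of "\<lambda>\<kappa>' \<mu>. A \<kappa> \<mu>0 * A \<kappa>' \<mu> - A \<kappa>' \<mu>0 * A \<kappa> \<mu>"]
    obtain v where v: "\<And>\<kappa>'. \<kappa>' \<in> K \<Longrightarrow> (\<Sum>\<mu>\<in>N. (A \<kappa> \<mu>0 * A \<kappa>' \<mu> - A \<kappa>' \<mu>0 * A \<kappa> \<mu>) * v \<mu>) = 0"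
      "\<exists>\<mu>\<in>N. v \<mu> \<noteq> 0" by blast
    \<comment> \<open>The value at \<open>\<mu>0\<close> is chosen to satisfy the row
      \<open>\<kappa>\<close>; the other values are scaled by the pivot to avoid a quotient.\<close>
    define w where "w \<mu> = (if \<mu> = \<mu>0 then - (\<Sum>\<mu>\<in>N. A \<kappa> \<mu> * v \<mu>) else A \<kappa> \<mu>0 * v \<mu>)" for \<mu>
    have w: "(\<Sum>\<mu>\<in>M. A \<kappa>' \<mu> * w \<mu>) = (\<Sum>\<mu>\<in>N. (A \<kappa> \<mu>0 * A \<kappa>' \<mu> - A \<kappa>' \<mu>0 * A \<kappa> \<mu>) * v \<mu>)" for \<kappa>'
    proof -
      have "(\<Sum>\<mu>\<in>N. A \<kappa>' \<mu> * w \<mu>) = (\<Sum>\<mu>\<in>N. A \<kappa> \<mu>0 * A \<kappa>' \<mu> * v \<mu>)"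
        using M(2) by (intro sum.cong) (auto simp: w_def)
      moreover have "A \<kappa>' \<mu>0 * w \<mu>0 = - (\<Sum>\<mu>\<in>N. A \<kappa>' \<mu>0 * A \<kappa> \<mu> * v \<mu>)"
        by (simp add: w_def sum_distrib_left mult.assoc)
      ultimately show ?thesis
        using M by (simp add: sum_subtractf left_diff_distrib)
    qed
    have "(\<Sum>\<mu>\<in>M. A \<kappa> \<mu> * w \<mu>) = 0" unfolding w by (simp add: mult.commute)
    moreover have "\<exists>\<mu>\<in>M. w \<mu> \<noteq> 0" using v(2) M \<mu>0 by (auto simp: w_def)
    ultimately show ?thesis using w v(1) by (intro exI[of _ w]) auto
  qed
qed

text \<open>Dividing by the largest common power of t keeps the specialisation at t = 0 from being
  trivial.\<close>

lemma normalize_at_0: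
  fixes v :: "'a \<Rightarrow> 'k::field poly"
  assumes "finite M" "\<exists>\<mu>\<in>M. v \<mu> \<noteq> 0"
  shows "\<exists>w c. c \<noteq> 0 \<and> (\<forall>\<mu>\<in>M. v \<mu> = c * w \<mu>) \<and> (\<exists>\<mu>\<in>M. poly (w \<mu>) 0 \<noteq> 0)"
  using assms(2)
proof (induction "\<Sum>\<mu>\<in>M. degree (v \<mu>)" arbitrary: v rule: less_induct)
  case less
  show ?case
  proof (cases "\<exists>\<mu>\<in>M. poly (v \<mu>) 0 \<noteq> 0")
    case True
    then show ?thesis by (intro exI[of _ v] exI[of _ 1]) auto
  next
    case False
    have "\<exists>q. v \<mu> = [:0, 1:] * q" if "\<mu> \<in> M" for \<mu>
      using False that poly_eq_0_iff_dvd[of "v \<mu>" 0] by (auto elim!: dvdE)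
    then obtain w where w: "\<And>\<mu>. \<mu> \<in> M \<Longrightarrow> v \<mu> = [:0, 1:] * w \<mu>" by metis
    have le: "degree (w \<mu>) \<le> degree (v \<mu>)" if "\<mu> \<in> M" for \<mu> using w[OF that] by (cases "w \<mu> = 0") simp_all
    from less.prems obtain \<mu>1 where \<mu>1: "\<mu>1 \<in> M" "v \<mu>1 \<noteq> 0" by blast
    then have "w \<mu>1 \<noteq> 0" using w by auto
    then have "degree (w \<mu>1) < degree (v \<mu>1)" using w[OF \<mu>1(1)] by simp
    then have "(\<Sum>\<mu>\<in>M. degree (w \<mu>)) < (\<Sum>\<mu>\<in>M. degree (v \<mu>))"
      using assms(1) \<mu>1(1) le by (intro sum_strict_mono_ex1) auto
    from less.hyps[OF this] \<open>w \<mu>1 \<noteq> 0\<close> \<mu>1(1)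
    obtain w' c where w': "c \<noteq> 0" "\<forall>\<mu>\<in>M. w \<mu> = c * w' \<mu>" "\<exists>\<mu>\<in>M. poly (w' \<mu>) 0 \<noteq> 0" by blast
    have "\<forall>\<mu>\<in>M. v \<mu> = ([:0, 1:] * c) * w' \<mu>"
      using w w'(2) by (simp only: mult.assoc ball_simps) simp
    moreover have "[:0, 1:] * c \<noteq> 0" using w'(1) by simp
    ultimately show ?thesis using w'(3) by blast
  qed
qed

section \<open>Deformation of the parameter to zero\<close>

text \<open>At r = 0 equal entries of the same parity give equal coordinates, where the operator is
  undefined; but 0 is still generic, so uniqueness of interpolation holds. Omitting the condition at
  \<open>lam\<close> leaves one equation fewer than unknowns, hence a nonzero solution over k[t],
  and by uniqueness R is a multiple of its value at t = 0.\<close>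

theorem expansion_preceq:
  fixes r :: "'k::field_char_0"
  assumes n: "n \<ge> 1" and r: "generic r" and R: "Inv n d R"
    and lam: "lam \<in> Lam n" "odd_size n lam = int d"
    and zero: "\<And>\<mu>. \<mu> \<in> Lam n \<Longrightarrow> odd_size n \<mu> \<le> int d \<Longrightarrow> \<mu> \<noteq> lam \<Longrightarrow> poly_eval (shifted n r \<mu>) R = 0"
  shows "\<exists>b. R = (\<Sum>\<mu>\<in>LamD n d. Const (b \<mu>) * elem_semisym_prod n \<mu>) \<and>
    (\<forall>\<mu>\<in>LamD n d. b \<mu> \<noteq> 0 \<longrightarrow> preceq n \<mu> lam)"
proof (cases "r = 0")
  case False
  obtain b where b: "R = (\<Sum>\<mu>\<in>LamD n d. Const (b \<mu>) * elem_semisym_prod n \<mu>)"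
    using semisym_expansion[OF R] by blast
  have "preceq n \<mu> lam" if "\<mu> \<in> LamD n d" "b \<mu> \<noteq> 0" for \<mu>
    by (rule expansion_support[OF n r False lam zero[unfolded b] that])
  then show ?thesis using b by blast
next
  case True
  let ?M = "LamD n d"
  have "\<exists>q. \<forall>t. poly q t = poly_eval (shifted n t \<kappa>) (elem_semisym_prod n \<mu> :: 'k mpoly)" for \<kappa> \<mu>
    using poly_eval_line[of "\<lambda>i. of_int (\<kappa> i)" "\<lambda>i. of_nat (n - i)" "elem_semisym_prod n \<mu> :: 'k mpoly"]
    unfolding shifted_def by (simp add: add.commute mult.commute)
  then obtain E where E: "\<And>\<kappa> \<mu> t. poly (E \<kappa> \<mu>) t = poly_eval (shifted n t \<kappa>) (elem_semisym_prod n \<mu> :: 'k mpoly)"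
    by metis
  have lamM: "lam \<in> ?M" using lam by (simp add: LamD_def)
  have "card (?M - {lam}) < card ?M" by (rule card_Diff1_less[OF finite_LamD lamM])
  from underdetermined_system[OF finite_Diff[OF finite_LamD] finite_LamD this, of E]
  obtain v where v: "\<And>\<kappa>. \<kappa> \<in> ?M - {lam} \<Longrightarrow> (\<Sum>\<mu>\<in>?M. E \<kappa> \<mu> * v \<mu>) = 0" "\<exists>\<mu>\<in>?M. v \<mu> \<noteq> 0"
    by blast
  obtain w c where w: "c \<noteq> 0" "\<And>\<mu>. \<mu> \<in> ?M \<Longrightarrow> v \<mu> = c * w \<mu>" "\<exists>\<mu>\<in>?M. poly (w \<mu>) 0 \<noteq> 0"
    using normalize_at_0[OF finite_LamD v(2)] by blast
  define f where "f t = (\<Sum>\<mu>\<in>?M. Const (poly (w \<mu>) t) * elem_semisym_prod n \<mu>)" for t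
  have f_zero: "poly_eval (shifted n t \<kappa>) (f t) = 0"
    if "\<kappa> \<in> Lam n" "odd_size n \<kappa> \<le> int d" "\<kappa> \<noteq> lam" for \<kappa> t
  proof -
    have \<kappa>: "\<kappa> \<in> ?M - {lam}" using that by (simp add: LamD_def)
    have "c * (\<Sum>\<mu>\<in>?M. E \<kappa> \<mu> * w \<mu>) = (\<Sum>\<mu>\<in>?M. E \<kappa> \<mu> * v \<mu>)"
      unfolding sum_distrib_left by (intro sum.cong refl) (simp add: w(2))
    then have "(\<Sum>\<mu>\<in>?M. E \<kappa> \<mu> * w \<mu>) = 0" using v(1)[OF \<kappa>] w(1) by simp
    moreover have "poly_eval (shifted n t \<kappa>) (f t) = poly (\<Sum>\<mu>\<in>?M. E \<kappa> \<mu> * w \<mu>) t"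
      by (simp add: f_def poly_sum E mult.commute)
    ultimately show ?thesis by simp
  qed
  have support: "preceq n \<mu> lam" if \<mu>: "\<mu> \<in> ?M" "poly (w \<mu>) 0 \<noteq> 0" for \<mu>
  proof (rule ccontr)
    assume not: "\<not> preceq n \<mu> lam"
    \<comment> \<open>Positive integers are generic and nonzero, so \<open>expansion_support\<close>
      applies at each of them; a polynomial in t with all these zeros is 0.\<close>
    have "poly (w \<mu>) (of_nat (Suc k)) = 0" for k
    proof (rule ccontr)
      assume nz: "poly (w \<mu>) (of_nat (Suc k)) \<noteq> 0"
      have "generic (of_nat (Suc k) :: 'k)"
        unfolding generic_def by (auto simp flip: of_nat_mult of_nat_add simp del: of_nat_Suc)
      moreover have "of_nat (Suc k) \<noteq> (0 :: 'k)" by (rule of_nat_neq_0)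
      ultimately have "preceq n \<mu> lam"
        by (rule expansion_support[OF n _ _ lam f_zero[unfolded f_def] \<mu>(1) nz])
      then show False using not by blast
    qed
    then have "range (\<lambda>k. of_nat (Suc k)) \<subseteq> {t. poly (w \<mu>) t = 0}" by auto
    moreover have "infinite (range (\<lambda>k. of_nat (Suc k) :: 'k))"
      by (rule range_inj_infinite) (auto simp: inj_def simp del: of_nat_Suc)
    ultimately have "w \<mu> = 0" using infinite_zeros_imp_zero infinite_super by blast
    then show False using \<mu>(2) by simp
  qed
  have Inv_f: "Inv n d (f 0)" unfolding f_def by (rule Inv_expansion)
  have M_Lam: "?M \<subseteq> Lam n" by (auto simp: LamD_def)
  have "f 0 \<noteq> 0"
  proof
    assume "f 0 = 0"
    then have "poly (w \<mu>) 0 = 0" if "\<mu> \<in> ?M" for \<mu>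
      using elem_semisym_prod_independent[OF finite_LamD M_Lam _ that, of "\<lambda>\<mu>. poly (w \<mu>) 0"]
      unfolding f_def by blast
    then show False using w(3) by blast
  qed
  have f_lam: "poly_eval (shifted n r lam) (f 0) \<noteq> 0"
  proof
    assume *: "poly_eval (shifted n r lam) (f 0) = 0"
    have "f 0 = 0"
    proof (rule Inv_vanishing[OF r Inv_f])
      fix \<mu> assume "\<mu> \<in> Lam n" "odd_size n \<mu> \<le> int d"
      then show "poly_eval (shifted n r \<mu>) (f 0) = 0"
        using f_zero[of \<mu> 0] * True by (cases "\<mu> = lam") auto
    qed
    then show False using \<open>f 0 \<noteq> 0\<close> by blast
  qed
  define a where "a = poly_eval (shifted n r lam) R / poly_eval (shifted n r lam) (f 0)"
  have "R - Const a * f 0 = 0"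
  proof (rule Inv_vanishing[OF r])
    show "Inv n d (R - Const a * f 0)" by (intro Inv_diff R Inv_smult Inv_f)
    fix \<mu> assume "\<mu> \<in> Lam n" "odd_size n \<mu> \<le> int d"
    then show "poly_eval (shifted n r \<mu>) (R - Const a * f 0) = 0"
      using f_zero[of \<mu> 0] zero[of \<mu>] f_lam True by (cases "\<mu> = lam") (auto simp: a_def)
  qed
  then have "R = Const a * f 0" by simp
  also have "\<dots> = (\<Sum>\<mu>\<in>?M. Const (a * poly (w \<mu>) 0) * elem_semisym_prod n \<mu>)"
    using Const_hom[where 'k = 'k] by (simp add: f_def sum_distrib_left mult.assoc coeff_hom_def)
  finally show ?thesis
    using support by (intro exI[of _ "\<lambda>\<mu>. a * poly (w \<mu>) 0"]) auto
qed

section \<open>Homogeneous components\<close>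

definition homog :: "nat \<Rightarrow> 'k::zero mpoly \<Rightarrow> bool" where
  "homog d p \<longleftrightarrow> (\<forall>m \<in> kys p. mon_degree m = d)"

lemma mon_degree_add: "mon_degree (m + m') = mon_degree m + mon_degree m'"
  by (simp add: mon_degree_eq_wdeg wdeg_add)

lemma homog_X: "homog 1 (X i)"
  by (simp add: homog_def X_def mon_degree_eq_wdeg)

lemma homog_add: "homog d p \<Longrightarrow> homog d q \<Longrightarrow> homog d (p + q)"
  using Poly_Mapping.keys_add[of p q] unfolding homog_def by blast

lemma homog_diff: "homog d p \<Longrightarrow> homog d q \<Longrightarrow> homog d (p - (q :: 'k::comm_ring_1 mpoly))"
  using Poly_Mapping.keys_add[of p "- q"] unfolding homog_def by (auto simp: in_keys_iff lookup_minus)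

lemma homog_one: "homog 0 (1 :: 'k::comm_semiring_1 mpoly)"
  by (auto simp: homog_def mon_degree_def)

lemma homog_mult:
  assumes "homog d p" "homog e q"
  shows "homog (d + e) (p * (q :: 'k::comm_semiring_1 mpoly))"
  unfolding homog_def
proof
  fix m assume "m \<in> kys (p * q)"
  then obtain a b where "a \<in> kys p" "b \<in> kys q" "m = a + b" using keys_mult[of p q] by auto
  then show "mon_degree m = d + e" using assms by (simp add: homog_def mon_degree_add)
qed

lemma homog_sum: "(\<And>i. i \<in> I \<Longrightarrow> homog d (g i)) \<Longrightarrow> homog d (\<Sum>i\<in>I. g i)"
  by (induction I rule: infinite_finite_induct) (simp_all add: homog_add, simp_all add: homog_def)

lemma homog_prod:
  "(\<And>i. i \<in> I \<Longrightarrow> homog (e i) (g i)) \<Longrightarrow> homog (\<Sum>i\<in>I. e i) (\<Prod>i\<in>I. g i :: 'k::comm_semiring_1 mpoly)"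
  by (induction I rule: infinite_finite_induct) (simp_all add: homog_mult homog_one)

lemma homog_power: "homog d p \<Longrightarrow> homog (k * d) ((p :: 'k::comm_semiring_1 mpoly) ^ k)"
  by (induction k) (simp_all add: homog_mult homog_one)

lemma homog_elem_sym: "homog k (elem_sym A k :: 'k::comm_semiring_1 mpoly)"
  unfolding elem_sym_def
proof (rule homog_sum)
  fix S assume "S \<in> {S. S \<subseteq> A \<and> card S = k}"
  then show "homog k (\<Prod>i\<in>S. X i :: 'k mpoly)"
    using homog_prod[OF homog_X, of S "\<lambda>i. i" , where 'k = 'k] by simp
qed

lemma homog_elem_semisym: "homog ((i + 1) div 2) (elem_semisym n i :: 'k::comm_ring_1 mpoly)"
proof (cases "odd i")
  case False
  then have "(i + 1) div 2 = i div 2" by presburger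
  then show ?thesis using False homog_elem_sym unfolding elem_semisym_def by simp
qed (simp add: elem_semisym_def homog_diff homog_elem_sym)

text \<open>A product of homogeneous polynomials is homogeneous of some degree; its value is read
  off the leading exponent rather than by summing the degrees of the factors.\<close>

lemma homog_elem_semisym_prod:
  assumes "\<mu> \<in> Lam n"
  shows "homog (nat (odd_size n \<mu>)) (elem_semisym_prod n \<mu> :: 'k::field_char_0 mpoly)"
proof -
  have "\<exists>d. homog d (elem_semisym_prod n \<mu> :: 'k mpoly)"
    unfolding elem_semisym_prod_def by (rule exI, rule homog_prod, rule homog_power, rule homog_elem_semisym)
  then obtain d where d: "homog d (elem_semisym_prod n \<mu> :: 'k mpoly)" by blast
  have "lead (lexp n \<mu>) (elem_semisym_prod n \<mu> :: 'k mpoly)"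
    using lead_elem_semisym_prod[of n \<mu> 0, where 'a = 'k] by (simp add: cs_zero)
  then have "lexp n \<mu> \<in> kys (elem_semisym_prod n \<mu> :: 'k mpoly)"
    using lead_coeff[of "lexp n \<mu>" "elem_semisym_prod n \<mu> :: 'k mpoly"] by (simp add: in_keys_iff)
  then have "mon_degree (lexp n \<mu>) = d" using d unfolding homog_def by blast
  then show ?thesis using d mon_degree_lexp[OF assms] by (simp add: mon_degree_eq_wdeg flip: mon_degree_lexp[OF assms])
qed

lemma lookup_hom_component: "lkp (hom_component d p) m = (if mon_degree m = d then lkp p m else 0)"
  by (auto simp: hom_component_def lookup_sum lookup_single when_def in_keys_iff)

lemma hom_component_sum: "hom_component d (\<Sum>i\<in>I. g i) = (\<Sum>i\<in>I. hom_component d (g i))"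
  by (rule poly_mapping_eqI) (simp add: lookup_hom_component lookup_sum)

lemma hom_component_homog: "homog e p \<Longrightarrow> hom_component d p = (if e = d then p else 0)"
  by (rule poly_mapping_eqI) (auto simp: lookup_hom_component homog_def in_keys_iff)

lemma homog_smult: "homog d p \<Longrightarrow> homog d (Const c * (p :: 'k::comm_semiring_1 mpoly))"
  using homog_mult[of 0 "Const c" d p] by (simp add: homog_def Const_def mon_degree_def)

section \<open>Monomials of the expansion in the variables u\<close>

lemma sum_mon_expansion:
  fixes p :: "'k::comm_semiring_1 mpoly"
  assumes vars: "inv_vars {1..n} p" and D: "finite D" "D \<subseteq> nat_vecs n"
    and keys: "\<And>k. k \<in> kys p \<Longrightarrow> (\<lambda>i. int (lkp k i)) \<in> D"
  shows "p = (\<Sum>\<mu>\<in>D. Const (lkp p (expo n \<mu>)) * mon n \<mu>)"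
proof (rule poly_mapping_eqI)
  fix k :: "nat \<Rightarrow>\<^sub>0 nat"
  let ?\<kappa> = "\<lambda>i. int (lkp k i)"
  have lookup: "lkp (expo n \<mu>) i = nat (\<mu> i)" if "\<mu> \<in> nat_vecs n" for \<mu> i
  proof -
    have "lkp (expo n \<mu>) i = (if i \<in> {1..n} then nat (\<mu> i) else 0)"
      by (auto simp: expo_def lookup_sum lookup_single when_def)
    then show ?thesis using that by (auto simp: nat_vecs_def int_vecs_def)
  qed
  have inj: "expo n \<mu> = k \<longleftrightarrow> \<mu> = ?\<kappa>" if "\<mu> \<in> D" for \<mu>
  proof -
    have \<mu>: "\<mu> \<in> nat_vecs n" using D(2) that by blast
    then have "0 \<le> \<mu> i" for i by (auto simp: nat_vecs_def)
    then have int: "int (lkp (expo n \<mu>) i) = \<mu> i" for i by (simp add: lookup[OF \<mu>])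
    show ?thesis
    proof
      assume "\<mu> = ?\<kappa>"
      then have "int (lkp (expo n \<mu>) i) = int (lkp k i)" for i using int by simp
      then show "expo n \<mu> = k" by (intro poly_mapping_eqI) simp
    qed (use int in auto)
  qed
  have "lkp (\<Sum>\<mu>\<in>D. Const (lkp p (expo n \<mu>)) * mon n \<mu>) k = (\<Sum>\<mu>\<in>D. if expo n \<mu> = k then lkp p (expo n \<mu>) else 0)"
    by (simp add: lookup_sum Const_def mon_def mult_single lookup_single when_def)
  also have "\<dots> = (\<Sum>\<mu>\<in>D. if ?\<kappa> = \<mu> then lkp p k else 0)"
  proof (intro sum.cong refl)
    fix \<mu> assume "\<mu> \<in> D"
    from inj[OF this] show "(if expo n \<mu> = k then lkp p (expo n \<mu>) else 0) = (if ?\<kappa> = \<mu> then lkp p k else 0)"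
      by (cases "expo n \<mu> = k") auto
  qed
  also have "\<dots> = (if ?\<kappa> \<in> D then lkp p k else 0)" using D(1) by (rule sum.delta')
  also have "\<dots> = lkp p k" using keys[of k] by (auto simp: in_keys_iff)
  finally show "lkp p k = lkp (\<Sum>\<mu>\<in>D. Const (lkp p (expo n \<mu>)) * mon n \<mu>) k" by simp
qed

text \<open>By \<open>preceqD\<close> both kinds of weights are monotone along \<preceq>, so every
  product in the sum obeys the bounds for \<open>lam\<close>; the substitution by
  \<open>u_arg n\<close> is \<open>cs (n div 2)\<close>, for which the weights are known.\<close>

lemma u_expansion_support:
  fixes b :: "(nat \<Rightarrow> int) \<Rightarrow> 'k::field_char_0"
  assumes n: "n \<ge> 1" and lam: "lam \<in> Lam n" and S: "S \<subseteq> {\<mu> \<in> Lam n. preceq n \<mu> lam}"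
    and k: "k \<in> kys (poly_subst (u_arg n) (\<Sum>\<mu>\<in>S. Const (b \<mu>) * elem_semisym_prod n \<mu>))"
  shows "dom_le n (\<lambda>i. int (lkp k i)) (bracket n lam)"
    "dom_le (n div 2) (even_part (\<lambda>i. int (lkp k i))) (even_part lam)"
proof -
  have bound: "wdeg \<omega> k \<le> c"
    if le: "\<And>\<mu>. \<mu> \<in> S \<Longrightarrow> wle \<omega> c (poly_subst (cs (n div 2)) (elem_semisym_prod n \<mu> :: 'k mpoly))" for \<omega> c
  proof -
    have "wle \<omega> c (poly_subst (u_arg n) (\<Sum>\<mu>\<in>S. Const (b \<mu>) * elem_semisym_prod n \<mu>))"
      unfolding cs_u_arg[symmetric] poly_subst_sum
    proof (rule wle_sum)
      fix \<mu> assume "\<mu> \<in> S"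
      from wle_mult[OF wle_Const le[OF this], of 0 "b \<mu>"]
      show "wle \<omega> c (poly_subst (cs (n div 2)) (Const (b \<mu>) * elem_semisym_prod n \<mu>))" by simp
    qed
    then show ?thesis using k unfolding wle_def by blast
  qed
  show "dom_le n (\<lambda>i. int (lkp k i)) (bracket n lam)" unfolding dom_le_def
  proof
    fix m assume "m \<in> {1..n}"
    then have m: "m \<le> n" by simp
    have "wdeg (chi {1..m}) k \<le> wdeg (chi {1..m}) (lexp n lam)"
    proof (rule bound)
      fix \<mu> assume "\<mu> \<in> S"
      then have \<mu>: "\<mu> \<in> Lam n" "preceq n \<mu> lam" using S by auto
      have "wdeg (chi {1..m}) (lexp n \<mu>) \<le> wdeg (chi {1..m}) (lexp n lam)"
        using preceqD(1)[OF \<mu>(2) n m] wdeg_prefix_lexp[OF \<mu>(1), of m] wdeg_prefix_lexp[OF lam, of m] by simp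
      moreover have "wle (chi {1..m}) (wdeg (chi {1..m}) (lexp n \<mu>)) (poly_subst (cs (n div 2)) (elem_semisym_prod n \<mu> :: 'k mpoly))"
        by (rule wle_elem_semisym_prod) (rule wle_prefix_elem_semisym[OF _ m])
      ultimately show "wle (chi {1..m}) (wdeg (chi {1..m}) (lexp n lam)) (poly_subst (cs (n div 2)) (elem_semisym_prod n \<mu> :: 'k mpoly))"
        by (rule wle_mono[rotated])
    qed
    then show "(\<Sum>i = 1..m. int (lkp k i)) \<le> (\<Sum>i = 1..m. bracket n lam i)"
      unfolding wdeg_prefix_lexp[OF lam, symmetric] by (simp add: wdeg_chi flip: of_nat_sum)
  qed
  show "dom_le (n div 2) (even_part (\<lambda>i. int (lkp k i))) (even_part lam)" unfolding dom_le_def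
  proof
    fix j assume "j \<in> {1..n div 2}"
    then have j: "2 * j \<le> n" by auto
    have "wdeg (chi (Evens (2 * j))) k \<le> nat (even_sum j lam)"
    proof (rule bound)
      fix \<mu> assume "\<mu> \<in> S"
      then have \<mu>: "\<mu> \<in> Lam n" "preceq n \<mu> lam" using S by auto
      show "wle (chi (Evens (2 * j))) (nat (even_sum j lam)) (poly_subst (cs (n div 2)) (elem_semisym_prod n \<mu> :: 'k mpoly))"
        by (rule wle_mono[OF wle_even_elem_semisym_prod[OF \<mu>(1) j] nat_mono[OF preceqD(2)[OF \<mu>(2) n j]]])
    qed
    then have "int (wdeg (chi (Evens (2 * j))) k) \<le> even_sum j lam" using even_sum_nonneg[OF lam, of j] by linarith
    moreover have "int (wdeg (chi (Evens (2 * j))) k) = even_sum j (\<lambda>i. int (lkp k i))"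
      unfolding even_sum_Evens by (simp add: wdeg_chi)
    ultimately show "(\<Sum>i = 1..j. even_part (\<lambda>i. int (lkp k i)) i) \<le> (\<Sum>i = 1..j. even_part lam i)"
      by (simp add: even_sum_def even_part_def)
  qed
qed

theorem theorem6p6:
  fixes n :: nat and r :: "'k::field_char_0" and lam :: "nat \<Rightarrow> int" and R :: "'k mpoly"
  assumes "n \<ge> 1"
    and "\<not> (\<exists>q::rat. q < 0 \<and> r = of_rat q)"
    and "lam \<in> Lam n"
    and "is_R n r lam R"
  shows "(\<exists>a :: (nat \<Rightarrow> int) \<Rightarrow> 'k.
           poly_subst (u_arg n) R =
             (\<Sum>\<mu> \<in> {\<mu> \<in> nat_vecs n. dom_le n \<mu> (bracket n lam) \<and>
                                     dom_le (n div 2) (even_part \<mu>) (even_part lam)}.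
                Const (a \<mu>) * mon n \<mu>))
         \<and> (\<exists>b :: (nat \<Rightarrow> int) \<Rightarrow> 'k.
           R = (\<Sum>\<mu> \<in> {\<mu> \<in> Lam n. preceq n \<mu> lam}. Const (b \<mu>) * elem_semisym_prod n \<mu>) \<and>
           top_component R =
             (\<Sum>\<mu> \<in> {\<mu> \<in> Lam n. preceq n \<mu> lam \<and> odd_size n \<mu> = odd_size n lam}.
                Const (b \<mu>) * elem_semisym_prod n \<mu>))"
proof -
  define d where "d = total_degree R"
  let ?P = "{\<mu> \<in> Lam n. preceq n \<mu> lam}"
  have R: "Inv n d R" and d: "odd_size n lam = int d"
    using assms(4) wle_total_degree[of R] by (auto simp: is_R_def Inv_def d_def)
  have zero: "poly_eval (shifted n r \<mu>) R = 0"
    if "\<mu> \<in> Lam n" "odd_size n \<mu> \<le> int d" "\<mu> \<noteq> lam" for \<mu>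
    using assms(4) that d by (auto simp: is_R_def)
  obtain b' where b': "R = (\<Sum>\<mu>\<in>LamD n d. Const (b' \<mu>) * elem_semisym_prod n \<mu>)"
    "\<And>\<mu>. \<mu> \<in> LamD n d \<Longrightarrow> b' \<mu> \<noteq> 0 \<Longrightarrow> preceq n \<mu> lam"
    using expansion_preceq[OF assms(1) assms(2)[folded generic_iff_not_negative_rational] R assms(3) d zero]
    by blast
  \<comment> \<open>Extension by zero from \<open>LamD n d\<close>, so that the sum can be moved to
    the set of all \<mu> \<preceq> \<lambda>.\<close>
  define b where "b \<mu> = (if \<mu> \<in> LamD n d then b' \<mu> else 0)" for \<mu>
  have "R = (\<Sum>\<mu>\<in>LamD n d \<inter> ?P. Const (b \<mu>) * elem_semisym_prod n \<mu>)"
    unfolding b'(1)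
  proof (rule sum.mono_neutral_cong_right)
    show "\<forall>\<mu>\<in>LamD n d - LamD n d \<inter> ?P. Const (b' \<mu>) * elem_semisym_prod n \<mu> = 0"
    proof
      fix \<mu> assume "\<mu> \<in> LamD n d - LamD n d \<inter> ?P"
      then have "b' \<mu> = 0" using b'(2)[of \<mu>] by (auto simp: LamD_def)
      then show "Const (b' \<mu>) * elem_semisym_prod n \<mu> = 0" by simp
    qed
  qed (auto simp: b_def)
  also have "\<dots> = (\<Sum>\<mu>\<in>?P. Const (b \<mu>) * elem_semisym_prod n \<mu>)"
    using finite_preceq[of n lam] by (intro sum.mono_neutral_left) (auto simp: b_def)
  finally have b: "R = (\<Sum>\<mu>\<in>?P. Const (b \<mu>) * elem_semisym_prod n \<mu>)" .
  have "top_component R = (\<Sum>\<mu>\<in>?P. hom_component d (Const (b \<mu>) * elem_semisym_prod n \<mu>))"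
    unfolding top_component_def d_def[symmetric] by (subst b) (rule hom_component_sum)
  also have "\<dots> = (\<Sum>\<mu>\<in>?P. if odd_size n \<mu> = odd_size n lam then Const (b \<mu>) * elem_semisym_prod n \<mu> else 0)"
  proof (intro sum.cong refl)
    fix \<mu> assume "\<mu> \<in> ?P"
    then have \<mu>: "\<mu> \<in> Lam n" by simp
    have "nat (odd_size n \<mu>) = d \<longleftrightarrow> odd_size n \<mu> = odd_size n lam"
      using mon_degree_lexp[OF \<mu>] d by linarith
    then show "hom_component d (Const (b \<mu>) * elem_semisym_prod n \<mu>) =
      (if odd_size n \<mu> = odd_size n lam then Const (b \<mu>) * elem_semisym_prod n \<mu> else 0)"
      by (simp only: hom_component_homog[OF homog_smult[OF homog_elem_semisym_prod[OF \<mu>]]])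
  qed
  also have "\<dots> = (\<Sum>\<mu> \<in> {\<mu> \<in> Lam n. preceq n \<mu> lam \<and> odd_size n \<mu> = odd_size n lam}.
      Const (b \<mu>) * elem_semisym_prod n \<mu>)"
    using finite_preceq[of n lam] by (subst sum.inter_filter[symmetric]) (auto intro!: sum.cong)
  finally have top: "top_component R = \<dots>" .
  let ?D = "{\<mu> \<in> nat_vecs n. dom_le n \<mu> (bracket n lam) \<and> dom_le (n div 2) (even_part \<mu>) (even_part lam)}"
  have vars: "inv_vars {1..n} (poly_subst (u_arg n) R)"
  proof (rule inv_vars_subst)
    show "inv_vars {1..n} R" using R by (simp add: Inv_def polys_iff)
    fix i assume "i \<in> {1..n}"
    then show "inv_vars {1..n} (u_arg n i :: 'k mpoly)"
      by (auto simp: u_arg_def intro!: inv_vars_add inv_vars_X)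
  qed
  have "poly_subst (u_arg n) R = (\<Sum>\<mu>\<in>?D. Const (lkp (poly_subst (u_arg n) R) (expo n \<mu>)) * mon n \<mu>)"
  proof (rule sum_mon_expansion[OF vars])
    show "finite ?D" using finite_dom_le[of n "bracket n lam"] by (rule rev_finite_subset) auto
    fix k assume k: "k \<in> kys (poly_subst (u_arg n) R)"
    then have "kys k \<subseteq> {1..n}" using vars unfolding inv_vars_def by blast
    then have "(\<lambda>i. int (lkp k i)) \<in> nat_vecs n" by (auto simp: nat_vecs_def int_vecs_def in_keys_iff)
    then show "(\<lambda>i. int (lkp k i)) \<in> ?D"
      using u_expansion_support[OF assms(1,3) order.refl k[unfolded b]] by simp
  qed auto
  then show ?thesis using b top
    by (intro conjI exI[of _ "\<lambda>\<mu>. lkp (poly_subst (u_arg n) R) (expo n \<mu>)"] exI[of _ b])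
qed

end
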